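(* Let $f:I\to I$ be a topologically transitive, piecewise affine expanding Markov map of $I=[0,1]$ (orientation preserving on each branch, as defined in the context), with Markov partition $\{I_j\}_{j=1}^N$, matrices $B_k$, absolutely continuous invariant probability measure $\mu_{\mathrm{SRB}}$, measure of maximal entropy $\mu_{\mathrm{BM}}$ and topological entropy $h_{\mathrm{top}}$. (1) There exists a set of complex numbers $\Xi_1=\{\xi_1,\xi_2,\dots\}$ and, for each $\xi_i\in\Xi_1$, an associated integer $m_i$ such that, for any $\phi,\varphi\in\mathcal C^\infty(\mathcal I)$ and $\epsilon>0$, there is an asymptotic expansion (as $n\to\infty$) $$\int_I \phi\cdot\varphi\circ f^n\,d\mu_{\mathrm{SRB}}=\sum_{\xi_i\in\Xi_1:\,|\xi_i|\ge\epsilon}\ \sum_{k=0}^{m_i-1}\xi_i^n n^k C_{i,k}(\phi,\varphi)+o(\epsilon^n),$$ where the $C_{i,k}(\phi,\varphi)$ are finite rank and non-zero bilinear functions of $\phi,\varphi$. The set $\Xi_1$ is equal (as a subset of $\mathbb C$) to $\bigcup_{l=1}^\infty\sigma(B_l)$, and the equality holds also for the total multiplicity of each eigenvalue. (2) Similarly, there exists a set of complex numbers $\Xi_0=\{\xi_1,\xi_2,\dots\}$ and, for each $\xi_i\in\Xi_0$, an associated integer $m_i$ such that, for any $\phi,\varphi\in\mathcal C^\infty(\mathcal I)$ and $\epsilon>0$, there is an asymptotic expansion $$\int_I \phi\cdot\varphi\circ f^n\,d\mu_{\mathrm{BM}}=e^{-n h_{\mathrm{top}}}\sum_{\xi_i\in\Xi_0:\,|\xi_i|\ge\epsilon}\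 \sum_{k=0}^{m_i-1}\xi_i^n n^k C'_{i,k}(\phi,\varphi)+o(\epsilon^n),$$ where the $C'_{i,k}(\phi,\varphi)$ are finite rank and non-zero bilinear functions of $\phi,\varphi$. The set $\Xi_0$ is equal (as a subset of $\mathbb C$) to $\bigcup_{l=0}^\infty\sigma(B_l)$, and the equality holds also for the total multiplicity of each eigenvalue.
   Context: Let $I=[0,1]$. A map $f:I\to I$ is a piecewise affine expanding Markov map if there is a collection of disjoint open intervals $\{I_j\}_{j=1}^N=\{(p_j,p_{j+1})\}_{j=1}^N$ forming a partition of a full measure subset of $I$ (the Markov partition) such that for all $i,j$ either $f(I_i)\cap I_j=\emptyset$ or $I_j\subseteq f(I_i)$; $f'$ is constant on each $I_i$ (so $f$ is affine on each $I_i$); and there is $\lambda>1$ with $f'(x)\ge\lambda$ for all $x\in\bigcup_i I_i$. Put $\mathcal I=\bigcup_{i=1}^N I_i$ (disjoint union) and $\lambda_j=f'|_{I_j}$. The adjacency matrix $A$ is the $N\times N$ matrix with $A[i,j]=1$ if $I_j\subseteq f(I_i)$ and $A[i,j]=0$ if $f(I_i)\cap I_j=\emptyset$. For $k\in\{0,1,2,\dots\}$, $B_k$ is the $N\times N$ matrix $B_k[i,j]=\lambda_j^{-k}A[j,i]$. $\sigma(B)$ is the spectrum (set of eigenvalues) of a matrix $B$. $\mathcal C^\infty(\mathcal I)$ is the set of functions on $I$ which are $\mathcal C^\infty$ when restricted to each $I_j$, i.e. $\bigoplus_j\mathcal C^\infty(I_j)$. Since $f$ is topologically transitive there is a unique $f$-invariant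 probability measure absolutely continuous with respect to Lebesgue, denoted $\mu_{\mathrm{SRB}}$, and a unique measure of maximal entropy, denoted $\mu_{\mathrm{BM}}$; $h_{\mathrm{top}}$ is the topological entropy of $f$. The integer $m_i$ is a Jordan block dimension; a given value $\xi_i$ may be repeated in the list $\Xi_0$ or $\Xi_1$ according to its geometric multiplicity. The total multiplicity of $\xi$ in $\bigcup_l\sigma(B_l)$ is the sum over $l$ of its (algebraic) multiplicities as an eigenvalue of $B_l$.
   Formalization: Transitivity is witnessed by orbit segments avoiding partition points (where f is arbitrary; otherwise the invariant measure may be non-unique), and C^∞ on each I_j means smooth up to the end points (for 1/x the integral diverges). *)

theory Defs
  imports
    "HOL-Probability.Probability"
    "HOL-Library.Landau_Symbols"
    "Jordan_Normal_Form.Jordan_Normal_Form"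
    "Jordan_Normal_Form.Spectral_Radius"
begin

text \<open>
  Maps of the unit interval are functions on the reals of which only the restriction to
  \<open>{0..1}\<close> matters. The partition points are \<open>p 0 < p 1 < \<dots> < p N\<close>, so the \<open>N\<close> intervals of
  the Markov partition are numbered \<open>0, \<dots>, N - 1\<close>. The values of \<open>f\<close> at partition points are
  not constrained.
\<close>

definition branch_interval :: "(nat \<Rightarrow> real) \<Rightarrow> nat \<Rightarrow> real set" where
  "branch_interval p j = {p j <..< p (Suc j)}"

definition branch_union :: "nat \<Rightarrow> (nat \<Rightarrow> real) \<Rightarrow> real set" where
  "branch_union N p = (\<Union>j<N. branch_interval p j)"

definition affine_markov_map ::
    "(real \<Rightarrow> real) \<Rightarrow> nat \<Rightarrow> (nat \<Rightarrow> real) \<Rightarrow> (nat \<Rightarrow> real) \<Rightarrow> bool" where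
  "affine_markov_map f N p slope \<longleftrightarrow>
     f ` {0..1} \<subseteq> {0..1} \<and>
     p 0 = 0 \<and> p N = 1 \<and> (\<forall>j<N. p j < p (Suc j)) \<and>
     (\<forall>i<N. \<forall>j<N. f ` branch_interval p i \<inter> branch_interval p j = {} \<or>
                   branch_interval p j \<subseteq> f ` branch_interval p i) \<and>
     (\<forall>j<N. \<forall>x\<in>branch_interval p j. (f has_real_derivative slope j) (at x)) \<and>
     (\<exists>l>1. \<forall>j<N. slope j \<ge> l)"

text \<open>
  Topological transitivity, witnessed by orbit segments that stay in the intervals of the
  partition, where \<open>f\<close> is given by its branches. If \<open>f\<close> maps the set of partition points to
  itself (for instance if \<open>f\<close> takes one of its one-sided limits at each of them), this is
  equivalent to the usual condition that for all nonempty open \<open>U\<close>, \<open>V\<close> some \<open>f\<^sup>n(U)\<close> meets \<open>V\<close>.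
  For arbitrary values at the partition points the usual condition can hold although the
  adjacency matrix is reducible, the orbit of a single partition point being dense.
\<close>

definition transitive_map :: "(real \<Rightarrow> real) \<Rightarrow> nat \<Rightarrow> (nat \<Rightarrow> real) \<Rightarrow> bool" where
  "transitive_map f N p \<longleftrightarrow>
     (\<forall>U V. open U \<and> open V \<and> U \<inter> {0..1} \<noteq> {} \<and> V \<inter> {0..1} \<noteq> {} \<longrightarrow>
        (\<exists>n. \<exists>x\<in>U \<inter> {0..1}. (\<forall>k<n. (f ^^ k) x \<in> branch_union N p) \<and> (f ^^ n) x \<in> V))"

definition adjacency :: "(real \<Rightarrow> real) \<Rightarrow> nat \<Rightarrow> (nat \<Rightarrow> real) \<Rightarrow> complex mat" where
  "adjacency f N p =
     mat N N (\<lambda>(i, j). if branch_interval p j \<subseteq> f ` branch_interval p i then 1 else 0)"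

definition weighted_adjacency ::
    "(real \<Rightarrow> real) \<Rightarrow> nat \<Rightarrow> (nat \<Rightarrow> real) \<Rightarrow> (nat \<Rightarrow> real) \<Rightarrow> nat \<Rightarrow> complex mat" where
  "weighted_adjacency f N p slope k =
     mat N N (\<lambda>(i, j). inverse (of_real (slope j)) ^ k * adjacency f N p $$ (j, i))"

abbreviation unit_borel :: "real measure" where
  "unit_borel \<equiv> restrict_space borel {0..1}"

definition invariant_prob :: "(real \<Rightarrow> real) \<Rightarrow> real measure \<Rightarrow> bool" where
  "invariant_prob f \<mu> \<longleftrightarrow>
     prob_space \<mu> \<and> sets \<mu> = sets unit_borel \<and> f \<in> measurable \<mu> \<mu> \<and> distr \<mu> \<mu> f = \<mu>"

definition srb_measure :: "(real \<Rightarrow> real) \<Rightarrow> real measure \<Rightarrow> bool" where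
  "srb_measure f \<mu> \<longleftrightarrow>
     invariant_prob f \<mu> \<and> absolutely_continuous (restrict_space lborel {0..1}) \<mu>"

text \<open>
  A finite measurable partition is given by a labelling \<open>X\<close> of the points by natural numbers;
  the \<open>n\<close>-th refinement of the partition is given by the itineraries of length \<open>n\<close>.
\<close>

definition itinerary :: "(real \<Rightarrow> real) \<Rightarrow> (real \<Rightarrow> nat) \<Rightarrow> nat \<Rightarrow> real \<Rightarrow> nat list" where
  "itinerary f X n x = map (\<lambda>k. X ((f ^^ k) x)) [0..<n]"

definition partition_entropy :: "real measure \<Rightarrow> (real \<Rightarrow> 'a) \<Rightarrow> real" where
  "partition_entropy \<mu> X = prob_space.entropy \<mu> (exp 1) (count_space (X ` space \<mu>)) X"

text \<open>The limit superior is a limit, by subadditivity.\<close>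

definition metric_entropy :: "(real \<Rightarrow> real) \<Rightarrow> real measure \<Rightarrow> ereal" where
  "metric_entropy f \<mu> =
     (SUP X\<in>{X. simple_function \<mu> X}.
        limsup (\<lambda>n. ereal (partition_entropy \<mu> (itinerary f X n) / real n)))"

definition max_entropy_measure :: "(real \<Rightarrow> real) \<Rightarrow> real measure \<Rightarrow> bool" where
  "max_entropy_measure f \<mu> \<longleftrightarrow>
     invariant_prob f \<mu> \<and> (\<forall>\<nu>. invariant_prob f \<nu> \<longrightarrow> metric_entropy f \<nu> \<le> metric_entropy f \<mu>)"

text \<open>Topological entropy in the sense of Bowen, by separated sets.\<close>

definition separated :: "(real \<Rightarrow> real) \<Rightarrow> nat \<Rightarrow> real \<Rightarrow> real set \<Rightarrow> bool" where
  "separated f n e E \<longleftrightarrow>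
     finite E \<and> E \<subseteq> {0..1} \<and>
     (\<forall>x\<in>E. \<forall>y\<in>E. x \<noteq> y \<longrightarrow> (\<exists>k<n. dist ((f ^^ k) x) ((f ^^ k) y) > e))"

definition topological_entropy :: "(real \<Rightarrow> real) \<Rightarrow> ereal" where
  "topological_entropy f =
     (SUP e\<in>{0<..}. limsup (\<lambda>n. SUP E\<in>{E. separated f n e E}. ereal (ln (real (card E)) / real n)))"

text \<open>
  Smoothness on an interval of the partition is smoothness up to the end points, so all
  derivatives are bounded; \<open>D k\<close> is the \<open>k\<close>-th derivative of the extension to the closed
  interval. The values outside the intervals are irrelevant.
\<close>

definition piecewise_smooth :: "nat \<Rightarrow> (nat \<Rightarrow> real) \<Rightarrow> (real \<Rightarrow> complex) set" where
  "piecewise_smooth N p =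
     {\<phi>. \<forall>j<N. \<exists>D. (\<forall>x\<in>branch_interval p j. D 0 x = \<phi> x) \<and>
        (\<forall>k. \<forall>x\<in>{p j..p (Suc j)}.
           (D k has_vector_derivative D (Suc k) x) (at x within {p j..p (Suc j)}))}"

text \<open>
  Linear functionals on the direct sum of the spaces of smooth functions on the intervals. The
  last clause says that they only see the values of a function on the intervals.
\<close>

definition linear_functional ::
    "nat \<Rightarrow> (nat \<Rightarrow> real) \<Rightarrow> ((real \<Rightarrow> complex) \<Rightarrow> complex) \<Rightarrow> bool" where
  "linear_functional N p u \<longleftrightarrow>
     (\<forall>\<phi>\<in>piecewise_smooth N p. \<forall>\<psi>\<in>piecewise_smooth N p. u (\<lambda>x. \<phi> x + \<psi> x) = u \<phi> + u \<psi>) \<and>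
     (\<forall>\<phi>\<in>piecewise_smooth N p. \<forall>c. u (\<lambda>x. c * \<phi> x) = c * u \<phi>) \<and>
     (\<forall>\<phi>\<in>piecewise_smooth N p. \<forall>\<psi>\<in>piecewise_smooth N p.
        (\<forall>x\<in>branch_union N p. \<phi> x = \<psi> x) \<longrightarrow> u \<phi> = u \<psi>)"

type_synonym form = "(real \<Rightarrow> complex) \<Rightarrow> (real \<Rightarrow> complex) \<Rightarrow> complex"

definition bilinear_form :: "nat \<Rightarrow> (nat \<Rightarrow> real) \<Rightarrow> form \<Rightarrow> bool" where
  "bilinear_form N p C \<longleftrightarrow>
     (\<forall>\<phi>\<in>piecewise_smooth N p. linear_functional N p (C \<phi>)) \<and>
     (\<forall>\<psi>\<in>piecewise_smooth N p. linear_functional N p (\<lambda>\<phi>. C \<phi> \<psi>))"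

definition finite_rank_form :: "nat \<Rightarrow> (nat \<Rightarrow> real) \<Rightarrow> form \<Rightarrow> bool" where
  "finite_rank_form N p C \<longleftrightarrow>
     (\<exists>r u v. (\<forall>s<r. linear_functional N p (u s) \<and> linear_functional N p (v s)) \<and>
        (\<forall>\<phi>\<in>piecewise_smooth N p. \<forall>\<psi>\<in>piecewise_smooth N p.
           C \<phi> \<psi> = (\<Sum>s<(r::nat). u s \<phi> * v s \<psi>)))"

definition nonzero_form :: "nat \<Rightarrow> (nat \<Rightarrow> real) \<Rightarrow> form \<Rightarrow> bool" where
  "nonzero_form N p C \<longleftrightarrow>
     (\<exists>\<phi>\<in>piecewise_smooth N p. \<exists>\<psi>\<in>piecewise_smooth N p. C \<phi> \<psi> \<noteq> 0)"

text \<open>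
  A list of resonances with repetitions is a family \<open>\<xi> i\<close> with block dimensions \<open>m i\<close>, indexed
  by a set \<open>J\<close> of natural numbers.
\<close>

definition independent_functionals ::
    "nat \<Rightarrow> (nat \<Rightarrow> real) \<Rightarrow> 'i set \<Rightarrow> ('i \<Rightarrow> (real \<Rightarrow> complex) \<Rightarrow> complex) \<Rightarrow> bool" where
  "independent_functionals N p K u \<longleftrightarrow>
     (\<forall>F c. finite F \<and> F \<subseteq> K \<and> (\<forall>\<phi>\<in>piecewise_smooth N p. (\<Sum>s\<in>F. c s * u s \<phi>) = 0) \<longrightarrow>
        (\<forall>s\<in>F. c s = 0))"

text \<open>
  The integers \<open>m i\<close> are the dimensions of the Jordan blocks that produce the terms
  \<open>\<xi>\<^sub>i\<^sup>n n\<^sup>k C\<^sub>i\<^sub>k\<close>: their sum over \<open>k\<close> is the \<open>n\<close>-th power of a Jordan block of size \<open>m i\<close> with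
  eigenvalue \<open>\<xi> i\<close>, in coordinates \<open>u (i, q)\<close> of the first and \<open>v (i, r)\<close> of the second
  observable. Independence of these coordinates makes the number of blocks and their sizes, for
  each nonzero value, depend only on the forms given by the expansion. Blocks with eigenvalue 0
  never contribute to an expansion.
\<close>

definition jordan_blocks ::
    "nat \<Rightarrow> (nat \<Rightarrow> real) \<Rightarrow> nat set \<Rightarrow> (nat \<Rightarrow> complex) \<Rightarrow> (nat \<Rightarrow> nat) \<Rightarrow> (nat \<Rightarrow> nat \<Rightarrow> form) \<Rightarrow> bool"
  where
  "jordan_blocks N p J \<xi> m C \<longleftrightarrow>
     (\<exists>u v. let K = {(i, q). i \<in> J \<and> \<xi> i \<noteq> 0 \<and> q < m i} in
        (\<forall>s\<in>K. linear_functional N p (u s) \<and> linear_functional N p (v s)) \<and>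
        independent_functionals N p K u \<and> independent_functionals N p K v \<and>
        (\<forall>i\<in>J. \<xi> i \<noteq> 0 \<longrightarrow>
           (\<forall>\<phi>\<in>piecewise_smooth N p. \<forall>\<psi>\<in>piecewise_smooth N p. \<forall>n.
              (\<Sum>k<m i. \<xi> i ^ n * of_nat n ^ k * C i k \<phi> \<psi>) =
              (\<Sum>q<m i. \<Sum>r<m i.
                 (jordan_block (m i) (\<xi> i) ^\<^sub>m n) $$ (q, r) * u (i, q) \<phi> * v (i, r) \<psi>))))"

text \<open>
  Total multiplicities are taken in \<open>[0, \<infinity>]\<close>: if the adjacency matrix is singular, then 0 is an
  eigenvalue of all the weighted adjacency matrices.
\<close>

definition list_multiplicity ::
    "nat set \<Rightarrow> (nat \<Rightarrow> complex) \<Rightarrow> (nat \<Rightarrow> nat) \<Rightarrow> complex \<Rightarrow> ennreal" where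
  "list_multiplicity J \<xi> m z = (\<Sum>\<^sub>\<infinity>i\<in>{i \<in> J. \<xi> i = z}. of_nat (m i))"

definition total_multiplicity :: "nat set \<Rightarrow> (nat \<Rightarrow> complex mat) \<Rightarrow> complex \<Rightarrow> ennreal" where
  "total_multiplicity L B z = (\<Sum>\<^sub>\<infinity>l\<in>L. of_nat (Polynomial.order z (char_poly (B l))))"

end

theory Submission
 imports Defs "HOL-Real_Asymp.Real_Asymp"
begin

text \<open>
 Let \<open>L\<^sub>s\<close> be the transfer operator \<open>transfer s\<close>: it sums \<open>phi\<close> over the inverse branches of \<open>f\<close> with
 weights \<open>slope^-s\<close>. Suppose that, for a number \<open>kappa\<close> and a function \<open>l > 0\<close> constant on each interval, an
 inverse branch from \<open>I j\<close> to \<open>I i\<close> multiplies an invariant measure \<open>\<mu>\<close> by \<open>l i slope i^-s / (kappa l j)\<close>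
 (\<open>local_jacobian\<close>). Change of variables turns \<open>\<integral> phi (psi \<circ> f^n) d\<mu>\<close> into
 \<open>kappa^-n \<integral> l^-1 L\<^sub>s^n (l phi) psi d\<mu>\<close> (\<open>correlation_eq_pairing\<close>), so expansions of correlations are
 expansions of the powers of \<open>L\<^sub>s\<close>.

 As the branches are affine, \<open>L\<^sub>s\<close> maps the Taylor coefficients of order at most \<open>k\<close> at the midpoints
 of the intervals to each other up to terms of higher order: in these coordinates it is block
 triangular with diagonal blocks \<open>B (s + k)\<close> (\<open>transfer_matrix_block\<close>). Derivatives of order \<open>K\<close> decay
 like \<open>(N / rate^(s + K))^n\<close>, so coordinates with respect to a Jordan basis of the first \<open>K\<close> blocks obey a
 Jordan recursion up to an error of that size. For eigenvalues larger than the error the recursion has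
 a limit, a functional that sees \<open>L\<^sub>s\<close> exactly as a Jordan block (\<open>resonance_level_exists\<close>). Letting
 \<open>K\<close> grow gives all nonzero resonances (\<open>resonance_family\<close>) and the theorem (\<open>resonance_expansion\<close>). Zero
 is an eigenvalue of all the \<open>B l\<close> or of none; it is listed by infinitely many blocks of size 1, which
 the expansion never uses.

 It remains to find \<open>l\<close>. For an absolutely continuous measure, \<open>s = 1\<close> and \<open>kappa = 1\<close>: functions with mean 0 on
 every interval become weakly small along the orbit (\<open>mixing_bound\<close>), which forces a constant density on
 each interval. For a measure of maximal entropy, \<open>s = 0\<close> and \<open>kappa = rho\<close>, the Perron eigenvalue
 of the adjacency matrix: \<open>ln rho\<close> is the topological entropy and is attained by some invariant measure
 (\<open>large_entropy_measure\<close>), and equality in Gibbs' inequality makes a measure with this entropy the Markov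
 measure of the Perron eigenvectors (\<open>bm_local_jacobian\<close>). The values of \<open>f\<close> at the partition points are
 arbitrary, so itineraries have extra letters for these points and the measure of the points has to be
 shown to vanish.
\<close>

section \<open>Jordan bases\<close>

text \<open>The position of entry \<open>q\<close> of block \<open>b\<close> on the diagonal of a Jordan matrix.\<close>
definition jordan_index :: "(nat \<times> 'a) list => nat => nat => nat" where
 "jordan_index bs b q = sum_list (map fst (take b bs)) + q"

lemma jordan_index_bij:
 "bij_betw (%(b, q). jordan_index bs b q)
  (SIGMA b:{..<length bs}. {..<fst (bs ! b)}) {..<sum_list (map fst bs)}"
proof (induction bs)
 case Nil
 then show ?case by (simp add: bij_betw_def)
next
 case (Cons x bs)
 let ?S = "%bs. (SIGMA b:{..<length bs}. {..<fst (bs ! b)})"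
 let ?i = "%bs. (%(b, q). jordan_index bs b q)"
 let ?s = "sum_list (map fst bs)"
 have split: "?S (x # bs) = {0} \<times> {..<fst x} Un (%(b, q). (Suc b, q)) ` ?S bs" (is "_ = ?A Un ?B")
 proof (intro equalityI subsetI)
  fix y assume "y \<in> ?S (x # bs)"
  then obtain b q where y: "y = (b, q)" "b < Suc (length bs)" "q < fst ((x # bs) ! b)" by auto
  show "y \<in> ?A Un ?B"
  proof (cases b)
   case (Suc c)
   then have "y = (%(b, q). (Suc b, q)) (c, q)" "(c, q) \<in> ?S bs" using y by auto
   then show ?thesis by blast
  qed (use y in auto)
 qed auto
 have 1: "bij_betw (?i (x # bs)) ?A {..<fst x}"
  by (auto simp: bij_betw_def inj_on_def jordan_index_def image_iff)
 have "bij_betw (%n. fst x + n) {..<?s} {fst x..<fst x + ?s}"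
  by (simp add: bij_betw_def lessThan_atLeast0 add.commute)
 from bij_betw_trans[OF Cons this]
 have *: "bij_betw (%(b, q). fst x + jordan_index bs b q) (?S bs) {fst x..<fst x + ?s}"
  by (simp add: comp_def case_prod_unfold)
 have "bij_betw (%(b, q). (b - 1, q)) ?B (?S bs)"
  by (rule bij_betw_byWitness[where f' = "%(b, q). (Suc b, q)"]) auto
 from bij_betw_trans[OF this *]
 have "bij_betw (%y. fst x + jordan_index bs (fst y - 1) (snd y)) ?B {fst x..<fst x + ?s}"
  by (simp add: comp_def case_prod_unfold)
 then have 2: "bij_betw (?i (x # bs)) ?B {fst x..<fst x + ?s}"
  by (rule bij_betw_cong[THEN iffD1, rotated]) (auto simp: jordan_index_def)
 have "bij_betw (?i (x # bs)) (?A Un ?B) ({..<fst x} Un {fst x..<fst x + ?s})"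
  by (rule bij_betw_combine[OF 1 2]) auto
 moreover have "{..<fst x} Un {fst x..<fst x + ?s} = {..<sum_list (map fst (x # bs))}" by auto
 ultimately show ?case unfolding split by simp
qed

lemma jordan_index_less:
 assumes "b < length bs" "q < fst (bs ! b)"
 shows "jordan_index bs b q < sum_list (map fst bs)"
 using bij_betwE[OF jordan_index_bij, of bs] assms by fastforce

lemma jordan_matrix_entry:
 assumes "b < length bs" "q < fst (bs ! b)" "b' < length bs" "q' < fst (bs ! b')"
 shows "jordan_matrix bs $$ (jordan_index bs b q, jordan_index bs b' q') =
  (if b = b' & q = q' then snd (bs ! b) else if b = b' & Suc q = q' then 1 else 0)"
 using assms
proof (induction bs arbitrary: b b')
 case (Cons x bs)
 obtain n a where x: "x = (n, a)" by force
 let ?s = "sum_list (map fst bs)"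
 note less = jordan_index_less[of _ bs]
 have suc: "jordan_index ((n, a) # bs) (Suc c) r = n + jordan_index bs c r" for c r
  by (simp add: jordan_index_def)
 have zero: "jordan_index ((n, a) # bs) 0 r = r" for r
  by (simp add: jordan_index_def)
 show ?case
 proof (cases b; cases b')
  assume "b = 0" "b' = 0"
  then show ?thesis using Cons.prems by (auto simp: x jordan_matrix_Cons zero)
 next
  fix c assume "b = 0" "b' = Suc c"
  then show ?thesis using Cons.prems less[of c q'] by (auto simp: x jordan_matrix_Cons zero suc)
 next
  fix c assume "b = Suc c" "b' = 0"
  then show ?thesis using Cons.prems less[of c q] by (auto simp: x jordan_matrix_Cons zero suc)
 next
  fix c c' assume "b = Suc c" "b' = Suc c'"
  then show ?thesis using Cons.prems less[of c q] less[of c' q'] Cons.IH[of c c']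
   by (auto simp: x jordan_matrix_Cons suc)
 qed
qed simp

text \<open>The columns \<open>e b q\<close> and rows \<open>alpha b q\<close> of a matrix that conjugates \<open>M\<close> to Jordan form, and of its inverse.\<close>
lemma jordan_basis:
 fixes M :: "nat => nat => complex"
 obtains B m xi and e alpha :: "nat => nat => nat => complex"
 where "!!b. b < B ==> m b >= (1::nat)"
  and "!!b q i. b < B ==> q < m b ==> i < n ==>
     (\<Sum>c<n. M i c * e b q c) = xi b * e b q i + (if q = 0 then 0 else e b (q - 1) i)"
  and "!!b q c. b < B ==> q < m b ==> c < n ==>
     (\<Sum>i<n. alpha b q i * M i c) = xi b * alpha b q c + (if Suc q < m b then alpha b (Suc q) c else 0)"
  and "!!b q b' q'. b < B ==> q < m b ==> b' < B ==> q' < m b' ==>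
     (\<Sum>i<n. alpha b q i * e b' q' i) = (if b = b' & q = q' then 1 else 0)"
  and "!!i c. i < n ==> c < n ==>
     (\<Sum>b<B. \<Sum>q<m b. e b q i * alpha b q c) = (if i = c then 1 else 0)"
  and "!!z. Polynomial.order z (char_poly (mat n n (%(i, c). M i c))) = (\<Sum>b | b < B & xi b = z. m b)"
proof -
 define A where "A = mat n n (%(i, c). M i c)"
 have A: "A \<in> carrier_mat n n" by (simp add: A_def)
 obtain as where "char_poly A = (\<Prod>a\<leftarrow>as. [:- a, 1:])" using char_poly_factorized[OF A] by blast
 from jordan_nf_exists[OF A this] obtain bs where bs: "jordan_nf A bs" by blast
 let ?J = "jordan_matrix bs"
 define idx where "idx = jordan_index bs"
 define s where "s = sum_list (map fst bs)"
 from bs obtain P Q where PQ: "similar_mat_wit A ?J P Q"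
  unfolding jordan_nf_def similar_mat_def by blast
 note D = similar_mat_witD2[OF A PQ]
 have s: "s = n" using D(5) unfolding s_def by (metis carrier_matD(1) jordan_matrix_dim(1))
 let ?S = "SIGMA b:{..<length bs}. {..<fst (bs ! b)}"
 have bij: "bij_betw (%(b, q). idx b q) ?S {..<n}"
  using jordan_index_bij[of bs] unfolding idx_def s[symmetric] s_def .
 have idx_less: "idx b q < n" if "b < length bs" "q < fst (bs ! b)" for b q
  using jordan_index_less[OF that] unfolding idx_def s[symmetric] s_def .
 have idx_inj: "idx b q = idx b' q' \<longleftrightarrow> b = b' & q = q'"
  if "b < length bs" "q < fst (bs ! b)" "b' < length bs" "q' < fst (bs ! b')" for b q b' q'
  using bij_betw_imp_inj_on[OF bij] that unfolding inj_on_def by fastforce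
 have J: "?J $$ (idx b q, idx b' q') =
   (if b = b' & q = q' then snd (bs ! b) else if b = b' & Suc q = q' then 1 else 0)"
  if "b < length bs" "q < fst (bs ! b)" "b' < length bs" "q' < fst (bs ! b')" for b q b' q'
  using jordan_matrix_entry[OF that] unfolding idx_def .
 have reindex: "(\<Sum>r<n. f r) = (\<Sum>b<length bs. \<Sum>q<fst (bs ! b). f (idx b q))"
  for f :: "nat => complex"
  unfolding sum.reindex_bij_betw[OF bij, symmetric] by (simp add: sum.Sigma case_prod_unfold)
 have prod: "(X * Y) $$ (i, c) = (\<Sum>r<n. X $$ (i, r) * Y $$ (r, c))"
  if "X \<in> carrier_mat n n" "Y \<in> carrier_mat n n" "i < n" "c < n" for X Y :: "complex mat" and i c
  using that by (simp add: scalar_prod_def lessThan_atLeast0)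
 have AP: "A * P = P * ?J"
 proof -
  have "P * ?J * Q * P = P * ?J * (Q * P)"
   by (rule assoc_mult_mat[of _ n n _ n _ n]) (use D(4-7) in auto)
  also have "... = P * ?J" unfolding D(2) by (rule right_mult_one_mat[of _ n n]) (use D(4-7) in auto)
  finally show ?thesis unfolding D(3)[symmetric] .
 qed
 have QA: "Q * A = ?J * Q"
 proof -
  have 1: "P * ?J * Q = P * (?J * Q)"
   by (rule assoc_mult_mat[of _ n n _ n _ n]) (use D(4-7) in auto)
  have "Q * A = Q * (P * (?J * Q))" using D(3) 1 by simp
  also have "... = Q * P * (?J * Q)"
   by (rule assoc_mult_mat[of _ n n _ n _ n, symmetric]) (use D(4-7) in auto)
  also have "... = ?J * Q" unfolding D(2) by (rule left_mult_one_mat[of _ n n]) (use D(4-7) in auto)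
  finally show ?thesis .
 qed
 define e where "e b q i = P $$ (i, idx b q)" for b q i
 define alpha where "alpha b q i = Q $$ (idx b q, i)" for b q i
 show thesis
 proof (rule that[of "length bs" "%b. fst (bs ! b)" e "%b. snd (bs ! b)" alpha])
  show "fst (bs ! b) >= 1" if "b < length bs" for b
  proof -
   have "fst (bs ! b) \<in> fst ` set bs" using that by simp
   then have "fst (bs ! b) ~= 0" using bs unfolding jordan_nf_def by metis
   then show ?thesis by simp
  qed
 next
  fix b q i assume h: "b < length bs" "q < fst (bs ! b)" "i < n"
  have "(\<Sum>c<n. M i c * e b q c) = (A * P) $$ (i, idx b q)"
   using h idx_less[OF h(1,2)] by (simp add: prod[OF A D(6)]) (simp add: A_def e_def)
  also have "... = (\<Sum>r<n. P $$ (i, r) * ?J $$ (r, idx b q))"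
   using h idx_less[OF h(1,2)] by (simp only: AP prod[OF D(6) D(5)])
  also have "... = (\<Sum>b'<length bs. \<Sum>q'<fst (bs ! b').
    (if b' = b then if q' = q then snd (bs ! b) * e b q i else if Suc q' = q then e b q' i else 0
    else 0))"
   unfolding reindex by (intro sum.cong refl) (use h in "auto simp: J e_def")
  also have "... = (\<Sum>q'<fst (bs ! b).
    (if q' = q then snd (bs ! b) * e b q i else if Suc q' = q then e b q' i else 0))"
  proof -
   have "(\<Sum>b'<length bs. \<Sum>q'<fst (bs ! b').
    (if b' = b then if q' = q then snd (bs ! b) * e b q i else if Suc q' = q then e b q' i else 0
    else 0)) = (\<Sum>b'<length bs. if b' = b then (\<Sum>q'<fst (bs ! b).
    (if q' = q then snd (bs ! b) * e b q i else if Suc q' = q then e b q' i else 0)) else 0)"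
    by (intro sum.cong) auto
   then show ?thesis using h by simp
  qed
  also have "... = (\<Sum>q'<fst (bs ! b). (if q' = q then snd (bs ! b) * e b q i else 0) +
    (if q' = q - 1 then (if q = 0 then 0 else e b (q - 1) i) else 0))"
   by (intro sum.cong) auto
  also have "... = snd (bs ! b) * e b q i + (if q = 0 then 0 else e b (q - 1) i)"
   unfolding sum.distrib using h by (subst (1 2) sum.delta) auto
  finally show "(\<Sum>c<n. M i c * e b q c) = snd (bs ! b) * e b q i + (if q = 0 then 0 else e b (q - 1) i)" .
 next
  fix b q c assume h: "b < length bs" "q < fst (bs ! b)" "c < n"
  have "(\<Sum>i<n. alpha b q i * M i c) = (Q * A) $$ (idx b q, c)"
   using h idx_less[OF h(1,2)] by (simp add: prod[OF D(7) A]) (simp add: A_def alpha_def)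
  also have "... = (\<Sum>r<n. ?J $$ (idx b q, r) * Q $$ (r, c))"
   using h idx_less[OF h(1,2)] by (simp only: QA prod[OF D(5) D(7)])
  also have "... = (\<Sum>b'<length bs. \<Sum>q'<fst (bs ! b').
    (if b' = b then if q' = q then snd (bs ! b) * alpha b q c else if Suc q = q' then alpha b q' c else 0
    else 0))"
   unfolding reindex by (intro sum.cong refl) (use h in "auto simp: J alpha_def")
  also have "... = (\<Sum>q'<fst (bs ! b).
    (if q' = q then snd (bs ! b) * alpha b q c else if Suc q = q' then alpha b q' c else 0))"
  proof -
   have "(\<Sum>b'<length bs. \<Sum>q'<fst (bs ! b').
    (if b' = b then if q' = q then snd (bs ! b) * alpha b q c else if Suc q = q' then alpha b q' c else 0
    else 0)) = (\<Sum>b'<length bs. if b' = b then (\<Sum>q'<fst (bs ! b).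
    (if q' = q then snd (bs ! b) * alpha b q c else if Suc q = q' then alpha b q' c else 0)) else 0)"
    by (intro sum.cong) auto
   then show ?thesis using h by simp
  qed
  also have "... = (\<Sum>q'<fst (bs ! b). (if q' = q then snd (bs ! b) * alpha b q c else 0) +
    (if q' = Suc q then alpha b (Suc q) c else 0))"
   by (intro sum.cong) auto
  also have "... = snd (bs ! b) * alpha b q c + (if Suc q < fst (bs ! b) then alpha b (Suc q) c else 0)"
   unfolding sum.distrib using h by (subst (1 2) sum.delta) auto
  finally show "(\<Sum>i<n. alpha b q i * M i c) =
    snd (bs ! b) * alpha b q c + (if Suc q < fst (bs ! b) then alpha b (Suc q) c else 0)" .
 next
  fix b q b' q' assume h: "b < length bs" "q < fst (bs ! b)" "b' < length bs" "q' < fst (bs ! b')"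
  have "(\<Sum>i<n. alpha b q i * e b' q' i) = (Q * P) $$ (idx b q, idx b' q')"
   using idx_less h by (simp add: prod[OF D(7) D(6)] alpha_def e_def)
  also have "... = (if b = b' & q = q' then 1 else 0)"
   using idx_less h idx_inj[OF h] by (simp add: D(2))
  finally show "(\<Sum>i<n. alpha b q i * e b' q' i) = (if b = b' & q = q' then 1 else 0)" .
 next
  fix i c assume h: "i < n" "c < n"
  have "(\<Sum>b<length bs. \<Sum>q<fst (bs ! b). e b q i * alpha b q c) = (P * Q) $$ (i, c)"
   unfolding prod[OF D(6) D(7) h] reindex e_def alpha_def ..
  then show "(\<Sum>b<length bs. \<Sum>q<fst (bs ! b). e b q i * alpha b q c) = (if i = c then 1 else 0)"
   using h by (simp add: D(1))
 next
  fix z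
  have "Polynomial.order z (char_poly A) = sum_list (map fst (filter (%x. snd x = z) bs))"
   by (rule jordan_nf_order[OF bs])
  also have "... = (\<Sum>b | b < length bs & snd (bs ! b) = z. fst (bs ! b))"
  proof -
   have "sum_list (map fst (filter (%x. snd x = z) bs)) =
     sum_list (map (%x. if snd x = z then fst x else 0) bs)"
    by (induction bs) auto
   also have "... = (\<Sum>b<length bs. if snd (bs ! b) = z then fst (bs ! b) else 0)"
    by (simp add: sum_list_sum_nth lessThan_atLeast0)
   also have "... = (\<Sum>b\<in>{b \<in> {..<length bs}. snd (bs ! b) = z}. fst (bs ! b))"
    by (rule sum.inter_filter[symmetric]) simp
   finally show ?thesis by simp
  qed
  finally show "Polynomial.order z (char_poly (mat n n (%(i, c). M i c))) =
    (\<Sum>b | b < length bs & snd (bs ! b) = z. fst (bs ! b))"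
   by (simp add: A_def)
 qed
qed

lemma char_poly_block_upper_triangular:
 fixes A1 :: "'a :: idom mat"
 assumes "A1 \<in> carrier_mat n n" "A2 \<in> carrier_mat n k" "A3 \<in> carrier_mat k k"
 shows "char_poly (four_block_mat A1 A2 (0\<^sub>m k n) A3) = char_poly A1 * char_poly A3"
proof -
 let ?cm = "%A. [:0, 1:] \<cdot>\<^sub>m 1\<^sub>m (dim_row A) + map_mat (%a. [:- a:]) A"
 have "?cm (four_block_mat A1 A2 (0\<^sub>m k n) A3) =
   four_block_mat (?cm A1) (map_mat (%a. [:- a:]) A2) (0\<^sub>m k n) (?cm A3)"
  by (rule eq_matI) (use assms in "auto simp: one_poly_def")
 then have "char_poly (four_block_mat A1 A2 (0\<^sub>m k n) A3) =
   det (four_block_mat (?cm A1) (map_mat (%a. [:- a:]) A2) (0\<^sub>m k n) (?cm A3))"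
  unfolding char_poly_defs using assms by simp
 also have "... = det (?cm A1) * det (?cm A3)"
  by (rule det_four_block_mat_lower_left_zero[OF _ _ refl]) (use assms in auto)
 finally show ?thesis unfolding char_poly_defs .
qed

lemma order_char_poly_block_upper_triangular:
 fixes M :: "nat => nat => complex" and D :: "nat => nat => nat => complex"
 assumes low: "!!k l i j. l < k ==> i < N ==> j < N ==> M (k * N + i) (l * N + j) = 0"
  and diag: "!!k i j. i < N ==> j < N ==> M (k * N + i) (k * N + j) = D k i j"
  and N: "N > 0"
 shows "Polynomial.order z (char_poly (mat (K * N) (K * N) (%(i, c). M i c))) =
  (\<Sum>k<K. Polynomial.order z (char_poly (mat N N (%(i, j). D k i j))))"
proof (induction K)
 case 0
 have "mat 0 0 (%(i, c). M i c) = 1\<^sub>m 0" by auto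
 then show ?case by (simp add: char_poly_defs det_def order_0I)
next
 case (Suc K)
 let ?A = "mat (K * N) (K * N) (%(i, c). M i c)"
 let ?B = "mat (K * N) N (%(i, j). M i (K * N + j))"
 let ?C = "mat N N (%(i, j). D K i j)"
 have "mat (Suc K * N) (Suc K * N) (%(i, c). M i c) = four_block_mat ?A ?B (0\<^sub>m N (K * N)) ?C"
 proof (rule eq_matI)
  fix i j assume "i < dim_row (four_block_mat ?A ?B (0\<^sub>m N (K * N)) ?C)"
   "j < dim_col (four_block_mat ?A ?B (0\<^sub>m N (K * N)) ?C)"
  then have h: "i < Suc K * N" "j < Suc K * N" by auto
  show "mat (Suc K * N) (Suc K * N) (%(i, c). M i c) $$ (i, j) =
    four_block_mat ?A ?B (0\<^sub>m N (K * N)) ?C $$ (i, j)"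
  proof (cases "i < K * N")
   case True
   then show ?thesis using h by auto
  next
   case False
   then obtain i' where i': "i = K * N + i'" "i' < N"
    using h by (metis add_diff_inverse_nat add_less_cancel_left mult_Suc add.commute)
   show ?thesis
   proof (cases "j < K * N")
    case True
    then have "j div N < K" by (simp add: less_mult_imp_div_less)
    then have "M (K * N + i') j = 0" using low[of "j div N" K i' "j mod N"] i' N by simp
    then show ?thesis using True h i' by simp
   next
    case False
    then obtain j' where "j = K * N + j'" "j' < N"
     using h by (metis add_diff_inverse_nat add_less_cancel_left mult_Suc add.commute)
    then show ?thesis using diag i' by auto
   qed
  qed
 qed auto
 then have cp: "char_poly (mat (Suc K * N) (Suc K * N) (%(i, c). M i c)) = char_poly ?A * char_poly ?C"
  by (simp only:) (rule char_poly_block_upper_triangular[where n = "K * N" and k = N], auto)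
 have "char_poly (X :: complex mat) ~= 0" if "X \<in> carrier_mat n n" for X n
  using degree_monic_char_poly[OF that] by auto
 from this[of ?A "K * N"] this[of ?C N] have "char_poly ?A * char_poly ?C ~= 0" by simp
 from order_mult[OF this, of z] show ?case unfolding cp using Suc.IH by simp
qed

section \<open>The branches of the map\<close>

locale markov_map =
 fixes f :: "real => real" and N :: nat and p slope :: "nat => real"
 assumes affine_markov: "affine_markov_map f N p slope"
begin

abbreviation I where "I j \<equiv> branch_interval p j"
abbreviation cI where "cI j \<equiv> {p j..p (Suc j)}"
abbreviation U where "U \<equiv> branch_union N p"
abbreviation V where "V \<equiv> piecewise_smooth N p"

definition mid :: "nat => real" where "mid j = (p j + p (Suc j)) / 2"
text \<open>The limits of \<open>f\<close> at the end points of \<open>I j\<close>, by extrapolation: \<open>f\<close> itself is arbitrary there.\<close>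
definition lower :: "nat => real" where "lower j = f (mid j) + slope j * (p j - mid j)"
definition upper :: "nat => real" where "upper j = f (mid j) + slope j * (p (Suc j) - mid j)"
definition inv_branch :: "nat => real => real" where
 "inv_branch i x = p i + (x - lower i) / slope i"
definition adj :: "nat => nat => bool" where "adj i j \<longleftrightarrow> I j \<subseteq> f ` I i"
definition rate :: real where "rate = Min (slope ` {..<N})"

lemma unit_interval: "f ` {0..1} \<subseteq> {0..1}" and p_0: "p 0 = 0" and p_N: "p N = 1"
 and p_less: "j < N ==> p j < p (Suc j)"
 and markov: "i < N ==> j < N ==> f ` I i Int I j = {} \<or> I j \<subseteq> f ` I i"
 and deriv: "j < N ==> x \<in> I j ==> (f has_real_derivative slope j) (at x)"
 using affine_markov unfolding affine_markov_map_def by auto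

lemma N_pos: "N > 0"
 using p_0 p_N by (cases N) auto

lemma rate_gt_1: "rate > 1" and slope_ge_rate: "j < N ==> slope j >= rate"
proof -
 obtain l where l: "l > 1" "ALL j<N. slope j >= l"
  using affine_markov unfolding affine_markov_map_def by auto
 have "rate \<in> slope ` {..<N}" unfolding rate_def by (rule Min_in) (use N_pos in auto)
 then show "rate > 1" using l by auto
 show "j < N ==> slope j >= rate" unfolding rate_def by (rule Min_le) auto
qed

lemma slope_gt_1: "j < N ==> slope j > 1"
 using rate_gt_1 slope_ge_rate by fastforce

lemma p_mono: "i <= j ==> j <= N ==> p i <= p j"
proof (induction j rule: dec_induct)
 case (step n)
 then show ?case using p_less[of n] by auto
qed simp

lemma p_strict: "i < j ==> j <= N ==> p i < p j"
 using p_less[of i] p_mono[of "Suc i" j] by auto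

lemma p_inj: "i <= N ==> j <= N ==> p i = p j \<longleftrightarrow> i = j"
 by (metis less_irrefl linorder_neqE_nat p_strict)

lemma p_unit: "j <= N ==> p j \<in> {0..1}"
 using p_mono[of 0 j] p_mono[of j N] p_0 p_N by auto

lemma I_unit: "j < N ==> I j \<subseteq> {0..1}"
 using p_unit[of j] p_unit[of "Suc j"] by (auto simp: branch_interval_def)

lemma U_unit: "U \<subseteq> {0..1}"
 using I_unit by (auto simp: branch_union_def)

lemma I_U: "j < N ==> x \<in> I j ==> x \<in> U"
 by (auto simp: branch_union_def)

lemma U_E: assumes "x \<in> U" obtains j where "j < N" "x \<in> I j"
 using assms by (auto simp: branch_union_def)

lemma I_disjoint: "i < N ==> j < N ==> x \<in> I i ==> x \<in> I j ==> i = j"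
proof (rule ccontr)
 assume h: "i < N" "j < N" "x \<in> I i" "x \<in> I j" "i ~= j"
 then consider "Suc i <= j" | "Suc j <= i" by linarith
 then show False
  using h p_mono[of "Suc i" j] p_mono[of "Suc j" i] by cases (auto simp: branch_interval_def)
qed

lemma I_open: "open (I j)" and I_convex: "convex (I j)"
 by (auto simp: branch_interval_def)

lemma U_open: "open U"
 unfolding branch_union_def by (intro open_UN ballI I_open)

lemma mid_in: "j < N ==> mid j \<in> I j"
 using p_less by (auto simp: mid_def branch_interval_def)

lemma unit_cases:
 assumes "x \<in> {0..1}"
 obtains j where "j < N" "x \<in> I j" | j where "j <= N" "x = p j"
proof -
 let ?j = "Max {j. j <= N & p j <= x}"
 have fin: "finite {j. j <= N & p j <= x}" by simp
 have ne: "{j. j <= N & p j <= x} ~= {}" using assms p_0 by (auto intro: exI[of _ 0])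
 have j: "?j <= N" "p ?j <= x" using Max_in[OF fin ne] by auto
 show thesis
 proof (cases "x = p ?j")
  case False
  then have lt: "p ?j < x" using j by simp
  have jN: "?j < N" using lt assms p_N j by (cases "?j = N") auto
  have "\<not> p (Suc ?j) <= x"
  proof
   assume "p (Suc ?j) <= x"
   then have "Suc ?j <= ?j" by (intro Max_ge fin) (use jN in auto)
   then show False by simp
  qed
  then show thesis using that(1)[OF jN] lt by (auto simp: branch_interval_def)
 qed (use that(2) j in blast)
qed

lemma p_notin_U: "j <= N ==> p j \<notin> U"
proof
 assume "j <= N" "p j \<in> U"
 then obtain i where i: "i < N" "p i < p j" "p j < p (Suc i)"
  by (auto simp: branch_union_def branch_interval_def)
 then show False using p_mono[of j i] p_mono[of "Suc i" j] \<open>j <= N\<close> by linarith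
qed

lemma unit_minus_U: "{0..1} - U = p ` {..N}"
 using p_notin_U p_unit by (auto elim!: unit_cases intro: I_U)

lemma f_affine:
 assumes "j < N" "x \<in> I j"
 shows "f x = lower j + slope j * (x - p j)"
proof -
 have "(%x. f x - slope j * x) x = (%x. f x - slope j * x) (mid j)"
 proof (rule has_derivative_zero_constant[OF I_convex[of j], THEN exE])
  show "((%x. f x - slope j * x) has_derivative (%h. 0)) (at y within I j)" if "y \<in> I j" for y
  proof -
   have "((%x. f x - slope j * x) has_real_derivative (slope j - slope j * 1)) (at y)"
    by (intro DERIV_diff DERIV_cmult DERIV_ident deriv assms that)
   then have "((%x. f x - slope j * x) has_derivative (*) 0) (at y within I j)"
    unfolding has_field_derivative_def by (simp add: has_derivative_at_withinI)
   then show ?thesis by (simp add: lambda_zero)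
  qed
 qed (use assms mid_in in auto)
 then show ?thesis by (simp add: lower_def algebra_simps)
qed

lemma upper_lower: "upper j = lower j + slope j * (p (Suc j) - p j)"
 by (simp add: upper_def lower_def algebra_simps)

lemma f_inv_branch: "j < N ==> inv_branch j x \<in> I j ==> f (inv_branch j x) = x"
 using slope_gt_1[of j] by (simp add: f_affine) (simp add: inv_branch_def)

lemma inv_branch_f: "j < N ==> x \<in> I j ==> inv_branch j (f x) = x"
 using slope_gt_1[of j] by (simp add: f_affine inv_branch_def)

lemma inv_branch_in: "j < N ==> inv_branch j x \<in> I j \<longleftrightarrow> x \<in> {lower j<..<upper j}"
 using slope_gt_1[of j] by (simp add: inv_branch_def branch_interval_def upper_lower field_simps)

lemma inv_branch_cI: "j < N ==> inv_branch j x \<in> cI j \<longleftrightarrow> x \<in> {lower j..upper j}"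
 using slope_gt_1[of j] by (simp add: inv_branch_def upper_lower field_simps)

lemma image_I:
 assumes "j < N" shows "f ` I j = {lower j<..<upper j}"
proof (intro equalityI subsetI)
 fix y assume "y \<in> f ` I j"
 then show "y \<in> {lower j<..<upper j}" using inv_branch_f assms inv_branch_in by fastforce
next
 fix y assume "y \<in> {lower j<..<upper j}"
 then have "inv_branch j y \<in> I j" using inv_branch_in[OF assms] by simp
 from imageI[OF this, of f] f_inv_branch[OF assms this] show "y \<in> f ` I j" by simp
qed

lemma lower_less_upper: "j < N ==> lower j < upper j"
 using slope_gt_1[of j] p_less[of j] by (simp add: upper_lower)

lemma adj_iff: "i < N ==> j < N ==> x \<in> I j ==> adj i j \<longleftrightarrow> x \<in> {lower i<..<upper i}"
 using markov[of i j] image_I[of i] unfolding adj_def by auto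

lemma adj_inv_branch_in: "i < N ==> j < N ==> x \<in> I j ==> adj i j \<longleftrightarrow> inv_branch i x \<in> I i"
 using adj_iff inv_branch_in by blast

lemma adj_bounds:
 assumes "i < N" "j < N" "adj i j"
 shows "lower i <= p j" "p (Suc j) <= upper i"
proof -
 have "closure (I j) \<subseteq> closure {lower i<..<upper i}"
  using assms image_I[of i] unfolding adj_def by (intro closure_mono) auto
 then have "cI j \<subseteq> {lower i..upper i}"
  using p_less[OF assms(2)] lower_less_upper[OF assms(1)] by (simp add: branch_interval_def)
 then show "lower i <= p j" "p (Suc j) <= upper i" using p_less[OF assms(2)] by auto
qed

lemma adj_inv_branch_cI: "i < N ==> j < N ==> adj i j ==> x \<in> cI j ==> inv_branch i x \<in> cI i"
 using adj_bounds[of i j] inv_branch_cI[of i x] by auto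

lemma f_adj: "i < N ==> j < N ==> x \<in> I i ==> f x \<in> I j ==> adj i j"
 using markov[of i j] unfolding adj_def by auto

lemma dist_in_I: "j < N ==> x \<in> I j ==> y \<in> I j ==> \<bar>x - y\<bar> <= 1"
 using p_unit[of j] p_unit[of "Suc j"] by (auto simp: branch_interval_def)

section \<open>Derivatives of piecewise smooth functions\<close>

definition Df :: "(real => complex) => real => complex" where
 "Df phi x = vector_derivative phi (at x)"

definition extension :: "nat => (real => complex) => (nat => real => complex) => bool" where
 "extension j phi D \<longleftrightarrow> (ALL x:I j. D 0 x = phi x) &
  (ALL k. ALL x:cI j. (D k has_vector_derivative D (Suc k) x) (at x within cI j))"

lemma V_iff: "phi \<in> V \<longleftrightarrow> (ALL j<N. EX D. extension j phi D)"
 by (simp add: piecewise_smooth_def extension_def)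

lemma V_I: "(!!j. j < N ==> extension j phi (D j)) ==> phi \<in> V"
 unfolding V_iff by blast

lemma extension_at:
 assumes "extension j phi D" "x \<in> I j"
 shows "(D k has_vector_derivative D (Suc k) x) (at x)"
proof -
 have "(D k has_vector_derivative D (Suc k) x) (at x within cI j)"
  using assms unfolding extension_def branch_interval_def by auto
 then have "(D k has_vector_derivative D (Suc k) x) (at x within I j)"
  by (rule has_vector_derivative_within_subset) (auto simp: branch_interval_def)
 then show ?thesis unfolding at_within_open[OF assms(2) I_open] .
qed

lemma extension_Df:
 assumes "extension j phi D" "x \<in> I j"
 shows "(Df ^^ k) phi x = D k x"
 using assms(2)
proof (induction k arbitrary: x)
 case 0
 then show ?case using assms(1) by (simp add: extension_def)
next
 case (Suc k)
 have "((Df ^^ k) phi has_vector_derivative D (Suc k) x) (at x)"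
  by (rule has_vector_derivative_transform_within_open[OF extension_at[OF assms(1) Suc.prems] I_open Suc.prems])
   (simp add: Suc.IH)
 then show ?case by (simp add: Df_def[of "(Df ^^ k) phi"] vector_derivative_at)
qed

lemma Df_at:
 assumes "phi \<in> V" "x \<in> U"
 shows "((Df ^^ k) phi has_vector_derivative (Df ^^ Suc k) phi x) (at x)"
proof -
 obtain j where j: "j < N" "x \<in> I j" using assms(2) by (rule U_E)
 obtain D where D: "extension j phi D" using assms(1) j unfolding V_iff by blast
 have "((Df ^^ k) phi has_vector_derivative D (Suc k) x) (at x)"
  by (rule has_vector_derivative_transform_within_open[OF extension_at[OF D j(2)] I_open j(2)])
   (simp add: extension_Df[OF D])
 then show ?thesis using extension_Df[OF D j(2)] by metis
qed

lemma Df_cong: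
 assumes "!!x. x \<in> U ==> phi x = psi x" "x \<in> U"
 shows "(Df ^^ k) phi x = (Df ^^ k) psi x"
 using assms(2)
proof (induction k arbitrary: x)
 case (Suc k)
 have "((Df ^^ k) phi has_vector_derivative D) (at x) \<longleftrightarrow> ((Df ^^ k) psi has_vector_derivative D) (at x)" for D
  by (rule iffI; erule has_vector_derivative_transform_within_open[OF _ U_open Suc.prems]; simp add: Suc.IH)
 then have "vector_derivative ((Df ^^ k) phi) (at x) = vector_derivative ((Df ^^ k) psi) (at x)"
  unfolding vector_derivative_def by simp
 then show ?case by (simp add: Df_def[of "(Df ^^ k) phi"] Df_def[of "(Df ^^ k) psi"])
qed (use assms in auto)

lemma V_cong: "phi \<in> V ==> (!!x. x \<in> U ==> phi x = psi x) ==> psi \<in> V"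
proof -
 assume h: "phi \<in> V" "!!x. x \<in> U ==> phi x = psi x"
 from h(1) obtain D where D: "!!j. j < N ==> extension j phi (D j)" unfolding V_iff by metis
 show ?thesis by (rule V_I[of _ D]) (use D h(2) I_U in "auto simp: extension_def")
qed

lemma V_bounded:
 assumes "phi \<in> V"
 obtains S where "S >= 0" "!!x. x \<in> U ==> norm ((Df ^^ k) phi x) <= S"
proof -
 have "EX S. ALL x:I j. norm ((Df ^^ k) phi x) <= S" if j: "j < N" for j
 proof -
  obtain D where D: "extension j phi D" using assms j unfolding V_iff by blast
  then have "continuous_on (cI j) (D k)"
   unfolding extension_def by (auto intro!: has_vector_derivative_continuous simp: continuous_on_eq_continuous_within)
  then have "compact (D k ` cI j)" by (intro compact_continuous_image) auto
  then obtain S where "ALL y:D k ` cI j. norm y <= S" using compact_imp_bounded bounded_iff by blast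
  then have "ALL x:I j. norm ((Df ^^ k) phi x) <= S"
   using extension_Df[OF D] by (auto simp: branch_interval_def)
  then show ?thesis ..
 qed
 then obtain S where S: "!!j x. j < N ==> x \<in> I j ==> norm ((Df ^^ k) phi x) <= S j" by metis
 show thesis
 proof (rule that[of "\<Sum>j<N. \<bar>S j\<bar>"])
  fix x assume "x \<in> U"
  then obtain j where j: "j < N" "x \<in> I j" by (rule U_E)
  have "norm ((Df ^^ k) phi x) <= \<bar>S j\<bar>" using S[OF j] by simp
  also have "... <= (\<Sum>j<N. \<bar>S j\<bar>)" by (rule member_le_sum) (use j in auto)
  finally show "norm ((Df ^^ k) phi x) <= (\<Sum>j<N. \<bar>S j\<bar>)" .
 qed (auto intro: sum_nonneg)
qed

lemma extension_sum:
 assumes "!!q. q \<in> F ==> extension j (\<Phi> q) (D q)"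
 shows "extension j (%x. \<Sum>q\<in>F. c q * \<Phi> q x) (%k x. \<Sum>q\<in>F. c q * D q k x)"
 using assms unfolding extension_def
 by (auto intro!: sum.cong has_vector_derivative_sum has_vector_derivative_mult_right)

lemma
 assumes "!!q. q \<in> F ==> \<Phi> q \<in> V"
 shows V_sum: "(%x. \<Sum>q\<in>F. c q * \<Phi> q x) \<in> V"
  and Df_sum: "x \<in> U ==> (Df ^^ k) (%x. \<Sum>q\<in>F. c q * \<Phi> q x) x = (\<Sum>q\<in>F. c q * (Df ^^ k) (\<Phi> q) x)"
proof -
 have "EX D. ALL q:F. extension j (\<Phi> q) (D q)" if "j < N" for j
  by (rule bchoice) (use assms that in "auto simp: V_iff")
 then obtain D where D: "!!j q. j < N ==> q \<in> F ==> extension j (\<Phi> q) (D j q)" by metis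
 note * = extension_sum[where F = F and \<Phi> = \<Phi> and c = c, OF D]
 show "(%x. \<Sum>q\<in>F. c q * \<Phi> q x) \<in> V" by (rule V_I) (rule *)
 assume "x \<in> U"
 then obtain j where j: "j < N" "x \<in> I j" by (rule U_E)
 show "(Df ^^ k) (%x. \<Sum>q\<in>F. c q * \<Phi> q x) x = (\<Sum>q\<in>F. c q * (Df ^^ k) (\<Phi> q) x)"
  using extension_Df[OF *[OF j(1)] j(2)] extension_Df[OF D[OF j(1)] j(2)] by simp
qed

lemma
 assumes "phi \<in> V" "psi \<in> V"
 shows V_lin: "(%x. a * phi x + b * psi x) \<in> V"
  and Df_lin: "x \<in> U ==> (Df ^^ k) (%x. a * phi x + b * psi x) x = a * (Df ^^ k) phi x + b * (Df ^^ k) psi x"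
 using V_sum[of "{True, False}" "%t. if t then phi else psi" "%t. if t then a else b"] assms
  Df_sum[of "{True, False}" "%t. if t then phi else psi" x k "%t. if t then a else b"] by auto

lemma V_diff: "phi \<in> V ==> psi \<in> V ==> (%x. phi x - psi x) \<in> V"
 using V_lin[of phi psi 1 "-1"] by simp

lemma Df_diff: "phi \<in> V ==> psi \<in> V ==> x \<in> U ==>
  (Df ^^ k) (%x. phi x - psi x) x = (Df ^^ k) phi x - (Df ^^ k) psi x"
 using Df_lin[of phi psi x k 1 "-1"] by simp

lemma V_scale: "phi \<in> V ==> (%x. c * phi x) \<in> V"
 using V_lin[of phi phi c 0] by simp

lemma V_cnj: "phi \<in> V ==> (%x. cnj (phi x)) \<in> V"
proof -
 assume "phi \<in> V"
 then obtain D where D: "!!j. j < N ==> extension j phi (D j)" unfolding V_iff by metis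
 have "extension j (%x. cnj (phi x)) (%k x. cnj (D j k x))" if "j < N" for j
  using D[OF that] unfolding extension_def by (auto intro: has_vector_derivative_cnj)
 then show ?thesis by (rule V_I)
qed

definition step_function :: "(nat => real) => real => complex" where
 "step_function l x = (\<Sum>j<N. if x \<in> I j then of_real (l j) else 0)"

lemma step_function: "j < N ==> x \<in> I j ==> step_function l x = of_real (l j)"
proof -
 assume j: "j < N" "x \<in> I j"
 have "step_function l x = (\<Sum>i<N. if i = j then of_real (l j) else 0)"
  unfolding step_function_def by (intro sum.cong) (use I_disjoint j in auto)
 then show ?thesis using j by simp
qed

lemma V_step: "phi \<in> V ==> (%x. step_function l x * phi x) \<in> V"
proof -
 assume "phi \<in> V"
 then obtain D where D: "!!j. j < N ==> extension j phi (D j)" unfolding V_iff by metis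
 have "extension j (%x. step_function l x * phi x) (%k x. of_real (l j) * D j k x)" if "j < N" for j
  using D[OF that] that unfolding extension_def
  by (auto intro!: has_vector_derivative_mult_right simp: step_function)
 then show ?thesis by (rule V_I)
qed

subsection \<open>The transfer operators\<close>

definition transfer :: "nat => (real => complex) => real => complex" where
 "transfer s phi x = (\<Sum>i<N. if x \<in> {lower i<..<upper i}
  then inverse (of_real (slope i)) ^ s * phi (inv_branch i x) else 0)"

lemma transfer_on_I:
 assumes "j < N" "x \<in> I j"
 shows "transfer s phi x =
  (\<Sum>i | i < N & adj i j. inverse (of_real (slope i)) ^ s * phi (inv_branch i x))"
proof -
 have "transfer s phi x = (\<Sum>i<N. if adj i j
  then inverse (of_real (slope i)) ^ s * phi (inv_branch i x) else 0)"
  unfolding transfer_def by (intro sum.cong) (use assms adj_iff in auto)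
 also have "... = (\<Sum>i\<in>{i \<in> {..<N}. adj i j}. inverse (of_real (slope i)) ^ s * phi (inv_branch i x))"
  by (rule sum.inter_filter[symmetric]) simp
 finally show ?thesis by simp
qed

lemma transfer_cong:
 assumes "!!x. x \<in> U ==> phi x = psi x"
 shows "transfer s phi x = transfer s psi x"
 unfolding transfer_def using assms inv_branch_in by (intro sum.cong) (auto intro: I_U)

lemma transfer_sum: "transfer s (%x. \<Sum>q\<in>F. c q * \<Phi> q x) x = (\<Sum>q\<in>F. c q * transfer s (\<Phi> q) x)"
 unfolding transfer_def sum_distrib_left
 by (subst sum.swap) (auto simp: sum_distrib_left algebra_simps intro!: sum.cong)

lemma transfer_lin:
 "transfer s (%x. a * phi x + b * psi x) x = a * transfer s phi x + b * transfer s psi x"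
 unfolding transfer_def sum_distrib_left sum.distrib[symmetric]
 by (intro sum.cong) (auto simp: algebra_simps)

lemma transfer_bound:
 assumes "!!x. x \<in> U ==> norm (phi x) <= S" "S >= 0"
 shows "norm (transfer s phi x) <= real N / rate ^ s * S"
proof -
 have "norm (if x \<in> {lower i<..<upper i}
  then inverse (of_real (slope i)) ^ s * phi (inv_branch i x) else 0) <= S / rate ^ s" if i: "i < N" for i
 proof (cases "x \<in> {lower i<..<upper i}")
  case True
  then have "norm (phi (inv_branch i x)) <= S" using assms(1) inv_branch_in[OF i] I_U[OF i] by blast
  moreover have "norm (inverse (of_real (slope i) :: complex) ^ s) <= 1 / rate ^ s"
  proof -
   have "rate ^ s <= slope i ^ s" "rate ^ s > 0" using slope_ge_rate[OF i] rate_gt_1 by (auto intro: power_mono)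
   then show ?thesis using slope_gt_1[OF i] by (simp add: norm_power norm_inverse power_inverse divide_inverse le_imp_inverse_le)
  qed
  ultimately have "norm (inverse (of_real (slope i) :: complex) ^ s) * norm (phi (inv_branch i x)) <= 1 / rate ^ s * S"
   by (intro mult_mono) (use rate_gt_1 in auto)
  then show ?thesis using True by (simp add: norm_mult)
 qed (use assms rate_gt_1 in auto)
 then have "norm (transfer s phi x) <= (\<Sum>i<N. S / rate ^ s)"
  unfolding transfer_def by (intro sum_norm_le) auto
 then show ?thesis by simp
qed

text \<open>Differentiating through an affine inverse branch gains a factor \<open>1 / slope\<close>: \<open>transfer s\<close> becomes \<open>transfer (s + k)\<close> on \<open>k\<close>-th derivatives.\<close>
lemma extension_transfer:
 assumes D: "!!i. i < N ==> extension i phi (D i)" and j: "j < N"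
 shows "extension j (transfer s phi)
  (%k x. \<Sum>i | i < N & adj i j. inverse (of_real (slope i)) ^ (s + k) * D i k (inv_branch i x))"
proof -
 have "((%x. inverse (of_real (slope i)) ^ (s + k) * D i k (inv_branch i x)) has_vector_derivative
   inverse (of_real (slope i)) ^ (s + Suc k) * D i (Suc k) (inv_branch i x)) (at x within cI j)"
  if i: "i < N" "adj i j" and x: "x \<in> cI j" for i k x
 proof -
  have "(inv_branch i has_real_derivative 1 / slope i) (at x within cI j)"
   unfolding inv_branch_def by (rule derivative_eq_intros refl | use slope_gt_1[OF i(1)] in simp)+
  then have 1: "(inv_branch i has_vector_derivative inverse (slope i)) (at x within cI j)"
   by (simp add: has_real_derivative_iff_has_vector_derivative inverse_eq_divide)
  have 2: "inv_branch i ` cI j \<subseteq> cI i" using adj_inv_branch_cI[OF i(1) j i(2)] by auto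
  have "(D i k has_vector_derivative D i (Suc k) (inv_branch i x)) (at (inv_branch i x) within cI i)"
   using D[OF i(1)] imageI[OF x, of "inv_branch i"] 2 unfolding extension_def by blast
  then have "(D i k has_vector_derivative D i (Suc k) (inv_branch i x)) (at (inv_branch i x) within inv_branch i ` cI j)"
   by (rule has_vector_derivative_within_subset) (rule 2)
  from vector_diff_chain_within[OF 1 this]
  have "((%x. D i k (inv_branch i x)) has_vector_derivative inverse (slope i) *\<^sub>R D i (Suc k) (inv_branch i x)) (at x within cI j)"
   by (simp add: o_def)
  from has_vector_derivative_mult_right[OF this, of "inverse (of_real (slope i)) ^ (s + k)"]
  show ?thesis by (simp add: scaleR_conv_of_real mult_ac)
 qed
 then have "ALL x:cI j. ((%x. \<Sum>i | i < N & adj i j. inverse (of_real (slope i)) ^ (s + k) * D i k (inv_branch i x))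
   has_vector_derivative (\<Sum>i | i < N & adj i j. inverse (of_real (slope i)) ^ (s + Suc k) *
    D i (Suc k) (inv_branch i x))) (at x within cI j)" for k
  by (auto intro!: has_vector_derivative_sum simp del: power_Suc)
 moreover have "(\<Sum>i | i < N & adj i j. inverse (of_real (slope i)) ^ (s + 0) * D i 0 (inv_branch i x)) =
   transfer s phi x" if "x \<in> I j" for x
  unfolding transfer_on_I[OF j that]
 proof (intro sum.cong refl)
  fix i assume "i \<in> {i. i < N & adj i j}"
  then have i: "i < N" "inv_branch i x \<in> I i" using adj_inv_branch_in[OF _ j that] by auto
  then have "D i 0 (inv_branch i x) = phi (inv_branch i x)" using D[OF i(1)] unfolding extension_def by blast
  then show "inverse (of_real (slope i)) ^ (s + 0) * D i 0 (inv_branch i x) =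
    inverse (of_real (slope i)) ^ s * phi (inv_branch i x)" by simp
 qed
 ultimately show ?thesis unfolding extension_def by blast
qed

lemma
 assumes "phi \<in> V"
 shows V_transfer: "transfer s phi \<in> V"
  and Df_transfer: "x \<in> U ==> (Df ^^ k) (transfer s phi) x = transfer (s + k) ((Df ^^ k) phi) x"
proof -
 obtain D where D: "!!j. j < N ==> extension j phi (D j)" using assms unfolding V_iff by metis
 have *: "extension j (transfer s phi)
   (%k x. \<Sum>i | i < N & adj i j. inverse (of_real (slope i)) ^ (s + k) * D i k (inv_branch i x))"
  if "j < N" for j
  by (rule extension_transfer[OF D that])
 show "transfer s phi \<in> V" by (rule V_I) (rule *)
 assume "x \<in> U"
 then obtain j where j: "j < N" "x \<in> I j" by (rule U_E)
 show "(Df ^^ k) (transfer s phi) x = transfer (s + k) ((Df ^^ k) phi) x"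
  unfolding transfer_on_I[OF j] extension_Df[OF *[OF j(1)] j(2)]
 proof (intro sum.cong refl)
  fix i assume "i \<in> {i. i < N & adj i j}"
  then have i: "i < N" "inv_branch i x \<in> I i" using adj_inv_branch_in[OF _ j] by auto
  show "inverse (of_real (slope i)) ^ (s + k) * D i k (inv_branch i x) =
    inverse (of_real (slope i)) ^ (s + k) * (Df ^^ k) phi (inv_branch i x)"
   using extension_Df[OF D[OF i(1)] i(2)] by simp
 qed
qed

lemma V_transfer_pow: "phi \<in> V ==> (transfer s ^^ n) phi \<in> V"
 by (induction n) (auto intro: V_transfer)

lemma Df_transfer_pow_bound:
 assumes "phi \<in> V" "!!x. x \<in> U ==> norm ((Df ^^ k) phi x) <= S" "S >= 0" "x \<in> U"
 shows "norm ((Df ^^ k) ((transfer s ^^ n) phi) x) <= (real N / rate ^ (s + k)) ^ n * S"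
 using assms(4)
proof (induction n arbitrary: x)
 case (Suc n)
 have nn: "(real N / rate ^ (s + k)) ^ n * S >= 0" using assms(3) rate_gt_1 by auto
 have "(Df ^^ k) ((transfer s ^^ Suc n) phi) x = transfer (s + k) ((Df ^^ k) ((transfer s ^^ n) phi)) x"
  using Df_transfer[OF V_transfer_pow[OF assms(1)] Suc.prems] by simp
 then show ?case using transfer_bound[OF Suc.IH nn, where x = x and s = "s + k"] by (simp add: mult_ac)
qed (use assms in auto)

subsection \<open>Taylor coefficients at the midpoints\<close>

text \<open>The pair (order, interval) is encoded by \<open>q = order * N + interval\<close>, so that truncation at order \<open>K\<close> is \<open>q < K * N\<close>.\<close>
definition coord :: "nat => (real => complex) => complex" where
 "coord q phi = (Df ^^ (q div N)) phi (mid (q mod N))"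

definition monomial :: "nat => nat => real => complex" where
 "monomial k j x = (if x \<in> I j then of_real ((x - mid j) ^ k / fact k) else 0)"

definition basis :: "nat => real => complex" where
 "basis q = monomial (q div N) (q mod N)"

lemma extension_monomial:
 assumes "i < N" "j < N"
 shows "extension i (monomial k j)
  (%m x. if i = j & m <= k then of_real ((x - mid j) ^ (k - m) / fact (k - m)) else 0)"
proof (cases "i = j")
 case True
 have "((%x. if m <= k then of_real ((x - mid j) ^ (k - m) / fact (k - m)) else (0::complex)) has_vector_derivative
   (if Suc m <= k then of_real ((x - mid j) ^ (k - Suc m) / fact (k - Suc m)) else 0))
   (at x within cI j)" for m and x :: real
 proof -
  consider "m > k" | "m = k" | "m < k" by linarith
  then show ?thesis
  proof cases
   case 3
   then obtain d where d: "k = Suc (m + d)" using less_iff_Suc_add by auto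
   have km: "k - m = Suc d" "k - Suc m = d" using d by auto
   have "((%x. (x - mid j) ^ Suc d / fact (Suc d)) has_real_derivative
     (real (Suc d) * ((1 - 0) * (x - mid j) ^ (Suc d - Suc 0)) / fact (Suc d))) (at x within cI j)"
    by (intro DERIV_cdivide DERIV_power DERIV_diff DERIV_ident DERIV_const)
   moreover have "real (Suc d) * ((1 - 0) * (x - mid j) ^ (Suc d - Suc 0)) / fact (Suc d) =
     (x - mid j) ^ d / fact d"
    by (simp add: fact_Suc del: of_nat_Suc)
   ultimately have "((%x. (x - mid j) ^ Suc d / fact (Suc d)) has_real_derivative
     (x - mid j) ^ d / fact d) (at x within cI j)" by metis
   note * = has_vector_derivative_of_real[OF this, where 'a = complex]
   have if_k: "(m <= k) = True" "(Suc m <= k) = True" using 3 by auto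
   show ?thesis unfolding km if_k if_True by (rule *)
  qed auto
 qed
 then show ?thesis using True by (auto simp: extension_def monomial_def)
next
 case False
 then show ?thesis using I_disjoint[OF assms] by (auto simp: extension_def monomial_def)
qed

lemma V_monomial: "j < N ==> monomial k j \<in> V"
 by (rule V_I) (rule extension_monomial)

lemma Df_monomial:
 assumes "j < N" "x \<in> U"
 shows "(Df ^^ m) (monomial k j) x =
  (if x \<in> I j & m <= k then of_real ((x - mid j) ^ (k - m) / fact (k - m)) else 0)"
proof -
 obtain i where i: "i < N" "x \<in> I i" using assms(2) by (rule U_E)
 have "x \<in> I j \<longleftrightarrow> i = j" using I_disjoint i assms by auto
 then show ?thesis using extension_Df[OF extension_monomial[OF i(1) assms(1)] i(2)] by auto
qed

lemma mod_N: "q mod N < N" using N_pos by simp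

lemma V_basis: "basis q \<in> V"
 unfolding basis_def by (rule V_monomial[OF mod_N])

lemma coord_basis: "coord q (basis r) = (if q = r then 1 else 0)"
proof -
 let ?k = "q div N" and ?i = "q mod N" and ?l = "r div N" and ?j = "r mod N"
 have "mid ?i \<in> I ?j \<longleftrightarrow> ?i = ?j" using I_disjoint mid_in mod_N by metis
 then have "coord q (basis r) = (if ?i = ?j & ?k <= ?l then of_real ((mid ?i - mid ?j) ^ (?l - ?k) / fact (?l - ?k)) else 0)"
  unfolding coord_def basis_def using Df_monomial[OF mod_N I_U[OF mod_N mid_in[OF mod_N]]] by simp
 moreover have "q = r \<longleftrightarrow> ?i = ?j & ?k = ?l" by (metis div_mult_mod_eq)
 ultimately show ?thesis by (auto simp: power_0_left)
qed

lemma coord_sum: "(!!q. q \<in> F ==> \<Phi> q \<in> V) ==> coord r (%x. \<Sum>q\<in>F. c q * \<Phi> q x) = (\<Sum>q\<in>F. c q * coord r (\<Phi> q))"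
 unfolding coord_def by (rule Df_sum) (auto intro: I_U mid_in mod_N)

lemma coord_lin: "phi \<in> V ==> psi \<in> V ==> coord r (%x. a * phi x + b * psi x) = a * coord r phi + b * coord r psi"
 unfolding coord_def by (rule Df_lin) (auto intro: I_U mid_in mod_N)

lemma coord_diff: "phi \<in> V ==> psi \<in> V ==> coord r (%x. phi x - psi x) = coord r phi - coord r psi"
 unfolding coord_def by (rule Df_diff) (auto intro: I_U mid_in mod_N)

lemma coord_cong: "(!!x. x \<in> U ==> phi x = psi x) ==> coord r phi = coord r psi"
 unfolding coord_def by (rule Df_cong) (auto intro: I_U mid_in mod_N)

text \<open>Integration from the midpoint; the intervals have length at most 1, so no constant appears.\<close>
lemma vanishing_jets_bound:
 assumes "eta \<in> V" "!!q. q < K * N ==> coord q eta = 0"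
  and "!!x. x \<in> U ==> norm ((Df ^^ K) eta x) <= S" "S >= 0" and "k <= K" "x \<in> U"
 shows "norm ((Df ^^ k) eta x) <= S"
 using assms(5,6)
proof (induction k arbitrary: x rule: inc_induct)
 case (step n)
 obtain j where j: "j < N" "x \<in> I j" using step.prems by (rule U_E)
 have z: "(Df ^^ n) eta (mid j) = 0"
 proof -
  have "n * N + j < K * N"
   using mult_le_mono1[of "Suc n" K N] step.hyps j by simp
  from assms(2)[OF this] show ?thesis using j unfolding coord_def by simp
 qed
 have "norm ((Df ^^ n) eta x - (Df ^^ n) eta (mid j)) <= S * norm (x - mid j)"
 proof (rule differentiable_bound[OF I_convex[of j]])
  fix y assume y: "y \<in> I j"
  have "((Df ^^ n) eta has_vector_derivative (Df ^^ Suc n) eta y) (at y)"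
   by (rule Df_at[OF assms(1) I_U[OF j(1) y]])
  then show "((Df ^^ n) eta has_derivative (%h. h *\<^sub>R (Df ^^ Suc n) eta y)) (at y within I j)"
   unfolding has_vector_derivative_def by (rule has_derivative_at_withinI)
  show "onorm (%h. h *\<^sub>R (Df ^^ Suc n) eta y) <= S"
   by (rule onorm_le) (use step.IH[OF I_U[OF j(1) y]] in "auto simp: mult.commute[of S] intro: mult_left_mono")
 qed (use j mid_in in auto)
 also have "... <= S * 1" using dist_in_I[OF j mid_in[OF j(1)]] assms(4) by (intro mult_left_mono) auto
 finally show ?case using z by simp
qed (use assms in auto)

definition jet_rest :: "nat => (real => complex) => real => complex" where
 "jet_rest K phi x = phi x - (\<Sum>q<K * N. coord q phi * basis q x)"

lemma V_jet_rest: "phi \<in> V ==> jet_rest K phi \<in> V"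
 unfolding jet_rest_def by (intro V_diff V_sum V_basis)

lemma coord_jet_rest: "phi \<in> V ==> q < K * N ==> coord q (jet_rest K phi) = 0"
 unfolding jet_rest_def
 by (simp add: coord_diff V_sum V_basis coord_sum coord_basis if_distrib[of "(*) _"] cong: if_cong)

lemma Df_basis_0: "q < K * N ==> x \<in> U ==> (Df ^^ K) (basis q) x = 0"
 unfolding basis_def by (subst Df_monomial[OF mod_N]) (auto dest: less_mult_imp_div_less)

lemma Df_jet_rest: "phi \<in> V ==> x \<in> U ==> (Df ^^ K) (jet_rest K phi) x = (Df ^^ K) phi x"
 unfolding jet_rest_def by (simp add: Df_diff V_sum V_basis Df_sum Df_basis_0)

lemma jet_rest_bound:
 assumes "phi \<in> V" "!!x. x \<in> U ==> norm ((Df ^^ K) phi x) <= S" "S >= 0" "k <= K" "x \<in> U"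
 shows "norm ((Df ^^ k) (jet_rest K phi) x) <= S"
 by (rule vanishing_jets_bound[OF V_jet_rest[OF assms(1)] coord_jet_rest[OF assms(1)] _ assms(3-5)])
  (use assms Df_jet_rest in auto)

definition transfer_matrix :: "nat => nat => nat => complex" where
 "transfer_matrix s q r = coord q (transfer s (basis r))"

text \<open>The inverse branch is affine, so the \<open>k\<close>-jet of \<open>L phi\<close> at a midpoint pulls back a polynomial: a monomial of degree \<open>l\<close> contributes to the orders \<open>k \<le> l\<close> only, and to \<open>k = l\<close> by an entry of \<open>B (s + k)\<close>.\<close>
lemma transfer_matrix_block:
 assumes "i < N" "j < N"
 shows "transfer_matrix s (k * N + i) (l * N + j) =
  (if adj j i & k <= l then inverse (of_real (slope j)) ^ (s + k) *
   of_real ((inv_branch j (mid i) - mid j) ^ (l - k) / fact (l - k)) else 0)"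
proof -
 have m: "mid i \<in> I i" "mid i \<in> U" using mid_in assms I_U by auto
 have "transfer_matrix s (k * N + i) (l * N + j) =
   (\<Sum>i' | i' < N & adj i' i. inverse (of_real (slope i')) ^ (s + k) *
    (Df ^^ k) (monomial l j) (inv_branch i' (mid i)))"
  unfolding transfer_matrix_def coord_def basis_def using assms
  by (simp add: Df_transfer[OF V_monomial] m transfer_on_I[OF assms(1) m(1)])
 also have "... = (\<Sum>i' | i' < N & adj i' i. if i' = j then (if k <= l then inverse (of_real (slope j)) ^ (s + k) *
   of_real ((inv_branch j (mid i) - mid j) ^ (l - k) / fact (l - k)) else 0) else 0)"
 proof (intro sum.cong refl)
  fix i' assume "i' \<in> {i'. i' < N & adj i' i}"
  then have i': "i' < N" "inv_branch i' (mid i) \<in> I i'" using adj_inv_branch_in assms m by auto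
  then have "inv_branch i' (mid i) \<in> I j \<longleftrightarrow> i' = j" using I_disjoint assms by auto
  then show "inverse (of_real (slope i')) ^ (s + k) * (Df ^^ k) (monomial l j) (inv_branch i' (mid i)) =
   (if i' = j then (if k <= l then inverse (of_real (slope j)) ^ (s + k) *
   of_real ((inv_branch j (mid i) - mid j) ^ (l - k) / fact (l - k)) else 0) else 0)"
   using Df_monomial[OF assms(2) I_U[OF i'], of k l] by auto
 qed
 also have "... = (if adj j i & k <= l then inverse (of_real (slope j)) ^ (s + k) *
   of_real ((inv_branch j (mid i) - mid j) ^ (l - k) / fact (l - k)) else 0)"
  using assms by (simp add: sum.delta)
 finally show ?thesis .
qed

lemma Df_transfer_basis_0:
 assumes "q < K * N" "x \<in> U" shows "(Df ^^ K) (transfer s (basis q)) x = 0"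
proof -
 have "(Df ^^ K) (transfer s (basis q)) x = transfer (s + K) (%x. 0) x"
  unfolding Df_transfer[OF V_basis assms(2)] by (rule transfer_cong) (use Df_basis_0 assms in auto)
 then show ?thesis by (simp add: transfer_def)
qed

lemma transfer_basis:
 assumes "r < K * N" "x \<in> U"
 shows "transfer s (basis r) x = (\<Sum>q<K * N. transfer_matrix s q r * basis q x)"
proof -
 have "norm ((Df ^^ 0) (jet_rest K (transfer s (basis r))) x) <= 0"
  by (rule jet_rest_bound[OF V_transfer[OF V_basis]]) (use assms Df_transfer_basis_0 in auto)
 then show ?thesis by (simp add: jet_rest_def transfer_matrix_def)
qed

end

section \<open>Perturbed Jordan blocks\<close>

definition geometric_bound :: "real => (nat => complex) => bool" where
 "geometric_bound theta w \<longleftrightarrow> (EX C. ALL n. norm (w n) <= C * theta ^ n)"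

lemma geometric_boundI: "(!!n. norm (w n) <= C * theta ^ n) ==> geometric_bound theta w"
 unfolding geometric_bound_def by blast

lemma geometric_boundE:
 assumes "geometric_bound theta w" "theta >= 0"
 obtains C where "C >= 0" "!!n. norm (w n) <= C * theta ^ n"
proof -
 obtain C where C: "!!n. norm (w n) <= C * theta ^ n" using assms(1) unfolding geometric_bound_def by blast
 have "C >= 0" using order_trans[OF norm_ge_zero C[of 0]] by simp
 then show thesis using that C by blast
qed

lemma geometric_bound_mono:
 assumes "geometric_bound theta w" "0 <= theta" "theta <= theta'"
 shows "geometric_bound theta' w"
proof -
 obtain C where C: "C >= 0" "!!n. norm (w n) <= C * theta ^ n" using geometric_boundE[OF assms(1,2)] by blast
 have "C * theta ^ n <= C * theta' ^ n" for n using assms C(1) by (intro mult_left_mono power_mono) auto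
 then have "norm (w n) <= C * theta' ^ n" for n using C(2)[of n] order_trans by blast
 then show ?thesis by (rule geometric_boundI)
qed

lemma geometric_bound_add:
 assumes "geometric_bound theta v" "geometric_bound theta w"
 shows "geometric_bound theta (%n. v n + w n)"
proof -
 obtain C D where "!!n. norm (v n) <= C * theta ^ n" "!!n. norm (w n) <= D * theta ^ n"
  using assms unfolding geometric_bound_def by blast
 then have "norm (v n + w n) <= (C + D) * theta ^ n" for n
  unfolding distrib_right by (intro norm_triangle_le add_mono)
 then show ?thesis by (rule geometric_boundI)
qed

lemma geometric_bound_mult:
 assumes "geometric_bound theta w"
 shows "geometric_bound theta (%n. c * w n)"
proof -
 obtain C where C: "!!n. norm (w n) <= C * theta ^ n" using assms unfolding geometric_bound_def by blast
 have "norm (c * w n) <= (norm c * C) * theta ^ n" for n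
  using mult_left_mono[OF C[of n], of "norm c"] by (simp add: norm_mult mult.assoc)
 then show ?thesis by (rule geometric_boundI)
qed

lemma geometric_bound_diff:
 "geometric_bound theta v ==> geometric_bound theta w ==> geometric_bound theta (%n. v n - w n)"
 using geometric_bound_add[of theta v "%n. -1 * w n"] geometric_bound_mult[of theta w "-1"] by simp

lemma geometric_bound_0: "geometric_bound theta (%n. 0)"
 by (rule geometric_boundI[of _ 0]) simp

lemma geometric_bound_sum:
 "(!!i. i \<in> F ==> geometric_bound theta (w i)) ==> geometric_bound theta (%n. \<Sum>i\<in>F. w i n)"
 by (induction F rule: infinite_finite_induct) (auto intro: geometric_bound_0 geometric_bound_add)

lemma contracting_recursion:
 assumes rec: "!!n. w (Suc n) = xi * w n + d n" and d: "geometric_bound theta d" and xi: "norm xi < theta"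
 shows "geometric_bound theta w"
proof -
 have theta: "theta > 0" using xi norm_ge_zero[of xi] by linarith
 obtain C where C: "C >= 0" "!!n. norm (d n) <= C * theta ^ n" using geometric_boundE[OF d] theta by auto
 define C' where "C' = norm (w 0) + C / (theta - norm xi)"
 have "C <= C' * (theta - norm xi)"
  using xi C by (simp add: C'_def distrib_right)
 have "norm (w n) <= C' * theta ^ n" for n
 proof (induction n)
  case 0
  then show ?case using C xi by (simp add: C'_def)
 next
  case (Suc n)
  have "norm (w (Suc n)) <= norm xi * norm (w n) + norm (d n)"
   unfolding rec by (rule norm_triangle_le) (simp add: norm_mult)
  also have "... <= norm xi * (C' * theta ^ n) + C' * (theta - norm xi) * theta ^ n"
  proof (rule add_mono)
   show "norm xi * norm (w n) <= norm xi * (C' * theta ^ n)" using Suc by (intro mult_left_mono) auto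
   show "norm (d n) <= C' * (theta - norm xi) * theta ^ n"
    by (rule order_trans[OF C(2)]) (use mult_right_mono[OF \<open>C <= C' * (theta - norm xi)\<close>, of "theta ^ n"] theta in simp)
  qed
  also have "... = C' * theta ^ Suc n" by (simp add: algebra_simps)
  finally show ?case .
 qed
 then show ?thesis by (rule geometric_boundI)
qed

text \<open>The sequence \<open>w n / xi^n\<close> is Cauchy, and \<open>l\<close> is its limit.\<close>
lemma expanding_recursion:
 assumes rec: "!!n. w (Suc n) = xi * w n + d n" and d: "geometric_bound theta d"
  and xi: "theta < norm xi" and theta: "theta > 0"
 obtains l where "geometric_bound theta (%n. w n - xi ^ n * l)"
proof -
 obtain C where C: "C >= 0" "!!n. norm (d n) <= C * theta ^ n" using geometric_boundE[OF d] theta by auto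
 have xi0: "xi ~= 0" "norm xi > 0" using xi theta by auto
 define r where "r = theta / norm xi"
 have r: "0 <= r" "r < 1" using xi theta xi0 by (auto simp: r_def)
 define e where "e n = d n / xi ^ Suc n" for n
 have e: "norm (e n) <= C / norm xi * r ^ n" for n
 proof -
  have "norm (e n) = norm (d n) / norm xi ^ Suc n" by (simp add: e_def norm_divide norm_power norm_mult)
  also have "... <= C * theta ^ n / norm xi ^ Suc n" by (rule divide_right_mono[OF C(2)]) simp
  finally show ?thesis by (simp add: r_def power_divide)
 qed
 have summ: "summable (%n. C / norm xi * r ^ n)" using r by (intro summable_mult summable_geometric) auto
 have sumn: "summable (%n. norm (e n))" by (rule summable_comparison_test'[OF summ]) (use e in auto)
 then have sume: "summable e" by (rule summable_norm_cancel)
 define l where "l = w 0 + (\<Sum>n. e n)"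
 have wn: "w n = xi ^ n * (w 0 + (\<Sum>k<n. e k))" for n
 proof (induction n)
  case (Suc n)
  have "xi ^ Suc n * e n = d n" using xi0 by (simp add: e_def)
  then show ?case unfolding rec Suc by (simp add: algebra_simps)
 qed simp
 have "norm (w n - xi ^ n * l) <= (C / norm xi / (1 - r)) * theta ^ n" for n
 proof -
  have tail: "(\<Sum>k. e k) = (\<Sum>k. e (k + n)) + (\<Sum>k<n. e k)" by (rule suminf_split_initial_segment[OF sume])
  have "w n - xi ^ n * l = - (xi ^ n * (\<Sum>k. e (k + n)))"
   unfolding wn[of n] l_def tail by (simp add: algebra_simps)
  then have "norm (w n - xi ^ n * l) = norm xi ^ n * norm (\<Sum>k. e (k + n))"
   by (simp add: norm_mult norm_power)
  also have "norm (\<Sum>k. e (k + n)) <= (\<Sum>k. C / norm xi * r ^ n * r ^ k)"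
  proof (rule norm_suminf_le)
   show "norm (e (k + n)) <= C / norm xi * r ^ n * r ^ k" for k
    using e[of "k + n"] by (simp add: power_add mult_ac)
   show "summable (%k. C / norm xi * r ^ n * r ^ k)" using r by (intro summable_mult summable_geometric) auto
  qed
  also have "(\<Sum>k. C / norm xi * r ^ n * r ^ k) = C / norm xi * r ^ n * (1 / (1 - r))"
   using suminf_mult[OF summable_geometric, of r "C / norm xi * r ^ n"] suminf_geometric[of r] r by simp
  finally have "norm (w n - xi ^ n * l) <= norm xi ^ n * (C / norm xi * r ^ n * (1 / (1 - r)))"
   by (simp add: mult_left_mono)
  also have "... = (C / norm xi / (1 - r)) * theta ^ n"
   using xi0 by (simp add: r_def power_divide)
  finally show ?thesis .
 qed
 then show thesis by (rule that[OF geometric_boundI])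
qed

text \<open>Entry \<open>q\<close> of the \<open>n\<close>-th power of a Jordan block applied to the vector \<open>l\<close>.\<close>
definition block_power :: "complex => nat => (nat => complex) => nat => nat => complex" where
 "block_power xi m l q n = (\<Sum>d<m - q. of_nat (n choose d) * xi ^ (n - d) * l (q + d))"

lemma block_power_0: "q < m ==> block_power xi m l q 0 = l q"
proof -
 assume q: "q < m"
 have "block_power xi m l q 0 = (\<Sum>d<m - q. if d = 0 then l q else 0)"
  unfolding block_power_def by (intro sum.cong) (auto simp: gr0_conv_Suc)
 then show ?thesis using q by simp
qed

lemma block_power_Suc:
 assumes "q < m"
 shows "block_power xi m l q (Suc n) =
  xi * block_power xi m l q n + (if Suc q < m then block_power xi m l (Suc q) n else 0)"
proof -
 obtain k where k: "m - q = Suc k" using assms by (metis Suc_diff_Suc)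
 then have k': "m - Suc q = k" by simp
 have "xi * (of_nat (n choose Suc d) * xi ^ (n - Suc d)) = of_nat (n choose Suc d) * xi ^ (n - d)" for d
 proof (cases "Suc d <= n")
  case True
  then have "n - d = Suc (n - Suc d)" by simp
  then show ?thesis by simp
 qed auto
 note * = this[symmetric]
 have "block_power xi m l q (Suc n) = xi * (xi ^ n * l q) +
   (\<Sum>d<k. of_nat (n choose d) * xi ^ (n - d) * l (Suc q + d) +
    xi * (of_nat (n choose Suc d) * xi ^ (n - Suc d) * l (q + Suc d)))"
  unfolding block_power_def k sum.lessThan_Suc_shift
  by (simp add: distrib_right * mult.assoc)
 also have "... = xi * block_power xi m l q n + block_power xi m l (Suc q) n"
  unfolding block_power_def k k' sum.lessThan_Suc_shift
  by (simp add: sum.distrib sum_distrib_left distrib_left mult.assoc)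
 also have "block_power xi m l (Suc q) n = (if Suc q < m then block_power xi m l (Suc q) n else 0)"
  by (simp add: block_power_def)
 finally show ?thesis .
qed

lemma block_power_linear:
 "block_power xi m (%q. a * l q + b * l' q) q n = a * block_power xi m l q n + b * block_power xi m l' q n"
 unfolding block_power_def sum_distrib_left sum.distrib[symmetric]
 by (intro sum.cong) (auto simp: algebra_simps)

lemma block_power_cong:
 "(!!r. q <= r ==> r < m ==> l r = l' r) ==> block_power xi m l q n = block_power xi m l' q n"
 unfolding block_power_def by (intro sum.cong) auto

lemma block_power_upd:
 assumes "q < m" shows "block_power xi m (l(q := x)) q n = xi ^ n * x + block_power xi m (l(q := 0)) q n"
proof -
 obtain k where k: "m - q = Suc k" using assms by (metis Suc_diff_Suc)
 show ?thesis unfolding block_power_def k sum.lessThan_Suc_shift by simp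
qed

lemma block_power_shift:
 "block_power xi m (%q. if Suc q < m then l (Suc q) else 0) q n =
  (if Suc q < m then block_power xi m l (Suc q) n else 0)"
proof (cases "Suc q < m")
 case True
 then have k: "m - q = Suc (m - Suc q)" by simp
 have "(\<Sum>d<m - Suc q. of_nat (n choose d) * xi ^ (n - d) * (if Suc (q + d) < m then l (Suc (q + d)) else 0)) =
   (\<Sum>d<m - Suc q. of_nat (n choose d) * xi ^ (n - d) * l (Suc (q + d)))"
  by (intro sum.cong) auto
 then show ?thesis using True unfolding block_power_def k sum.lessThan_Suc by auto
next
 case False
 then show ?thesis unfolding block_power_def by (auto intro!: sum.neutral)
qed

lemma block_power_exact:
 assumes "!!q n. q < m ==> w q (Suc n) = xi * w q n + (if Suc q < m then w (Suc q) n else 0)" "q < m"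
 shows "w q n = block_power xi m (%q. w q 0) q n"
 using assms(2)
proof (induction n arbitrary: q)
 case (Suc n)
 then show ?case using assms(1)[OF Suc.prems] by (simp add: block_power_Suc)
qed (simp add: block_power_0)

lemma contracting_block:
 assumes rec: "!!q n. q < m ==> w q (Suc n) = xi * w q n + (if Suc q < m then w (Suc q) n else 0) + d q n"
  and d: "!!q. q < m ==> geometric_bound theta (d q)" and xi: "norm xi < theta" and q: "q < m"
 shows "geometric_bound theta (w q)"
proof -
 have "q <= m" using q by simp
 then have "q < m --> geometric_bound theta (w q)"
 proof (induction q rule: inc_induct)
  case (step q)
  show ?case
  proof
   assume q: "q < m"
   have "geometric_bound theta (%n. (if Suc q < m then w (Suc q) n else 0) + d q n)"
    using step.IH d[OF q] by (cases "Suc q < m") (auto intro: geometric_bound_add)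
   then show "geometric_bound theta (w q)"
    by (rule contracting_recursion[rotated]) (use rec[OF q] xi in "auto simp: add.assoc")
  qed
 qed simp
 then show ?thesis using q by blast
qed

text \<open>From the last coordinate upwards: once the limits of the later coordinates are known, their exact contribution is subtracted and the scalar recursion applies.\<close>
lemma expanding_block:
 assumes rec: "!!q n. q < m ==> w q (Suc n) = xi * w q n + (if Suc q < m then w (Suc q) n else 0) + d q n"
  and d: "!!q. q < m ==> geometric_bound theta (d q)" and xi: "theta < norm xi" and theta: "theta > 0"
 obtains l where "!!q. q < m ==> geometric_bound theta (%n. w q n - block_power xi m l q n)"
proof -
 have "EX l. ALL q<m. r <= q --> geometric_bound theta (%n. w q n - block_power xi m l q n)" if "r <= m" for r
  using that
 proof (induction r rule: inc_induct)
  case (step r)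
  then obtain l where l: "!!q. q < m ==> Suc r <= q ==> geometric_bound theta (%n. w q n - block_power xi m l q n)"
   by blast
  have r: "r < m" using step by simp
  let ?h = "block_power xi m (l(r := 0)) r"
  have h: "?h (Suc n) = xi * ?h n + (if Suc r < m then block_power xi m l (Suc r) n else 0)" for n
   unfolding block_power_Suc[OF r] using block_power_cong[of "Suc r" m "l(r := 0)" l] by simp
  let ?e = "%n. (if Suc r < m then w (Suc r) n - block_power xi m l (Suc r) n else 0) + d r n"
  have "geometric_bound theta ?e"
   using l d[OF r] by (cases "Suc r < m") (auto intro: geometric_bound_add)
  moreover have "w r (Suc n) - ?h (Suc n) = xi * (w r n - ?h n) + ?e n" for n
   unfolding rec[OF r] h by (simp add: algebra_simps)
  ultimately obtain x where x: "geometric_bound theta (%n. (w r n - ?h n) - xi ^ n * x)"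
   using expanding_recursion[of "%n. w r n - ?h n" xi ?e theta] xi theta by metis
  have "geometric_bound theta (%n. w q n - block_power xi m (l(r := x)) q n)" if q: "q < m" "r <= q" for q
  proof (cases "q = r")
   case True
   then show ?thesis using x unfolding True block_power_upd[OF r, of xi l x] by (simp add: algebra_simps)
  next
   case False
   then have "block_power xi m (l(r := x)) q n = block_power xi m l q n" for n
    by (intro block_power_cong) (use q in auto)
   then show ?thesis using l q False by simp
  qed
  then show ?case by blast
 qed auto
 from this[of 0] show thesis using that by auto
qed

lemma expanding_block_unique:
 assumes "!!q. q < m ==> geometric_bound theta (block_power xi m l q)" and xi: "theta < norm xi" and theta: "theta > 0"
  and "q < m"
 shows "l q = 0"
proof -
 have "q <= m" using assms by simp
 then have "ALL r. q <= r & r < m --> l r = 0"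
 proof (induction q rule: inc_induct)
  case (step q)
  have q: "q < m" using step by simp
  have "block_power xi m l q n = xi ^ n * l q" for n
  proof -
   have "block_power xi m (l(q := l q)) q n = xi ^ n * l q + block_power xi m (l(q := 0)) q n"
    by (rule block_power_upd[OF q])
   also have "block_power xi m (l(q := 0)) q n = 0"
    unfolding block_power_def using step.IH by (auto intro!: sum.neutral)
   finally show ?thesis by simp
  qed
  then have "block_power xi m l q = (%n. xi ^ n * l q)" by blast
  then have "geometric_bound theta (%n. xi ^ n * l q)" using assms(1)[OF q] by simp
  then obtain C where C: "!!n. norm (xi ^ n * l q) <= C * theta ^ n" unfolding geometric_bound_def by blast
  define r where "r = theta / norm xi"
  have "norm xi > 0" using xi theta by linarith
  then have r: "0 <= r" "r < 1" using xi theta by (auto simp: r_def)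
  have "norm (l q) <= C * r ^ n" for n
  proof -
   have "norm xi ^ n > 0" using xi theta by (intro zero_less_power) linarith
   then show ?thesis using C[of n] by (simp add: r_def power_divide norm_mult norm_power field_simps)
  qed
  moreover have "(%n. C * r ^ n) \<longlonglongrightarrow> C * 0" by (intro tendsto_intros LIMSEQ_realpow_zero r)
  ultimately have "norm (l q) <= C * 0" by (intro LIMSEQ_le_const) auto
  then have "l q = 0" by simp
  then show ?case using step.IH by (metis Suc_leI le_neq_implies_less)
 qed auto
 then show ?thesis using assms by blast
qed

section \<open>Resonances of a given level\<close>

context markov_map
begin

lemma linear_functionalI:
 assumes "!!phi psi. phi \<in> V ==> psi \<in> V ==> u (%x. phi x + psi x) = u phi + u psi"
  and "!!phi c. phi \<in> V ==> u (%x. c * phi x) = c * u phi"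
  and "!!phi psi. phi \<in> V ==> psi \<in> V ==> (!!x. x \<in> U ==> phi x = psi x) ==> u phi = u psi"
 shows "linear_functional N p u"
 using assms unfolding linear_functional_def by blast

lemma linear_functional_add:
 "linear_functional N p u ==> phi \<in> V ==> psi \<in> V ==> u (%x. phi x + psi x) = u phi + u psi"
 unfolding linear_functional_def by blast

lemma linear_functional_scale:
 "linear_functional N p u ==> phi \<in> V ==> u (%x. c * phi x) = c * u phi"
 unfolding linear_functional_def by blast

lemma linear_functional_lin:
 assumes "linear_functional N p u" "phi \<in> V" "psi \<in> V"
 shows "u (%x. a * phi x + b * psi x) = a * u phi + b * u psi"
 unfolding linear_functional_add[OF assms(1) V_scale[OF assms(2), of a] V_scale[OF assms(3), of b]]
  linear_functional_scale[OF assms(1,2)] linear_functional_scale[OF assms(1,3)] ..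

lemma linear_functional_0: "linear_functional N p u ==> (%x. 0) \<in> V ==> u (%x. 0) = 0"
 using linear_functional_scale[of u "%x. 0" 0] by simp

lemma V_0: "(%x. 0) \<in> V"
 using V_scale[OF V_basis, of 0 0] by simp

lemma linear_functional_sum:
 assumes "linear_functional N p u" "!!i. i \<in> F ==> \<Phi> i \<in> V"
 shows "u (%x. \<Sum>i\<in>F. c i * \<Phi> i x) = (\<Sum>i\<in>F. c i * u (\<Phi> i))"
 using assms(2)
proof (induction F rule: infinite_finite_induct)
 case (insert i F)
 have "u (%x. c i * \<Phi> i x + 1 * (\<Sum>j\<in>F. c j * \<Phi> j x)) = c i * u (\<Phi> i) + 1 * u (%x. \<Sum>j\<in>F. c j * \<Phi> j x)"
  by (rule linear_functional_lin[OF assms(1)]) (use insert in "auto intro: V_sum")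
 then show ?case using insert by simp
qed (use linear_functional_0[OF assms(1) V_0] in auto)

lemma linear_functional_cong:
 "linear_functional N p u ==> phi \<in> V ==> (!!x. x \<in> U ==> phi x = psi x) ==> u phi = u psi"
 unfolding linear_functional_def using V_cong[of phi psi] by blast

lemma transfer_pow_lin:
 "(transfer s ^^ n) (%x. a * phi x + b * psi x) x = a * (transfer s ^^ n) phi x + b * (transfer s ^^ n) psi x"
proof (induction n arbitrary: x)
 case (Suc n)
 have "transfer s ((transfer s ^^ n) (%x. a * phi x + b * psi x)) x =
   transfer s (%x. a * (transfer s ^^ n) phi x + b * (transfer s ^^ n) psi x) x"
  by (rule transfer_cong) (rule Suc.IH)
 then show ?case by (simp add: transfer_lin)
qed simp

lemma transfer_pow_cong:
 assumes "!!x. x \<in> U ==> phi x = psi x" "x \<in> U"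
 shows "(transfer s ^^ n) phi x = (transfer s ^^ n) psi x"
 using assms(2)
proof (induction n arbitrary: x)
 case (Suc n)
 show ?case using transfer_cong[OF Suc.IH] by simp
qed (use assms in auto)

lemma transfer_pow_sum:
 "(transfer s ^^ n) (%x. \<Sum>q\<in>F. c q * \<Phi> q x) x = (\<Sum>q\<in>F. c q * (transfer s ^^ n) (\<Phi> q) x)"
proof (induction n arbitrary: x)
 case (Suc n)
 have "transfer s ((transfer s ^^ n) (%x. \<Sum>q\<in>F. c q * \<Phi> q x)) x =
   transfer s (%x. \<Sum>q\<in>F. c q * (transfer s ^^ n) (\<Phi> q) x) x"
  by (rule transfer_cong) (rule Suc.IH)
 then show ?case by (simp add: transfer_sum)
qed simp

text \<open>The decay rate of \<open>transfer s\<close> on \<open>K\<close>-th derivatives, by counting at most \<open>N\<close> inverse branches.\<close>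
definition quotient_rate :: "nat => nat => real" where
 "quotient_rate s K = real N / rate ^ (s + K)"

lemma quotient_rate_pos: "quotient_rate s K > 0"
 using N_pos rate_gt_1 by (simp add: quotient_rate_def)

definition transfer_decay :: "nat => (real => complex) => real => bool" where
 "transfer_decay s phi theta \<longleftrightarrow>
  (ALL k. EX C. ALL n. ALL x:U. norm ((Df ^^ k) ((transfer s ^^ n) phi) x) <= C * theta ^ n)"

lemma quotient_rate_antimono: "K <= k ==> quotient_rate s k <= quotient_rate s K"
 unfolding quotient_rate_def using rate_gt_1 by (intro divide_left_mono power_increasing) auto

lemma high_derivative_decay:
 assumes phi: "phi \<in> V" and "K <= k"
 shows "EX C>=0. ALL n. ALL x:U. norm ((Df ^^ k) ((transfer s ^^ n) phi) x) <= C * quotient_rate s K ^ n"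
proof -
 obtain S where S: "S >= 0" "!!x. x \<in> U ==> norm ((Df ^^ k) phi x) <= S" using V_bounded[OF phi] by blast
 have "norm ((Df ^^ k) ((transfer s ^^ n) phi) x) <= S * quotient_rate s K ^ n" if "x \<in> U" for n x
 proof -
  have "norm ((Df ^^ k) ((transfer s ^^ n) phi) x) <= S * quotient_rate s k ^ n"
   using Df_transfer_pow_bound[OF phi S(2,1) that] by (simp add: quotient_rate_def mult.commute)
  also have "... <= S * quotient_rate s K ^ n"
   using quotient_rate_antimono[OF assms(2)] quotient_rate_pos[of s k] S(1)
   by (intro mult_left_mono power_mono) (auto intro: less_imp_le)
  finally show ?thesis .
 qed
 then show ?thesis using S(1) by blast
qed

lemma transfer_decay_base: "phi \<in> V ==> transfer_decay s phi (quotient_rate s 0)"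
 unfolding transfer_decay_def using high_derivative_decay[of phi 0] by blast

text \<open>The coordinates of \<open>transfer s ^^ n\<close> with respect to one row of a Jordan basis.\<close>

definition jordan_coord :: "nat => nat => (nat => complex) => (real => complex) => nat => complex" where
 "jordan_coord s K alpha phi n = (\<Sum>c<K * N. alpha c * coord c ((transfer s ^^ n) phi))"

definition jordan_error :: "nat => nat => (nat => complex) => (real => complex) => nat => complex" where
 "jordan_error s K alpha phi n = (\<Sum>c<K * N. alpha c * coord c (transfer s (jet_rest K ((transfer s ^^ n) phi))))"

lemma jordan_coord_Suc:
 assumes phi: "phi \<in> V"
  and alpha: "!!c. c < K * N ==> (\<Sum>i<K * N. alpha i * transfer_matrix s i c) = z * alpha c + beta c"
 shows "jordan_coord s K alpha phi (Suc n) =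
  z * jordan_coord s K alpha phi n + jordan_coord s K beta phi n + jordan_error s K alpha phi n"
proof -
 define eta where "eta = (transfer s ^^ n) phi"
 have eta: "eta \<in> V" unfolding eta_def by (rule V_transfer_pow[OF phi])
 have split: "coord c (transfer s eta) =
   (\<Sum>r<K * N. transfer_matrix s c r * coord r eta) + coord c (transfer s (jet_rest K eta))" for c
 proof -
  have "transfer s eta = transfer s (%x. 1 * (\<Sum>r<K * N. coord r eta * basis r x) + 1 * jet_rest K eta x)"
   by (simp add: jet_rest_def)
  also have "... = (%x. 1 * (\<Sum>r<K * N. coord r eta * transfer s (basis r) x) + 1 * transfer s (jet_rest K eta) x)"
   unfolding transfer_lin transfer_sum ..
  finally have "coord c (transfer s eta) =
    coord c (%x. 1 * (\<Sum>r<K * N. coord r eta * transfer s (basis r) x) + 1 * transfer s (jet_rest K eta) x)"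
   by simp
  also have "... = 1 * (\<Sum>r<K * N. coord r eta * coord c (transfer s (basis r))) + 1 * coord c (transfer s (jet_rest K eta))"
   by (simp only: coord_lin coord_sum V_sum V_transfer V_basis V_jet_rest eta)
  finally show ?thesis by (simp add: transfer_matrix_def mult.commute)
 qed
 have "jordan_coord s K alpha phi (Suc n) = (\<Sum>c<K * N. alpha c * coord c (transfer s eta))"
  by (simp add: jordan_coord_def eta_def)
 also have "... = (\<Sum>c<K * N. \<Sum>r<K * N. alpha c * transfer_matrix s c r * coord r eta) + jordan_error s K alpha phi n"
  unfolding split jordan_error_def eta_def[symmetric]
  by (simp add: distrib_left sum.distrib sum_distrib_left mult.assoc)
 also have "(\<Sum>c<K * N. \<Sum>r<K * N. alpha c * transfer_matrix s c r * coord r eta) =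
   (\<Sum>r<K * N. (z * alpha r + beta r) * coord r eta)"
  by (subst sum.swap) (intro sum.cong refl, simp add: alpha[symmetric] sum_distrib_right)
 also have "... = z * jordan_coord s K alpha phi n + jordan_coord s K beta phi n"
  unfolding jordan_coord_def eta_def[symmetric]
  by (simp add: distrib_right sum.distrib sum_distrib_left mult.assoc)
 finally show ?thesis .
qed

lemma jet_rest_pow_bound:
 assumes phi: "phi \<in> V" and S: "!!x. x \<in> U ==> norm ((Df ^^ K) phi x) <= S" "S >= 0" and "k <= K" "x \<in> U"
 shows "norm ((Df ^^ k) (jet_rest K ((transfer s ^^ n) phi)) x) <= quotient_rate s K ^ n * S"
 by (rule jet_rest_bound[OF V_transfer_pow[OF phi] _ _ assms(4,5)])
  (use Df_transfer_pow_bound[OF phi S] quotient_rate_pos[of s K] S(2) in "auto simp: quotient_rate_def")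

lemma jordan_error_bound:
 assumes phi: "phi \<in> V" and S: "!!x. x \<in> U ==> norm ((Df ^^ K) phi x) <= S" "S >= 0"
 shows "norm (jordan_error s K alpha phi n) <= (\<Sum>c<K * N. norm (alpha c) * N) * S * quotient_rate s K ^ n"
proof -
 let ?R = "jet_rest K ((transfer s ^^ n) phi)"
 have R: "?R \<in> V" by (intro V_jet_rest V_transfer_pow phi)
 have "norm (coord c (transfer s ?R)) <= N * (quotient_rate s K ^ n * S)" if c: "c < K * N" for c
 proof -
  let ?k = "c div N" and ?x = "mid (c mod N)"
  have x: "?x \<in> U" using I_U mid_in mod_N by blast
  have k: "?k <= K" using c by (simp add: less_imp_le less_mult_imp_div_less)
  have nn: "quotient_rate s K ^ n * S >= 0" using quotient_rate_pos[of s K] S(2) by simp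
  have "coord c (transfer s ?R) = transfer (s + ?k) ((Df ^^ ?k) ?R) ?x"
   unfolding coord_def by (rule Df_transfer[OF R x])
  also have "norm ... <= real N / rate ^ (s + ?k) * (quotient_rate s K ^ n * S)"
   by (rule transfer_bound[OF jet_rest_pow_bound[OF phi S k] nn])
  also have "... <= N * (quotient_rate s K ^ n * S)"
  proof (rule mult_right_mono[OF _ nn])
   show "real N / rate ^ (s + ?k) <= N"
    using rate_gt_1 one_le_power[of rate "s + ?k"] by (simp add: divide_le_eq mult_le_cancel_left1)
  qed
  finally show ?thesis .
 qed
 then have "norm (jordan_error s K alpha phi n) <= (\<Sum>c<K * N. norm (alpha c) * (N * (quotient_rate s K ^ n * S)))"
  unfolding jordan_error_def by (intro sum_norm_le) (auto simp: norm_mult intro!: mult_left_mono)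
 then show ?thesis by (simp add: sum_distrib_left sum_distrib_right mult_ac)
qed

lemma jordan_error_geometric: "phi \<in> V ==> geometric_bound (quotient_rate s K) (jordan_error s K alpha phi)"
proof -
 assume phi: "phi \<in> V"
 obtain S where S: "S >= 0" "!!x. x \<in> U ==> norm ((Df ^^ K) phi x) <= S" using V_bounded[OF phi] by blast
 show ?thesis by (rule geometric_boundI) (rule jordan_error_bound[OF phi S(2,1)])
qed

lemma jordan_coord_lin:
 "phi \<in> V ==> psi \<in> V ==> jordan_coord s K alpha (%x. a * phi x + b * psi x) n =
  a * jordan_coord s K alpha phi n + b * jordan_coord s K alpha psi n"
 unfolding jordan_coord_def transfer_pow_lin[abs_def] sum_distrib_left sum.distrib[symmetric]
 by (intro sum.cong) (auto simp: coord_lin V_transfer_pow algebra_simps)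

lemma jordan_coord_cong:
 "(!!x. x \<in> U ==> phi x = psi x) ==> jordan_coord s K alpha phi n = jordan_coord s K alpha psi n"
 unfolding jordan_coord_def by (intro sum.cong refl arg_cong[where f = "(*) _"] coord_cong transfer_pow_cong)

lemma jordan_coord_shift: "jordan_coord s K alpha (transfer s phi) n = jordan_coord s K alpha phi (Suc n)"
 by (simp add: jordan_coord_def funpow_swap1)

text \<open>Jordan blocks of \<open>transfer s\<close> on jets of order below \<open>K\<close>. The functions \<open>E b q\<close> are piecewise polynomial generalized eigenfunctions; the functionals \<open>u b q\<close> are only meaningful for eigenvalues of modulus at least \<open>t\<close>. By the last clause, a function that decays like \<open>theta'^n\<close> and has no components with eigenvalues between \<open>t\<close> and \<open>theta'\<close> decays faster than \<open>t^n\<close>.\<close>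
definition resonance_level ::
  "nat => nat => real => nat => (nat => nat) => (nat => complex) =>
  (nat => nat => real => complex) => (nat => nat => (real => complex) => complex) => bool"
 where
 "resonance_level s K t B m xi E u \<longleftrightarrow>
  (ALL b<B. m b >= 1) &
  (ALL b<B. ALL q<m b. E b q \<in> V) &
  (ALL b<B. ALL q<m b. ALL x:U. transfer s (E b q) x = xi b * E b q x + (if q = 0 then 0 else E b (q - 1) x)) &
  (ALL b<B. ALL q<m b. t <= norm (xi b) --> linear_functional N p (u b q)) &
  (ALL b<B. ALL q<m b. ALL phi:V. t <= norm (xi b) -->
   u b q (transfer s phi) = xi b * u b q phi + (if Suc q < m b then u b (Suc q) phi else 0)) &
  (ALL b<B. ALL q<m b. ALL b'<B. ALL q'<m b'. t <= norm (xi b) -->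
   u b q (E b' q') = (if b = b' & q = q' then 1 else 0)) &
  (ALL z. Polynomial.order z (char_poly (mat (K * N) (K * N) (%(i, c). transfer_matrix s i c))) =
   (\<Sum>b | b < B & xi b = z. m b)) &
  (ALL phi:V. ALL theta'>0. transfer_decay s phi theta' -->
   (ALL b<B. ALL q<m b. t <= norm (xi b) --> norm (xi b) <= theta' --> u b q phi = 0) -->
   (EX theta. 0 < theta & theta < t & transfer_decay s phi theta))"

text \<open>The functionals are the limits given by \<open>expanding_block\<close> for the Jordan coordinates of \<open>transfer s ^^ n\<close>. If they vanish, the coordinates are contracted, and with them all derivatives.\<close>
lemma resonance_level_exists:
 assumes t: "quotient_rate s K < t"
 shows "EX B m xi E u. resonance_level s K t B m xi E u"
proof -
 let ?n = "K * N" and ?gamma = "quotient_rate s K"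
 obtain B m xi and e alpha :: "nat => nat => nat => complex" where
  m: "!!b. b < B ==> m b >= (1::nat)"
  and Me: "!!b q i. b < B ==> q < m b ==> i < ?n ==>
   (\<Sum>c<?n. transfer_matrix s i c * e b q c) = xi b * e b q i + (if q = 0 then 0 else e b (q - 1) i)"
  and alphaM: "!!b q c. b < B ==> q < m b ==> c < ?n ==>
   (\<Sum>i<?n. alpha b q i * transfer_matrix s i c) = xi b * alpha b q c + (if Suc q < m b then alpha b (Suc q) c else 0)"
  and alphae: "!!b q b' q'. b < B ==> q < m b ==> b' < B ==> q' < m b' ==>
   (\<Sum>i<?n. alpha b q i * e b' q' i) = (if b = b' & q = q' then 1 else 0)"
  and ealpha: "!!i c. i < ?n ==> c < ?n ==> (\<Sum>b<B. \<Sum>q<m b. e b q i * alpha b q c) = (if i = c then 1 else 0)"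
  and mult: "!!z. Polynomial.order z (char_poly (mat ?n ?n (%(i, c). transfer_matrix s i c))) =
   (\<Sum>b | b < B & xi b = z. m b)"
  by (rule jordan_basis[of ?n "transfer_matrix s"]) (rule that; assumption)
 define E where "E b q x = (\<Sum>c<?n. e b q c * basis c x)" for b q x
 define y where "y b q phi = jordan_coord s K (alpha b q) phi" for b q phi
 define is_limit where "is_limit b phi l \<longleftrightarrow>
  (ALL q<m b. geometric_bound ?gamma (%n. y b q phi n - block_power (xi b) (m b) l q n))" for b phi l
 define u where "u b q phi = (SOME l. is_limit b phi l) q" for b q phi
 have gamma: "?gamma > 0" by (rule quotient_rate_pos)
 have E: "E b q \<in> V" for b q unfolding E_def by (intro V_sum V_basis)
 have y_Suc: "y b q phi (Suc n) = xi b * y b q phi n + (if Suc q < m b then y b (Suc q) phi n else 0)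
   + jordan_error s K (alpha b q) phi n" if "b < B" "q < m b" "phi \<in> V" for b q phi n
  using jordan_coord_Suc[OF that(3) alphaM[OF that(1,2)], of n]
  by (cases "Suc q < m b") (auto simp: y_def jordan_coord_def)
 have limit_unique: "l q = l' q"
  if b: "b < B" "t <= norm (xi b)" and l: "is_limit b phi l" "is_limit b phi l'" and q: "q < m b" for b phi l l' q
 proof -
  have "geometric_bound ?gamma (block_power (xi b) (m b) (%q. 1 * l q + (-1) * l' q) q)" if "q < m b" for q
   using geometric_bound_diff[of ?gamma "%n. y b q phi n - block_power (xi b) (m b) l' q n"
    "%n. y b q phi n - block_power (xi b) (m b) l q n"] l that
   unfolding is_limit_def block_power_linear[abs_def] by (simp add: algebra_simps)
  then have "1 * l q + (-1) * l' q = 0"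
   by (rule expanding_block_unique[where m = "m b"]) (use b t gamma q in auto)
  then show ?thesis by simp
 qed
 have limit_ex: "EX l. is_limit b phi l" if b: "b < B" "t <= norm (xi b)" and phi: "phi \<in> V" for b phi
 proof -
  obtain l where "!!q. q < m b ==> geometric_bound ?gamma (%n. y b q phi n - block_power (xi b) (m b) l q n)"
   by (rule expanding_block[of "m b" "%q. y b q phi" "xi b" "%q. jordan_error s K (alpha b q) phi" ?gamma])
    (use y_Suc[OF b(1) _ phi] jordan_error_geometric[OF phi] b t gamma in auto)
  then show ?thesis unfolding is_limit_def by blast
 qed
 have u_eqI: "u b q phi = l q" if "b < B" "t <= norm (xi b)" "is_limit b phi l" "q < m b" for b q phi l
  unfolding u_def by (rule limit_unique[OF that(1,2) someI[of "is_limit b phi"] that(3,4)]) (rule that(3))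
 have u_limit: "is_limit b phi (%q. u b q phi)" if "b < B" "t <= norm (xi b)" "phi \<in> V" for b phi
  unfolding u_def using someI_ex[OF limit_ex[OF that]] by simp
 have u_lin: "u b q (%x. a * phi x + c * psi x) = a * u b q phi + c * u b q psi"
  if b: "b < B" "t <= norm (xi b)" and q: "q < m b" and phi: "phi \<in> V" "psi \<in> V" for b q phi psi a c
 proof (rule u_eqI[OF b _ q])
  show "is_limit b (%x. a * phi x + c * psi x) (%q. a * u b q phi + c * u b q psi)"
   unfolding is_limit_def
  proof (intro allI impI)
   fix q assume q: "q < m b"
   have "geometric_bound ?gamma (%n. a * (y b q phi n - block_power (xi b) (m b) (%q. u b q phi) q n) +
     c * (y b q psi n - block_power (xi b) (m b) (%q. u b q psi) q n))"
    by (intro geometric_bound_add geometric_bound_mult)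
     (use u_limit[OF b phi(1)] u_limit[OF b phi(2)] q in "auto simp: is_limit_def")
   then show "geometric_bound ?gamma (%n. y b q (%x. a * phi x + c * psi x) n -
     block_power (xi b) (m b) (%q. a * u b q phi + c * u b q psi) q n)"
    unfolding y_def jordan_coord_lin[OF phi] block_power_linear by (simp add: algebra_simps)
  qed
 qed
 have u_cong: "u b q phi = u b q psi" if "!!x. x \<in> U ==> phi x = psi x" for b q phi psi
 proof -
  have "y b q phi = y b q psi" for q unfolding y_def by (rule ext) (rule jordan_coord_cong[OF that])
  then have "is_limit b phi = is_limit b psi" unfolding is_limit_def by simp
  then show ?thesis unfolding u_def by simp
 qed
 have u_functional: "linear_functional N p (u b q)" if b: "b < B" "t <= norm (xi b)" and q: "q < m b" for b q
 proof (rule linear_functionalI)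
  show "u b q (%x. phi x + psi x) = u b q phi + u b q psi" if "phi \<in> V" "psi \<in> V" for phi psi
   using u_lin[OF b q that, of 1 1] by simp
  show "u b q (%x. c * phi x) = c * u b q phi" if "phi \<in> V" for phi c
   using u_lin[OF b q that that, of c 0] by simp
 qed (rule u_cong)
 have u_transfer: "u b q (transfer s phi) = xi b * u b q phi + (if Suc q < m b then u b (Suc q) phi else 0)"
  if b: "b < B" "t <= norm (xi b)" and q: "q < m b" and phi: "phi \<in> V" for b q phi
 proof -
  let ?l = "%q. u b q phi"
  have "is_limit b (transfer s phi) (%q. xi b * ?l q + 1 * (if Suc q < m b then ?l (Suc q) else 0))"
   unfolding is_limit_def
  proof (intro allI impI)
   fix q assume q: "q < m b"
   have *: "block_power (xi b) (m b) (%q. xi b * ?l q + 1 * (if Suc q < m b then ?l (Suc q) else 0)) q n =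
     block_power (xi b) (m b) ?l q (Suc n)" for n
    unfolding block_power_linear block_power_Suc[OF q]
     block_power_shift[where l = "%q. u b q phi"] by simp
   have "geometric_bound ?gamma (%n. y b q phi n - block_power (xi b) (m b) ?l q n)"
    using u_limit[OF b phi] q unfolding is_limit_def by blast
   then obtain C where C: "!!n. norm (y b q phi n - block_power (xi b) (m b) ?l q n) <= C * ?gamma ^ n"
    unfolding geometric_bound_def by blast
   have "geometric_bound ?gamma (%n. y b q phi (Suc n) - block_power (xi b) (m b) ?l q (Suc n))"
    by (rule geometric_boundI[of _ "C * ?gamma"]) (use C[of "Suc _"] in "simp add: mult.assoc")
   then show "geometric_bound ?gamma (%n. y b q (transfer s phi) n -
     block_power (xi b) (m b) (%q. xi b * ?l q + 1 * (if Suc q < m b then ?l (Suc q) else 0)) q n)"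
    unfolding * by (simp add: y_def jordan_coord_shift)
  qed
  from u_eqI[OF b this q] show ?thesis by simp
 qed
 have coord_E: "coord c (E b q) = e b q c" if "c < ?n" for b q c
  unfolding E_def using that by (simp add: coord_sum V_basis coord_basis if_distrib[of "(*) _"] cong: if_cong)
 have Df_E: "(Df ^^ K) (E b q) x = 0" if "x \<in> U" for b q x
  unfolding E_def using that by (simp add: Df_sum V_basis Df_basis_0)
 have u_E: "u b q (E b' q') = (if b = b' & q = q' then 1 else 0)"
  if b: "b < B" "t <= norm (xi b)" and q: "q < m b" and b': "b' < B" "q' < m b'" for b q b' q'
 proof -
  have err: "jordan_error s K beta (E b' q') n = 0" for beta n
   using jordan_error_bound[OF E, of K b' q' 0 s beta n] Df_E by simp
  have "is_limit b (E b' q') (%q. y b q (E b' q') 0)"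
   unfolding is_limit_def
  proof (intro allI impI)
   fix q assume q: "q < m b"
   have "y b q (E b' q') n = block_power (xi b) (m b) (%q. y b q (E b' q') 0) q n" for n
    by (rule block_power_exact[OF _ q, of "%q. y b q (E b' q')"]) (use y_Suc[OF b(1) _ E] err in simp)
   then show "geometric_bound ?gamma (%n. y b q (E b' q') n -
     block_power (xi b) (m b) (%q. y b q (E b' q') 0) q n)"
    by (simp add: geometric_bound_0)
  qed
  from u_eqI[OF b this q] have "u b q (E b' q') = y b q (E b' q') 0" .
  also have "... = (\<Sum>c<?n. alpha b q c * e b' q' c)" by (simp add: y_def jordan_coord_def coord_E)
  finally show ?thesis using alphae[OF b(1) q b'] by simp
 qed
 have E_transfer: "transfer s (E b q) x = xi b * E b q x + (if q = 0 then 0 else E b (q - 1) x)"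
  if b: "b < B" and q: "q < m b" and x: "x \<in> U" for b q x
 proof -
  have "transfer s (E b q) x = (\<Sum>c<?n. e b q c * (\<Sum>i<?n. transfer_matrix s i c * basis i x))"
   unfolding E_def transfer_sum by (intro sum.cong refl) (simp add: transfer_basis[OF _ x])
  also have "... = (\<Sum>i<?n. (\<Sum>c<?n. transfer_matrix s i c * e b q c) * basis i x)"
   unfolding sum_distrib_left sum_distrib_right by (subst sum.swap) (intro sum.cong refl, simp add: mult_ac)
  also have "... = (\<Sum>i<?n. (xi b * e b q i + (if q = 0 then 0 else e b (q - 1) i)) * basis i x)"
   by (intro sum.cong refl) (simp add: Me[OF b q])
  also have "... = xi b * E b q x + (if q = 0 then 0 else E b (q - 1) x)"
   unfolding E_def by (simp add: distrib_right sum.distrib sum_distrib_left mult.assoc)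
  finally show ?thesis .
 qed
 have decay: "EX theta. 0 < theta & theta < t & transfer_decay s phi theta"
  if phi: "phi \<in> V" and dec: "transfer_decay s phi theta'" and theta': "theta' > 0"
   and van: "!!b q. b < B ==> t <= norm (xi b) ==> norm (xi b) <= theta' ==> q < m b ==> u b q phi = 0" for phi theta'
 proof -
  have "EX C. ALL n. norm (coord c ((transfer s ^^ n) phi)) <= C * theta' ^ n" for c
  proof -
   obtain C where "ALL n. ALL x:U. norm ((Df ^^ (c div N)) ((transfer s ^^ n) phi) x) <= C * theta' ^ n"
    using dec unfolding transfer_decay_def by blast
   then show ?thesis unfolding coord_def using I_U mid_in mod_N by blast
  qed
  then have y_dec: "geometric_bound theta' (y b q phi)" for b q
   unfolding y_def jordan_coord_def
   by (intro geometric_bound_sum geometric_bound_mult) (auto simp: geometric_bound_def)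
  define theta0 where "theta0 = Max (insert ?gamma {norm (xi b) |b. b < B & norm (xi b) < t})"
  define theta where "theta = (theta0 + t) / 2"
  have fin: "finite (insert ?gamma {norm (xi b) |b. b < B & norm (xi b) < t})" by simp
  have "theta0 < t" unfolding theta0_def using t by (subst Max_less_iff[OF fin]) auto
  then have thetat: "theta0 < theta" "theta < t" by (auto simp: theta_def)
  have gammatheta: "?gamma < theta" using Max_ge[OF fin, of ?gamma] thetat unfolding theta0_def by auto
  have thetapos: "theta > 0" using gammatheta gamma by linarith
  have y_theta: "geometric_bound theta (y b q phi)" if b: "b < B" and q: "q < m b" for b q
  proof (cases "t <= norm (xi b)")
   case True
   have lim: "is_limit b phi (%q. u b q phi)" by (rule u_limit[OF b True phi])
   have "u b q phi = 0" if q: "q < m b" for q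
   proof (cases "norm (xi b) <= theta'")
    case False
    have "geometric_bound (max ?gamma theta') (block_power (xi b) (m b) (%q. u b q phi) q)" if "q < m b" for q
    proof -
     have "geometric_bound ?gamma (%n. y b q phi n - block_power (xi b) (m b) (%q. u b q phi) q n)"
      using lim that unfolding is_limit_def by blast
     then have 2: "geometric_bound (max ?gamma theta')
       (%n. y b q phi n - block_power (xi b) (m b) (%q. u b q phi) q n)"
      by (rule geometric_bound_mono) (use gamma in auto)
     have 1: "geometric_bound (max ?gamma theta') (y b q phi)"
      by (rule geometric_bound_mono[OF y_dec]) (use theta' in auto)
     from geometric_bound_diff[OF 1 2]
     show ?thesis by simp
    qed
    then show ?thesis by (rule expanding_block_unique[of "m b"]) (use False True t gamma q in auto)
   qed (use van b True q in blast)
   then have "block_power (xi b) (m b) (%q. u b q phi) q n = 0" for n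
    unfolding block_power_def by (intro sum.neutral) auto
   moreover have "geometric_bound ?gamma (%n. y b q phi n - block_power (xi b) (m b) (%q. u b q phi) q n)"
    using lim q unfolding is_limit_def by blast
   ultimately have "geometric_bound ?gamma (y b q phi)" by simp
   then show ?thesis by (rule geometric_bound_mono) (use gamma gammatheta in auto)
  next
   case False
   then have "norm (xi b) \<in> insert ?gamma {norm (xi b) |b. b < B & norm (xi b) < t}" using b by auto
   from le_less_trans[OF Max_ge[OF fin this] thetat(1)[unfolded theta0_def]] have "norm (xi b) < theta" .
   moreover have "geometric_bound theta (jordan_error s K (alpha b q) phi)" for q
    by (rule geometric_bound_mono[OF jordan_error_geometric[OF phi]]) (use gamma gammatheta in auto)
   ultimately show ?thesis
    by (intro contracting_block[where w = "%q. y b q phi", OF y_Suc[OF b _ phi]]) (use q in auto)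
  qed
  have coord_y: "coord i ((transfer s ^^ n) phi) = (\<Sum>b<B. \<Sum>q<m b. e b q i * y b q phi n)" if i: "i < ?n" for i n
  proof -
   have "(\<Sum>b<B. \<Sum>q<m b. e b q i * y b q phi n) =
     (\<Sum>b<B. \<Sum>q<m b. \<Sum>c<?n. e b q i * alpha b q c * coord c ((transfer s ^^ n) phi))"
    unfolding y_def jordan_coord_def sum_distrib_left by (simp add: mult.assoc)
   also have "... = (\<Sum>b<B. \<Sum>c<?n. \<Sum>q<m b. e b q i * alpha b q c * coord c ((transfer s ^^ n) phi))"
    by (intro sum.cong refl sum.swap)
   also have "... = (\<Sum>c<?n. (\<Sum>b<B. \<Sum>q<m b. e b q i * alpha b q c) * coord c ((transfer s ^^ n) phi))"
    unfolding sum_distrib_right by (rule sum.swap)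
   also have "... = (\<Sum>c<?n. (if i = c then 1 else 0) * coord c ((transfer s ^^ n) phi))"
    by (intro sum.cong refl) (simp add: ealpha[OF i])
   also have "... = coord i ((transfer s ^^ n) phi)"
    using i by (simp add: if_distrib[of "%z. z * _"] cong: if_cong)
   finally show ?thesis by simp
  qed
  have "geometric_bound theta (%n. coord i ((transfer s ^^ n) phi))" if "i < ?n" for i
   unfolding coord_y[OF that] by (intro geometric_bound_sum geometric_bound_mult y_theta) auto
  then have "EX C>=0. ALL n. norm (coord i ((transfer s ^^ n) phi)) <= C * theta ^ n" if "i < ?n" for i
   using geometric_boundE[of theta] thetapos that by (metis less_imp_le)
  then obtain C where C: "!!i. i < ?n ==> C i >= 0"
    "!!i n. i < ?n ==> norm (coord i ((transfer s ^^ n) phi)) <= C i * theta ^ n" by metis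
  have gammathetan: "?gamma ^ n <= theta ^ n" for n using gamma gammatheta by (intro power_mono) auto
  have "transfer_decay s phi theta"
   unfolding transfer_decay_def
  proof
   fix k
   show "EX C. ALL n. ALL x:U. norm ((Df ^^ k) ((transfer s ^^ n) phi) x) <= C * theta ^ n"
   proof (cases "K <= k")
    case True
    obtain C where C: "C >= 0" "!!n x. x \<in> U ==> norm ((Df ^^ k) ((transfer s ^^ n) phi) x) <= C * ?gamma ^ n"
     using high_derivative_decay[OF phi True] by blast
    have "norm ((Df ^^ k) ((transfer s ^^ n) phi) x) <= C * theta ^ n" if "x \<in> U" for n x
     by (rule order_trans[OF C(2)[OF that] mult_left_mono[OF gammathetan C(1)]])
    then show ?thesis by blast
   next
    case False
    obtain S where S: "S >= 0" "!!x. x \<in> U ==> norm ((Df ^^ K) phi x) <= S" using V_bounded[OF phi] by blast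
    have "ALL i. EX S. S >= 0 & (ALL x:U. norm ((Df ^^ k) (basis i) x) <= S)"
    proof
     fix i show "EX S. S >= 0 & (ALL x:U. norm ((Df ^^ k) (basis i) x) <= S)"
      by (rule V_bounded[OF V_basis[of i], of k]) blast
    qed
    from choice[OF this] obtain Sb where
     "ALL i. Sb i >= 0 & (ALL x:U. norm ((Df ^^ k) (basis i) x) <= Sb i)" ..
    then have Sb: "!!i. Sb i >= 0" "!!i x. x \<in> U ==> norm ((Df ^^ k) (basis i) x) <= Sb i" by auto
    have "norm ((Df ^^ k) ((transfer s ^^ n) phi) x) <= ((\<Sum>i<?n. C i * Sb i) + S) * theta ^ n" if x: "x \<in> U" for n x
    proof -
     let ?eta = "(transfer s ^^ n) phi"
     have eta: "?eta \<in> V" by (rule V_transfer_pow[OF phi])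
     have split: "(Df ^^ k) ?eta x = (\<Sum>i<?n. coord i ?eta * (Df ^^ k) (basis i) x) + (Df ^^ k) (jet_rest K ?eta) x"
      unfolding jet_rest_def using x eta by (simp add: Df_diff V_sum V_basis Df_sum)
     have "norm ((Df ^^ k) ?eta x) <= (\<Sum>i<?n. C i * theta ^ n * Sb i) + S * theta ^ n"
      unfolding split
     proof (intro norm_triangle_le add_mono sum_norm_le)
      show "norm (coord i ?eta * (Df ^^ k) (basis i) x) <= C i * theta ^ n * Sb i" if "i \<in> {..<?n}" for i
       unfolding norm_mult using C(2)[of i n] Sb(1)[of i] Sb(2)[OF x, of i] that C(1)[of i] thetapos
       by (intro mult_mono) auto
      have "norm ((Df ^^ k) (jet_rest K ?eta) x) <= ?gamma ^ n * S"
       by (rule jet_rest_pow_bound[OF phi S(2,1) _ x]) (use False in auto)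
      also have "... <= S * theta ^ n" using mult_left_mono[OF gammathetan S(1)] by (simp add: mult.commute)
      finally show "norm ((Df ^^ k) (jet_rest K ?eta) x) <= S * theta ^ n" .
     qed
     moreover have "(\<Sum>i<?n. C i * theta ^ n * Sb i) + S * theta ^ n = ((\<Sum>i<?n. C i * Sb i) + S) * theta ^ n"
      unfolding distrib_right sum_distrib_right by (intro arg_cong2[where f = "(+)"] sum.cong refl) simp
     ultimately show ?thesis by linarith
    qed
    then show ?thesis by blast
   qed
  qed
  then show ?thesis using thetat thetapos by blast
 qed
 have "resonance_level s K t B m xi E u"
  unfolding resonance_level_def
 proof (intro conjI allI ballI impI)
  fix phi theta'
  assume "phi \<in> V" "0 < theta'" "transfer_decay s phi theta'"
   "ALL b<B. ALL q<m b. t <= norm (xi b) --> norm (xi b) <= theta' --> u b q phi = 0"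
  then show "EX theta. 0 < theta & theta < t & transfer_decay s phi theta"
   by (intro decay[of phi theta']) auto
 qed (fact m E E_transfer u_functional u_transfer u_E mult | rule m E E_transfer u_functional u_transfer u_E mult; assumption)+
 then show ?thesis by blast
qed

end

section \<open>The list of resonances\<close>

text \<open>The expansion uses powers of \<open>n\<close> where powers of Jordan blocks have binomial coefficients.\<close>
lemma binomial_coefficient_polynomial:
 obtains beta :: "nat => nat => complex"
 where "!!d n. of_nat (n choose d) = (\<Sum>k\<le>d. beta d k * of_nat n ^ k)" "!!d. beta d d ~= 0"
  "!!d k. d < k ==> beta d k = 0"
proof -
 define P where "P d = (\<Prod>i<d. [:- of_nat i, 1:] :: complex poly)" for d
 have P: "coeff (P d) d = 1 & degree (P d) = d" for d
 proof (induction d)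
  case (Suc d)
  have PS: "P (Suc d) = P d * [:- of_nat d, 1:]" by (simp add: P_def)
  then have "lead_coeff (P (Suc d)) = lead_coeff (P d) * lead_coeff [:- of_nat d, 1:]"
   by (simp only: lead_coeff_mult)
  moreover have "degree (P (Suc d)) = degree (P d) + degree [:- of_nat d :: complex, 1:]"
   unfolding PS by (rule degree_mult_eq) (use Suc in auto)
  ultimately show ?case using Suc by simp
 qed (simp add: P_def)
 show thesis
 proof (rule that[of "%d k. coeff (P d) k / fact d"])
  fix d n :: nat
  have "(of_nat (n choose d) :: complex) = poly (P d) (of_nat n) / fact d"
   by (simp add: binomial_gbinomial gbinomial_prod_rev P_def poly_prod lessThan_atLeast0)
  also have "... = (\<Sum>k\<le>d. coeff (P d) k / fact d * of_nat n ^ k)"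
   unfolding poly_altdef using P[of d] by (simp add: sum_divide_distrib)
  finally show "of_nat (n choose d) = (\<Sum>k\<le>d. coeff (P d) k / fact d * (of_nat n :: complex) ^ k)" .
 next
  show "coeff (P d) d / fact d ~= 0" for d using P[of d] by simp
  show "coeff (P d) k / fact d = 0" if "d < k" for d k using P[of d] that by (simp add: coeff_eq_0)
 qed
qed

context markov_map
begin

abbreviation B where "B \<equiv> weighted_adjacency f N p slope"

lemma B_index: "i < N ==> j < N ==> B l $$ (i, j) = (if adj j i then inverse (of_real (slope j)) ^ l else 0)"
 by (simp add: weighted_adjacency_def adjacency_def adj_def)

lemma B_carrier: "B l \<in> carrier_mat N N"
 by (simp add: weighted_adjacency_def)

lemma order_transfer_matrix:
 "Polynomial.order z (char_poly (mat (K * N) (K * N) (%(i, c). transfer_matrix s i c))) =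
  (\<Sum>k<K. Polynomial.order z (char_poly (B (s + k))))"
proof -
 let ?D = "%k i j. if adj j i then inverse (of_real (slope j)) ^ (s + k) else (0::complex)"
 have "mat N N (%(i, j). ?D k i j) = B (s + k)" for k
  by (rule eq_matI) (use B_carrier[of "s + k"] in "auto simp: B_index")
 then show ?thesis
  using order_char_poly_block_upper_triangular[of N "transfer_matrix s" ?D z K] N_pos
  by (simp add: transfer_matrix_block)
qed

lemma spectrum_order: "z \<in> spectrum (B l) \<longleftrightarrow> Polynomial.order z (char_poly (B l)) > 0"
proof -
 have "char_poly (B l) ~= 0" using degree_monic_char_poly[OF B_carrier, of l] by (metis coeff_0 zero_neq_one)
 then show ?thesis
  unfolding spectrum_def by (simp add: eigenvalue_root_char_poly[OF B_carrier] order_root)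
qed

lemma spectrum_iff:
 "z \<in> spectrum (B l) \<longleftrightarrow>
  (EX v. (EX j<N. v j ~= 0) & (ALL i<N. (\<Sum>j<N. B l $$ (i, j) * v j) = z * v i))"
proof
 assume "z \<in> spectrum (B l)"
 then obtain w where w: "w \<in> carrier_vec N" "w ~= 0\<^sub>v N" "B l *\<^sub>v w = z \<cdot>\<^sub>v w"
  using B_carrier[of l] unfolding spectrum_def eigenvalue_def eigenvector_def by auto
 have "EX j<N. vec_index w j ~= 0"
 proof (rule ccontr)
  assume "\<not> (EX j<N. vec_index w j ~= 0)"
  then have "w = 0\<^sub>v N" using w(1) by (intro eq_vecI) auto
  then show False using w(2) by simp
 qed
 moreover have "(\<Sum>j<N. B l $$ (i, j) * vec_index w j) = z * vec_index w i" if "i < N" for i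
 proof -
  have "(B l *\<^sub>v w) $ i = (\<Sum>j<N. B l $$ (i, j) * vec_index w j)"
   using that w(1) B_carrier[of l] by (simp add: scalar_prod_def lessThan_atLeast0)
  then show ?thesis using that w(1) unfolding w(3) by simp
 qed
 ultimately show "EX v. (EX j<N. v j ~= 0) & (ALL i<N. (\<Sum>j<N. B l $$ (i, j) * v j) = z * v i)"
  by (intro exI[of _ "%j. vec_index w j"]) auto
next
 assume "EX v. (EX j<N. v j ~= 0) & (ALL i<N. (\<Sum>j<N. B l $$ (i, j) * v j) = z * v i)"
 then obtain v where v: "EX j<N. v j ~= 0" "!!i. i < N ==> (\<Sum>j<N. B l $$ (i, j) * v j) = z * v i" by blast
 have "vec N v ~= 0\<^sub>v N" using v(1) by (metis index_vec index_zero_vec(1))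
 moreover have "B l *\<^sub>v vec N v = z \<cdot>\<^sub>v vec N v"
  using v(2) B_carrier[of l] by (intro eq_vecI) (auto simp: scalar_prod_def lessThan_atLeast0)
 ultimately show "z \<in> spectrum (B l)"
  using B_carrier[of l] unfolding spectrum_def eigenvalue_def eigenvector_def by (auto intro!: exI[of _ "vec N v"])
qed

lemma spectrum_bound:
 assumes "z \<in> spectrum (B l)"
 shows "norm z <= real N / rate ^ l"
proof -
 obtain v where v: "EX j<N. v j ~= 0" "!!i. i < N ==> (\<Sum>j<N. B l $$ (i, j) * v j) = z * v i"
  using assms unfolding spectrum_iff by blast
 define S where "S = Max ((%j. norm (v j)) ` {..<N})"
 have fin: "finite ((%j. norm (v j)) ` {..<N})" and ne: "(%j. norm (v j)) ` {..<N} ~= {}" using N_pos by auto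
 obtain i where i: "i < N" "norm (v i) = S" using Max_in[OF fin ne] unfolding S_def by auto
 have le: "norm (v j) <= S" if "j < N" for j unfolding S_def using that fin by (intro Max_ge) auto
 have S: "S > 0" using v(1) le by (meson less_le_trans zero_less_norm_iff)
 have "norm z * S = norm (\<Sum>j<N. B l $$ (i, j) * v j)"
  unfolding v(2)[OF i(1)] by (simp add: norm_mult i(2))
 also have "... <= (\<Sum>j<N. 1 / rate ^ l * S)"
 proof (rule sum_norm_le)
  fix j assume "j \<in> {..<N}"
  then have j: "j < N" by simp
  have "rate ^ l <= slope j ^ l" "rate ^ l > 0" using slope_ge_rate[OF j] rate_gt_1 by (auto intro: power_mono)
  then have "norm (B l $$ (i, j)) <= 1 / rate ^ l" using slope_gt_1[OF j]
   by (simp add: B_index i j norm_power norm_inverse power_inverse divide_inverse le_imp_inverse_le)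
  then show "norm (B l $$ (i, j) * v j) <= 1 / rate ^ l * S"
   unfolding norm_mult using le[OF j] rate_gt_1 by (intro mult_mono) auto
 qed
 finally have "norm z * S <= (real N / rate ^ l) * S" by simp
 then show ?thesis using S by (simp only: mult_le_cancel_right_pos)
qed

text \<open>The matrices \<open>B l\<close> differ by invertible diagonal factors.\<close>
lemma spectrum_0: "0 \<in> spectrum (B l) \<longleftrightarrow> 0 \<in> spectrum (B l')"
proof -
 have "0 \<in> spectrum (B l')" if "0 \<in> spectrum (B l)" for l l'
 proof -
  obtain v where v: "EX j<N. v j ~= 0" "!!i. i < N ==> (\<Sum>j<N. B l $$ (i, j) * v j) = 0 * v i"
   using \<open>0 \<in> spectrum (B l)\<close> unfolding spectrum_iff by blast
  define w where "w j = of_real (slope j) ^ l' * (inverse (of_real (slope j)) ^ l * v j)" for j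
  have ne: "(of_real (slope j) :: complex) ~= 0" if "j < N" for j using slope_gt_1[OF that] by auto
  have "EX j<N. w j ~= 0" using v(1) ne by (auto simp: w_def)
  moreover have "(\<Sum>j<N. B l' $$ (i, j) * w j) = 0 * w i" if i: "i < N" for i
  proof -
   have "(\<Sum>j<N. B l' $$ (i, j) * w j) = (\<Sum>j<N. B l $$ (i, j) * v j)"
    by (intro sum.cong refl) (use ne in "auto simp: B_index i w_def power_inverse")
   then show ?thesis using v(2)[OF i] by simp
  qed
  ultimately show ?thesis unfolding spectrum_iff by blast
 qed
 then show ?thesis by blast
qed

end

context markov_map
begin

text \<open>Level \<open>K\<close> is used for the eigenvalues of modulus between \<open>threshold s K\<close> and \<open>threshold s (K - 1)\<close>.\<close>
definition threshold :: "nat => nat => real" where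
 "threshold s K = 2 * quotient_rate s K"

lemma quotient_rate_less_threshold: "quotient_rate s K < threshold s K"
 using quotient_rate_pos[of s K] by (simp add: threshold_def)

lemma threshold_pos: "threshold s K > 0"
 using quotient_rate_pos[of s K] by (simp add: threshold_def)

lemma threshold_antimono: "K <= k ==> threshold s k <= threshold s K"
 using quotient_rate_antimono[of K k s] by (simp add: threshold_def)

lemma threshold_small: "eps > 0 ==> EX K. threshold s K < eps"
proof -
 assume eps: "eps > 0"
 have "(%K. inverse (rate ^ K)) \<longlonglongrightarrow> 0" using rate_gt_1 by (rule LIMSEQ_inverse_realpow_zero)
 then have "(%K. 2 * real N / rate ^ s * inverse (rate ^ K)) \<longlonglongrightarrow> 2 * real N / rate ^ s * 0"
  by (intro tendsto_intros)
 then have "eventually (%K. 2 * real N / rate ^ s * inverse (rate ^ K) < eps) sequentially"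
  using eps by (auto dest: order_tendstoD(2))
 then obtain K where "2 * real N / rate ^ s * inverse (rate ^ K) < eps" by (auto simp: eventually_sequentially)
 then show ?thesis by (auto simp: threshold_def quotient_rate_def power_add divide_inverse mult_ac intro!: exI[of _ K])
qed

lemma order_0_above:
 assumes "threshold s K <= norm z" "l >= s + K"
 shows "Polynomial.order z (char_poly (B l)) = 0"
proof (rule ccontr)
 assume "Polynomial.order z (char_poly (B l)) ~= 0"
 then have "z \<in> spectrum (B l)" by (simp add: spectrum_order)
 then have "norm z <= real N / rate ^ l" by (rule spectrum_bound)
 also have "... <= real N / rate ^ (s + K)"
  using rate_gt_1 assms(2) by (intro divide_left_mono power_increasing) auto
 finally show False
  using assms(1) quotient_rate_less_threshold[of s K] by (simp add: quotient_rate_def)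
qed

text \<open>Blocks with different eigenvalues are biorthogonal: the Sylvester equation has only the zero solution.\<close>
lemma sylvester_zero:
 fixes X :: "nat => nat => complex"
 assumes rec: "!!q r. q < m ==> r < m' ==>
   z * X q r + (if Suc q < m then X (Suc q) r else 0) = z' * X q r + (if r = 0 then 0 else X q (r - 1))"
  and "z ~= z'" and "q < m" "r < m'"
 shows "X q r = 0"
 using assms(3,4)
proof (induction "m - q + r" arbitrary: q r rule: less_induct)
 case less
 have "(if Suc q < m then X (Suc q) r else 0) = 0" using less.hyps[of "Suc q" r] less.prems by auto
 moreover have "(if r = 0 then 0 else X q (r - 1)) = 0" using less.hyps[of q "r - 1"] less.prems by auto
 ultimately have "z * X q r = z' * X q r" using rec[OF less.prems] by simp
 then show ?case using assms(2) by simp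
qed

definition block_projection ::
  "'g set => ('g => nat) => ('g => nat => real => complex) =>
   ('g => nat => (real => complex) => complex) => (real => complex) => real => complex"
 where "block_projection F m E u phi x = (\<Sum>g\<in>F. \<Sum>q<m g. u g q phi * E g q x)"

lemma block_projection_Sigma:
 "finite F ==> block_projection F m E u phi x =
  (\<Sum>y\<in>(SIGMA g:F. {..<m g}). u (fst y) (snd y) phi * E (fst y) (snd y) x)"
 unfolding block_projection_def by (subst sum.Sigma) (auto simp: case_prod_unfold)

lemma resonance_levelD:
 assumes "resonance_level s K t R m xi E u"
 shows "b < R ==> m b >= 1"
  and "b < R ==> q < m b ==> E b q \<in> V"
  and "b < R ==> q < m b ==> x \<in> U ==>
   transfer s (E b q) x = xi b * E b q x + (if q = 0 then 0 else E b (q - 1) x)"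
  and "b < R ==> t <= norm (xi b) ==> q < m b ==> linear_functional N p (u b q)"
  and "b < R ==> t <= norm (xi b) ==> q < m b ==> phi \<in> V ==>
   u b q (transfer s phi) = xi b * u b q phi + (if Suc q < m b then u b (Suc q) phi else 0)"
  and "b < R ==> t <= norm (xi b) ==> q < m b ==> b' < R ==> q' < m b' ==>
   u b q (E b' q') = (if b = b' & q = q' then 1 else 0)"
  and "Polynomial.order z (char_poly (mat (K * N) (K * N) (%(i, c). transfer_matrix s i c))) =
   (\<Sum>b | b < R & xi b = z. m b)"
  and "phi \<in> V ==> theta' > 0 ==> transfer_decay s phi theta' ==>
   (!!b q. b < R ==> q < m b ==> t <= norm (xi b) ==> norm (xi b) <= theta' ==> u b q phi = 0) ==>
   EX theta. 0 < theta & theta < t & transfer_decay s phi theta"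
proof -
 note * = assms[unfolded resonance_level_def]
 note c1 = conjunct1[OF *] note r1 = conjunct2[OF *]
 note c2 = conjunct1[OF r1] note r2 = conjunct2[OF r1]
 note c3 = conjunct1[OF r2] note r3 = conjunct2[OF r2]
 note c4 = conjunct1[OF r3] note r4 = conjunct2[OF r3]
 note c5 = conjunct1[OF r4] note r5 = conjunct2[OF r4]
 note c6 = conjunct1[OF r5] note r6 = conjunct2[OF r5]
 note c7 = conjunct1[OF r6] note c8 = conjunct2[OF r6]
 show "b < R ==> m b >= 1" using c1 by simp
 show "b < R ==> q < m b ==> E b q \<in> V" using c2 by simp
 show "b < R ==> q < m b ==> x \<in> U ==>
   transfer s (E b q) x = xi b * E b q x + (if q = 0 then 0 else E b (q - 1) x)" using c3 by blast
 show "b < R ==> t <= norm (xi b) ==> q < m b ==> linear_functional N p (u b q)" using c4 by blast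
 show "b < R ==> t <= norm (xi b) ==> q < m b ==> phi \<in> V ==>
   u b q (transfer s phi) = xi b * u b q phi + (if Suc q < m b then u b (Suc q) phi else 0)" using c5 by blast
 show "b < R ==> t <= norm (xi b) ==> q < m b ==> b' < R ==> q' < m b' ==>
   u b q (E b' q') = (if b = b' & q = q' then 1 else 0)" using c6 by blast
 show "Polynomial.order z (char_poly (mat (K * N) (K * N) (%(i, c). transfer_matrix s i c))) =
   (\<Sum>b | b < R & xi b = z. m b)" using c7 by blast
 show "phi \<in> V ==> theta' > 0 ==> transfer_decay s phi theta' ==>
   (!!b q. b < R ==> q < m b ==> t <= norm (xi b) ==> norm (xi b) <= theta' ==> u b q phi = 0) ==>
   EX theta. 0 < theta & theta < t & transfer_decay s phi theta" using c8 by blast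
qed

text \<open>Indices are pairs (level, block), with levels counted from 1; level 0 is free to label the eigenvalue 0. Blocks of different levels have different eigenvalues, so the levels are biorthogonal, and removing the components of one level after another lowers the decay rate below every threshold.\<close>
lemma resonance_family:
 obtains G :: "(nat \<times> nat) set" and m xi and E :: "nat \<times> nat => nat => real => complex" and u
 where "!!g. g \<in> G ==> fst g >= 1 & m g >= (1::nat) & xi g ~= 0"
  and "!!g q. g \<in> G ==> q < m g ==> E g q \<in> V"
  and "!!g q x. g \<in> G ==> q < m g ==> x \<in> U ==>
   transfer s (E g q) x = xi g * E g q x + (if q = 0 then 0 else E g (q - 1) x)"
  and "!!g q. g \<in> G ==> q < m g ==> linear_functional N p (u g q)"
  and "!!g q g' q'. g \<in> G ==> q < m g ==> g' \<in> G ==> q' < m g' ==>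
   u g q (E g' q') = (if g = g' & q = q' then 1 else 0)"
  and "!!eps::real. eps > 0 ==> finite {g \<in> G. eps <= norm (xi g)}"
  and "!!phi eps. phi \<in> V ==> eps > 0 ==> EX F. finite F & F \<subseteq> G & {g \<in> G. eps <= norm (xi g)} \<subseteq> F &
   (EX theta. 0 < theta & theta < eps & transfer_decay s (%x. phi x - block_projection F m E u phi x) theta)"
  and "!!z. z ~= 0 ==> EX K. (\<Sum>g | g \<in> G & xi g = z. m g) =
   (\<Sum>k<K. Polynomial.order z (char_poly (B (s + k)))) &
   (ALL l>=s + K. Polynomial.order z (char_poly (B l)) = 0)"
proof -
 let ?t = "threshold s"
 have "ALL K. EX B m xi E u. resonance_level s K (?t K) B m xi E u"
  using resonance_level_exists[OF quotient_rate_less_threshold] by blast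
 then obtain B\<^sub>K m\<^sub>K xi\<^sub>K E\<^sub>K u\<^sub>K where lev: "!!K. resonance_level s K (?t K) (B\<^sub>K K) (m\<^sub>K K) (xi\<^sub>K K) (E\<^sub>K K) (u\<^sub>K K)"
  by metis
 define m where "m g = m\<^sub>K (fst g) (snd g)" for g
 define xi where "xi g = xi\<^sub>K (fst g) (snd g)" for g
 define E where "E g = E\<^sub>K (fst g) (snd g)" for g
 define u where "u g = u\<^sub>K (fst g) (snd g)" for g
 define G where "G = {g. fst g >= 1 & snd g < B\<^sub>K (fst g) & ?t (fst g) <= norm (xi g) & norm (xi g) < ?t (fst g - 1)}"
 have GD: "fst g >= 1" "snd g < B\<^sub>K (fst g)" "?t (fst g) <= norm (xi\<^sub>K (fst g) (snd g))" if "g \<in> G" for g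
  using that by (auto simp: G_def xi_def)
 note levD = resonance_levelD[OF lev]
 have m1: "fst g >= 1 & m g >= 1 & xi g ~= 0" if "g \<in> G" for g
  using levD(1)[OF GD(2)[OF that]] GD[OF that] threshold_pos[of s "fst g"] unfolding m_def xi_def by auto
 have E: "E g q \<in> V" if "g \<in> G" "q < m g" for g q
  using levD(2)[OF GD(2)[OF that(1)]] that(2) unfolding m_def E_def by simp
 have LE: "transfer s (E g q) x = xi g * E g q x + (if q = 0 then 0 else E g (q - 1) x)"
  if "g \<in> G" "q < m g" "x \<in> U" for g q x
  unfolding E_def xi_def by (rule levD(3)[OF GD(2)[OF that(1)] that(2)[unfolded m_def] that(3)])
 have u: "linear_functional N p (u g q)" if "g \<in> G" "q < m g" for g q
  unfolding u_def by (rule levD(4)[OF GD(2,3)[OF that(1)] that(2)[unfolded m_def]])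
 have uL: "u g q (transfer s phi) = xi g * u g q phi + (if Suc q < m g then u g (Suc q) phi else 0)"
  if "g \<in> G" "q < m g" "phi \<in> V" for g q phi
  unfolding u_def m_def xi_def by (rule levD(5)[OF GD(2,3)[OF that(1)] that(2)[unfolded m_def] that(3)])
 have level_unique: "fst g = fst g'" if "g \<in> G" "g' \<in> G" "xi g = xi g'" for g g'
 proof (rule ccontr)
  assume "fst g ~= fst g'"
  then consider "fst g <= fst g' - 1" | "fst g' <= fst g - 1" by linarith
  then show False
   using that threshold_antimono[of "fst g" "fst g' - 1" s] threshold_antimono[of "fst g'" "fst g - 1" s]
   unfolding G_def by cases auto
 qed
 have uE: "u g q (E g' q') = (if g = g' & q = q' then 1 else 0)"
  if g: "g \<in> G" "q < m g" and g': "g' \<in> G" "q' < m g'" for g q g' q'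
 proof (cases "xi g = xi g'")
  case True
  then have eq: "fst g = fst g'" using level_unique g g' by blast
  then have "u\<^sub>K (fst g) (snd g) q (E\<^sub>K (fst g) (snd g') q') = (if snd g = snd g' & q = q' then 1 else 0)"
   using levD(6)[OF GD(2,3)[OF g(1)] g(2)[unfolded m_def], of "snd g'" q'] GD(2)[OF g'(1)] g'(2)
   unfolding m_def by simp
  then show ?thesis using eq unfolding u_def E_def by (auto simp: prod_eq_iff)
 next
  case False
  have "xi g * u g q (E g' r) + (if Suc q < m g then u g (Suc q) (E g' r) else 0) =
    xi g' * u g q (E g' r) + (if r = 0 then 0 else u g q (E g' (r - 1)))" if "q < m g" "r < m g'" for q r
  proof -
   have "u g q (transfer s (E g' r)) = u g q (%x. xi g' * E g' r x + (if r = 0 then 0 else 1) * E g' (r - 1) x)"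
    by (rule linear_functional_cong[OF u[OF g(1) that(1)] V_transfer[OF E[OF g'(1) that(2)]]])
     (use LE[OF g'(1) that(2)] in auto)
   also have "... = xi g' * u g q (E g' r) + (if r = 0 then 0 else 1) * u g q (E g' (r - 1))"
    by (rule linear_functional_lin[OF u[OF g(1) that(1)]]) (use E[OF g'(1)] that in auto)
   finally show ?thesis using uL[OF g(1) that(1) E[OF g'(1) that(2)]] by (simp split: if_splits)
  qed
  from sylvester_zero[of "m g" "m g'" "xi g" "%q r. u g q (E g' r)", OF this False g(2) g'(2)]
  show ?thesis using False by auto
 qed
 define GK where "GK K = {g \<in> G. fst g <= K}" for K
 have GK_fin: "finite (GK K)" for K
 proof (rule finite_subset)
  show "GK K \<subseteq> (SIGMA k:{..K}. {..<B\<^sub>K k})" using GD by (auto simp: GK_def) 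
 qed auto
 have GK_large: "{g \<in> G. eps <= norm (xi g)} \<subseteq> GK K" if "?t K <= eps" for K eps
 proof
  fix g assume g: "g \<in> {g \<in> G. eps <= norm (xi g)}"
  have "\<not> K <= fst g - 1"
  proof
   assume "K <= fst g - 1"
   from threshold_antimono[OF this, of s] g that show False unfolding G_def by auto
  qed
  then show "g \<in> GK K" using g by (auto simp: GK_def)
 qed
 have fin: "finite {g \<in> G. eps <= norm (xi g)}" if "eps > 0" for eps :: real
  using threshold_small[OF that, of s] GK_large GK_fin finite_subset by (meson less_imp_le)
 have decay: "EX theta. 0 < theta & theta < ?t K & transfer_decay s (%x. phi x - block_projection (GK K) m E u phi x) theta"
  if phi: "phi \<in> V" for phi K
 proof -
  let ?P = "block_projection (GK K) m E u phi"
  let ?S = "SIGMA g:GK K. {..<m g}"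
  have P: "?P = (%x. \<Sum>y\<in>?S. u (fst y) (snd y) phi * E (fst y) (snd y) x)"
   by (rule ext) (rule block_projection_Sigma[OF GK_fin])
  have SG: "fst y \<in> G" "snd y < m (fst y)" if "y \<in> ?S" for y using that by (auto simp: GK_def)
  have PV: "?P \<in> V" unfolding P by (rule V_sum) (use E SG in blast)
  define psi where "psi x = phi x - ?P x" for x
  have psi: "psi \<in> V" unfolding psi_def by (rule V_diff[OF phi PV])
  have van: "u g q psi = 0" if g: "g \<in> GK K" and q: "q < m g" for g q
  proof -
   have gG: "g \<in> G" using g by (simp add: GK_def)
   have "u g q (%x. 1 * phi x + (-1) * ?P x) = 1 * u g q phi + (-1) * u g q ?P"
    by (rule linear_functional_lin[OF u[OF gG q] phi PV])
   moreover have "u g q ?P = (\<Sum>y\<in>?S. u (fst y) (snd y) phi * u g q (E (fst y) (snd y)))"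
    unfolding P by (rule linear_functional_sum[OF u[OF gG q]]) (use E SG in blast)
   moreover have "... = (\<Sum>y\<in>?S. if y = (g, q) then u g q phi else 0)"
    by (intro sum.cong refl) (use uE[OF gG q] SG in "auto simp: prod_eq_iff")
   moreover have "... = u g q phi" using g q GK_fin by (subst sum.delta) auto
   ultimately show ?thesis by (simp add: psi_def[abs_def])
  qed
  have "EX theta. 0 < theta & theta < ?t k & transfer_decay s psi theta" if "k <= K" for k
   using that
  proof (induction k)
   case 0
   show ?case using transfer_decay_base[OF psi] quotient_rate_less_threshold quotient_rate_pos by blast
  next
   case (Suc k)
   then obtain theta' where theta': "0 < theta'" "theta' < ?t k" "transfer_decay s psi theta'" by auto
   have "u\<^sub>K (Suc k) b q psi = 0"
    if "b < B\<^sub>K (Suc k)" "q < m\<^sub>K (Suc k) b" "?t (Suc k) <= norm (xi\<^sub>K (Suc k) b)" "norm (xi\<^sub>K (Suc k) b) <= theta'" for b q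
    using van[of "(Suc k, b)" q] that theta'(2) Suc.prems by (simp add: GK_def G_def u_def m_def xi_def)
   then show ?case by (intro levD(8)[OF psi theta'(1,3)])
  qed
  from this[of K] show ?thesis unfolding psi_def by simp
 qed
 have decay': "EX F. finite F & F \<subseteq> G & {g \<in> G. eps <= norm (xi g)} \<subseteq> F &
   (EX theta. 0 < theta & theta < eps & transfer_decay s (%x. phi x - block_projection F m E u phi x) theta)"
  if phi: "phi \<in> V" and eps: "eps > 0" for phi eps
 proof -
  obtain K where K: "?t K < eps" using threshold_small[OF eps] by blast
  show ?thesis
   by (rule exI[of _ "GK K"]) (use GK_fin GK_large[of K eps] decay[OF phi, of K] K in "auto simp: GK_def")
 qed
 have mult: "EX K. (\<Sum>g | g \<in> G & xi g = z. m g) = (\<Sum>k<K. Polynomial.order z (char_poly (B (s + k)))) &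
   (ALL l>=s + K. Polynomial.order z (char_poly (B l)) = 0)" if z: "z ~= 0" for z
 proof -
  define K where "K = (LEAST K. ?t K <= norm z)"
  have ex: "EX K. ?t K <= norm z" using threshold_small[of "norm z" s] z by (auto intro: less_imp_le)
  have K: "?t K <= norm z" unfolding K_def by (rule LeastI_ex[OF ex])
  have K': "norm z < ?t k" if "k < K" for k using not_less_Least[of k "%K. ?t K <= norm z"] that unfolding K_def by auto
  have "{g. g \<in> G & xi g = z} = (%b. (K, b)) ` {b. b < B\<^sub>K K & xi\<^sub>K K b = z}"
  proof (cases "K = 0")
   case True
   have "(\<Sum>b | b < B\<^sub>K 0 & xi\<^sub>K 0 b = z. m\<^sub>K 0 b) = 0"
    using levD(7)[of z 0] order_transfer_matrix[of z 0 s] by simp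
   then have "{b. b < B\<^sub>K 0 & xi\<^sub>K 0 b = z} = {}"
    using levD(1)[of _ 0] by (fastforce simp: sum_eq_0_iff)
   moreover have "xi g ~= z" if "g \<in> G" for g
   proof
    assume "xi g = z"
    then have "norm z < ?t (fst g - 1)" using that by (simp add: G_def)
    also have "... <= ?t 0" by (rule threshold_antimono) simp
    finally show False using K True by simp
   qed
   then have "{g. g \<in> G & xi g = z} = {}" by blast
   ultimately show ?thesis unfolding True by (simp only: image_empty)
  next
   case False
   have "fst g = K" if g: "g \<in> G" "xi g = z" for g
   proof (rule antisym)
    show "K <= fst g" unfolding K_def by (rule Least_le) (use g in "auto simp: G_def")
    show "fst g <= K"
    proof (rule ccontr)
     assume "\<not> fst g <= K"
     then have "K <= fst g - 1" by simp
     from threshold_antimono[OF this, of s] show False using g K unfolding G_def by auto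
    qed
   qed
   then show ?thesis using False K K'[of "K - 1"]
    by (auto simp: G_def xi_def image_iff)
  qed
  then have "(\<Sum>g | g \<in> G & xi g = z. m g) = (\<Sum>b | b < B\<^sub>K K & xi\<^sub>K K b = z. m\<^sub>K K b)"
   by (simp add: sum.reindex inj_on_def m_def)
  also have "... = (\<Sum>k<K. Polynomial.order z (char_poly (B (s + k))))"
   using levD(7)[of z K] order_transfer_matrix[of z K s] by simp
  finally show ?thesis using order_0_above[OF K] by blast
 qed
 show thesis
  by (rule that[of G m xi E u]) (fact m1 E LE u uE fin decay' mult)+
qed

end

section \<open>The asymptotic expansion\<close>

lemma block_power_eq_sum:
 assumes "q < m"
 shows "block_power xi m l q n =
  (\<Sum>r<m. (if q <= r then of_nat (n choose (r - q)) * xi ^ (n - (r - q)) else 0) * l r)"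
proof -
 have "(\<Sum>r<m. (if q <= r then of_nat (n choose (r - q)) * xi ^ (n - (r - q)) else 0) * l r) =
   (\<Sum>r\<in>{q..<m}. of_nat (n choose (r - q)) * xi ^ (n - (r - q)) * l r)"
  by (rule sum.mono_neutral_cong_right) auto
 also have "... = (\<Sum>d<m - q. of_nat (n choose d) * xi ^ (n - d) * l (q + d))"
  by (rule sum.reindex_bij_witness[of _ "%d. q + d" "%r. r - q"]) auto
 finally show ?thesis by (simp add: block_power_def)
qed

lemma block_power_jordan_block:
 assumes "q < m"
 shows "block_power xi m l q n = (\<Sum>r<m. (jordan_block m xi ^\<^sub>m n) $$ (q, r) * l r)"
 unfolding block_power_eq_sum[OF assms] jordan_block_pow
 by (intro sum.cong refl) (use assms in auto)

lemma contracting_block_power: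
 assumes "norm xi < theta" "q < m"
 shows "geometric_bound theta (block_power xi m l q)"
 by (rule contracting_block[of m "block_power xi m l" xi "%_ _. 0"])
  (use assms in "auto simp: block_power_Suc geometric_bound_0")

lemma geometric_bound_smallo:
 assumes "geometric_bound theta w" "0 < theta" "theta < eps"
 shows "w \<in> o(%n. complex_of_real eps ^ n)"
proof (rule smalloI_tendsto)
 obtain C where C: "C >= 0" "!!n. norm (w n) <= C * theta ^ n" using geometric_boundE[OF assms(1)] assms(2) by auto
 show "(%n. w n / complex_of_real eps ^ n) \<longlonglongrightarrow> 0"
 proof (rule Lim_null_comparison)
  show "eventually (%n. norm (w n / complex_of_real eps ^ n) <= C * (theta / eps) ^ n) sequentially"
  proof (rule always_eventually, rule allI)
   fix n
   have "norm (w n / complex_of_real eps ^ n) = norm (w n) / eps ^ n"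
    using assms by (simp add: norm_divide norm_power)
   also have "... <= C * theta ^ n / eps ^ n" by (rule divide_right_mono[OF C(2)]) (use assms in auto)
   finally show "norm (w n / complex_of_real eps ^ n) <= C * (theta / eps) ^ n" by (simp add: power_divide)
  qed
  have "(%n. C * (theta / eps) ^ n) \<longlonglongrightarrow> C * 0"
   by (intro tendsto_intros LIMSEQ_realpow_zero) (use assms in auto)
  then show "(%n. C * (theta / eps) ^ n) \<longlonglongrightarrow> 0" by simp
 qed
qed (use assms in auto)

lemma smallo_bounded_mult:
 assumes "w \<in> o(%n. g n)" "!!n. \<bar>a n\<bar> <= (1::real)"
 shows "(%n. complex_of_real (a n) * w n) \<in> o(%n. (g n :: complex))"
proof -
 have "(%n. complex_of_real (a n) * w n) \<in> O(w)"
 proof (rule bigoI[of _ 1], rule always_eventually, rule allI)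
  fix n show "norm (complex_of_real (a n) * w n) <= 1 * norm (w n)"
   unfolding norm_mult by (rule mult_right_mono) (use assms(2) in auto)
 qed
 then show ?thesis using assms(1) by (rule landau_o.big_small_trans)
qed

context markov_map
begin

lemma linear_functional_sum_of:
 assumes "!!q. q < (n::nat) ==> linear_functional N p (u q)"
 shows "linear_functional N p (%phi. \<Sum>q<n. c q * u q phi)"
proof (rule linear_functionalI)
 fix phi psi assume h: "phi \<in> V" "psi \<in> V"
 show "(\<Sum>q<n. c q * u q (%x. phi x + psi x)) = (\<Sum>q<n. c q * u q phi) + (\<Sum>q<n. c q * u q psi)"
  unfolding sum.distrib[symmetric]
  by (intro sum.cong refl) (simp add: linear_functional_add[OF assms h] distrib_left)
 show "(\<Sum>q<n. c q * u q phi) = (\<Sum>q<n. c q * u q psi)" if "!!x. x \<in> U ==> phi x = psi x"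
  by (intro sum.cong refl) (simp add: linear_functional_cong[OF assms h(1) that])
next
 fix phi a assume h: "phi \<in> V"
 show "(\<Sum>q<n. c q * u q (%x. a * phi x)) = a * (\<Sum>q<n. c q * u q phi)"
  unfolding sum_distrib_left by (intro sum.cong refl) (simp add: linear_functional_scale[OF assms h])
qed

lemma bilinear_formI:
 assumes "!!q. q < (n::nat) ==> linear_functional N p (u q)" "!!q. q < n ==> linear_functional N p (v q)"
 shows "bilinear_form N p (%phi psi. \<Sum>q<n. u q phi * v q psi)"
proof -
 have "linear_functional N p (%psi. \<Sum>q<n. u q phi * v q psi)" for phi
  by (rule linear_functional_sum_of) (rule assms)
 moreover have "linear_functional N p (%phi. \<Sum>q<n. v q psi * u q phi)" for psi
  by (rule linear_functional_sum_of) (rule assms)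
 ultimately show ?thesis unfolding bilinear_form_def by (simp add: mult.commute)
qed

lemma finite_rank_formI:
 assumes "!!q. q < (n::nat) ==> linear_functional N p (u q)" "!!q. q < n ==> linear_functional N p (v q)"
 shows "finite_rank_form N p (%phi psi. \<Sum>q<n. u q phi * v q psi)"
 unfolding finite_rank_form_def using assms by (intro exI[of _ n] exI[of _ u] exI[of _ v]) auto

lemma linear_functional_eval: "linear_functional N p (%phi. phi (mid 0))"
 by (rule linear_functionalI) (use I_U mid_in N_pos in auto)

end

context markov_map
begin

lemma step_function_inverse:
 assumes "!!j. j < N ==> l j > 0" "x \<in> U"
 shows "step_function l x * (step_function (%j. inverse (l j)) x * y) = y"
proof -
 obtain j where j: "j < N" "x \<in> I j" using assms(2) by (rule U_E)
 show ?thesis using assms(1)[OF j(1)] by (simp add: step_function[OF j])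
qed

lemma V_eval: "EX phi:V. phi (mid 0) ~= 0"
proof
 show "monomial 0 0 \<in> V" by (rule V_monomial[OF N_pos])
 show "monomial 0 0 (mid 0) ~= 0" using mid_in[OF N_pos] by (simp add: monomial_def)
qed

text \<open>In \<open>jordan_blocks\<close> both coordinates belong to the same Jordan block in its standard form; this is why the indices inside a block are reversed (\<open>m g - 1 - q\<close>). Nondegeneracy of the pairing makes the coordinates of \<open>psi\<close> independent. The factor \<open>a n\<close> stands for \<open>kappa^-n\<close>.\<close>
theorem resonance_expansion:
 fixes pair :: form and l :: "nat => real" and a :: "nat => real"
 assumes pair: "bilinear_form N p pair"
  and bounded: "!!psi. psi \<in> V ==> EX C. ALL eta:V. ALL S. (ALL x:U. norm (eta x) <= S) --> norm (pair eta psi) <= C * S"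
  and nondegenerate: "!!eta x. eta \<in> V ==> pair eta (%x. cnj (eta x)) = 0 ==> x \<in> U ==> eta x = 0"
  and l: "!!j. j < N ==> l j > 0"
  and a: "!!n. \<bar>a n\<bar> <= 1"
 shows "EX (J :: nat set) (xi :: nat => complex) (m :: nat => nat) (C :: nat => nat => form).
    (ALL i:J. m i >= 1) &
    (ALL i:J. ALL k<m i. bilinear_form N p (C i k) & finite_rank_form N p (C i k) &
            nonzero_form N p (C i k)) &
    jordan_blocks N p J xi m C &
    (ALL phi:V. ALL psi:V. ALL eps::real. eps > 0 -->
     finite {i \<in> J. cmod (xi i) >= eps} &
     (%n. of_real (a n) * pair ((transfer s ^^ n) (%x. step_function l x * phi x)) psi - of_real (a n) *
        (\<Sum>i\<in>{i \<in> J. cmod (xi i) >= eps}. \<Sum>k<m i. xi i ^ n * of_nat n ^ k * C i k phi psi))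
      \<in> o(%n. complex_of_real eps ^ n)) &
    xi ` J = (\<Union>l\<in>{s..}. spectrum (B l)) &
    (ALL z. list_multiplicity J xi m z = total_multiplicity {s..} B z)"
proof -
 obtain G :: "(nat \<times> nat) set" and m xi and E :: "nat \<times> nat => nat => real => complex" and u where
  G1: "!!g. g \<in> G ==> fst g >= 1 & m g >= (1::nat) & xi g ~= 0"
  and EV: "!!g q. g \<in> G ==> q < m g ==> E g q \<in> V"
  and LE: "!!g q x. g \<in> G ==> q < m g ==> x \<in> U ==>
   transfer s (E g q) x = xi g * E g q x + (if q = 0 then 0 else E g (q - 1) x)"
  and u: "!!g q. g \<in> G ==> q < m g ==> linear_functional N p (u g q)"
  and uE: "!!g q g' q'. g \<in> G ==> q < m g ==> g' \<in> G ==> q' < m g' ==>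
   u g q (E g' q') = (if g = g' & q = q' then 1 else 0)"
  and fin: "!!eps::real. eps > 0 ==> finite {g \<in> G. eps <= norm (xi g)}"
  and decay: "!!phi eps. phi \<in> V ==> eps > 0 ==> EX F. finite F & F \<subseteq> G & {g \<in> G. eps <= norm (xi g)} \<subseteq> F &
   (EX theta. 0 < theta & theta < eps & transfer_decay s (%x. phi x - block_projection F m E u phi x) theta)"
  and mult: "!!z. z ~= 0 ==> EX K. (\<Sum>g | g \<in> G & xi g = z. m g) =
   (\<Sum>k<K. Polynomial.order z (char_poly (B (s + k)))) &
   (ALL l>=s + K. Polynomial.order z (char_poly (B l)) = 0)"
  by (rule resonance_family[of s]) (rule that; assumption)
 obtain beta :: "nat => nat => complex" where
  beta: "!!d n. of_nat (n choose d) = (\<Sum>k\<le>d. beta d k * of_nat n ^ k)" "!!d. beta d d ~= 0"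
   "!!d k. d < k ==> beta d k = 0"
  using binomial_coefficient_polynomial by blast
 define twist where "twist phi x = step_function l x * phi x" for phi :: "real => complex" and x
 define cu where "cu g q phi = u g (m g - 1 - q) (twist phi)" for g q phi
 define cv where "cv g r psi = pair (E g (m g - 1 - r)) psi" for g r psi
 define T where "T g phi psi n = (\<Sum>q<m g. cu g q phi * block_power (xi g) (m g) (%r. cv g r psi) q n)" for g phi psi n
 define D where "D g k phi psi = (\<Sum>r<m g. (\<Sum>q<m g. (if q <= r then beta (r - q) k / xi g ^ (r - q) else 0) * cu g q phi) * cv g r psi)"
  for g k phi psi
 have twist_V: "twist phi \<in> V" if "phi \<in> V" for phi unfolding twist_def[abs_def] by (rule V_step[OF that])
 have rev: "m g - 1 - q < m g" if "g \<in> G" for g q using G1[OF that] by simp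
 have pair1: "linear_functional N p (%eta. pair eta psi)" if "psi \<in> V" for psi
  using pair that unfolding bilinear_form_def by blast
 have cu: "linear_functional N p (cu g q)" if g: "g \<in> G" for g q
 proof (rule linear_functionalI)
  note ug = u[OF g rev[OF g, of q]]
  fix phi psi assume h: "phi \<in> V" "psi \<in> V"
  have "twist (%x. phi x + psi x) = (%x. twist phi x + twist psi x)" by (auto simp: twist_def distrib_left)
  then show "cu g q (%x. phi x + psi x) = cu g q phi + cu g q psi"
   unfolding cu_def by (simp only: linear_functional_add[OF ug twist_V[OF h(1)] twist_V[OF h(2)]])
  show "cu g q phi = cu g q psi" if "!!x. x \<in> U ==> phi x = psi x"
   unfolding cu_def by (rule linear_functional_cong[OF ug twist_V[OF h(1)]]) (simp add: twist_def that)
 next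
  note ug = u[OF g rev[OF g, of q]]
  fix phi c assume h: "phi \<in> V"
  have "twist (%x. c * phi x) = (%x. c * twist phi x)" by (auto simp: twist_def)
  then show "cu g q (%x. c * phi x) = c * cu g q phi"
   unfolding cu_def by (simp only: linear_functional_scale[OF ug twist_V[OF h]])
 qed
 have cv: "linear_functional N p (cv g r)" if g: "g \<in> G" for g r
  using pair EV[OF g rev[OF g]] unfolding bilinear_form_def cv_def[abs_def] by blast
 \<comment> \<open>test functions dual to the functionals \<open>cu\<close>\<close>
 define w where "w g q x = step_function (%j. inverse (l j)) x * E g (m g - 1 - q) x" for g q x
 have w_V: "w g q \<in> V" if "g \<in> G" for g q
  unfolding w_def[abs_def] by (rule V_step[OF EV[OF that rev[OF that]]])
 have cu_w: "cu g q (w g' q') = (if g = g' & q = q' then 1 else 0)"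
  if g: "g \<in> G" "q < m g" and g': "g' \<in> G" "q' < m g'" for g q g' q'
 proof -
  have "cu g q (w g' q') = u g (m g - 1 - q) (E g' (m g' - 1 - q'))"
   unfolding cu_def
   by (rule linear_functional_cong[OF u[OF g(1) rev[OF g(1)]] twist_V[OF w_V[OF g'(1)]]])
    (simp add: twist_def w_def step_function_inverse l)
  then show ?thesis using uE[OF g(1) rev[OF g(1)] g'(1) rev[OF g'(1)]] g(2) g'(2) by auto
 qed
 have indep_u: "c y0 = 0"
  if F: "finite F" "!!g q. (g, q) \<in> F ==> g \<in> G & q < m g"
   and z: "!!phi. phi \<in> V ==> (\<Sum>y\<in>F. c y * cu (fst y) (snd y) phi) = 0" and y0: "y0 \<in> F"
  for F and c :: "(nat \<times> nat) \<times> nat => complex" and y0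
 proof -
  have y0': "fst y0 \<in> G" "snd y0 < m (fst y0)" using F(2)[of "fst y0" "snd y0"] y0 by auto
  have "0 = (\<Sum>y\<in>F. c y * cu (fst y) (snd y) (w (fst y0) (snd y0)))" using z w_V[OF y0'(1)] by simp
  also have "... = (\<Sum>y\<in>F. if y = y0 then c y0 else 0)"
  proof (intro sum.cong refl)
   fix y assume "y \<in> F"
   then have "fst y \<in> G" "snd y < m (fst y)" using F(2)[of "fst y" "snd y"] by auto
   moreover have "(fst y = fst y0 & snd y = snd y0) = (y = y0)" by (simp only: prod_eq_iff)
   ultimately show "c y * cu (fst y) (snd y) (w (fst y0) (snd y0)) = (if y = y0 then c y0 else 0)"
    by (simp only: cu_w[OF _ _ y0']) simp
  qed
  also have "... = c y0" using F(1) y0 by simp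
  finally show ?thesis by simp
 qed
 have indep_v: "c y0 = 0"
  if F: "finite F" "!!g q. (g, q) \<in> F ==> g \<in> G & q < m g"
   and z: "!!psi. psi \<in> V ==> (\<Sum>y\<in>F. c y * cv (fst y) (snd y) psi) = 0" and y0: "y0 \<in> F"
  for F and c :: "(nat \<times> nat) \<times> nat => complex" and y0
 proof -
  define e where "e y = E (fst y) (m (fst y) - 1 - snd y)" for y :: "(nat \<times> nat) \<times> nat"
  have FG: "fst y \<in> G" "snd y < m (fst y)" if "y \<in> F" for y using F(2)[of "fst y" "snd y"] that by auto
  have e: "e y \<in> V" if "y \<in> F" for y unfolding e_def using EV[OF FG(1) rev[OF FG(1)]] that by blast
  define eta where "eta x = (\<Sum>y\<in>F. c y * e y x)" for x
  have eta: "eta \<in> V" unfolding eta_def[abs_def] by (rule V_sum) (rule e)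
  have "pair eta (%x. cnj (eta x)) = (\<Sum>y\<in>F. c y * pair (e y) (%x. cnj (eta x)))"
   unfolding eta_def[abs_def]
   by (rule linear_functional_sum[OF pair1 e]) (use V_cnj[OF eta] in "simp add: eta_def[abs_def]")
  also have "... = 0" using z[OF V_cnj[OF eta]] by (simp add: cv_def e_def)
  finally have eta0: "eta x = 0" if "x \<in> U" for x using nondegenerate[OF eta] that by blast
  let ?u = "u (fst y0) (m (fst y0) - 1 - snd y0)"
  note y0' = FG[OF y0]
  note ul = u[OF y0'(1) rev[OF y0'(1), of "snd y0"]]
  have "0 = ?u (%x. 0)" using linear_functional_0[OF ul V_0] by simp
  also have "... = ?u eta" by (rule linear_functional_cong[OF ul V_0]) (simp add: eta0)
  also have "... = (\<Sum>y\<in>F. c y * ?u (e y))"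
   unfolding eta_def[abs_def] by (rule linear_functional_sum[OF ul e])
  also have "... = (\<Sum>y\<in>F. if y = y0 then c y0 else 0)"
  proof (intro sum.cong refl)
   fix y assume y: "y \<in> F"
   have "(fst y0 = fst y & m (fst y0) - 1 - snd y0 = m (fst y) - 1 - snd y) = (y = y0)"
   proof
    assume "fst y0 = fst y & m (fst y0) - 1 - snd y0 = m (fst y) - 1 - snd y"
    then have "fst y = fst y0" "snd y = snd y0" using FG(2)[OF y] y0'(2) by auto
    then show "y = y0" by (rule prod_eqI)
   qed simp
   then show "c y * ?u (e y) = (if y = y0 then c y0 else 0)"
    unfolding e_def uE[OF y0'(1) rev[OF y0'(1)] FG(1)[OF y] rev[OF FG(1)[OF y]]] by simp
  qed
  also have "... = c y0" using F(1) y0 by simp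
  finally show ?thesis by simp
 qed
 have D_sum: "(\<Sum>k<m g. xi g ^ n * of_nat n ^ k * D g k phi psi) = T g phi psi n" if g: "g \<in> G" for g n phi psi
 proof -
  have coeff: "(\<Sum>k<m g. xi g ^ n * of_nat n ^ k * (if q <= r then beta (r - q) k / xi g ^ (r - q) else 0)) =
    (if q <= r then of_nat (n choose (r - q)) * xi g ^ (n - (r - q)) else 0)" if r: "r < m g" for q r
  proof (cases "q <= r")
   case True
   let ?d = "r - q"
   have "(\<Sum>k<m g. xi g ^ n * of_nat n ^ k * (beta ?d k / xi g ^ ?d)) =
     xi g ^ n / xi g ^ ?d * (\<Sum>k<m g. beta ?d k * of_nat n ^ k)"
    unfolding sum_distrib_left by (intro sum.cong refl) simp
   also have "(\<Sum>k<m g. beta ?d k * of_nat n ^ k) = (\<Sum>k\<le>?d. beta ?d k * of_nat n ^ k)"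
    by (rule sum.mono_neutral_right) (use r beta(3) in auto)
   also have "... = of_nat (n choose ?d)" by (rule beta(1)[symmetric])
   also have "xi g ^ n / xi g ^ ?d * of_nat (n choose ?d) = of_nat (n choose ?d) * xi g ^ (n - ?d)"
    using G1[OF g] by (cases "?d <= n") (auto simp: power_diff binomial_eq_0)
   finally show ?thesis using True by simp
  qed simp
  have "(\<Sum>k<m g. xi g ^ n * of_nat n ^ k * D g k phi psi) =
   (\<Sum>k<m g. \<Sum>r<m g. \<Sum>q<m g. xi g ^ n * of_nat n ^ k *
    (if q <= r then beta (r - q) k / xi g ^ (r - q) else 0) * (cu g q phi * cv g r psi))"
   unfolding D_def sum_distrib_left sum_distrib_right by (simp only: mult.assoc)
  also have "... = (\<Sum>r<m g. \<Sum>k<m g. \<Sum>q<m g. xi g ^ n * of_nat n ^ k *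
    (if q <= r then beta (r - q) k / xi g ^ (r - q) else 0) * (cu g q phi * cv g r psi))"
   by (rule sum.swap)
  also have "... = (\<Sum>r<m g. \<Sum>q<m g. \<Sum>k<m g. xi g ^ n * of_nat n ^ k *
    (if q <= r then beta (r - q) k / xi g ^ (r - q) else 0) * (cu g q phi * cv g r psi))"
   by (intro sum.cong refl sum.swap)
  also have "... = (\<Sum>r<m g. \<Sum>q<m g.
    (if q <= r then of_nat (n choose (r - q)) * xi g ^ (n - (r - q)) else 0) * (cu g q phi * cv g r psi))"
   unfolding sum_distrib_right[symmetric] by (intro sum.cong refl arg_cong2[where f = "(*)"] coeff) simp
  also have "... = (\<Sum>q<m g. \<Sum>r<m g.
    (if q <= r then of_nat (n choose (r - q)) * xi g ^ (n - (r - q)) else 0) * (cu g q phi * cv g r psi))"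
   by (rule sum.swap)
  also have "... = T g phi psi n"
   unfolding T_def by (intro sum.cong refl) (simp add: block_power_eq_sum sum_distrib_left mult_ac)
  finally show ?thesis .
 qed
 have T_jordan: "T g phi psi n = (\<Sum>q<m g. \<Sum>r<m g. (jordan_block (m g) (xi g) ^\<^sub>m n) $$ (q, r) * cu g q phi * cv g r psi)"
  for g phi psi n
  unfolding T_def by (intro sum.cong refl) (simp add: block_power_jordan_block sum_distrib_left mult_ac)
 have T_small: "geometric_bound theta (T g phi psi)" if "norm (xi g) < theta" for g phi psi theta
  unfolding T_def[abs_def] by (intro geometric_bound_sum geometric_bound_mult contracting_block_power) (use that in auto)
 have D_bilinear: "bilinear_form N p (D g k)" and D_finite: "finite_rank_form N p (D g k)" if g: "g \<in> G" for g k
 proof -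
  have 1: "linear_functional N p (%phi. \<Sum>q<m g. (if q <= r then beta (r - q) k / xi g ^ (r - q) else 0) * cu g q phi)" for r
   by (rule linear_functional_sum_of) (rule cu[OF g])
  show "bilinear_form N p (D g k)" "finite_rank_form N p (D g k)"
   unfolding D_def[abs_def] by (rule bilinear_formI[OF 1 cv[OF g]]) (rule finite_rank_formI[OF 1 cv[OF g]])
 qed
 have D_nonzero: "nonzero_form N p (D g k)" if g: "g \<in> G" and k: "k < m g" for g k
 proof (rule ccontr)
  assume "\<not> nonzero_form N p (D g k)"
  then have zero: "D g k (w g 0) psi = 0" if "psi \<in> V" for psi
   using w_V[OF g] that unfolding nonzero_form_def by blast
  have cu0: "cu g q (w g 0) = (if q = 0 then 1 else 0)" if "q < m g" for q
   using cu_w[OF g that g, of 0] G1[OF g] by auto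
  have "(\<Sum>y\<in>{g} \<times> {..<m g}. (beta (snd y) k / xi g ^ snd y) * cv (fst y) (snd y) psi) = 0" if "psi \<in> V" for psi
  proof -
   have "(\<Sum>y\<in>{g} \<times> {..<m g}. (beta (snd y) k / xi g ^ snd y) * cv (fst y) (snd y) psi) =
     (\<Sum>r<m g. (beta r k / xi g ^ r) * cv g r psi)"
    by (rule sum.reindex_bij_witness[of _ "%r. (g, r)" snd]) auto
   also have "... = D g k (w g 0) psi"
    unfolding D_def
   proof (intro sum.cong refl arg_cong2[where f = "(*)"])
    fix r assume "r \<in> {..<m g}"
    have "(\<Sum>q<m g. (if q <= r then beta (r - q) k / xi g ^ (r - q) else 0) * cu g q (w g 0)) =
      (\<Sum>q<m g. if q = 0 then beta r k / xi g ^ r else 0)"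
     by (intro sum.cong refl) (simp add: cu0)
    then show "beta r k / xi g ^ r =
      (\<Sum>q<m g. (if q <= r then beta (r - q) k / xi g ^ (r - q) else 0) * cu g q (w g 0))"
     using G1[OF g] by (simp add: Suc_le_eq)
   qed
   finally show ?thesis using zero[OF that] by simp
  qed
  from indep_v[of "{g} \<times> {..<m g}" "%y. beta (snd y) k / xi g ^ snd y" "(g, k)", OF _ _ this]
  have "beta k k / xi g ^ k = 0" using g k by auto
  then show False using beta(2) G1[OF g] by simp
 qed
 have pair_E: "pair ((transfer s ^^ n) (E g (m g - 1 - q))) psi = block_power (xi g) (m g) (%r. cv g r psi) q n"
  if g: "g \<in> G" and q: "q < m g" and psi: "psi \<in> V" for g q psi n
 proof -
  let ?W = "%q n. pair ((transfer s ^^ n) (E g (m g - 1 - q))) psi"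
  have "?W q (Suc n) = xi g * ?W q n + (if Suc q < m g then ?W (Suc q) n else 0)" if q: "q < m g" for q n
  proof -
   let ?e = "if m g - 1 - q = 0 then 0 else (1::complex)"
   have "?W q (Suc n) = pair (%x. xi g * (transfer s ^^ n) (E g (m g - 1 - q)) x +
     ?e * (transfer s ^^ n) (E g (m g - 1 - q - 1)) x) psi"
   proof (rule linear_functional_cong[OF pair1[OF psi] V_transfer_pow[OF EV[OF g rev[OF g]]]])
    fix x assume x: "x \<in> U"
    have "(transfer s ^^ Suc n) (E g (m g - 1 - q)) x = (transfer s ^^ n) (transfer s (E g (m g - 1 - q))) x"
     by (simp add: funpow_swap1)
    also have "... = (transfer s ^^ n) (%x. xi g * E g (m g - 1 - q) x + ?e * E g (m g - 1 - q - 1) x) x"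
     by (rule transfer_pow_cong[OF _ x]) (use LE[OF g rev[OF g, of q]] in auto)
    finally show "(transfer s ^^ Suc n) (E g (m g - 1 - q)) x = xi g * (transfer s ^^ n) (E g (m g - 1 - q)) x +
     ?e * (transfer s ^^ n) (E g (m g - 1 - q - 1)) x" by (simp only: transfer_pow_lin)
   qed
   also have "... = xi g * ?W q n + ?e * pair ((transfer s ^^ n) (E g (m g - 1 - q - 1))) psi"
    by (rule linear_functional_lin[OF pair1[OF psi]]) (intro V_transfer_pow EV[OF g], use rev[OF g] G1[OF g] in auto)+
   also have "?e * pair ((transfer s ^^ n) (E g (m g - 1 - q - 1))) psi = (if Suc q < m g then ?W (Suc q) n else 0)"
    using q by auto
   finally show ?thesis .
  qed
  from block_power_exact[of "m g" ?W "xi g", OF this q, of n] show ?thesis by (simp add: cv_def)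
 qed
 have expansion: "(%n. of_real (a n) * pair ((transfer s ^^ n) (twist phi)) psi -
   of_real (a n) * (\<Sum>g\<in>{g \<in> G. eps <= norm (xi g)}. T g phi psi n)) \<in> o(%n. complex_of_real eps ^ n)"
  if phi: "phi \<in> V" and psi: "psi \<in> V" and eps: "eps > 0" for phi psi eps
 proof -
  obtain F theta where F: "finite F" "F \<subseteq> G" "{g \<in> G. eps <= norm (xi g)} \<subseteq> F"
   and theta: "0 < theta" "theta < eps"
   and dec: "transfer_decay s (%x. twist phi x - block_projection F m E u (twist phi) x) theta"
   using decay[OF twist_V[OF phi] eps] by blast
  let ?P = "block_projection F m E u (twist phi)"
  let ?S = "SIGMA g:F. {..<m g}"
  have P: "?P = (%x. \<Sum>y\<in>?S. u (fst y) (snd y) (twist phi) * E (fst y) (snd y) x)"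
   by (rule ext) (rule block_projection_Sigma[OF F(1)])
  have SE: "E (fst y) (snd y) \<in> V" if "y \<in> ?S" for y using that F(2) EV by auto
  have PV: "?P \<in> V" unfolding P by (rule V_sum[OF SE])
  have main: "pair ((transfer s ^^ n) ?P) psi = (\<Sum>g\<in>F. T g phi psi n)" for n
  proof -
   have "(transfer s ^^ n) ?P = (%x. \<Sum>y\<in>?S. u (fst y) (snd y) (twist phi) * (transfer s ^^ n) (E (fst y) (snd y)) x)"
    unfolding P by (rule ext) (rule transfer_pow_sum)
   then have "pair ((transfer s ^^ n) ?P) psi =
     pair (%x. \<Sum>y\<in>?S. u (fst y) (snd y) (twist phi) * (transfer s ^^ n) (E (fst y) (snd y)) x) psi" by simp
   also have "... = (\<Sum>y\<in>?S. u (fst y) (snd y) (twist phi) * pair ((transfer s ^^ n) (E (fst y) (snd y))) psi)"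
    by (rule linear_functional_sum[OF pair1[OF psi]]) (intro V_transfer_pow SE)
   also have "... = (\<Sum>g\<in>F. \<Sum>q<m g. u g q (twist phi) * pair ((transfer s ^^ n) (E g q)) psi)"
    using F(1) by (subst sum.Sigma) (auto simp: case_prod_unfold)
   also have "... = (\<Sum>g\<in>F. T g phi psi n)"
   proof (intro sum.cong refl)
    fix g assume "g \<in> F"
    then have g: "g \<in> G" using F(2) by blast
    have "(\<Sum>q<m g. u g q (twist phi) * pair ((transfer s ^^ n) (E g q)) psi) =
      (\<Sum>q<m g. cu g q phi * pair ((transfer s ^^ n) (E g (m g - 1 - q))) psi)"
     unfolding cu_def by (rule sum.reindex_bij_witness[of _ "%q. m g - 1 - q" "%q. m g - 1 - q"]) auto
    then show "(\<Sum>q<m g. u g q (twist phi) * pair ((transfer s ^^ n) (E g q)) psi) = T g phi psi n"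
     unfolding T_def using pair_E[OF g _ psi] by simp
   qed
   finally show ?thesis .
  qed
  let ?R = "%x. twist phi x - ?P x"
  have RV: "?R \<in> V" by (rule V_diff[OF twist_V[OF phi] PV])
  have rest: "geometric_bound theta (%n. pair ((transfer s ^^ n) ?R) psi)"
  proof -
   obtain S where S: "ALL n. ALL x:U. norm ((Df ^^ 0) ((transfer s ^^ n) ?R) x) <= S * theta ^ n"
    using dec unfolding transfer_decay_def by blast
   obtain C where C: "ALL eta:V. ALL S. (ALL x:U. norm (eta x) <= S) --> norm (pair eta psi) <= C * S"
    using bounded[OF psi] by blast
   show ?thesis
   proof (rule geometric_boundI)
    fix n
    have "norm (pair ((transfer s ^^ n) ?R) psi) <= C * (S * theta ^ n)"
     by (rule C[rule_format, OF V_transfer_pow[OF RV]]) (use S in simp)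
    then show "norm (pair ((transfer s ^^ n) ?R) psi) <= C * S * theta ^ n" by (simp add: mult.assoc)
   qed
  qed
  have split: "pair ((transfer s ^^ n) (twist phi)) psi - (\<Sum>g\<in>{g \<in> G. eps <= norm (xi g)}. T g phi psi n) =
    pair ((transfer s ^^ n) ?R) psi + (\<Sum>g\<in>F - {g \<in> G. eps <= norm (xi g)}. T g phi psi n)" for n
  proof -
   have "(transfer s ^^ n) ?R = (transfer s ^^ n) (%x. 1 * twist phi x + (-1) * ?P x)" by simp
   also have "... = (%x. 1 * (transfer s ^^ n) (twist phi) x + (-1) * (transfer s ^^ n) ?P x)"
    by (rule ext) (rule transfer_pow_lin)
   finally have "pair ((transfer s ^^ n) ?R) psi =
     pair (%x. 1 * (transfer s ^^ n) (twist phi) x + (-1) * (transfer s ^^ n) ?P x) psi" by simp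
   also have "... = 1 * pair ((transfer s ^^ n) (twist phi)) psi + (-1) * pair ((transfer s ^^ n) ?P) psi"
    by (rule linear_functional_lin[OF pair1[OF psi]]) (intro V_transfer_pow twist_V phi PV)+
   finally show ?thesis using F sum_diff[OF F(1,3), of "%g. T g phi psi n"] main[of n] by simp
  qed
  have "(%n. \<Sum>g\<in>F - {g \<in> G. eps <= norm (xi g)}. T g phi psi n) \<in> o(%n. complex_of_real eps ^ n)"
  proof (rule big_sum_in_smallo)
   fix g assume "g \<in> F - {g \<in> G. eps <= norm (xi g)}"
   then have lt: "norm (xi g) < eps" using F(2) by auto
   then obtain theta' where "norm (xi g) < theta'" "theta' < eps" using dense by blast
   then show "T g phi psi \<in> o(%n. complex_of_real eps ^ n)"
    using geometric_bound_smallo[OF T_small] norm_ge_zero[of "xi g"] by (smt (verit))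
  qed
  then have "(%n. pair ((transfer s ^^ n) ?R) psi + (\<Sum>g\<in>F - {g \<in> G. eps <= norm (xi g)}. T g phi psi n))
    \<in> o(%n. complex_of_real eps ^ n)"
   by (intro sum_in_smallo geometric_bound_smallo[OF rest theta])
  from smallo_bounded_mult[OF this a] show ?thesis
   unfolding split[symmetric] by (simp add: right_diff_distrib)
 qed
 define Z where "Z = (if (0::complex) \<in> spectrum (B s) then range (%b. prod_encode (0, b)) else {})"
 define J where "J = prod_encode ` G Un Z"
 define g_of where "g_of i = prod_decode i" for i
 define xi' where "xi' i = (if fst (g_of i) = 0 then 0 else xi (g_of i))" for i
 define m' where "m' i = (if fst (g_of i) = 0 then 1 else m (g_of i))" for i
 define C where "C i k = (if fst (g_of i) = 0 then (%phi psi. \<Sum>q<(1::nat). phi (mid 0) * psi (mid 0)) else D (g_of i) k)" for i k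
 have enc: "g_of (prod_encode g) = g" for g by (simp add: g_of_def)
 have GZ: "fst g ~= 0" if "g \<in> G" for g using G1[OF that] by simp
 have J_G: "g_of i \<in> G" "i = prod_encode (g_of i)" if "i \<in> J" "fst (g_of i) ~= 0" for i
  using that by (auto simp: J_def Z_def g_of_def split: if_splits)
 have J_nz: "fst (g_of i) ~= 0" if "i \<in> J" "xi' i ~= 0" for i using that by (auto simp: xi'_def split: if_splits)
 have on_G: "xi' (prod_encode g) = xi g" "m' (prod_encode g) = m g" "C (prod_encode g) = D g" if "g \<in> G" for g
  using GZ[OF that] by (auto simp: xi'_def m'_def C_def enc fun_eq_iff)
 have J_set: "{i \<in> J. P (xi' i)} = prod_encode ` {g \<in> G. P (xi g)}" if "\<not> P 0" for P
 proof (intro equalityI subsetI)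
  fix i assume i: "i \<in> {i \<in> J. P (xi' i)}"
  then have "xi' i ~= 0" using that by auto
  then have nz: "fst (g_of i) ~= 0" using J_nz i by blast
  have "g_of i \<in> {g \<in> G. P (xi g)}" using J_G(1)[OF _ nz] i nz by (simp add: xi'_def)
  then show "i \<in> prod_encode ` {g \<in> G. P (xi g)}" using J_G(2)[OF _ nz] i by blast
 qed (use on_G in "auto simp: J_def")
 have inj: "inj_on prod_encode A" for A by (rule inj_prod_encode)
 have order_total: "(EX g:G. xi g = z) \<longleftrightarrow> (EX l>=s. z \<in> spectrum (B l))"
  "(\<Sum>\<^sub>\<infinity>l\<in>{s..}. of_nat (Polynomial.order z (char_poly (B l)))) = (of_nat (\<Sum>g | g \<in> G & xi g = z. m g) :: ennreal)"
  if z: "z ~= 0" for z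
 proof -
  obtain K where K: "(\<Sum>g | g \<in> G & xi g = z. m g) = (\<Sum>k<K. Polynomial.order z (char_poly (B (s + k))))"
    "!!l. l >= s + K ==> Polynomial.order z (char_poly (B l)) = 0" using mult[OF z] by blast
  have "finite {g \<in> G. norm z <= norm (xi g)}" using fin z by simp
  then have finz: "finite {g. g \<in> G & xi g = z}" by (rule finite_subset[rotated]) auto
  have shift: "(\<Sum>k<K. F (s + k)) = (\<Sum>l\<in>{s..<s + K}. F l)" for F :: "nat => nat"
   by (rule sum.reindex_bij_witness[of _ "%l. l - s" "%k. s + k"]) auto
  have "(EX g:G. xi g = z) \<longleftrightarrow> (\<Sum>g | g \<in> G & xi g = z. m g) ~= 0"
  proof -
   have "m g ~= 0" if "g \<in> G" for g using G1[OF that] by simp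
   then show ?thesis using finz by (auto simp: sum_eq_0_iff simp del: split_paired_Ex)
  qed
  also have "... \<longleftrightarrow> (EX l:{s..<s + K}. Polynomial.order z (char_poly (B l)) > 0)"
   unfolding K(1) shift[of "%l. Polynomial.order z (char_poly (B l))"] by (simp add: sum_eq_0_iff)
  also have "... \<longleftrightarrow> (EX l>=s. z \<in> spectrum (B l))"
  proof
   assume "EX l>=s. z \<in> spectrum (B l)"
   then obtain l where l: "l >= s" "Polynomial.order z (char_poly (B l)) > 0" by (auto simp: spectrum_order)
   then have "l < s + K" using K(2)[of l] by (cases "s + K <= l") auto
   then show "EX l:{s..<s + K}. Polynomial.order z (char_poly (B l)) > 0" using l by auto
  qed (auto simp: spectrum_order)
  finally show "(EX g:G. xi g = z) \<longleftrightarrow> (EX l>=s. z \<in> spectrum (B l))" .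
  have "(\<Sum>\<^sub>\<infinity>l\<in>{s..}. of_nat (Polynomial.order z (char_poly (B l)))) =
    (\<Sum>\<^sub>\<infinity>l\<in>{s..<s + K}. of_nat (Polynomial.order z (char_poly (B l))) :: ennreal)"
   by (rule infsum_cong_neutral) (use K(2) in auto)
  then show "(\<Sum>\<^sub>\<infinity>l\<in>{s..}. of_nat (Polynomial.order z (char_poly (B l)))) =
    (of_nat (\<Sum>g | g \<in> G & xi g = z. m g) :: ennreal)"
   unfolding K(1) shift[of "%l. Polynomial.order z (char_poly (B l))"] by simp
 qed
 have sum_J: "(\<Sum>i\<in>{i \<in> J. P (xi' i)}. F (prod_decode i)) = (\<Sum>g\<in>{g \<in> G. P (xi g)}. F g)" if "\<not> P 0"
  for P and F :: "nat \<times> nat => complex"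
  unfolding J_set[of P, OF that] by (simp add: sum.reindex[OF inj])
 have infinite_range: "infinite (range (%b::nat. prod_encode (0, b)))"
  by (rule range_inj_infinite) (auto simp: inj_def)
 show ?thesis
 proof (intro exI[of _ J] exI[of _ xi'] exI[of _ m'] exI[of _ C] conjI)
  show "ALL i:J. 1 <= m' i" using J_G G1 by (auto simp: m'_def)
  show "ALL i:J. ALL k<m' i. bilinear_form N p (C i k) & finite_rank_form N p (C i k) & nonzero_form N p (C i k)"
  proof (intro ballI allI impI)
   fix i k assume i: "i \<in> J" and k: "k < m' i"
   show "bilinear_form N p (C i k) & finite_rank_form N p (C i k) & nonzero_form N p (C i k)"
   proof (cases "fst (g_of i) = 0")
    case True
    obtain phi where phi: "phi \<in> V" "phi (mid 0) ~= 0" using V_eval by blast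
    have "nonzero_form N p (%phi psi. \<Sum>q<(1::nat). phi (mid 0) * psi (mid 0))"
     unfolding nonzero_form_def using phi by (intro bexI[of _ phi]) auto
    moreover have "bilinear_form N p (%phi psi. \<Sum>q<(1::nat). phi (mid 0) * psi (mid 0))"
     by (rule bilinear_formI[of 1 "%_ phi. phi (mid 0)" "%_ psi. psi (mid 0)"]) (rule linear_functional_eval)+
    moreover have "finite_rank_form N p (%phi psi. \<Sum>q<(1::nat). phi (mid 0) * psi (mid 0))"
     by (rule finite_rank_formI[of 1 "%_ phi. phi (mid 0)" "%_ psi. psi (mid 0)"]) (rule linear_functional_eval)+
    moreover have "C i k = (%phi psi. \<Sum>q<(1::nat). phi (mid 0) * psi (mid 0))"
     unfolding C_def using True by (rule if_P)
    ultimately show ?thesis by (simp only: simp_thms)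
   next
    case False
    then have "C i k = D (g_of i) k" "m' i = m (g_of i)" by (auto simp: C_def m'_def fun_eq_iff)
    then show ?thesis using D_bilinear D_finite D_nonzero J_G(1)[OF i False] k by simp
   qed
  qed
  show "jordan_blocks N p J xi' m' C"
  proof -
   define u' where "u' y = cu (g_of (fst y)) (snd y)" for y :: "nat \<times> nat"
   define v' where "v' y = cv (g_of (fst y)) (snd y)" for y :: "nat \<times> nat"
   let ?K = "{(i, q). i \<in> J & xi' i ~= 0 & q < m' i}"
   have K: "g_of (fst y) \<in> G" "snd y < m (g_of (fst y))" "fst y = prod_encode (g_of (fst y))" if "y \<in> ?K" for y
    using that J_G[of "fst y"] J_nz[of "fst y"] by (auto simp: m'_def)
   have ind: "independent_functionals N p ?K (%y. W (g_of (fst y)) (snd y))"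
    if W: "!!F (c :: (nat \<times> nat) \<times> nat => complex) y0. finite F ==> (!!g q. (g, q) \<in> F ==> g \<in> G & q < m g) ==>
     (!!phi. phi \<in> V ==> (\<Sum>y\<in>F. c y * W (fst y) (snd y) phi) = 0) ==> y0 \<in> F ==> c y0 = 0" for W
    unfolding independent_functionals_def
   proof (intro allI impI ballI)
    fix F and c :: "nat \<times> nat => complex" and y0
    assume h: "finite F & F \<subseteq> ?K & (ALL phi:V. (\<Sum>y\<in>F. c y * W (g_of (fst y)) (snd y) phi) = 0)" and y0: "y0 \<in> F"
    let ?d = "%y. (g_of (fst y), snd y)" and ?e = "%y. (prod_encode (fst y), snd y)"
    have ed: "?e (?d y) = y" if "y \<in> F" for y using K(3)[of y] h that by (auto simp: prod_eq_iff)
    have injd: "inj_on ?d F" by (rule inj_on_inverseI[of F ?e]) (rule ed)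
    have "c (?e (?d y0)) = 0"
    proof (rule W[of "?d ` F" "%y. c (?e y)"])
     show "g \<in> G & q < m g" if "(g, q) \<in> ?d ` F" for g q using that K h by fastforce
     show "(\<Sum>y\<in>?d ` F. c (?e y) * W (fst y) (snd y) phi) = 0" if "phi \<in> V" for phi
     proof -
      have "(\<Sum>y\<in>?d ` F. c (?e y) * W (fst y) (snd y) phi) = (\<Sum>y\<in>F. c y * W (g_of (fst y)) (snd y) phi)"
       unfolding sum.reindex[OF injd] by (intro sum.cong refl) (use ed in simp)
      then show ?thesis using h that by simp
     qed
    qed (use h y0 in auto)
    then show "c y0 = 0" using ed[OF y0] by simp
   qed
   have "independent_functionals N p ?K u'" "independent_functionals N p ?K v'"
    unfolding u'_def[abs_def] v'_def[abs_def]
    by (rule ind, rule indep_u; blast) (rule ind, rule indep_v; blast)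
   moreover have "ALL y:?K. linear_functional N p (u' y) & linear_functional N p (v' y)"
    unfolding u'_def v'_def using K cu cv by blast
   moreover have "(\<Sum>k<m' i. xi' i ^ n * of_nat n ^ k * C i k phi psi) =
     (\<Sum>q<m' i. \<Sum>r<m' i. (jordan_block (m' i) (xi' i) ^\<^sub>m n) $$ (q, r) * u' (i, q) phi * v' (i, r) psi)"
    if i: "i \<in> J" "xi' i ~= 0" for i phi psi n
   proof -
    note nz = J_nz[OF i]
    have eqs: "C i = D (g_of i)" "m' i = m (g_of i)" "xi' i = xi (g_of i)"
     using nz by (auto simp: C_def m'_def xi'_def fun_eq_iff)
    show ?thesis unfolding eqs D_sum[OF J_G(1)[OF i(1) nz]] T_jordan by (simp add: u'_def v'_def)
   qed
   ultimately show ?thesis unfolding jordan_blocks_def Let_def by blast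
  qed
  show "ALL phi:V. ALL psi:V. ALL eps::real. eps > 0 -->
     finite {i \<in> J. cmod (xi' i) >= eps} &
     (%n. of_real (a n) * pair ((transfer s ^^ n) (%x. step_function l x * phi x)) psi - of_real (a n) *
        (\<Sum>i\<in>{i \<in> J. cmod (xi' i) >= eps}. \<Sum>k<m' i. xi' i ^ n * of_nat n ^ k * C i k phi psi))
      \<in> o(%n. complex_of_real eps ^ n)"
  proof (intro ballI allI impI conjI)
   fix phi psi and eps :: real assume h: "phi \<in> V" "psi \<in> V" "eps > 0"
   have n0: "\<not> eps <= cmod 0" using h(3) by simp
   note set = J_set[of "%z. eps <= cmod z", OF n0]
   show "finite {i \<in> J. cmod (xi' i) >= eps}" unfolding set using fin[OF h(3)] by simp
   have "(\<Sum>i\<in>{i \<in> J. cmod (xi' i) >= eps}. \<Sum>k<m' i. xi' i ^ n * of_nat n ^ k * C i k phi psi) =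
     (\<Sum>g\<in>{g \<in> G. eps <= cmod (xi g)}. T g phi psi n)" for n
    unfolding set sum.reindex[OF inj] by (intro sum.cong refl) (simp add: on_G D_sum)
   then show "(%n. of_real (a n) * pair ((transfer s ^^ n) (%x. step_function l x * phi x)) psi - of_real (a n) *
        (\<Sum>i\<in>{i \<in> J. cmod (xi' i) >= eps}. \<Sum>k<m' i. xi' i ^ n * of_nat n ^ k * C i k phi psi))
      \<in> o(%n. complex_of_real eps ^ n)"
    using expansion[OF h] by (simp add: twist_def[abs_def])
  qed
  have Z0: "xi' i = 0" if "i \<in> Z" for i using that by (auto simp: Z_def xi'_def enc split: if_splits)
  have G0: "xi' (prod_encode g) ~= 0" if "g \<in> G" for g using on_G(1)[OF that] G1[OF that] by simp
  have zero_Z2: "{i \<in> J. xi' i = 0} = Z" using Z0 G0 unfolding J_def by blast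
  have "(EX i:J. xi' i = 0) \<longleftrightarrow> Z ~= {}" using zero_Z2 by blast
  then have zero_Z: "(EX i:J. xi' i = 0) \<longleftrightarrow> 0 \<in> spectrum (B s)" "{i \<in> J. xi' i = 0} = Z"
   using zero_Z2 by (auto simp: Z_def)
  have nz_J: "(EX i:J. xi' i = z) \<longleftrightarrow> (EX g:G. xi g = z)" if "z ~= 0" for z
   using J_set[of "%y. y = z"] that by auto
  show "xi' ` J = (\<Union>l\<in>{s..}. spectrum (B l))"
  proof (rule Set.set_eqI)
   fix z
   have "z \<in> xi' ` J \<longleftrightarrow> (EX i:J. xi' i = z)" by auto
   also have "... \<longleftrightarrow> (EX l>=s. z \<in> spectrum (B l))"
    using zero_Z(1) nz_J order_total(1) spectrum_0[of _ s] by (cases "z = 0") auto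
   finally show "z \<in> xi' ` J \<longleftrightarrow> z \<in> (\<Union>l\<in>{s..}. spectrum (B l))" by auto
  qed
  show "ALL z. list_multiplicity J xi' m' z = total_multiplicity {s..} B z"
  proof
   fix z
   show "list_multiplicity J xi' m' z = total_multiplicity {s..} B z"
   proof (cases "z = 0")
    case False
    note set = J_set[of "%y. y = z"]
    have finz: "finite {g \<in> G. xi g = z}"
     by (rule finite_subset[OF _ fin[of "norm z"]]) (use False in auto)
    have "list_multiplicity J xi' m' z = (\<Sum>g | g \<in> G & xi g = z. of_nat (m' (prod_encode g)))"
     unfolding list_multiplicity_def using False set finz by (simp add: sum.reindex[OF inj])
    also have "... = of_nat (\<Sum>g | g \<in> G & xi g = z. m g)"
     unfolding of_nat_sum by (intro sum.cong refl) (simp add: on_G)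
    finally show ?thesis unfolding total_multiplicity_def order_total(2)[OF False] .
   next
    case True
    show ?thesis
    proof (cases "0 \<in> spectrum (B s)")
     case s0: True
     have "Z = range (%b. prod_encode (0, b))" using s0 by (simp add: Z_def)
     then have "list_multiplicity J xi' m' z = \<infinity>"
      unfolding list_multiplicity_def True zero_Z(2)
      using infinite_range by (intro infsum_superconst_infinite_ennreal[where b = 1]) (auto simp: m'_def enc)
     moreover have "total_multiplicity {s..} B z = \<infinity>"
      unfolding total_multiplicity_def True
     proof (rule infsum_superconst_infinite_ennreal[where b = 1])
      fix l assume "l \<in> {s..}"
      have "Polynomial.order 0 (char_poly (B l)) >= 1"
       using s0 spectrum_0[of l s] spectrum_order[of 0 l] by simp
      then show "(1 :: ennreal) <= of_nat (Polynomial.order 0 (char_poly (B l)))"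
       by (metis of_nat_1 of_nat_mono)
     qed (auto simp: infinite_Ici)
     ultimately show ?thesis by simp
    next
     case s0: False
     have "Polynomial.order 0 (char_poly (B l)) = 0" for l
      using s0 spectrum_0[of l s] spectrum_order[of 0 l] by simp
     then show ?thesis
      unfolding list_multiplicity_def total_multiplicity_def True zero_Z(2) using s0 by (simp add: Z_def)
    qed
   qed
  qed
 qed
qed

end

section \<open>Positive eigenvectors of irreducible matrices\<close>

lemma coordinatewise_convergent_subsequence:
 fixes X :: "nat => nat => real"
 assumes "!!n i. i < N ==> X n i \<in> {0..1}"
 obtains r x where "strict_mono (r :: nat => nat)" "!!i. i < N ==> (%n. X (r n) i) \<longlonglongrightarrow> x i"
proof -
 have "EX r x. strict_mono (r :: nat => nat) & (ALL i<K. (%n. X (r n) i) \<longlonglongrightarrow> x i)" if "K <= N" for K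
  using that
 proof (induction K)
  case 0
  show ?case by (rule exI[of _ id]) (auto simp: strict_mono_def)
 next
  case (Suc K)
  then obtain r x where r: "strict_mono (r :: nat => nat)" "!!i. i < K ==> (%n. X (r n) i) \<longlonglongrightarrow> x i" by auto
  have "ALL n. X (r n) K \<in> {0..1}" using assms[of K] Suc.prems by simp
  then have "EX l:{0..1}. EX r'. strict_mono (r' :: nat => nat) & ((%n. X (r n) K) \<circ> r') \<longlonglongrightarrow> l"
   using compact_Icc[of 0 "1::real"] unfolding compact_def by (elim allE[of _ "%n. X (r n) K"]) simp
  then obtain l r' where r': "strict_mono (r' :: nat => nat)" "((%n. X (r n) K) \<circ> r') \<longlonglongrightarrow> l" by blast
  show ?case
  proof (intro exI conjI allI impI)
   show "strict_mono (r \<circ> r')" by (rule strict_mono_o[OF r(1) r'(1)])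
   fix i assume "i < Suc K"
   then consider "i < K" | "i = K" by linarith
   then show "(%n. X ((r \<circ> r') n) i) \<longlonglongrightarrow> (x(K := l)) i"
   proof cases
    case 1
    then show ?thesis using LIMSEQ_subseq_LIMSEQ[OF r(2)[OF 1] r'(1)] by (simp add: comp_def)
   qed (use r'(2) in "simp add: comp_def")
  qed
 qed
 from this[of N] show thesis using that by auto
qed

text \<open>The Collatz-Wielandt argument: the largest \<open>t\<close> with \<open>t x \<le> A x\<close> for some \<open>x \<ge> 0\<close> is attained, and an inequality that is strict somewhere could be improved by applying a positive power of \<open>1 + A\<close>.\<close>
theorem positive_eigenvector:
 fixes A :: "nat => nat => real"
 assumes N: "N > 0" and nonneg: "!!i j. i < N ==> j < N ==> A i j >= 0"
  and irreducible: "!!i j. i < N ==> j < N ==> (i, j) \<in> {(i, j). i < N & j < N & A i j > 0}\<^sup>*"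
 obtains rho x where "rho >= 0" "!!i. i < N ==> x i > 0" "!!i. i < N ==> (\<Sum>j<N. A i j * x j) = rho * x i"
proof -
 define Aop where "Aop w i = (\<Sum>j<N. A i j * w j)" for w :: "nat => real" and i
 define S where "S w i = w i + Aop w i" for w i
 define P where "P t x \<longleftrightarrow> (ALL i<N. 0 <= x i & t * x i <= Aop x i) & (\<Sum>i<N. x i) = 1" for t x
 define T where "T = {t. EX x. P t x}"
 have S_Suc: "(S ^^ Suc k) w i = (S ^^ k) w i + Aop ((S ^^ k) w) i" for k w i
  by (simp add: S_def[of "(S ^^ k) w"])
 have Aop_nn: "Aop w i >= 0" if "!!j. j < N ==> w j >= 0" "i < N" for w i
  unfolding Aop_def using that nonneg by (intro sum_nonneg mult_nonneg_nonneg) auto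
 have S_nn: "(S ^^ k) w i >= 0" if "!!j. j < N ==> w j >= 0" "i < N" for w i k
  using that(2)
 proof (induction k arbitrary: i)
  case (Suc k)
  have "Aop ((S ^^ k) w) i >= 0" by (rule Aop_nn[OF Suc.IH Suc.prems])
  then show ?case unfolding S_Suc using Suc.IH[OF Suc.prems] by simp
 qed (use that(1) in simp)
 have S_pos: "EX k. ALL i<N. (S ^^ k) w i > 0" if nn: "!!j. j < N ==> w j >= 0" and i0: "i0 < N" "w i0 > 0" for w i0
 proof -
  have mono: "(S ^^ k') w i > 0" if "(S ^^ k) w i > 0" "k <= k'" "i < N" for k k' i
   using that(2)
  proof (induction k' rule: dec_induct)
   case (step n)
   have "Aop ((S ^^ n) w) i >= 0" by (rule Aop_nn) (use S_nn nn that in auto)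
   then show ?case unfolding S_Suc using step.IH by simp
  qed (rule that(1))
  have "EX k. (S ^^ k) w i > 0" if "i < N" for i
   using irreducible[OF that i0(1)]
  proof (induction rule: converse_rtrancl_induct)
   case base
   show ?case using i0 by (intro exI[of _ 0]) simp
  next
   case (step i j)
   then obtain k where k: "(S ^^ k) w j > 0" by blast
   have ij: "i < N" "j < N" "A i j > 0" using step by auto
   have "0 < A i j * (S ^^ k) w j" using ij k by simp
   also have "... <= Aop ((S ^^ k) w) i"
    unfolding Aop_def by (rule member_le_sum) (use ij nonneg S_nn[OF nn] in auto)
   also have "... <= (S ^^ Suc k) w i" unfolding S_Suc using S_nn[OF nn ij(1), where k = k] by simp
   finally show ?case by blast
  qed
  then obtain k where k: "!!i. i < N ==> (S ^^ k i) w i > 0" by metis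
  have "(S ^^ Max (k ` {..<N})) w i > 0" if "i < N" for i
   by (rule mono[OF k[OF that] _ that]) (use that in auto)
  then show ?thesis by blast
 qed
 have Aop_diff: "Aop (%i. Aop v i - t * v i) i = Aop (Aop v) i - t * Aop v i" for v t i
  unfolding Aop_def[of "%i. Aop v i - t * v i"] Aop_def[of "Aop v"] Aop_def[of v i]
  by (simp add: sum_subtractf right_diff_distrib sum_distrib_left mult.left_commute)
 have Aop_S: "Aop (S v) i = Aop v i + Aop (Aop v) i" for v i
  unfolding S_def[of v, abs_def] Aop_def[of "%i. v i + Aop v i"] Aop_def[of "Aop v"] Aop_def[of v i]
  by (simp add: sum.distrib distrib_left)
 have Aop_Suc: "Aop ((S ^^ Suc k) w) i = Aop ((S ^^ k) w) i + Aop (Aop ((S ^^ k) w)) i" for k w i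
  using Aop_S[of "(S ^^ k) w" i] by simp
 have commute: "Aop ((S ^^ k) w) i - t * (S ^^ k) w i = (S ^^ k) (%i. Aop w i - t * w i) i" for k w t i
 proof (induction k arbitrary: i)
  case (Suc k)
  have "(S ^^ Suc k) (%i. Aop w i - t * w i) i = S ((S ^^ k) (%i. Aop w i - t * w i)) i" by simp
  also have "(S ^^ k) (%i. Aop w i - t * w i) = (%i. Aop ((S ^^ k) w) i - t * (S ^^ k) w i)"
   using Suc.IH by (intro ext) simp
  also have "S (%i. Aop ((S ^^ k) w) i - t * (S ^^ k) w i) i = Aop ((S ^^ Suc k) w) i - t * (S ^^ Suc k) w i"
   by (simp only: S_def[of "%i. Aop ((S ^^ k) w) i - t * (S ^^ k) w i"] Aop_diff S_Suc Aop_Suc) (simp add: algebra_simps)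
  finally show ?case by simp
 qed simp
 have P0: "P 0 (%i. 1 / N)" unfolding P_def using N Aop_nn[of "%i. 1 / N"] by simp
 have le1: "x i <= 1" if "P t x" "i < N" for t x i
 proof -
  have "x i <= (\<Sum>i<N. x i)" by (rule member_le_sum) (use that in "auto simp: P_def")
  then show ?thesis using that by (simp add: P_def)
 qed
 have bound: "t <= (\<Sum>i<N. \<Sum>j<N. A i j)" if "P t x" for t x
 proof -
  have "t = (\<Sum>i<N. t * x i)" using that by (simp add: P_def sum_distrib_left[symmetric])
  also have "... <= (\<Sum>i<N. Aop x i)" using that by (intro sum_mono) (simp add: P_def)
  also have "... <= (\<Sum>i<N. \<Sum>j<N. A i j)"
   unfolding Aop_def using le1[OF that] nonneg by (intro sum_mono) (simp add: mult_left_le)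
  finally show ?thesis .
 qed
 have T: "T ~= {}" "bdd_above T" using P0 bound by (auto simp: T_def bdd_above_def)
 define rho where "rho = Sup T"
 have rho0: "rho >= 0" unfolding rho_def by (rule cSup_upper[OF _ T(2)]) (use P0 in "auto simp: T_def")
 have "EX t:T. rho - 1 / Suc n < t" for n
  unfolding rho_def by (subst less_cSup_iff[OF T, symmetric]) simp
 then have "EX t x. P t x & rho - 1 / Suc n < t" for n by (auto simp: T_def)
 then obtain t X where X: "!!n. P (t n) (X n)" "!!n. rho - 1 / Suc n < t n" by metis
 have t: "t \<longlonglongrightarrow> rho"
 proof (rule tendsto_sandwich)
  show "eventually (%n. rho - inverse (real (Suc n)) <= t n) sequentially"
   using X(2) by (auto simp: inverse_eq_divide intro!: always_eventually less_imp_le)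
  have "t n <= rho" for n unfolding rho_def by (rule cSup_upper[OF _ T(2)]) (use X(1) in "auto simp: T_def")
  then show "eventually (%n. t n <= rho) sequentially" by auto
  have "(%n. rho - inverse (real (Suc n))) \<longlonglongrightarrow> rho - 0" by (intro tendsto_intros LIMSEQ_inverse_real_of_nat)
  then show "(%n. rho - inverse (real (Suc n))) \<longlonglongrightarrow> rho" by simp
 qed auto
 have "X n i \<in> {0..1}" if "i < N" for n i using X(1)[of n] le1[OF X(1) that] that by (auto simp: P_def)
 from coordinatewise_convergent_subsequence[of N X, OF this]
 obtain r x where r: "strict_mono (r :: nat => nat)" and x: "!!i. i < N ==> (%n. X (r n) i) \<longlonglongrightarrow> x i"
  by blast
 have tr: "(%n. t (r n)) \<longlonglongrightarrow> rho" using LIMSEQ_subseq_LIMSEQ[OF t r] by (simp add: comp_def)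
 have Px: "P rho x"
  unfolding P_def
 proof (intro conjI allI impI)
  fix i assume i: "i < N"
  show "0 <= x i" by (rule LIMSEQ_le_const[OF x[OF i]]) (use X(1) i in "auto simp: P_def")
  have "(%n. Aop (X (r n)) i) \<longlonglongrightarrow> Aop x i" unfolding Aop_def by (intro tendsto_intros x) auto
  then show "rho * x i <= Aop x i"
   by (rule LIMSEQ_le[OF tendsto_mult[OF tr x[OF i]]]) (use X(1) i in "auto simp: P_def")
 next
  have "(%n. \<Sum>i<N. X (r n) i) \<longlonglongrightarrow> (\<Sum>i<N. x i)" by (intro tendsto_intros x) auto
  then show "(\<Sum>i<N. x i) = 1" using X(1) by (simp add: P_def LIMSEQ_const_iff)
 qed
 have x_nn: "x i >= 0" if "i < N" for i using Px that by (simp add: P_def)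
 obtain i1 where i1: "i1 < N" "x i1 > 0"
 proof -
  have "\<not> (ALL i<N. x i <= 0)"
  proof
   assume "ALL i<N. x i <= 0"
   then have "(\<Sum>i<N. x i) <= 0" by (intro sum_nonpos) auto
   then show False using Px by (simp add: P_def)
  qed
  then show thesis using that by (auto simp: not_le)
 qed
 have eigen: "Aop x i = rho * x i" if "i < N" for i
 proof (rule ccontr)
  assume ne: "Aop x i ~= rho * x i"
  define z where "z i = Aop x i - rho * x i" for i
  have z: "z j >= 0" if "j < N" for j using Px that by (simp add: P_def z_def)
  have "z i > 0" using ne z[OF that] by (simp add: z_def)
  from S_pos[of z i, OF z that this] obtain k where k: "!!i. i < N ==> (S ^^ k) z i > 0" by blast
  define y where "y = (S ^^ k) x"
  have y_nn: "y i >= 0" if "i < N" for i unfolding y_def by (rule S_nn[OF x_nn that])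
  define s where "s = (\<Sum>i<N. y i)"
  have y_bigger: "y j >= x j" if "j < N" for j
  proof -
   have "(S ^^ n) x j >= x j" for n
   proof (induction n)
    case (Suc n)
    have "Aop ((S ^^ n) x) j >= 0" by (rule Aop_nn) (use S_nn x_nn that in auto)
    then show ?case unfolding S_Suc using Suc by simp
   qed simp
   then show ?thesis unfolding y_def .
  qed
  have s: "s > 0"
   unfolding s_def by (rule sum_pos2[of _ i1]) (use i1 y_bigger[of i1] y_nn in auto)
  have gap: "Aop y i - rho * y i > 0" if "i < N" for i
   using k[OF that] unfolding y_def commute z_def[abs_def] .
  define delta where "delta = Min ((%i. Aop y i - rho * y i) ` {..<N}) / s"
  have mpos: "Min ((%i. Aop y i - rho * y i) ` {..<N}) > 0" using gap N by (subst Min_gr_iff) auto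
  then have delta: "delta > 0" using s by (simp add: delta_def)
  have "P (rho + delta) (%i. y i / s)"
   unfolding P_def
  proof (intro conjI allI impI)
   fix i assume i: "i < N"
   show "0 <= y i / s" using y_nn[OF i] s by simp
   have "y i <= s" unfolding s_def by (rule member_le_sum) (use i y_nn in auto)
   then have "delta * y i <= delta * s" using delta by simp
   also have "delta * s = Min ((%i. Aop y i - rho * y i) ` {..<N})" using s by (simp add: delta_def)
   also have "... <= Aop y i - rho * y i" by (rule Min_le) (use i in auto)
   finally have "(rho + delta) * y i <= Aop y i" by (simp add: algebra_simps)
   then have "(rho + delta) * y i / s <= Aop y i / s" using s by (simp add: divide_right_mono)
   also have "Aop y i / s = Aop (%i. y i / s) i" by (simp add: Aop_def sum_divide_distrib)
   finally show "(rho + delta) * (y i / s) <= Aop (%i. y i / s) i" by simp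
  next
   show "(\<Sum>i<N. y i / s) = 1" using s by (simp add: sum_divide_distrib[symmetric] s_def[symmetric])
  qed
  then have "rho + delta <= rho" unfolding rho_def by (intro cSup_upper[OF _ T(2)]) (auto simp: T_def)
  then show False using delta by simp
 qed
 have "x i > 0" if "i < N" for i
 proof -
  obtain k where k: "!!i. i < N ==> (S ^^ k) x i > 0" using S_pos[of x i1, OF x_nn i1] by blast
  have "(S ^^ n) x i = (1 + rho) ^ n * x i" if "i < N" for n i
   using that
  proof (induction n arbitrary: i)
   case (Suc n)
   have "Aop ((S ^^ n) x) i = (1 + rho) ^ n * Aop x i"
    unfolding Aop_def by (simp add: Suc.IH sum_distrib_left mult.left_commute)
   then show ?case unfolding S_Suc using Suc eigen by (simp add: algebra_simps)
  qed simp
  then show ?thesis using k[OF that] rho0 that by (simp add: zero_less_mult_iff)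
 qed
 with rho0 eigen show thesis using that unfolding Aop_def by blast
qed

section \<open>Itineraries\<close>

lemma itinerary_0 [simp]: "itinerary f X 0 x = []"
 by (simp add: itinerary_def)

lemma itinerary_add: "itinerary f X (n + m) x = itinerary f X n x @ itinerary f X m ((f ^^ n) x)"
 unfolding itinerary_def
 by (rule nth_equalityI) (auto simp: nth_append funpow_add[of "_ - n" n, symmetric, simplified o_def, THEN fun_cong])

lemma itinerary_Suc: "itinerary f X (Suc n) x = X x # itinerary f X n (f x)"
 using itinerary_add[of f X 1 n x] by (simp add: itinerary_def)

lemma itinerary_snoc: "itinerary f X (Suc n) x = itinerary f X n x @ [X ((f ^^ n) x)]"
 by (simp add: itinerary_def)

lemma length_itinerary [simp]: "length (itinerary f X n x) = n"
 by (simp add: itinerary_def)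

lemma nth_itinerary: "k < n ==> itinerary f X n x ! k = X ((f ^^ k) x)"
 by (simp add: itinerary_def)

lemma take_itinerary: "k <= n ==> take k (itinerary f X n x) = itinerary f X k x"
 by (simp add: itinerary_def take_map)

lemma simple_function_itinerary:
 assumes X: "simple_function M X" and f: "f \<in> measurable M M"
 shows "simple_function M (itinerary f X n)"
proof (induction n)
 case 0
 show ?case by (simp add: itinerary_def)
next
 case (Suc n)
 have "simple_function M (%x. itinerary f X n (f x))" by (rule simple_function_comp[OF f Suc])
 from simple_function_compose2[OF X this, of "(#)"] show ?case by (simp add: itinerary_Suc)
qed

context markov_map
begin

text \<open>Partition points get letters of their own, since \<open>f\<close> is arbitrary there.\<close>
definition lab :: "real => nat" where
 "lab x = (if x \<in> U then (THE j. j < N & x \<in> I j) else N + (THE j. j <= N & x = p j))"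

lemma lab_I: "j < N ==> x \<in> I j ==> lab x = j"
 unfolding lab_def using I_U I_disjoint by (auto intro!: the_equality)

lemma lab_p: "j <= N ==> lab (p j) = N + j"
 unfolding lab_def using p_notin_U p_inj by (auto intro!: the_equality)

lemma lab_cases:
 assumes "x \<in> {0..1}"
 obtains "lab x < N" "x \<in> I (lab x)" "x \<in> U" | j where "j <= N" "lab x = N + j" "x = p j" "x \<notin> U"
 by (rule unit_cases[OF assms]) (use that lab_I lab_p I_U p_notin_U in auto)

lemma lab_less_iff: "x \<in> {0..1} ==> lab x < N \<longleftrightarrow> x \<in> U"
 by (erule lab_cases) auto

lemma lab_bound: "x \<in> {0..1} ==> lab x < 2 * N + 1"
 by (erule lab_cases) auto

lemma lab_in_I: "x \<in> {0..1} ==> lab x < N ==> x \<in> I (lab x)"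
 by (erule lab_cases) auto

lemma lab_eq_point: "x \<in> {0..1} ==> y \<in> {0..1} ==> lab x = lab y ==> \<not> lab x < N ==> x = y"
 by (elim lab_cases) auto

lemma f_unit: "x \<in> {0..1} ==> f x \<in> {0..1}"
 using unit_interval by blast

lemma f_pow_unit: "x \<in> {0..1} ==> (f ^^ n) x \<in> {0..1}"
 by (induction n) (auto simp del: atLeastAtMost_iff intro: f_unit)

abbreviation itin where "itin n x \<equiv> itinerary f lab n x"

lemma f_diff: "j < N ==> x \<in> I j ==> y \<in> I j ==> f x - f y = slope j * (x - y)"
 by (simp add: f_affine algebra_simps)

lemma itin_close:
 "x \<in> {0..1} ==> y \<in> {0..1} ==> itin n x = itin n y ==> \<bar>x - y\<bar> <= (1 / rate) ^ n"
proof (induction n arbitrary: x y)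
 case (Suc n)
 have eq: "lab x = lab y" "itin n (f x) = itin n (f y)" using Suc.prems(3) by (auto simp: itinerary_Suc)
 show ?case
 proof (cases "lab x < N")
  case True
  have xy: "x \<in> I (lab x)" "y \<in> I (lab x)" using True eq(1) lab_in_I Suc.prems by metis+
  have "rate * \<bar>x - y\<bar> <= slope (lab x) * \<bar>x - y\<bar>" using slope_ge_rate[OF True] by (intro mult_right_mono) auto
  also have "... = \<bar>f x - f y\<bar>" using f_diff[OF True xy] slope_gt_1[OF True] by (simp add: abs_mult)
  also have "... <= (1 / rate) ^ n" by (rule Suc.IH[OF f_unit f_unit eq(2)]) (use Suc.prems in auto)
  finally have "\<bar>x - y\<bar> <= (1 / rate) ^ n / rate" using rate_gt_1 by (simp add: field_simps)
  then show ?thesis by simp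
 next
  case False
  then have "x = y" using lab_eq_point Suc.prems eq by blast
  then show ?thesis using rate_gt_1 by simp
 qed
qed auto

text \<open>The finitely many points at which itineraries of length \<open>n\<close> can change.\<close>
definition Z :: "nat => real set" where
 "Z n = {x \<in> {0..1}. EX k<n. (f ^^ k) x \<notin> U}"

lemma Z_Suc: "Z (Suc n) = p ` {..N} Un {x \<in> U. f x \<in> Z n}"
proof -
 have "x \<in> Z (Suc n) \<longleftrightarrow> x \<in> p ` {..N} Un {x \<in> U. f x \<in> Z n}" if x: "x \<in> {0..1}" for x
 proof (cases "x \<in> U")
  case True
  have "(EX k<Suc n. (f ^^ k) x \<notin> U) \<longleftrightarrow> (EX k<n. (f ^^ Suc k) x \<notin> U)"
   using True by (auto simp: less_Suc_eq_0_disj)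
  then show ?thesis using x True f_unit[OF x] p_notin_U by (auto simp: Z_def funpow_swap1)
 next
  case False
  then have "x \<in> p ` {..N}" using unit_minus_U x by blast
  then show ?thesis using False x by (auto simp: Z_def)
 qed
 moreover have "Z (Suc n) \<subseteq> {0..1}" "p ` {..N} Un {x \<in> U. f x \<in> Z n} \<subseteq> {0..1}"
  using unit_minus_U U_unit by (auto simp: Z_def)
 ultimately show ?thesis by blast
qed

lemma Z_finite: "finite (Z n)"
proof (induction n)
 case 0
 show ?case by (simp add: Z_def)
next
 case (Suc n)
 have "{x \<in> U. f x \<in> Z n} \<subseteq> (\<Union>i<N. inv_branch i ` Z n)"
 proof
  fix x assume "x \<in> {x \<in> U. f x \<in> Z n}"
  then have x: "x \<in> U" "f x \<in> Z n" by auto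
  obtain i where i: "i < N" "x \<in> I i" using x(1) by (rule U_E)
  have "x = inv_branch i (f x)" using inv_branch_f[OF i] by simp
  then show "x \<in> (\<Union>i<N. inv_branch i ` Z n)" using i x by blast
 qed
 then have "finite {x \<in> U. f x \<in> Z n}" by (rule finite_subset) (use Suc in auto)
 then show ?case unfolding Z_Suc by simp
qed

lemma itin_eq_between:
 "x \<in> {0..1} ==> y \<in> {0..1} ==> x <= y ==> {x..y} Int Z n = {} ==> itin n x = itin n y"
proof (induction n arbitrary: x y)
 case (Suc n)
 have P: "{x..y} Int p ` {..N} = {}" and Zn: "{x..y} Int {x \<in> U. f x \<in> Z n} = {}"
  using Suc.prems(4) unfolding Z_Suc by auto
 have "x \<notin> p ` {..N}" using P Suc.prems(3) by auto
 then have xU: "x \<in> U" using unit_minus_U Suc.prems(1) by blast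
 then obtain i where i: "i < N" "x \<in> I i" by (rule U_E)
 have "p (Suc i) \<notin> {x..y}" using P i(1) by auto
 then have yi: "y \<in> I i" using i(2) Suc.prems(3) by (auto simp: branch_interval_def)
 have sub: "{x..y} \<subseteq> I i" using i(2) yi by (auto simp: branch_interval_def)
 have le: "f x <= f y" using f_diff[OF i(1) yi i(2)] slope_gt_1[OF i(1)] Suc.prems(3)
  by (metis diff_ge_0_iff_ge less_le_trans less_numeral_extra(1) mult_nonneg_nonneg less_imp_le)
 have "{f x..f y} Int Z n = {}"
 proof (rule ccontr)
  assume "{f x..f y} Int Z n ~= {}"
  then obtain z where z: "z \<in> Z n" "f x <= z" "z <= f y" by auto
  let ?w = "inv_branch i z"
  have "inv_branch i (f x) <= ?w" "?w <= inv_branch i (f y)"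
   using z slope_gt_1[OF i(1)] by (auto simp: inv_branch_def divide_right_mono)
  then have w: "?w \<in> {x..y}" using inv_branch_f[OF i(1)] i(2) yi by simp
  then have wi: "?w \<in> I i" using sub by auto
  then have "f ?w = z" by (rule f_inv_branch[OF i(1)])
  then show False using Zn w z(1) I_U[OF i(1) wi] by auto
 qed
 then have "itin n (f x) = itin n (f y)" using Suc.IH[OF f_unit f_unit le] Suc.prems by blast
 then show ?case using lab_I[OF i] lab_I[OF i(1) yi] by (simp add: itinerary_Suc)
qed simp

section \<open>Measures on the unit interval\<close>

text \<open>A Borel version of \<open>f\<close>; for a measure without mass at the partition points, orbits agree almost everywhere.\<close>
definition fb :: "real => real" where
 "fb x = (\<Sum>j<N. if x \<in> I j then lower j + slope j * (x - p j) else 0)"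

lemma fb_eq: "x \<in> U ==> fb x = f x"
proof -
 assume "x \<in> U"
 then obtain j where j: "j < N" "x \<in> I j" by (rule U_E)
 have "fb x = (\<Sum>i<N. if i = j then f x else 0)"
  unfolding fb_def by (intro sum.cong refl) (use I_disjoint j f_affine in auto)
 then show ?thesis using j by simp
qed

lemma I_borel [measurable]: "I j \<in> sets borel"
 by (rule borel_open[OF I_open])

lemma U_borel [measurable]: "U \<in> sets borel"
 by (rule borel_open[OF U_open])

lemma fb_borel [measurable]: "fb \<in> borel_measurable borel"
 unfolding fb_def by measurable

end

locale markov_measure = markov_map + prob_space \<mu> for \<mu> :: "real measure" +
 assumes sets_\<mu> [measurable_cong]: "sets \<mu> = sets unit_borel"
begin

lemma space_\<mu>: "space \<mu> = {0..1}"
 using sets_eq_imp_space_eq[OF sets_\<mu>] by (simp add: space_restrict_space)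

lemma borel_\<mu>: "E \<in> sets borel ==> E Int {0..1} \<in> sets \<mu>"
 unfolding sets_\<mu> sets_restrict_space by auto

lemma borel_\<mu>': "E \<in> sets borel ==> E \<subseteq> {0..1} ==> E \<in> sets \<mu>"
 using borel_\<mu>[of E] by (simp add: Int_absorb2)

lemma borel_measurable_\<mu>: "h \<in> measurable borel M ==> h \<in> measurable \<mu> M"
 unfolding measurable_cong_sets[OF sets_\<mu> refl] by (rule measurable_restrict_space1)

lemma \<mu>_borel: "E \<in> sets \<mu> ==> E \<in> sets borel"
 unfolding sets_\<mu> sets_restrict_space by auto

lemma lab_vimage: "lab -` {k} Int space \<mu> \<in> sets \<mu>"
proof -
 consider "k < N" | j where "k = N + j" "j <= N" | j where "k = N + j" "j > N"
  by (metis add.commute le_add_diff_inverse2 not_le)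
 then show ?thesis
 proof cases
  case 1
  have "lab -` {k} Int space \<mu> = I k"
   unfolding space_\<mu> using lab_in_I[of _] lab_I[OF 1] I_unit[OF 1] 1 by blast
  then show ?thesis using borel_\<mu>'[OF I_borel I_unit[OF 1]] by simp
 next
  case 2
  have "lab -` {k} Int space \<mu> = {p j}"
  proof (intro equalityI subsetI)
   fix x assume "x \<in> lab -` {k} Int space \<mu>"
   then have x: "x \<in> {0..1}" "lab x = N + j" using 2 by (auto simp: space_\<mu>)
   then show "x \<in> {p j}" by (elim lab_cases) auto
  qed (use p_unit lab_p 2 in "auto simp: space_\<mu>")
  then show ?thesis using borel_\<mu>'[of "{p j}"] p_unit[OF 2(2)] by simp
 next
  case 3
  have "lab -` {k} Int space \<mu> = {}"
   using 3 lab_bound by (fastforce simp: space_\<mu> elim: lab_cases)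
  then show ?thesis by (simp only: sets.empty_sets)
 qed
qed

lemma simple_lab: "simple_function \<mu> lab"
proof (rule simple_function_cong[THEN iffD1])
 show "simple_function \<mu> lab"
  unfolding simple_function_def
 proof (intro conjI ballI)
  show "finite (lab ` space \<mu>)"
   by (rule finite_subset[of _ "{..<2 * N + 1}"]) (use lab_bound in "auto simp: space_\<mu> simp del: atLeastAtMost_iff")
 qed (rule lab_vimage)
qed simp

end

locale invariant_markov_measure = markov_measure +
 assumes f_measurable [measurable]: "f \<in> measurable \<mu> \<mu>" and f_invariant: "distr \<mu> \<mu> f = \<mu>"
begin

lemma simple_itin: "simple_function \<mu> (itinerary f lab n)"
 by (rule simple_function_itinerary[OF simple_lab f_measurable])

lemma f_pow_measurable [measurable]: "(f ^^ n) \<in> measurable \<mu> \<mu>"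
 by (induction n) (auto intro: measurable_comp f_measurable)

lemma f_pow_invariant: "distr \<mu> \<mu> (f ^^ n) = \<mu>"
proof (induction n)
 case 0
 show ?case by (simp add: distr_id2 id_def)
next
 case (Suc n)
 have "distr \<mu> \<mu> (f ^^ Suc n) = distr (distr \<mu> \<mu> (f ^^ n)) \<mu> f" by (simp add: distr_distr)
 then show ?case using Suc f_invariant by (simp add: o_def)
qed

lemma measure_vimage: "E \<in> sets \<mu> ==> prob ((f ^^ n) -` E Int space \<mu>) = prob E"
 using measure_distr[OF f_pow_measurable, of E n] f_pow_invariant[of n] by simp

lemma itin_sets: "{x \<in> space \<mu>. itin n x \<in> S} \<in> sets \<mu>"
proof -
 have "itinerary f lab n \<in> measurable \<mu> (count_space UNIV)" by (rule measurable_simple_function[OF simple_itin])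
 from measurable_sets[OF this, of S] show ?thesis by (simp add: vimage_def Int_def conj_commute)
qed

text \<open>By induction on the generation of Borel sets. For \<open>{..t}\<close> the error is contained in an interval of length \<open>rate^-n\<close> to the right of \<open>t\<close>.\<close>
theorem itinerary_approximation:
 assumes "E \<in> sets \<mu>" "delta > 0"
 shows "EX n S. prob {x \<in> space \<mu>. (x \<in> E) ~= (itin n x \<in> S)} < delta"
proof -
 define D where "D E n S = {x \<in> space \<mu>. (x \<in> E) ~= (itin n x \<in> S)}" for E n S
 have D_sets: "D E n S \<in> sets \<mu>" if "E \<in> sets borel" for E n S
 proof -
  have "D E n S = sym_diff (E Int {0..1}) {x \<in> space \<mu>. itin n x \<in> S}"
   by (auto simp: D_def space_\<mu>)
  then show ?thesis using borel_\<mu>[OF that] itin_sets[of n S] by simp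
 qed
 have "E \<in> sigma_sets UNIV (range atMost)"
  using \<mu>_borel[OF assms(1)] by (simp add: borel_eq_atMost)
 then have "ALL delta>0. EX n S. prob (D E n S) < delta"
 proof (induction rule: sigma_sets.induct)
  case (Basic E)
  then obtain t where t: "E = {..t}" by auto
  define A where "A n = {x \<in> {0..1}. t < x & x <= t + (1 / rate) ^ n}" for n
  have A: "A n \<in> sets \<mu>" for n
  proof -
   have "A n = {t<..t + (1 / rate) ^ n} Int {0..1}" by (auto simp: A_def)
   then show ?thesis using borel_\<mu>[of "{t<..t + (1 / rate) ^ n}"] by simp
  qed
  have "(%n. prob (A n)) \<longlonglongrightarrow> prob (\<Inter>n. A n)"
  proof (rule finite_Lim_measure_decseq)
   show "range A \<subseteq> sets \<mu>" using A by blast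
   show "decseq A"
   proof (rule decseq_SucI)
    fix n
    have "(1 / rate) ^ Suc n <= (1 / rate) ^ n" using rate_gt_1 by (intro power_decreasing) auto
    then show "A (Suc n) \<subseteq> A n" unfolding A_def by auto
   qed
  qed
  moreover have "(\<Inter>n. A n) = {}"
  proof (rule ccontr)
   assume "(\<Inter>n. A n) ~= {}"
   then obtain x where x: "!!n. x \<in> A n" by blast
   have "(%n. (1 / rate) ^ n) \<longlonglongrightarrow> 0" using rate_gt_1 by (intro LIMSEQ_realpow_zero) auto
   then have "x - t <= 0" by (rule LIMSEQ_le_const) (use x in "auto simp: A_def algebra_simps")
   then show False using x[of 0] by (simp add: A_def)
  qed
  ultimately have lim: "(%n. prob (A n)) \<longlonglongrightarrow> 0" by simp
  show ?case
  proof (intro allI impI)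
   fix delta :: real assume "delta > 0"
   then obtain n where n: "prob (A n) < delta"
    using order_tendstoD(2)[OF lim] by (auto simp: eventually_sequentially)
   have "D E n (itin n ` ({0..1} Int {..t})) \<subseteq> A n"
   proof
    fix x assume "x \<in> D E n (itin n ` ({0..1} Int {..t}))"
    then have x: "x \<in> {0..1}" and ne: "(x <= t) ~= (itin n x \<in> itin n ` ({0..1} Int {..t}))"
     unfolding D_def t space_\<mu> by auto
    have "\<not> x <= t" using ne x by blast
    with ne obtain y where y: "y \<in> {0..1}" "y <= t" "itin n x = itin n y" by blast
    from itin_close[OF x y(1,3)] show "x \<in> A n" using x y \<open>\<not> x <= t\<close> by (simp add: A_def abs_le_iff)
   qed
   then have "prob (D E n (itin n ` ({0..1} Int {..t}))) <= prob (A n)"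
    by (rule finite_measure_mono) (rule A)
   then show "EX n S. prob (D E n S) < delta" using n by (meson le_less_trans)
  qed
 next
  case Empty
  have "D {} 0 {} = {}" by (simp add: D_def)
  then show ?case by (metis measure_empty)
 next
  case (Compl E)
  have "D (UNIV - E) n (- S) = D E n S" for n S by (auto simp: D_def)
  then show ?case using Compl.IH by metis
 next
  case (Union E)
  have E: "E i \<in> sets borel" for i using Union.hyps by (simp add: borel_eq_atMost)
  show ?case
  proof (intro allI impI)
   fix delta :: real assume delta: "delta > 0"
   define R where "R K = {0..1} Int ((\<Union>i. E i) - (\<Union>i<K. E i))" for K
   have R: "R K \<in> sets \<mu>" for K
    unfolding R_def Int_commute[of "{0..1}"] by (rule borel_\<mu>) (use E in auto)
   have "(%K. prob (R K)) \<longlonglongrightarrow> prob (\<Inter>K. R K)"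
    by (rule finite_Lim_measure_decseq) (use R in "auto simp: R_def decseq_def")
   moreover have "(\<Inter>K. R K) = {}" by (auto simp: R_def)
   ultimately have "(%K. prob (R K)) \<longlonglongrightarrow> 0" by simp
   then obtain K where K: "prob (R K) < delta / 2"
    using delta order_tendstoD(2)[of _ 0 _ "delta / 2"] by (fastforce simp: eventually_sequentially)
   have "delta / (2 * Suc K) > 0" using delta by simp
   then have "EX n S. prob (D (E i) n S) < delta / (2 * Suc K)" for i using Union.IH by blast
   then obtain n S where nS: "!!i. prob (D (E i) (n i) (S i)) < delta / (2 * Suc K)" by metis
   define m where "m = Max (insert 0 (n ` {..<K}))"
   define T where "T = {w. EX i<K. take (n i) w \<in> S i}"
   have nm: "n i <= m" if "i < K" for i unfolding m_def using that by (intro Max_ge) auto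
   have T: "itin m x \<in> T \<longleftrightarrow> (EX i<K. itin (n i) x \<in> S i)" for x
    unfolding T_def using take_itinerary[OF nm] by auto
   have "D (\<Union>i. E i) m T \<subseteq> R K Un (\<Union>i<K. D (E i) (n i) (S i))"
    unfolding D_def R_def T space_\<mu> by blast
   then have "prob (D (\<Union>i. E i) m T) <= prob (R K Un (\<Union>i<K. D (E i) (n i) (S i)))"
    by (rule finite_measure_mono) (use R D_sets E in auto)
   also have "... <= prob (R K) + prob (\<Union>i<K. D (E i) (n i) (S i))"
    by (rule measure_Un_le) (use R D_sets E in auto)
   also have "prob (\<Union>i<K. D (E i) (n i) (S i)) <= (\<Sum>i<K. prob (D (E i) (n i) (S i)))"
    by (rule measure_UNION_le) (use D_sets E in auto)
   also have "... <= (\<Sum>i<K. delta / (2 * Suc K))" by (intro sum_mono less_imp_le nS)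
   also have "... <= delta / 2" using delta by (simp add: field_simps)
   finally show "EX n S. prob (D (\<Union>i. E i) n S) < delta" using K by (intro exI[of _ m] exI[of _ T]) simp
  qed
 qed
 then show ?thesis using assms(2) unfolding D_def by blast
qed

end

context invariant_markov_measure
begin

section \<open>Measures with a piecewise constant Jacobian\<close>

text \<open>The measure has density \<open>l\<close> with respect to one for which each inverse branch has Jacobian \<open>slope^-s / kappa\<close>: Lebesgue measure for \<open>s = 1\<close> and \<open>kappa = 1\<close>.\<close>
definition local_jacobian :: "nat => real => (nat => real) => bool" where
 "local_jacobian s kappa l \<longleftrightarrow> kappa > 0 & (ALL j<N. l j > 0 & prob (I j) > 0) & (ALL j<=N. prob {p j} = 0) &
  (ALL i<N. ALL j<N. ALL E:sets borel. adj i j --> E \<subseteq> I j -->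
    prob {x \<in> I i. f x \<in> E} = l i * inverse (slope i) ^ s / (kappa * l j) * prob E)"

lemma local_jacobianD:
 assumes "local_jacobian s kappa l"
 shows "kappa > 0" "j < N ==> l j > 0" "j < N ==> prob (I j) > 0" "j <= N ==> prob {p j} = 0"
  and "i < N ==> j < N ==> adj i j ==> E \<in> sets borel ==> E \<subseteq> I j ==>
   prob {x \<in> I i. f x \<in> E} = l i * inverse (slope i) ^ s / (kappa * l j) * prob E"
 using assms unfolding local_jacobian_def by auto

definition cyl :: "nat => real => real set" where
 "cyl n x = {y \<in> {0..1}. itin n y = itin n x}"

lemma cyl_sets: "cyl n x \<in> sets \<mu>"
 using itin_sets[of n "{itin n x}"] by (simp add: cyl_def space_\<mu>)

lemma cyl_Suc:
 assumes "x \<in> I i" "i < N"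
 shows "cyl (Suc n) x = {y \<in> I i. f y \<in> cyl n (f x)}"
proof -
 have "y \<in> cyl (Suc n) x \<longleftrightarrow> y \<in> I i & f y \<in> cyl n (f x)" if "y \<in> {0..1}" for y
  using that lab_in_I[OF that] lab_I[OF assms(2)] assms f_unit[OF that] by (auto simp: cyl_def itinerary_Suc)
 then show ?thesis using I_unit[OF assms(2)] by (auto simp: cyl_def)
qed

lemma cyl_1:
 assumes "x \<in> I i" "i < N" shows "cyl (Suc 0) x = I i"
 unfolding cyl_Suc[OF assms] using I_unit[OF assms(2)] f_unit by (auto simp: cyl_def)

lemma cyl_subset_I: "x \<in> I i ==> i < N ==> cyl (Suc n) x \<subseteq> I i"
 using cyl_Suc by blast

lemma Z_Suc_notin: "x \<in> {0..1} ==> x \<notin> Z (Suc n) ==> x \<in> U & f x \<notin> Z n"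
 unfolding Z_Suc using unit_minus_U by blast

lemma cyl_positive:
 assumes J: "local_jacobian s kappa l"
 shows "x \<in> {0..1} ==> x \<notin> Z (Suc n) ==> prob (cyl (Suc n) x) > 0"
proof (induction n arbitrary: x)
 case 0
 then obtain i where "i < N" "x \<in> I i" using Z_Suc_notin U_E by blast
 then show ?case using cyl_1 local_jacobianD(3)[OF J] by simp
next
 case (Suc n)
 have x: "x \<in> U" "f x \<notin> Z (Suc n)" using Z_Suc_notin Suc.prems by auto
 obtain i where i: "i < N" "x \<in> I i" using U_E[OF x(1)] .
 have fx: "f x \<in> {0..1}" by (rule f_unit[OF Suc.prems(1)])
 then obtain j where j: "j < N" "f x \<in> I j" using Z_Suc_notin[OF fx x(2)] U_E by blast
 have "prob (cyl (Suc (Suc n)) x) = l i * inverse (slope i) ^ s / (kappa * l j) * prob (cyl (Suc n) (f x))"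
  unfolding cyl_Suc[OF i(2,1), of "Suc n"]
  by (rule local_jacobianD(5)[OF J i(1) j(1) f_adj[OF i(1) j(1) i(2) j(2)] \<mu>_borel[OF cyl_sets] cyl_subset_I[OF j(2,1)]])
 then show ?case
  using Suc.IH[OF fx x(2)] local_jacobianD(1)[OF J] local_jacobianD(2)[OF J i(1)] local_jacobianD(2)[OF J j(1)]
   slope_gt_1[OF i(1)] by simp
qed

lemma open_positive:
 assumes J: "local_jacobian s kappa l" and W: "open W" "W \<subseteq> {0..1}" "x0 \<in> W"
 shows "prob W > 0"
proof -
 obtain e where e: "e > 0" "ball x0 e \<subseteq> W" using W open_contains_ball by blast
 have "uncountable (ball x0 e)" using e(1) by (rule uncountable_ball)
 moreover have "countable (\<Union>n. Z n)" using Z_finite by (intro countable_UN) (auto intro: countable_finite)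
 ultimately obtain x where x: "x \<in> ball x0 e" "!!n. x \<notin> Z n"
  by (metis UN_I UNIV_I countable_subset subsetI)
 have xW: "x \<in> W" using x e by blast
 obtain d where d: "d > 0" "ball x d \<subseteq> W" using W(1) xW open_contains_ball by blast
 have "(%n. (1 / rate) ^ n) \<longlonglongrightarrow> 0" using rate_gt_1 by (intro LIMSEQ_realpow_zero) auto
 then obtain n where n: "(1 / rate) ^ n < d"
  using order_tendstoD(2)[OF _ d(1)] by (fastforce simp: eventually_sequentially)
 have x01: "x \<in> {0..1}" using xW W(2) by blast
 have "cyl (Suc n) x \<subseteq> W"
 proof
  fix y assume y: "y \<in> cyl (Suc n) x"
  have "\<bar>y - x\<bar> <= (1 / rate) ^ Suc n" by (rule itin_close) (use y x01 in "auto simp: cyl_def")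
  also have "... <= (1 / rate) ^ n" using rate_gt_1 by (intro power_decreasing) auto
  finally show "y \<in> W" using n d(2) by (auto simp: dist_real_def abs_minus_commute)
 qed
 then have "prob (cyl (Suc n) x) <= prob W"
  by (rule finite_measure_mono) (rule borel_\<mu>'[OF borel_open[OF W(1)] W(2)])
 then show ?thesis using cyl_positive[OF J x01 x(2)[of "Suc n"]] by linarith
qed

lemma AE_orbit_U:
 assumes "!!j. j <= N ==> prob {p j} = 0"
 shows "AE x in \<mu>. ALL n. (f ^^ n) x \<in> U"
proof -
 have U_sets: "U \<in> sets \<mu>" by (rule borel_\<mu>'[OF U_borel U_unit])
 have "{0..1} - U = (\<Union>j\<le>N. {p j})" using unit_minus_U by auto
 moreover have "prob (\<Union>j\<le>N. {p j}) <= (\<Sum>j\<le>N. prob {p j})"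
 proof (rule measure_UNION_le)
  show "{p j} \<in> sets \<mu>" if "j \<in> {..N}" for j using p_unit[of j] that by (intro borel_\<mu>') auto
 qed simp
 ultimately have "prob (space \<mu> - U) = 0" using assms by (simp add: space_\<mu> measure_le_0_iff)
 then have "AE x in \<mu>. x \<in> U"
  using U_sets by (intro AE_I[of _ _ "space \<mu> - U"]) (auto simp: emeasure_eq_measure)
 then have "AE x in distr \<mu> \<mu> (f ^^ n). x \<in> U" for n unfolding f_pow_invariant .
 then have "AE x in \<mu>. (f ^^ n) x \<in> U" for n by (rule AE_distrD[OF f_pow_measurable])
 then show ?thesis by (simp add: AE_all_countable)
qed

lemma AE_orbit_U': "local_jacobian s kappa l ==> AE x in \<mu>. ALL n. (f ^^ n) x \<in> U"
 by (rule AE_orbit_U) (rule local_jacobianD(4))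

lemma branch_integral:
 fixes h :: "real => complex"
 assumes J: "local_jacobian s kappa l" and i: "i < N" and j: "j < N" and adj: "adj i j"
  and h: "h \<in> borel_measurable borel"
 shows "(\<integral>x. indicator {x \<in> I i. fb x \<in> I j} x *\<^sub>R h x \<partial>\<mu>) =
  (\<integral>x. (l i * inverse (slope i) ^ s / (kappa * l j) * indicator (I j) x) *\<^sub>R h (inv_branch i x) \<partial>\<mu>)"
proof -
 define c where "c = l i * inverse (slope i) ^ s / (kappa * l j)"
 let ?W = "{x \<in> I i. fb x \<in> I j}"
 have c: "c > 0" unfolding c_def using local_jacobianD(1,2)[OF J] i j slope_gt_1[OF i] by simp
 have W [measurable]: "?W \<in> sets borel"
 proof -
  have "?W = I i Int (fb -` I j Int space borel)" by auto
  then show ?thesis using measurable_sets[OF fb_borel I_borel] by simp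
 qed
 have g [measurable]: "inv_branch i \<in> borel_measurable borel" unfolding inv_branch_def by measurable
 have 1: "(%x. c * indicator (I j) x) \<in> borel_measurable borel" by measurable
 have 2: "(indicator ?W :: real => real) \<in> borel_measurable borel" by measurable
 have 3: "(%x. x :: real) \<in> borel_measurable borel" by measurable
 note in_\<mu> [measurable] = borel_measurable_\<mu>[OF 1] borel_measurable_\<mu>[OF 2]
  borel_measurable_\<mu>[OF 3] borel_measurable_\<mu>[OF g]
 define D1 where "D1 = distr (density \<mu> (%x. ennreal (c * indicator (I j) x))) borel (inv_branch i)"
 define D2 where "D2 = distr (density \<mu> (%x. ennreal (indicator ?W x))) borel (%x. x)"
 have "D1 = D2"
 proof (rule measure_eqI)
  fix E assume "E \<in> sets D1"
  then have E [measurable]: "E \<in> sets borel" by (simp add: D1_def)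
  let ?E = "I j Int inv_branch i -` E"
  have E'B: "?E \<in> sets borel" using measurable_sets[OF g E] by (intro sets.Int) auto
  have E': "?E \<in> sets \<mu>" using I_unit[OF j] by (intro borel_\<mu>'[OF E'B]) auto
  have "emeasure D1 E = (\<integral>\<^sup>+x. ennreal (c * indicator (I j) x) * indicator (inv_branch i -` E Int space \<mu>) x \<partial>\<mu>)"
   unfolding D1_def by (subst emeasure_distr, measurable) (subst emeasure_density, auto)
  also have "... = (\<integral>\<^sup>+x. ennreal c * indicator ?E x \<partial>\<mu>)"
   by (intro nn_integral_cong) (auto split: split_indicator)
  also have "... = ennreal c * emeasure \<mu> ?E" by (rule nn_integral_cmult_indicator[OF E'])
  also have "... = ennreal (c * prob ?E)" by (simp only: emeasure_eq_measure ennreal_mult[OF less_imp_le[OF c] measure_nonneg])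
  also have "c * prob ?E = prob {x \<in> I i. f x \<in> ?E}"
   unfolding c_def by (rule local_jacobianD(5)[OF J i j adj E'B, symmetric]) auto
  also have "{x \<in> I i. f x \<in> ?E} = ?W Int E"
   using inv_branch_f[OF i] fb_eq[OF I_U[OF i]] by auto
  finally have 1: "emeasure D1 E = ennreal (prob (?W Int E))" .
  have WE: "?W Int E \<in> sets \<mu>" using I_unit[OF i] by (intro borel_\<mu>' sets.Int W E) auto
  have "emeasure D2 E = (\<integral>\<^sup>+x. ennreal (indicator ?W x) * indicator (E Int space \<mu>) x \<partial>\<mu>)"
   unfolding D2_def by (subst emeasure_distr, measurable) (subst emeasure_density, auto)
  also have "... = (\<integral>\<^sup>+x. indicator (?W Int E) x \<partial>\<mu>)"
   by (intro nn_integral_cong) (auto split: split_indicator)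
  also have "... = emeasure \<mu> (?W Int E)" by (rule nn_integral_indicator[OF WE])
  finally show "emeasure D1 E = emeasure D2 E" unfolding 1 by (simp add: emeasure_eq_measure)
 qed (simp add: D1_def D2_def)
 moreover have "integral\<^sup>L D1 h = (\<integral>x. (c * indicator (I j) x) *\<^sub>R h (inv_branch i x) \<partial>\<mu>)"
  unfolding D1_def using h c
  by (subst integral_distr, measurable) (subst integral_density, auto intro!: AE_I2 borel_measurable_\<mu>)
 moreover have "integral\<^sup>L D2 h = (\<integral>x. indicator ?W x *\<^sub>R h x \<partial>\<mu>)"
  unfolding D2_def using h
  by (subst integral_distr, measurable) (subst integral_density, auto intro!: AE_I2 borel_measurable_\<mu>)
 ultimately show ?thesis unfolding c_def by simp
qed

end

context markov_map
begin

text \<open>Observables are arbitrary, possibly not measurable, outside the intervals.\<close>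
definition cut :: "(real => complex) => real => complex" where
 "cut phi x = (if x \<in> U then phi x else 0)"

lemma cut_borel [measurable]: "phi \<in> V ==> cut phi \<in> borel_measurable borel"
proof -
 assume phi: "phi \<in> V"
 have "continuous_on U phi"
  using Df_at[OF phi, of _ 0] by (auto intro!: has_vector_derivative_continuous continuous_at_imp_continuous_on)
 then show ?thesis unfolding cut_def[abs_def]
  by (intro borel_measurable_continuous_on_if) (auto simp: U_borel)
qed

lemma cut_bounded: "phi \<in> V ==> EX S>=0. ALL x. norm (cut phi x) <= S"
 by (rule V_bounded[of phi 0]) (auto simp: cut_def)

end

context invariant_markov_measure
begin

lemma integrable_bounded:
 fixes g :: "real => complex"
 assumes "g \<in> borel_measurable borel" "!!x. norm (g x) <= S"
 shows "integrable \<mu> g"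
 by (rule integrable_const_bound[of _ S]) (use assms in "auto intro: borel_measurable_\<mu>")

text \<open>Splitting the integral over the pairs of intervals visited by \<open>x\<close> and \<open>f x\<close> and changing variables on each piece.\<close>
lemma transfer_step:
 fixes \<Psi> :: "real => complex"
 assumes J: "local_jacobian s kappa l" and phi: "phi \<in> V"
  and \<Psi> [measurable]: "\<Psi> \<in> borel_measurable borel" and S: "!!x. norm (\<Psi> x) <= S"
 shows "(\<integral>x. cut phi x * \<Psi> (fb x) \<partial>\<mu>) =
  (\<integral>x. cut (%x. of_real (1 / kappa) * (step_function (%j. inverse (l j)) x *
   transfer s (%x. step_function l x * phi x) x)) x * \<Psi> x \<partial>\<mu>)"
proof -
 define h where "h x = cut phi x * \<Psi> (fb x)" for x
 define W where "W i j = {x \<in> I i. fb x \<in> I j}" for i j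
 define c where "c i j = l i * inverse (slope i) ^ s / (kappa * l j)" for i j
 define R where "R i j x = (if adj i j then (c i j * indicator (I j) x) *\<^sub>R h (inv_branch i x) else 0)" for i j x
 have cut_m [measurable]: "cut phi \<in> borel_measurable borel" by (rule cut_borel[OF phi])
 have h_m [measurable]: "h \<in> borel_measurable borel" unfolding h_def[abs_def] by measurable
 have g_m [measurable]: "inv_branch i \<in> borel_measurable borel" for i unfolding inv_branch_def by measurable
 have W_m [measurable]: "W i j \<in> sets borel" for i j unfolding W_def by measurable
 obtain S' where S': "S' >= 0" "!!x. norm (cut phi x) <= S'" using cut_bounded[OF phi] by blast
 have S0: "S >= 0" using order_trans[OF norm_ge_zero S] .
 have h_b: "norm (h x) <= S' * S" for x unfolding h_def norm_mult by (rule mult_mono[OF S'(2) S S'(1)]) simp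
 have int_W: "integrable \<mu> (%x. indicator (W i j) x *\<^sub>R h x)" for i j
  by (rule integrable_bounded[of _ "S' * S"]) (use h_b S' S0 in "auto split: split_indicator")
 have int_R: "integrable \<mu> (R i j)" for i j
 proof (rule integrable_bounded[of _ "\<bar>c i j\<bar> * (S' * S)"])
  show "R i j \<in> borel_measurable borel" unfolding R_def[abs_def] by (cases "adj i j") simp_all
  show "norm (R i j x) <= \<bar>c i j\<bar> * (S' * S)" for x
   unfolding R_def using mult_left_mono[OF h_b, of "\<bar>c i j\<bar>"] S' S0 by (auto split: split_indicator)
 qed
 have "(\<integral>x. h x \<partial>\<mu>) = (\<integral>x. (\<Sum>i<N. \<Sum>j<N. indicator (W i j) x *\<^sub>R h x) \<partial>\<mu>)"
 proof (rule integral_cong_AE)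
  show "h \<in> borel_measurable \<mu>" by (rule borel_measurable_\<mu>[OF h_m])
  show "(%x. \<Sum>i<N. \<Sum>j<N. indicator (W i j) x *\<^sub>R h x) \<in> borel_measurable \<mu>"
   by (rule borel_measurable_\<mu>) measurable
  show "AE x in \<mu>. h x = (\<Sum>i<N. \<Sum>j<N. indicator (W i j) x *\<^sub>R h x)"
   using AE_orbit_U'[OF J]
  proof eventually_elim
   case (elim x)
   have "x \<in> U" "f x \<in> U" using elim[rule_format, of 0] elim[rule_format, of 1] by auto
   then obtain i j where ij: "i < N" "x \<in> I i" "j < N" "f x \<in> I j" by (metis U_E)
   have "indicator (W i' j') x *\<^sub>R h x = (if j' = j then if i' = i then h x else 0 else 0)"
    if "i' < N" "j' < N" for i' j'
    using I_disjoint[OF that(1) ij(1)] I_disjoint[OF that(2) ij(3)] ij fb_eq[OF \<open>x \<in> U\<close>]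
    by (auto simp: W_def split: split_indicator)
   then have "(\<Sum>i'<N. \<Sum>j'<N. indicator (W i' j') x *\<^sub>R h x) =
     (\<Sum>i'<N. \<Sum>j'<N. if j' = j then if i' = i then h x else 0 else 0)"
    by (intro sum.cong refl) simp
   also have "... = h x" using ij by simp
   finally show ?case by simp
  qed
 qed
 also have "... = (\<Sum>i<N. \<Sum>j<N. \<integral>x. indicator (W i j) x *\<^sub>R h x \<partial>\<mu>)"
  by (subst Bochner_Integration.integral_sum, intro Bochner_Integration.integrable_sum int_W)
   (intro sum.cong refl Bochner_Integration.integral_sum int_W)
 also have "... = (\<Sum>i<N. \<Sum>j<N. \<integral>x. R i j x \<partial>\<mu>)"
 proof (intro sum.cong refl)
  fix i j assume "i \<in> {..<N}" "j \<in> {..<N}"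
  then have ij: "i < N" "j < N" by auto
  show "(\<integral>x. indicator (W i j) x *\<^sub>R h x \<partial>\<mu>) = (\<integral>x. R i j x \<partial>\<mu>)"
  proof (cases "adj i j")
   case True
   show ?thesis unfolding W_def branch_integral[OF J ij True h_m] using True by (simp add: R_def c_def)
  next
   case False
   then have "W i j = {}" using f_adj[OF ij] fb_eq I_U[OF ij(1)] by (auto simp: W_def)
   then show ?thesis using False by (simp add: R_def)
  qed
 qed
 also have "... = (\<integral>x. (\<Sum>i<N. \<Sum>j<N. R i j x) \<partial>\<mu>)"
  by (subst Bochner_Integration.integral_sum, intro Bochner_Integration.integrable_sum int_R)
   (intro sum.cong refl Bochner_Integration.integral_sum[symmetric] int_R)
 also have "... = (\<integral>x. cut (%x. of_real (1 / kappa) * (step_function (%j. inverse (l j)) x *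
   transfer s (%x. step_function l x * phi x) x)) x * \<Psi> x \<partial>\<mu>)"
 proof (intro Bochner_Integration.integral_cong refl)
  fix x
  show "(\<Sum>i<N. \<Sum>j<N. R i j x) = cut (%x. of_real (1 / kappa) * (step_function (%j. inverse (l j)) x *
   transfer s (%x. step_function l x * phi x) x)) x * \<Psi> x"
  proof (cases "x \<in> U")
   case False
   then have "R i j x = 0" if "j < N" for i j using I_U[OF that] by (auto simp: R_def split: split_indicator)
   then show ?thesis using False by (simp add: cut_def)
  next
   case True
   then obtain j where j: "j < N" "x \<in> I j" by (rule U_E)
   let ?r = "%i. of_real (c i j) * (phi (inv_branch i x) * \<Psi> x)"
   have "R i j' x = (if j' = j then if adj i j then ?r i else 0 else 0)" if ij: "i < N" "j' < N" for i j'
   proof (cases "j' = j & adj i j")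
    case True
    then have "inv_branch i x \<in> I i" using adj_inv_branch_in[OF ij(1) j] by simp
    then have "h (inv_branch i x) = phi (inv_branch i x) * \<Psi> x"
     using I_U[OF ij(1)] fb_eq f_inv_branch[OF ij(1)] by (simp add: h_def cut_def)
    then show ?thesis using True j by (simp add: R_def scaleR_conv_of_real)
   next
    case False
    then show ?thesis using I_disjoint[OF ij(2) j(1)] j(2) by (auto simp: R_def split: split_indicator)
   qed
   then have "(\<Sum>i<N. \<Sum>j'<N. R i j' x) = (\<Sum>i<N. \<Sum>j'<N. if j' = j then if adj i j then ?r i else 0 else 0)"
    by (intro sum.cong refl) simp
   also have "... = (\<Sum>i<N. if adj i j then ?r i else 0)" using j(1) by simp
   also have "... = (\<Sum>i\<in>{i \<in> {..<N}. adj i j}. ?r i)" by (rule sum.inter_filter[symmetric]) simp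
   also have "... = (\<Sum>i | i < N & adj i j. of_real (1 / kappa) * (of_real (inverse (l j)) *
     (inverse (of_real (slope i)) ^ s * (step_function l (inv_branch i x) * phi (inv_branch i x)))) * \<Psi> x)"
   proof (intro sum.cong)
    fix i assume "i \<in> {i. i < N & adj i j}"
    then have i: "i < N" "inv_branch i x \<in> I i" using adj_inv_branch_in[OF _ j] by auto
    show "?r i = of_real (1 / kappa) * (of_real (inverse (l j)) *
     (inverse (of_real (slope i)) ^ s * (step_function l (inv_branch i x) * phi (inv_branch i x)))) * \<Psi> x"
     unfolding step_function[OF i] c_def by (simp add: divide_inverse of_real_inverse)
   qed auto
   also have "... = of_real (1 / kappa) * (step_function (%j. inverse (l j)) x *
    transfer s (%x. step_function l x * phi x) x) * \<Psi> x"
    unfolding step_function[OF j] transfer_on_I[OF j] sum_distrib_left sum_distrib_right ..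
   finally show ?thesis using True by (simp add: cut_def)
  qed
 qed
 finally show ?thesis unfolding h_def .
qed

lemma fb_pow_borel [measurable]: "(fb ^^ n) \<in> borel_measurable borel"
 by (induction n) (auto intro: measurable_comp fb_borel)

lemma transfer_steps:
 fixes \<Psi> :: "real => complex"
 assumes J: "local_jacobian s kappa l"
  and \<Psi> [measurable]: "\<Psi> \<in> borel_measurable borel" and S: "!!x. norm (\<Psi> x) <= S"
 shows "phi \<in> V ==> (\<integral>x. cut phi x * \<Psi> ((fb ^^ n) x) \<partial>\<mu>) = of_real ((1 / kappa) ^ n) *
  (\<integral>x. cut (%x. step_function (%j. inverse (l j)) x *
   (transfer s ^^ n) (%x. step_function l x * phi x) x) x * \<Psi> x \<partial>\<mu>)"
proof (induction n arbitrary: phi)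
 case 0
 have "cut (%x. step_function (%j. inverse (l j)) x * (step_function l x * phi x)) x = cut phi x" for x
 proof (cases "x \<in> U")
  case True
  then obtain j where j: "j < N" "x \<in> I j" by (rule U_E)
  then show ?thesis using local_jacobianD(2)[OF J j(1)] by (simp add: cut_def step_function)
 qed (simp add: cut_def)
 then show ?case by simp
next
 case (Suc n)
 define phi' where "phi' x = of_real (1 / kappa) * (step_function (%j. inverse (l j)) x *
   transfer s (%x. step_function l x * phi x) x)" for x
 have phi': "phi' \<in> V" unfolding phi'_def[abs_def] by (intro V_scale V_step V_transfer Suc.prems)
 have m: "(%x. \<Psi> ((fb ^^ n) x)) \<in> borel_measurable borel" by measurable
 have "(\<integral>x. cut phi x * \<Psi> ((fb ^^ Suc n) x) \<partial>\<mu>) = (\<integral>x. cut phi x * \<Psi> ((fb ^^ n) (fb x)) \<partial>\<mu>)"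
  by (simp add: funpow_swap1)
 also have "... = (\<integral>x. cut phi' x * \<Psi> ((fb ^^ n) x) \<partial>\<mu>)"
  unfolding phi'_def[abs_def] by (rule transfer_step[OF J Suc.prems m S])
 also have "... = of_real ((1 / kappa) ^ n) * (\<integral>x. cut (%x. step_function (%j. inverse (l j)) x *
   (transfer s ^^ n) (%x. step_function l x * phi' x) x) x * \<Psi> x \<partial>\<mu>)"
  by (rule Suc.IH[OF phi'])
 also have "(\<integral>x. cut (%x. step_function (%j. inverse (l j)) x *
   (transfer s ^^ n) (%x. step_function l x * phi' x) x) x * \<Psi> x \<partial>\<mu>) =
   (\<integral>x. of_real (1 / kappa) * (cut (%x. step_function (%j. inverse (l j)) x *
   (transfer s ^^ Suc n) (%x. step_function l x * phi x) x) x * \<Psi> x) \<partial>\<mu>)"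
 proof (intro Bochner_Integration.integral_cong refl)
  fix x
  let ?T = "transfer s (%x. step_function l x * phi x)"
  have eq: "(transfer s ^^ n) (%x. step_function l x * phi' x) x = of_real (1 / kappa) * (transfer s ^^ Suc n) (%x. step_function l x * phi x) x"
   if x: "x \<in> U"
  proof -
   have "(transfer s ^^ n) (%x. step_function l x * phi' x) x = (transfer s ^^ n) (%x. of_real (1 / kappa) * ?T x + 0 * ?T x) x"
   proof (rule transfer_pow_cong[OF _ x])
    fix y assume "y \<in> U"
    then obtain j where j: "j < N" "y \<in> I j" by (rule U_E)
    then show "step_function l y * phi' y = of_real (1 / kappa) * ?T y + 0 * ?T y"
     using local_jacobianD(2)[OF J j(1)] by (simp add: phi'_def step_function)
   qed
   also have "... = of_real (1 / kappa) * (transfer s ^^ n) ?T x" unfolding transfer_pow_lin by simp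
   finally show ?thesis by (simp add: funpow_swap1)
  qed
  then show "cut (%x. step_function (%j. inverse (l j)) x *
   (transfer s ^^ n) (%x. step_function l x * phi' x) x) x * \<Psi> x = of_real (1 / kappa) * (cut (%x. step_function (%j. inverse (l j)) x *
   (transfer s ^^ Suc n) (%x. step_function l x * phi x) x) x * \<Psi> x)"
   by (cases "x \<in> U") (auto simp: cut_def eq simp del: funpow.simps)
 qed
 finally show ?case by simp
qed

definition pairing :: "(nat => real) => form" where
 "pairing l eta psi = (\<integral>x. cut (%x. step_function (%j. inverse (l j)) x * eta x) x * cut psi x \<partial>\<mu>)"

lemma correlation_eq_pairing:
 assumes J: "local_jacobian s kappa l" and phi: "phi \<in> V" and psi: "psi \<in> V"
 shows "(\<integral>x. phi x * psi ((f ^^ n) x) \<partial>\<mu>) =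
  of_real ((1 / kappa) ^ n) * pairing l ((transfer s ^^ n) (%x. step_function l x * phi x)) psi"
proof -
 obtain S where S: "!!x. norm (cut psi x) <= S" using cut_bounded[OF psi] by blast
 let ?g = "%x. cut phi x * cut psi ((fb ^^ n) x)"
 have AE_eq: "AE x in \<mu>. phi x * psi ((f ^^ n) x) = ?g x"
  using AE_orbit_U'[OF J]
 proof eventually_elim
  case (elim x)
  have "(fb ^^ n) x = (f ^^ n) x" for n
   by (induction n) (use fb_eq elim in auto)
  then show ?case using elim[rule_format, of n] elim[rule_format, of 0] by (simp add: cut_def)
 qed
 have [measurable]: "cut phi \<in> borel_measurable borel" "cut psi \<in> borel_measurable borel"
  using cut_borel phi psi by auto
 have "?g \<in> borel_measurable borel" by measurable
 then have gm: "?g \<in> borel_measurable \<mu>" by (rule borel_measurable_\<mu>)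
 have "(\<integral>x. phi x * psi ((f ^^ n) x) \<partial>\<mu>) = (\<integral>x. ?g x \<partial>\<mu>)"
 proof (rule integral_cong_AE[OF _ gm AE_eq])
  \<comment> \<open>both observables are Borel on \<open>U\<close>, and only finitely many points of the unit interval are not in \<open>U\<close>\<close>
  have obs: "\<zeta> \<in> borel_measurable \<mu>" if "\<zeta> \<in> V" for \<zeta> :: "real => complex"
  proof -
   have "(%x. cut \<zeta> x + (\<Sum>j\<le>N. indicator {p j} x *\<^sub>R \<zeta> (p j))) \<in> borel_measurable borel"
    using cut_borel[OF that] by measurable
   then have "(%x. cut \<zeta> x + (\<Sum>j\<le>N. indicator {p j} x *\<^sub>R \<zeta> (p j))) \<in> borel_measurable \<mu>"
    by (rule borel_measurable_\<mu>)
   moreover have "cut \<zeta> x + (\<Sum>j\<le>N. indicator {p j} x *\<^sub>R \<zeta> (p j)) = \<zeta> x" if xs: "x \<in> space \<mu>" for x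
   proof (cases "x \<in> U")
    case True
    then have "indicator {p j} x = (0::real)" if "j <= N" for j using p_notin_U[OF that] by (auto split: split_indicator)
    then show ?thesis using True by (simp add: cut_def)
   next
    case False
    then obtain i where i: "i <= N" "x = p i" using xs unit_minus_U unfolding space_\<mu> by blast
    have "(\<Sum>j\<le>N. indicator {p j} x *\<^sub>R \<zeta> (p j)) = (\<Sum>j\<le>N. if j = i then \<zeta> x else 0)"
     by (intro sum.cong refl) (use p_inj i in "auto split: split_indicator")
    then show ?thesis using False i by (simp add: cut_def)
   qed
   ultimately show ?thesis by (rule measurable_cong[THEN iffD1, rotated])
  qed
  show "(%x. phi x * psi ((f ^^ n) x)) \<in> borel_measurable \<mu>"
   using obs[OF phi] measurable_compose[OF f_pow_measurable obs[OF psi]] by (rule borel_measurable_times)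
 qed
 also have "... = of_real ((1 / kappa) ^ n) * pairing l ((transfer s ^^ n) (%x. step_function l x * phi x)) psi"
  unfolding pairing_def by (rule transfer_steps[OF J cut_borel[OF psi] S phi])
 finally show ?thesis .
qed

lemma pairing_integrable:
 assumes "eta \<in> V" "psi \<in> V"
 shows "integrable \<mu> (%x. cut (%x. step_function (%j. inverse (l j)) x * eta x) x * cut psi x)"
proof -
 have V1: "(%x. step_function (%j. inverse (l j)) x * eta x) \<in> V" by (rule V_step[OF assms(1)])
 obtain S S' where S: "S >= 0" "!!x. norm (cut (%x. step_function (%j. inverse (l j)) x * eta x) x) <= S"
   "!!x. norm (cut psi x) <= S'" using cut_bounded[OF V1] cut_bounded[OF assms(2)] by blast
 have [measurable]: "cut (%x. step_function (%j. inverse (l j)) x * eta x) \<in> borel_measurable borel"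
  "cut psi \<in> borel_measurable borel" using cut_borel V1 assms by auto
 show ?thesis
  by (rule integrable_bounded[of _ "S * S'"]) (measurable, simp add: norm_mult mult_mono S)
qed

lemma pairing_bilinear: "bilinear_form N p (pairing l)"
 unfolding bilinear_form_def
proof (intro conjI ballI)
 fix eta assume eta: "eta \<in> V"
 show "linear_functional N p (pairing l eta)"
 proof (rule linear_functionalI)
  fix phi psi assume h: "phi \<in> V" "psi \<in> V"
  have "cut (%x. phi x + psi x) x = cut phi x + cut psi x" for x by (simp add: cut_def)
  then show "pairing l eta (%x. phi x + psi x) = pairing l eta phi + pairing l eta psi"
   unfolding pairing_def
   by (simp only: distrib_left Bochner_Integration.integral_add[OF pairing_integrable[OF eta h(1)] pairing_integrable[OF eta h(2)]])
  show "pairing l eta phi = pairing l eta psi" if "!!x. x \<in> U ==> phi x = psi x"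
   unfolding pairing_def by (intro Bochner_Integration.integral_cong refl) (simp add: cut_def that)
 next
  fix phi c assume h: "phi \<in> V"
  have "pairing l eta (%x. c * phi x) = (\<integral>x. c * (cut (%x. step_function (%j. inverse (l j)) x * eta x) x * cut phi x) \<partial>\<mu>)"
   unfolding pairing_def by (intro Bochner_Integration.integral_cong refl) (simp add: cut_def)
  then show "pairing l eta (%x. c * phi x) = c * pairing l eta phi" by (simp add: pairing_def)
 qed
next
 fix psi assume psi: "psi \<in> V"
 show "linear_functional N p (%eta. pairing l eta psi)"
 proof (rule linear_functionalI)
  fix eta \<zeta> assume h: "eta \<in> V" "\<zeta> \<in> V"
  have "cut (%x. step_function (%j. inverse (l j)) x * (eta x + \<zeta> x)) x =
    cut (%x. step_function (%j. inverse (l j)) x * eta x) x + cut (%x. step_function (%j. inverse (l j)) x * \<zeta> x) x" for x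
   by (simp add: cut_def distrib_left)
  then show "pairing l (%x. eta x + \<zeta> x) psi = pairing l eta psi + pairing l \<zeta> psi"
   unfolding pairing_def
   by (simp only: distrib_right Bochner_Integration.integral_add[OF pairing_integrable[OF h(1) psi] pairing_integrable[OF h(2) psi]])
  show "pairing l eta psi = pairing l \<zeta> psi" if "!!x. x \<in> U ==> eta x = \<zeta> x"
   unfolding pairing_def by (intro Bochner_Integration.integral_cong refl) (simp add: cut_def that)
 next
  fix eta c assume h: "eta \<in> V"
  have "pairing l (%x. c * eta x) psi = (\<integral>x. c * (cut (%x. step_function (%j. inverse (l j)) x * eta x) x * cut psi x) \<partial>\<mu>)"
   unfolding pairing_def by (intro Bochner_Integration.integral_cong refl) (simp add: cut_def)
  then show "pairing l (%x. c * eta x) psi = c * pairing l eta psi" by (simp add: pairing_def)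
 qed
qed

lemma pairing_bounded:
 assumes l: "!!j. j < N ==> l j > 0" and psi: "psi \<in> V"
 shows "EX C. ALL eta:V. ALL S. (ALL x:U. norm (eta x) <= S) --> norm (pairing l eta psi) <= C * S"
proof -
 obtain S' where S': "S' >= 0" "!!x. norm (cut psi x) <= S'" using cut_bounded[OF psi] by blast
 define c where "c = (\<Sum>j<N. inverse (l j))"
 have c: "inverse (l j) <= c" if "j < N" for j
  unfolding c_def by (rule member_le_sum) (use that l in "auto intro: less_imp_le")
 have c0: "c >= 0" unfolding c_def using l by (intro sum_nonneg) (auto intro: less_imp_le)
 have "norm (pairing l eta psi) <= c * S' * S" if eta: "eta \<in> V" and S: "ALL x:U. norm (eta x) <= S" for eta S
 proof -
  have S0: "S >= 0" using S I_U[OF N_pos mid_in[OF N_pos]] norm_ge_zero order_trans by blast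
  have b: "norm (cut (%x. step_function (%j. inverse (l j)) x * eta x) x * cut psi x) <= c * S' * S" for x
  proof (cases "x \<in> U")
   case True
   then obtain j where j: "j < N" "x \<in> I j" by (rule U_E)
   have "norm (cut (%x. step_function (%j. inverse (l j)) x * eta x) x * cut psi x) = inverse (l j) * norm (eta x) * norm (cut psi x)"
    using True l[OF j(1)] by (simp add: cut_def step_function[OF j] norm_mult norm_inverse)
   also have "... <= c * S * S'"
    by (intro mult_mono c j S[rule_format, OF True] S') (use c0 S0 l[OF j(1)] in auto)
   finally show ?thesis by (simp add: mult_ac)
  qed (use c0 S' S0 in "simp add: cut_def")
  have "norm (pairing l eta psi) <= (\<integral>x. c * S' * S \<partial>\<mu>)"
   unfolding pairing_def
   by (rule Bochner_Integration.integral_norm_bound_integral[OF pairing_integrable[OF eta psi] integrable_const]) (rule b)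
  then show ?thesis by (simp add: prob_space)
 qed
 then show ?thesis by blast
qed

text \<open>The integrand is nonnegative and the measure charges every open set, because all cylinders have positive measure.\<close>
lemma pairing_nondegenerate:
 assumes J: "local_jacobian s kappa l" and eta: "eta \<in> V"
  and zero: "pairing l eta (%x. cnj (eta x)) = 0" and x: "x \<in> U"
 shows "eta x = 0"
proof (rule ccontr)
 assume ne: "eta x ~= 0"
 obtain j where j: "j < N" "x \<in> I j" using x by (rule U_E)
 define q where "q y = (if y \<in> U then (\<Sum>i<N. if y \<in> I i then inverse (l i) else 0) * (norm (eta y))\<^sup>2 else 0)" for y
 have q_I: "q y = inverse (l i) * (norm (eta y))\<^sup>2" if "i < N" "y \<in> I i" for i y
 proof -
  have "(\<Sum>i'<N. if y \<in> I i' then inverse (l i') else 0) = (\<Sum>i'<N. if i' = i then inverse (l i) else 0)"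
   by (intro sum.cong refl) (use I_disjoint that in auto)
  then show ?thesis using that I_U by (simp add: q_def)
 qed
 have q0: "q y >= 0" for y
 proof (cases "y \<in> U")
  case True
  then obtain i where "i < N" "y \<in> I i" by (rule U_E)
  then show ?thesis using q_I local_jacobianD(2)[OF J] by (simp add: less_imp_le)
 qed (simp add: q_def)
 have q_eq: "cut (%x. step_function (%j. inverse (l j)) x * eta x) y * cut (%x. cnj (eta x)) y = of_real (q y)" for y
 proof (cases "y \<in> U")
  case True
  then obtain i where i: "i < N" "y \<in> I i" by (rule U_E)
  show ?thesis using True by (simp add: cut_def step_function[OF i] q_I[OF i] complex_norm_square[symmetric] mult.assoc)
 qed (simp add: cut_def q_def)
 have "integrable \<mu> (%y. complex_of_real (q y))"
  using pairing_integrable[OF eta V_cnj[OF eta], of l] unfolding q_eq .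
 then have q_int: "integrable \<mu> q" by (simp only: complex_of_real_integrable_eq)
 have "(\<integral>y. q y \<partial>\<mu>) = 0" using zero unfolding pairing_def q_eq by simp
 then have AE0: "AE y in \<mu>. q y = 0" using integral_nonneg_eq_0_iff_AE[OF q_int] q0 by simp
 have "continuous (at x) eta" using Df_at[OF eta x, of 0] by (auto intro: has_vector_derivative_continuous)
 then have "continuous (at x within I j) eta" by (rule continuous_at_imp_continuous_within)
 from continuous_within_avoid[OF this ne] obtain e where
  e: "e > 0" "ALL y:I j. dist x y < e --> eta y ~= 0" by blast
 let ?W = "I j Int ball x e"
 have "prob ?W > 0"
  by (rule open_positive[OF J _ _ , of _ x]) (use I_unit[OF j(1)] I_open j e in "auto simp del: atLeastAtMost_iff")
 moreover have "prob ?W = 0"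
 proof -
  have Ws: "?W \<in> sets \<mu>" by (rule borel_\<mu>') (use I_unit[OF j(1)] in auto)
  have "AE y in \<mu>. y \<notin> ?W"
   using AE0
  proof eventually_elim
   case (elim y)
   show ?case
   proof
    assume "y \<in> ?W"
    then show False using elim e q_I[OF j(1), of y] local_jacobianD(2)[OF J j(1)] by auto
   qed
  qed
  then show ?thesis using Ws by (simp add: AE_iff_measurable[OF Ws, of "%y. y \<notin> ?W"] space_\<mu> emeasure_eq_measure
   AE_iff_null_sets measure_eq_0_null_sets)
 qed
 ultimately show False by simp
qed

end

context markov_map
begin

lemma lower_upper_unit:
 assumes i: "i < N" shows "lower i \<in> {0..1}" "upper i \<in> {0..1}"
proof -
 have "f ` I i \<subseteq> {0..1}" using unit_interval I_unit[OF i] by blast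
 then have "closure (f ` I i) \<subseteq> {0..1}" by (rule closure_minimal) simp
 then have "{lower i..upper i} \<subseteq> {0..1}"
  unfolding image_I[OF i] using lower_less_upper[OF i] by simp
 then show "lower i \<in> {0..1}" "upper i \<in> {0..1}" using lower_less_upper[OF i] by auto
qed

lemma lower_upper_partition:
 assumes i: "i < N"
 obtains a b where "a < b" "b <= N" "lower i = p a" "upper i = p b"
proof -
 have no: "x \<notin> I j" if j: "j < N" and x: "x = lower i \<or> x = upper i" for j x
 proof
  assume xj: "x \<in> I j"
  have lu: "lower i < upper i" by (rule lower_less_upper[OF i])
  from xj I_open[of j] obtain e where e: "e > 0" "ball x e \<subseteq> I j" using open_contains_ball by blast
  define d where "d = min e (upper i - lower i) / 2"
  have d: "d > 0" "d < e" "d < upper i - lower i" using e(1) lu by (auto simp: d_def)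
  have b: "x - d \<in> I j" "x + d \<in> I j" using e d by (auto simp: dist_real_def)
  show False
   using adj_iff[OF i j b(1)] adj_iff[OF i j b(2)] x d by auto
 qed
 obtain a where a: "a <= N" "lower i = p a"
  by (rule unit_cases[OF lower_upper_unit(1)[OF i]]) (use no in auto)
 obtain b where b: "b <= N" "upper i = p b"
  by (rule unit_cases[OF lower_upper_unit(2)[OF i]]) (use no in auto)
 have "a < b"
 proof (rule ccontr)
  assume "\<not> a < b"
  then have "p b <= p a" using p_mono[of b a] a by simp
  then show False using lower_less_upper[OF i] a b by simp
 qed
 then show thesis using that a b by blast
qed

end

locale transitive_markov_map = markov_map +
 assumes transitive: "transitive_map f N p"
begin

text \<open>An orbit segment from \<open>I i\<close> to \<open>I j\<close> that stays in the intervals is a path in the graph of the adjacency matrix.\<close>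
lemma irreducible:
 assumes "i < N" "j < N"
 shows "(i, j) \<in> {(i, j). i < N & j < N & adj i j}\<^sup>*"
proof -
 let ?R = "{(i, j). i < N & j < N & adj i j}"
 have path: "(i, j) \<in> ?R\<^sup>*"
  if "i < N" "j < N" "x \<in> I i" "ALL k<n. (f ^^ k) x \<in> U" "(f ^^ n) x \<in> I j" for n i x
  using that
 proof (induction n arbitrary: i x)
  case 0
  then show ?case using I_disjoint[of i j x] by simp
 next
  case (Suc n)
  have "(f ^^ k) (f x) \<in> U" if "k < n" for k
   using Suc.prems(4)[rule_format, of "Suc k"] that by (simp add: funpow_swap1)
  moreover have "(f ^^ n) (f x) \<in> I j" using Suc.prems(5) by (simp add: funpow_swap1)
  ultimately have fx: "ALL k<n. (f ^^ k) (f x) \<in> U" "(f ^^ n) (f x) \<in> I j" by auto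
  have "f x \<in> U" using fx I_U[OF Suc.prems(2)] by (cases n) auto
  then obtain m where m: "m < N" "f x \<in> I m" by (rule U_E)
  have "(i, m) \<in> ?R" using f_adj[OF Suc.prems(1) m(1) Suc.prems(3) m(2)] Suc.prems(1) m by simp
  then show ?case using Suc.IH[OF m(1) Suc.prems(2) m(2) fx] by (rule converse_rtrancl_into_rtrancl)
 qed
 have "I k Int {0..1} ~= {}" if "k < N" for k using mid_in[OF that] I_unit[OF that] by blast
 then obtain n x where "x \<in> I i" "ALL k<n. (f ^^ k) x \<in> U" "(f ^^ n) x \<in> I j"
  using transitive[unfolded transitive_map_def, rule_format, of "I i" "I j"] I_open assms by blast
 then show ?thesis using path assms by blast
qed

lemma irreducible_positive:
 assumes "i0 < N" "(l i0 :: real) > 0" and step: "!!i j. i < N ==> j < N ==> adj i j ==> l i > 0 ==> l j > 0"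
  and j: "j < N"
 shows "l j > 0"
 using irreducible[OF assms(1) j]
 by (induction rule: rtrancl_induct) (use assms in auto)

end

section \<open>Absolutely continuous invariant measures\<close>

text \<open>The functions \<open>r\<close> with this property form a closed subspace of \<open>L\<^sup>1\<close> that contains the indicators of intervals.\<close>
lemma weak_null_limit:
 fixes G :: "nat => real => real"
 assumes G [measurable]: "!!n. G n \<in> borel_measurable borel" and bound: "!!n x. \<bar>G n x\<bar> <= 1"
  and lim: "!!t. t \<in> {0..1} ==> (%n. \<integral>x. indicator {0<..<t} x * G n x \<partial>lborel) \<longlonglongrightarrow> 0"
  and r: "integrable lborel r"
 shows "(%n. \<integral>x. indicator {0<..<1} x * r x * G n x \<partial>lborel) \<longlonglongrightarrow> 0"
proof -
 define Q where "Q r \<longleftrightarrow> (%n. \<integral>x. r x * G n x \<partial>lborel) \<longlonglongrightarrow> 0" for r :: "real => real"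
 have intG: "integrable lborel (%x. r x * G n x)" if "integrable lborel r" for r n
  by (rule Bochner_Integration.integrable_bound[OF that]) (use that bound in "auto simp: abs_mult intro!: mult_left_le")
 have bnd: "\<bar>\<integral>x. r x * G n x \<partial>lborel\<bar> <= (\<integral>x. \<bar>r x\<bar> \<partial>lborel)" if "integrable lborel r" for r n
 proof -
  have "norm (\<integral>x. r x * G n x \<partial>lborel) <= (\<integral>x. \<bar>r x\<bar> \<partial>lborel)"
   by (rule Bochner_Integration.integral_norm_bound_integral[OF intG[OF that]])
    (use that bound in "auto simp: abs_mult intro!: mult_left_le")
  then show ?thesis by simp
 qed
 have Q_lim: "Q r"
  if r: "integrable lborel r" and s: "!!k. integrable lborel (s k)" "!!k. Q (s k)"
   and w: "integrable lborel w" "!!k x. \<bar>s k x\<bar> <= w x" and conv: "!!x. (%k. s k x) \<longlonglongrightarrow> r x" for r w and s :: "nat => real => real"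
  unfolding Q_def LIMSEQ_iff
 proof (intro allI impI)
  fix e :: real assume e: "e > 0"
  have "(%k. \<integral>x. \<bar>r x - s k x\<bar> \<partial>lborel) \<longlonglongrightarrow> (\<integral>x. 0 \<partial>(lborel :: real measure))"
  proof (rule integral_dominated_convergence[where w = "%x. \<bar>r x\<bar> + w x"])
   show "AE x in lborel. (%k. \<bar>r x - s k x\<bar>) \<longlonglongrightarrow> 0"
   proof (rule AE_I2)
    fix x
    have "(%k. r x - s k x) \<longlonglongrightarrow> r x - r x" by (intro tendsto_diff tendsto_const conv)
    then have "(%k. \<bar>r x - s k x\<bar>) \<longlonglongrightarrow> \<bar>r x - r x\<bar>" by (rule tendsto_rabs)
    then show "(%k. \<bar>r x - s k x\<bar>) \<longlonglongrightarrow> 0" by simp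
   qed
   show "AE x in lborel. norm \<bar>r x - s k x\<bar> <= \<bar>r x\<bar> + w x" for k
   proof (rule AE_I2)
    fix x show "norm \<bar>r x - s k x\<bar> <= \<bar>r x\<bar> + w x"
     using abs_triangle_ineq4[of "r x" "s k x"] w(2)[of k x] by simp
   qed
  qed (use r s w in auto)
  then have "(%k. \<integral>x. \<bar>r x - s k x\<bar> \<partial>lborel) \<longlonglongrightarrow> 0" by simp
  then obtain k where k: "(\<integral>x. \<bar>r x - s k x\<bar> \<partial>lborel) < e / 2"
   using order_tendstoD(2)[of _ 0 _ "e / 2"] e by (fastforce simp: eventually_sequentially)
  obtain n0 where n0: "!!n. n >= n0 ==> norm ((\<integral>x. s k x * G n x \<partial>lborel) - 0) < e / 2"
   using s(2)[of k] e unfolding Q_def LIMSEQ_iff by (meson half_gt_zero)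
  have "norm ((\<integral>x. r x * G n x \<partial>lborel) - 0) < e" if n: "n >= n0" for n
  proof -
   have "(\<integral>x. r x * G n x \<partial>lborel) = (\<integral>x. (r x - s k x) * G n x \<partial>lborel) + (\<integral>x. s k x * G n x \<partial>lborel)"
    unfolding left_diff_distrib using intG[OF r] intG[OF s(1)] by simp
   moreover have "\<bar>\<integral>x. (r x - s k x) * G n x \<partial>lborel\<bar> <= (\<integral>x. \<bar>r x - s k x\<bar> \<partial>lborel)"
    by (rule bnd) (use r s in auto)
   ultimately show ?thesis using k n0[OF n] by simp
  qed
  then show "EX n0. ALL n>=n0. norm ((\<integral>x. r x * G n x \<partial>lborel) - 0) < e" by blast
 qed
 have int_ind: "integrable lborel (indicator (A Int {0<..<1}) :: real => real)" if "A \<in> sets borel" for A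
 proof (rule integrable_real_indicator)
  have "emeasure lborel (A Int {0<..<1}) <= emeasure lborel {0<..<1::real}" by (rule emeasure_mono) auto
  also have "... < \<infinity>" by simp
  finally show "emeasure lborel (A Int {0<..<1}) < \<infinity>" .
 qed (use that in simp)
 have Q_add: "Q (%x. r x + s x)" if "integrable lborel r" "integrable lborel s" "Q r" "Q s" for r s
  using tendsto_add[OF that(3,4)[unfolded Q_def]] intG[OF that(1)] intG[OF that(2)]
  unfolding Q_def by (simp add: distrib_right)
 have Q_mult: "Q (%x. c * r x)" if "Q r" for r c
  using tendsto_mult_left[OF that[unfolded Q_def], of c] unfolding Q_def by (simp add: mult.assoc)
 have Q_cong: "Q r \<longleftrightarrow> Q s" if "AE x in lborel. r x = s x" "r \<in> borel_measurable borel" "s \<in> borel_measurable borel" for r s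
 proof -
  have "(\<integral>x. r x * G n x \<partial>lborel) = (\<integral>x. s x * G n x \<partial>lborel)" for n
   by (rule integral_cong_AE) (use that in auto)
  then show ?thesis unfolding Q_def by simp
 qed
 have Q_set: "Q (indicator (A Int {0<..<1}))" if "A \<in> sets borel" for A
 proof -
  have "Int_stable (range (atMost :: real => real set))" by (auto simp: Int_stable_def Int_atMost)
  moreover have "range (atMost :: real => real set) \<subseteq> Pow UNIV" by simp
  moreover have "A \<in> sigma_sets UNIV (range atMost)" using that by (simp add: borel_eq_atMost)
  ultimately show ?thesis
  proof (induction rule: sigma_sets_induct_disjoint)
   case (basic A)
   then obtain t where t: "A = {..t}" by auto
   define u where "u = max 0 (min t 1)"
   have u: "u \<in> {0..1}" by (simp add: u_def)
   have "Q (indicator {0<..<u})" using lim[OF u] by (simp add: Q_def)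
   moreover have "AE x in lborel. indicator {0<..<u} x = (indicator (A Int {0<..<1}) x :: real)"
    using AE_lborel_singleton[of u] by eventually_elim (auto simp: t u_def split: split_indicator)
   ultimately show ?case by (subst (asm) Q_cong) (auto simp: t)
  next
   case empty
   show ?case by (simp add: Q_def)
  next
   case (compl A)
   have AB: "A \<in> sets borel" using compl by (simp add: borel_eq_atMost)
   have "Q (indicator (UNIV Int {0<..<1}))" using lim[of 1] by (simp add: Q_def)
   then have "Q (%x. indicator (UNIV Int {0<..<1}) x + (-1) * indicator (A Int {0<..<1}) x)"
    by (intro Q_add Q_mult compl(2) int_ind AB integrable_mult_right) auto
   then show ?case
    by (rule back_subst[of Q]) (auto split: split_indicator)
  next
   case (union A)
   have AB: "A i \<in> sets borel" for i using union by (auto simp: borel_eq_atMost)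
   define s where "s k = (indicator ((\<Union>i<k. A i) Int {0<..<1}) :: real => real)" for k
   have sm: "(\<Union>i<k. A i) \<in> sets borel" for k using AB by auto
   have Qs: "Q (s k)" for k
   proof (induction k)
    case 0
    show ?case by (simp add: s_def Q_def)
   next
    case (Suc k)
    have "A i Int A k = {}" if "i < k" for i using union(1) that by (auto simp: disjoint_family_on_def)
    then have "s (Suc k) = (%x. s k x + indicator (A k Int {0<..<1}) x)"
     unfolding s_def lessThan_Suc by (auto split: split_indicator simp: fun_eq_iff)
    then show ?case using Q_add[OF int_ind[OF sm] int_ind[OF AB] Suc[unfolded s_def] union(3)] by (simp add: s_def)
   qed
   show ?case
   proof (rule Q_lim[where s = s and w = "indicator (UNIV Int {0<..<1})"])
    show "(%k. s k x) \<longlonglongrightarrow> indicator (\<Union> (range A) Int {0<..<1}) x" for x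
    proof (cases "EX i. x \<in> A i & x \<in> {0<..<1}")
     case True
     then obtain i where i: "x \<in> A i" "x \<in> {0<..<1}" by blast
     have "eventually (%k. s k x = indicator (\<Union> (range A) Int {0<..<1}) x) sequentially"
      by (rule eventually_sequentiallyI[of "Suc i"]) (use i in "auto simp: s_def split: split_indicator")
     then show ?thesis by (rule tendsto_eventually)
    next
     case False
     then have "s k x = 0" "indicator (\<Union> (range A) Int {0<..<1}) x = (0 :: real)" for k
      by (auto simp: s_def split: split_indicator)
     then show ?thesis by simp
    qed
    show "\<bar>s k x\<bar> <= indicator (UNIV Int {0<..<1}) x" for k x by (auto simp: s_def split: split_indicator)
    show "integrable lborel (s k)" for k unfolding s_def by (rule int_ind[OF sm])
    have "\<Union> (range A) \<in> sets borel" using AB by auto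
    then show "integrable lborel (indicator (\<Union> (range A) Int {0<..<1}) :: real => real)" by (rule int_ind)
   qed (use Qs int_ind[of UNIV] in auto)
  qed
 qed
 have "Q (%x. indicator {0<..<1} x * r x)" using r
 proof (induction rule: integrable_induct)
  case (base A c)
  have "Q (%x. c * indicator (A Int {0<..<1}) x)" using base by (intro Q_mult Q_set) simp
  then show ?case by (rule back_subst[of Q]) (auto split: split_indicator)
 next
  case (add f g)
  have "integrable lborel (%x. indicator {0<..<1} x * f x)" "integrable lborel (%x. indicator {0<..<1} x * g x)"
   using integrable_mult_indicator[OF _ add(1), of "{0<..<1}"] integrable_mult_indicator[OF _ add(2), of "{0<..<1}"] by auto
  from Q_add[OF this add(3,4)] show ?case by (simp add: distrib_left)
 next
  case (lim f s)
  have i: "integrable lborel (%x. indicator {0<..<1} x * g x)" if "integrable lborel g" for g :: "real => real"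
   using integrable_mult_indicator[OF _ that, of "{0<..<1}"] by simp
  show ?case
  proof (rule Q_lim[where s = "%k x. indicator {0<..<1} x * s k x" and w = "%x. 2 * \<bar>f x\<bar>"])
   show "(%k. indicator {0<..<1} x * s k x) \<longlonglongrightarrow> indicator {0<..<1} x * f x" for x
    using lim(2)[of x] by (intro tendsto_mult_left) simp
   show "\<bar>indicator {0<..<1} x * s k x\<bar> <= 2 * \<bar>f x\<bar>" for k x
    using lim(3)[of x k] by (auto split: split_indicator)
  qed (use lim i in auto)
 qed
 then show ?thesis unfolding Q_def by simp
qed

lemma emeasure_Ioo_finite: "emeasure lborel {a<..<b::real} < \<top>"
 by (cases "a <= b") auto

context markov_map
begin

lemma branch_lborel_integral:
 fixes g :: "real => real"
 assumes i: "i < N"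
 shows "(\<integral>x. g (lower i + slope i * (x - p i)) \<partial>lborel) = (\<integral>x. g x \<partial>lborel) / slope i"
proof -
 have "(\<integral>x. g x \<partial>lborel) = \<bar>slope i\<bar> *\<^sub>R (\<integral>x. g ((lower i - slope i * p i) + slope i * x) \<partial>lborel)"
  by (rule lborel_integral_real_affine) (use slope_gt_1[OF i] in auto)
 also have "(%x. g ((lower i - slope i * p i) + slope i * x)) = (%x. g (lower i + slope i * (x - p i)))"
  by (intro ext arg_cong[where f = g]) (simp add: algebra_simps)
 finally show ?thesis using slope_gt_1[OF i] by (simp add: field_simps)
qed

text \<open>Both claims are proved together: a primitive of \<open>G \<circ> f^n\<close> that vanishes at the partition points is, on each interval, a contracted copy of the previous primitive, which again vanishes at the partition points.\<close>
lemma mixing_bound: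
 fixes G :: "real => real"
 assumes G [measurable]: "G \<in> borel_measurable borel" and bound: "!!x. \<bar>G x\<bar> <= 1"
  and zero: "!!i. i < N ==> (\<integral>x. indicator (I i) x * G x \<partial>lborel) = 0"
 shows "(ALL t:{0..1}. \<bar>\<integral>x. indicator {0<..<t} x * G ((fb ^^ n) x) \<partial>lborel\<bar> <= (1 / rate) ^ n) &
  (ALL i<=N. (\<integral>x. indicator {0<..<p i} x * G ((fb ^^ n) x) \<partial>lborel) = 0)"
proof -
 define S where "S n a b = (\<integral>x. indicator {a<..<b} x * G ((fb ^^ n) x) \<partial>lborel)" for n and a b :: real
 have fbm [measurable]: "(fb ^^ n) \<in> borel_measurable borel" for n
  by (induction n) (auto intro: measurable_comp fb_borel)
 have int: "integrable lborel (%x. indicator {a<..<b} x * G ((fb ^^ n) x))" for a b n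
 proof (rule Bochner_Integration.integrable_bound[of _ "indicator {a<..<b} :: real => real"])
  show "integrable lborel (indicator {a<..<b} :: real => real)"
   by (rule integrable_real_indicator) (auto simp: emeasure_Ioo_finite)
 qed (use bound in "auto split: split_indicator intro!: AE_I2")
 have split: "S n a c = S n a b + S n b c" if "a <= b" "b <= c" for n a b c
 proof -
  have "S n a c = (\<integral>x. indicator {a<..<b} x * G ((fb ^^ n) x) + indicator {b<..<c} x * G ((fb ^^ n) x) \<partial>lborel)"
   unfolding S_def
  proof (rule integral_cong_AE)
   show "AE x in lborel. indicator {a<..<c} x * G ((fb ^^ n) x) =
     indicator {a<..<b} x * G ((fb ^^ n) x) + indicator {b<..<c} x * G ((fb ^^ n) x)"
    using AE_lborel_singleton[of b] by eventually_elim (use that in "auto split: split_indicator")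
  qed measurable
  then show ?thesis unfolding S_def using int by simp
 qed
 have from_branches: "(ALL t:{0..1}. \<bar>S n 0 t\<bar> <= c) & (ALL i<=N. S n 0 (p i) = 0)"
  if z: "!!i. i < N ==> S n (p i) (p (Suc i)) = 0"
   and b: "!!i t. i < N ==> t \<in> cI i ==> \<bar>S n (p i) t\<bar> <= c" for n c
 proof -
  have 0: "S n 0 (p i) = 0" if "i <= N" for i
   using that
  proof (induction i)
   case 0
   show ?case by (simp add: S_def p_0)
  next
   case (Suc i)
   have "S n 0 (p (Suc i)) = S n 0 (p i) + S n (p i) (p (Suc i))"
    by (rule split) (use p_unit[of i] p_less[of i] Suc.prems in auto)
   then show ?case using Suc z[of i] by simp
  qed
  have "\<bar>S n 0 t\<bar> <= c" if t: "t \<in> {0..1}" for t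
  proof -
   obtain i where i: "i < N" "t \<in> cI i"
   proof (rule unit_cases[OF t])
    fix j assume "j < N" "t \<in> I j"
    then show thesis using that[of j] by (auto simp: branch_interval_def)
   next
    fix j assume j: "j <= N" "t = p j"
    show thesis
    proof (cases j)
     case 0
     then show thesis using that[of 0] j N_pos p_less[of 0] by auto
    next
     case (Suc k)
     then show thesis using that[of k] j p_less[of k] by auto
    qed
   qed
   have "S n 0 t = S n 0 (p i) + S n (p i) t"
    by (rule split) (use p_unit[of i] i in auto)
   then show ?thesis using 0[of i] b[OF i] i(1) by simp
  qed
  then show ?thesis using 0 by blast
 qed
 have "(ALL t:{0..1}. \<bar>S n 0 t\<bar> <= (1 / rate) ^ n) & (ALL i<=N. S n 0 (p i) = 0)"
 proof (induction n)
  case 0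
  show ?case
  proof (rule from_branches)
   show "S 0 (p i) (p (Suc i)) = 0" if "i < N" for i
    using zero[OF that] by (simp add: S_def branch_interval_def)
   show "\<bar>S 0 (p i) t\<bar> <= (1 / rate) ^ 0" if "i < N" "t \<in> cI i" for i t
   proof -
    have "norm (S 0 (p i) t) <= (\<integral>x. indicator {p i<..<t} x \<partial>lborel)"
     unfolding S_def
     by (rule Bochner_Integration.integral_norm_bound_integral[OF int])
      (use bound in "auto split: split_indicator intro!: integrable_real_indicator simp: emeasure_Ioo_finite")
    also have "... = t - p i" using that by simp
    also have "... <= 1" using that p_unit[of i] p_unit[of "Suc i"] by auto
    finally show ?thesis by simp
   qed
  qed
 next
  case (Suc n)
  have IH: "!!t. t \<in> {0..1} ==> \<bar>S n 0 t\<bar> <= (1 / rate) ^ n" "!!i. i <= N ==> S n 0 (p i) = 0"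
   using Suc.IH by auto
  have step: "S (Suc n) (p i) t = S n 0 (lower i + slope i * (t - p i)) / slope i"
   if i: "i < N" and t: "t \<in> cI i" for i t
  proof -
   let ?u = "lower i + slope i * (t - p i)"
   obtain a where a: "a <= N" "lower i = p a"
    using lower_upper_partition[OF i] by (metis less_imp_le order_trans)
   have u: "lower i <= ?u" "0 <= lower i" using t slope_gt_1[OF i] lower_upper_unit[OF i] by auto
   have "S (Suc n) (p i) t =
     (\<integral>x. indicator {lower i<..<?u} (lower i + slope i * (x - p i)) * G ((fb ^^ n) (lower i + slope i * (x - p i))) \<partial>lborel)"
    unfolding S_def
   proof (intro Bochner_Integration.integral_cong refl)
    fix x
    have "x \<in> {p i<..<t} \<longleftrightarrow> lower i + slope i * (x - p i) \<in> {lower i<..<?u}"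
     using slope_gt_1[OF i] by (simp add: zero_less_mult_iff)
    moreover have "fb x = lower i + slope i * (x - p i)" if "x \<in> {p i<..<t}"
    proof -
     have "x \<in> I i" using that t by (auto simp: branch_interval_def)
     then show ?thesis using fb_eq[OF I_U[OF i]] f_affine[OF i] by simp
    qed
    ultimately show "indicator {p i<..<t} x * G ((fb ^^ Suc n) x) =
      indicator {lower i<..<?u} (lower i + slope i * (x - p i)) * G ((fb ^^ n) (lower i + slope i * (x - p i)))"
     by (cases "x \<in> {p i<..<t}") (auto simp: funpow_swap1)
   qed
   also have "... = S n (lower i) ?u / slope i"
    unfolding S_def by (rule branch_lborel_integral[OF i])
   also have "S n (lower i) ?u = S n 0 ?u"
    using split[of 0 "lower i" ?u n] u IH(2)[OF a(1)] a(2) by simp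
   finally show ?thesis .
  qed
  show ?case
  proof (rule from_branches)
   fix i assume i: "i < N"
   obtain b where b: "b <= N" "upper i = p b" using lower_upper_partition[OF i] by metis
   have "p (Suc i) \<in> cI i" using p_less[OF i] by simp
   from step[OF i this] show "S (Suc n) (p i) (p (Suc i)) = 0"
    using IH(2)[OF b(1)] b(2) upper_lower[of i] by simp
   fix t assume t: "t \<in> cI i"
   let ?u = "lower i + slope i * (t - p i)"
   have "?u <= upper i" unfolding upper_lower using t slope_gt_1[OF i] by (simp add: mult_left_mono)
   moreover have "lower i <= ?u" using t slope_gt_1[OF i] by simp
   ultimately have "?u \<in> {0..1}" using lower_upper_unit[OF i] by auto
   then have "\<bar>S n 0 ?u\<bar> / slope i <= (1 / rate) ^ n / rate"
    using IH(1) slope_ge_rate[OF i] rate_gt_1 by (intro frac_le) auto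
   then show "\<bar>S (Suc n) (p i) t\<bar> <= (1 / rate) ^ Suc n"
    unfolding step[OF i t] using slope_gt_1[OF i] by simp
  qed
 qed
 then show ?thesis unfolding S_def .
qed

end

locale transitive_invariant_measure =
 transitive_markov_map f N p slope + invariant_markov_measure f N p slope \<mu>
 for f N p slope \<mu>
begin

text \<open>Applied to \<open>psi = 1\<^sub>E - c 1\<^sub>I\<close> with mean 0, mixing and invariance give \<open>\<integral> psi d\<mu> = 0\<close>: inside an interval \<open>\<mu>\<close> is proportional to Lebesgue measure.\<close>
theorem srb_local_jacobian:
 assumes ac: "absolutely_continuous (restrict_space lborel {0..1}) \<mu>"
 shows "EX l. local_jacobian 1 1 l"
proof -
 let ?M = "restrict_space lborel {0..1::real}"
 have sets_M: "sets \<mu> = sets ?M" unfolding sets_\<mu> by (simp add: sets_restrict_space)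
 interpret M: finite_measure ?M
  by (rule finite_measureI) (simp add: space_restrict_space emeasure_restrict_space)
 have space_M: "space ?M = {0..1}" by (simp add: space_restrict_space)
 obtain D where D: "D \<in> borel_measurable ?M" "AE x in ?M. RN_deriv ?M \<mu> x = ennreal (D x)" "!!x. 0 <= D x"
  using M.real_RN_deriv[OF finite_measure_axioms ac sets_M] by metis
 have \<mu>_eq: "\<mu> = density ?M (%x. ennreal (D x))"
 proof -
  have "\<mu> = density ?M (RN_deriv ?M \<mu>)" by (rule M.density_RN_deriv[OF ac sets_M, symmetric])
  also have "... = density ?M (%x. ennreal (D x))"
   by (rule density_cong) (use D in auto)
  finally show ?thesis .
 qed
 define r where "r x = indicator {0..1} x * D x" for x
 have rm [measurable]: "r \<in> borel_measurable borel"
  using D(1) borel_measurable_restrict_space_iff[of "{0..1}" "lborel :: real measure" D] by (simp add: r_def[abs_def])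
 have r_int: "integrable lborel r"
 proof -
  have "integrable ?M D"
  proof (rule integrableI_nonneg[OF D(1)])
   have dm: "(%x. ennreal (D x)) \<in> borel_measurable ?M" using D(1) by simp
   have "emeasure \<mu> (space ?M) = (\<integral>\<^sup>+x. ennreal (D x) * indicator (space ?M) x \<partial>?M)"
    by (subst \<mu>_eq) (rule emeasure_density[OF dm sets.top])
   also have "... = (\<integral>\<^sup>+x. ennreal (D x) \<partial>?M)" by (intro nn_integral_cong) simp
   finally show "(\<integral>\<^sup>+x. ennreal (D x) \<partial>?M) < \<infinity>"
    using emeasure_space_1 unfolding space_\<mu> space_M by simp
  qed (use D in auto)
  then show ?thesis
   using integrable_restrict_space[of "{0..1}" "lborel :: real measure" D] by (simp add: r_def[abs_def])
 qed
 have \<mu>_integral: "(\<integral>x. h x \<partial>\<mu>) = (\<integral>x. indicator {0<..<1} x * r x * h x \<partial>lborel)"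
  if h [measurable]: "h \<in> borel_measurable borel" for h :: "real => real"
 proof -
  have hM: "h \<in> borel_measurable ?M" by (rule measurable_restrict_space1) (use h in simp)
  have "(\<integral>x. h x \<partial>\<mu>) = (\<integral>x. D x *\<^sub>R h x \<partial>?M)"
   unfolding \<mu>_eq by (rule integral_density[OF hM D(1)]) (use D in auto)
  also have "... = (\<integral>x. indicator {0..1} x *\<^sub>R (D x *\<^sub>R h x) \<partial>lborel)"
   by (rule integral_restrict_space) simp
  also have "... = (\<integral>x. r x * h x \<partial>lborel)" by (simp add: r_def mult.assoc)
  also have "... = (\<integral>x. indicator {0<..<1} x * r x * h x \<partial>lborel)"
  proof (rule integral_cong_AE)
   show "AE x in lborel. r x * h x = indicator {0<..<1} x * r x * h x"
    using AE_lborel_singleton[of 0] AE_lborel_singleton[of 1]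
    by eventually_elim (auto simp: r_def split: split_indicator)
  qed measurable
  finally show ?thesis .
 qed
 have \<mu>_p: "prob {p j} = 0" if j: "j <= N" for j
 proof -
  have "{p j} \<in> null_sets ?M"
   using p_unit[OF j] by (subst null_sets_restrict_space) (auto intro!: null_setsI)
  then have "{p j} \<in> null_sets \<mu>" using ac unfolding absolutely_continuous_def by blast
  then show ?thesis by (simp add: measure_def null_setsD1)
 qed
 have orbit_U: "AE x in \<mu>. ALL n. (f ^^ n) x \<in> U" by (rule AE_orbit_U) (rule \<mu>_p)
 define len where "len E = measure lborel E" for E :: "real set"
 have len_I: "len (I j) = p (Suc j) - p j" if "j < N" for j
  using p_less[OF that] by (simp add: len_def branch_interval_def)
 define l where "l j = prob (I j) / (p (Suc j) - p j)" for j
 have uniform: "prob E = l j * len E" if j: "j < N" and E [measurable]: "E \<in> sets borel" and EI: "E \<subseteq> I j" for j E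
 proof -
  define c where "c = len E / len (I j)"
  have finI: "emeasure lborel (I j) < \<infinity>" by (simp add: branch_interval_def emeasure_Ioo_finite)
  then have finE: "emeasure lborel E < \<infinity>" by (rule le_less_trans[OF emeasure_mono[OF EI], rotated]) simp
  have I_pos: "len (I j) > 0" using len_I[OF j] p_less[OF j] by simp
  have "len E <= len (I j)" unfolding len_def
   by (rule measure_mono_fmeasurable[OF EI]) (use finI in "auto simp: fmeasurable_def")
  then have c: "0 <= c" "c <= 1" using I_pos by (auto simp: c_def len_def)
  define psi where "psi x = indicator E x - c * indicator (I j) x" for x :: real
  have psim [measurable]: "psi \<in> borel_measurable borel" unfolding psi_def[abs_def] by measurable
  have psib: "\<bar>psi x\<bar> <= 1" for x using c EI by (auto simp: psi_def split: split_indicator)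
  have iE: "integrable lborel (indicator E :: real => real)" "integrable lborel (indicator (I j) :: real => real)"
   using finE finI by (auto intro: integrable_real_indicator)
  have psi0: "(\<integral>x. indicator (I i) x * psi x \<partial>lborel) = 0" if i: "i < N" for i
  proof (cases "i = j")
   case True
   have "(\<integral>x. indicator (I i) x * psi x \<partial>lborel) = (\<integral>x. indicator E x - c * indicator (I j) x \<partial>lborel)"
    using True EI by (intro Bochner_Integration.integral_cong refl) (auto simp: psi_def split: split_indicator)
   also have "... = len E - c * len (I j)" using iE by (simp add: len_def)
   also have "... = 0" using I_pos by (simp add: c_def)
   finally show ?thesis .
  next
   case False
   then have "(%x. indicator (I i) x * psi x) = (%x. 0)"
    using I_disjoint[OF i j] EI by (auto simp: psi_def fun_eq_iff split: split_indicator)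
   then show ?thesis by (simp only: Bochner_Integration.integral_zero)
  qed
  note mix = mixing_bound[OF psim psib psi0]
  have fbm [measurable]: "(fb ^^ n) \<in> borel_measurable borel" for n by (rule fb_pow_borel)
  have "(%n. \<integral>x. indicator {0<..<1} x * r x * psi ((fb ^^ n) x) \<partial>lborel) \<longlonglongrightarrow> 0"
  proof (rule weak_null_limit[OF _ _ _ r_int])
   fix t :: real assume t: "t \<in> {0..1}"
   have "(%n. (1 / rate) ^ n) \<longlonglongrightarrow> 0" using rate_gt_1 by (intro LIMSEQ_realpow_zero) auto
   then show "(%n. \<integral>x. indicator {0<..<t} x * psi ((fb ^^ n) x) \<partial>lborel) \<longlonglongrightarrow> 0"
    by (rule Lim_null_comparison[rotated]) (use mix t in auto)
  qed (use psib in auto)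
  moreover have "(\<integral>x. indicator {0<..<1} x * r x * psi ((fb ^^ n) x) \<partial>lborel) = prob E - c * prob (I j)" for n
  proof -
   have m: "(%x. psi ((fb ^^ n) x)) \<in> borel_measurable borel" by measurable
   have "(\<integral>x. indicator {0<..<1} x * r x * psi ((fb ^^ n) x) \<partial>lborel) = (\<integral>x. psi ((fb ^^ n) x) \<partial>\<mu>)"
    by (rule \<mu>_integral[OF m, symmetric])
   also have "... = (\<integral>x. psi ((f ^^ n) x) \<partial>\<mu>)"
   proof (rule integral_cong_AE)
    show "(%x. psi ((fb ^^ n) x)) \<in> borel_measurable \<mu>" by (rule borel_measurable_\<mu>[OF m])
    show "(%x. psi ((f ^^ n) x)) \<in> borel_measurable \<mu>"
     by (rule measurable_compose[OF f_pow_measurable borel_measurable_\<mu>[OF psim]])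
    show "AE x in \<mu>. psi ((fb ^^ n) x) = psi ((f ^^ n) x)"
     using orbit_U
    proof eventually_elim
     case (elim x)
     have "(fb ^^ n) x = (f ^^ n) x" by (induction n) (use fb_eq elim in auto)
     then show ?case by simp
    qed
   qed
   also have "... = (\<integral>x. psi x \<partial>distr \<mu> \<mu> (f ^^ n))"
    by (rule integral_distr[OF f_pow_measurable borel_measurable_\<mu>[OF psim], symmetric])
   also have "... = (\<integral>x. indicator E x - c * indicator (I j) x \<partial>\<mu>)" unfolding f_pow_invariant psi_def ..
   also have "... = prob E - c * prob (I j)"
   proof -
    have s: "E \<in> sets \<mu>" "I j \<in> sets \<mu>" using EI I_unit[OF j] by (auto intro!: borel_\<mu>')
    then have "integrable \<mu> (indicator E :: real => real)" "integrable \<mu> (indicator (I j) :: real => real)"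
     by (auto intro!: integrable_real_indicator simp: emeasure_eq_measure)
    then show ?thesis using s EI I_unit[OF j] by (simp add: space_\<mu> Int_absorb2 Int_absorb1 subset_trans[OF EI])
   qed
   finally show ?thesis .
  qed
  ultimately have "prob E - c * prob (I j) = 0" by (simp add: LIMSEQ_const_iff)
  then show ?thesis using len_I[OF j] by (simp add: c_def l_def)
 qed
 have pre: "len {x \<in> I i. f x \<in> E} = len E / slope i"
  if i: "i < N" and j: "j < N" and adj: "adj i j" and E [measurable]: "E \<in> sets borel" and EI: "E \<subseteq> I j" for i j E
 proof -
  have "len {x \<in> I i. f x \<in> E} = (\<integral>x. indicator {x \<in> I i. f x \<in> E} x \<partial>lborel)" by (simp add: len_def)
  also have "... = (\<integral>x. indicator E (lower i + slope i * (x - p i)) \<partial>lborel)"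
  proof (intro Bochner_Integration.integral_cong refl)
   fix x
   have "x \<in> I i & f x \<in> E \<longleftrightarrow> lower i + slope i * (x - p i) \<in> E"
   proof
    assume e: "lower i + slope i * (x - p i) \<in> E"
    then have "lower i + slope i * (x - p i) \<in> {lower i<..<upper i}"
     using EI adj_iff[OF i j] adj by blast
    then have "x \<in> I i" using slope_gt_1[OF i] by (simp add: branch_interval_def upper_lower zero_less_mult_iff)
    then show "x \<in> I i & f x \<in> E" using e f_affine[OF i] by simp
   qed (use f_affine[OF i] in auto)
   then show "indicator {x \<in> I i. f x \<in> E} x = (indicator E (lower i + slope i * (x - p i)) :: real)"
    by (auto split: split_indicator)
  qed
  also have "... = (\<integral>x. indicator E x \<partial>lborel) / slope i" by (rule branch_lborel_integral[OF i])
  finally show ?thesis by (simp add: len_def)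
 qed
 have pre_sets: "{x \<in> I i. f x \<in> E} \<in> sets borel" if "i < N" "E \<in> sets borel" for i E
 proof -
  have "{x \<in> I i. f x \<in> E} = I i Int (fb -` E Int space borel)" using fb_eq[OF I_U[OF that(1)]] by auto
  then show ?thesis using measurable_sets[OF fb_borel that(2)] by simp
 qed
 have l_nn: "l j >= 0" if "j < N" for j using p_less[OF that] by (simp add: l_def)
 have \<mu>I: "prob (I j) = l j * len (I j)" if "j < N" for j by (rule uniform[OF that]) auto
 have "EX i<N. l i > 0"
 proof (rule ccontr)
  assume neg: "\<not> (EX i<N. l i > 0)"
  have z: "prob (I j) = 0" if "j < N" for j
  proof -
   have "l j = 0" using neg l_nn[OF that] that by force
   then show ?thesis by (simp add: \<mu>I[OF that])
  qed
  have "AE x in \<mu>. x \<in> U" using orbit_U by eventually_elim (metis funpow_0)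
  moreover have "AE x in \<mu>. x \<notin> I j" if "j < N" for j
   using borel_\<mu>'[OF I_borel I_unit[OF that]] z[OF that]
   by (intro AE_not_in) (auto simp: null_sets_def emeasure_eq_measure)
  then have "AE x in \<mu>. ALL j:{..<N}. x \<notin> I j" by (subst AE_ball_countable) auto
  ultimately have "AE x in \<mu>. False" by eventually_elim (auto simp: branch_union_def)
  then show False by simp
 qed
 then obtain i0 where i0: "i0 < N" "l i0 > 0" by blast
 have sub: "{x \<in> I i. f x \<in> E} \<subseteq> I i" for i E by blast
 have pre_\<mu>: "prob {x \<in> I i. f x \<in> E} = l i * (len E / slope i)"
  if "i < N" "j < N" "adj i j" "E \<in> sets borel" "E \<subseteq> I j" for i j E
  using uniform[OF that(1) pre_sets[OF that(1,4)] sub] pre[OF that] by simp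
 have l_pos: "l j > 0" if "j < N" for j
 proof (rule irreducible_positive[of i0 l, OF i0 _ that])
  fix i j assume ij: "i < N" "j < N" "adj i j" "l i > 0"
  have "0 < l i * (len (I j) / slope i)" using ij len_I[OF ij(2)] p_less[OF ij(2)] slope_gt_1[OF ij(1)] by simp
  also have "... = prob {x \<in> I i. f x \<in> I j}"
   by (rule pre_\<mu>[OF ij(1,2,3) I_borel order_refl, symmetric])
  also have "... <= prob ((f ^^ 1) -` I j Int space \<mu>)"
  proof (rule finite_measure_mono)
   show "{x \<in> I i. f x \<in> I j} \<subseteq> (f ^^ 1) -` I j Int space \<mu>"
    using I_unit[OF ij(1)] by (auto simp: space_\<mu>)
   show "(f ^^ 1) -` I j Int space \<mu> \<in> sets \<mu>"
    by (rule measurable_sets[OF f_pow_measurable borel_\<mu>'[OF I_borel I_unit[OF ij(2)]]])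
  qed
  also have "... = prob (I j)" by (rule measure_vimage[OF borel_\<mu>'[OF I_borel I_unit[OF ij(2)]]])
  finally show "l j > 0" using \<mu>I[OF ij(2)] len_I[OF ij(2)] p_less[OF ij(2)] by (simp add: zero_less_mult_iff)
 qed
 have "local_jacobian 1 1 l"
  unfolding local_jacobian_def
 proof (intro conjI allI impI ballI)
  fix i j E assume h: "i < N" "j < N" "E \<in> sets borel" "adj i j" "E \<subseteq> I j"
  show "prob {x \<in> I i. f x \<in> E} = l i * inverse (slope i) ^ 1 / (1 * l j) * prob E"
   unfolding pre_\<mu>[OF h(1,2,4,3,5)] uniform[OF h(2,3,5)] using l_pos[OF h(2)]
   by (simp add: divide_inverse)
 qed (use l_pos \<mu>_p \<mu>I len_I p_less in auto)
 then show ?thesis by blast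
qed

end

section \<open>Counting itineraries\<close>

lemma entropy_bound_limit:
 fixes c L Q :: real
 assumes "Q >= 0"
 shows "(%n. (c + ln (real n + Q + 1) + (real n + Q) * L) / real n) \<longlonglongrightarrow> L"
proof -
 have "(%n. ln (real n + Q + 1) / real n) \<longlonglongrightarrow> 0" using assms by real_asymp
 from tendsto_add[OF tendsto_add[OF lim_const_over_n[of "c + Q * L"] this] tendsto_const[of L]]
 have "(%n. (c + Q * L) / real n + ln (real n + Q + 1) / real n + L) \<longlonglongrightarrow> L" by simp
 then show ?thesis
 proof (rule Lim_transform_eventually)
  show "eventually (%n. (c + Q * L) / real n + ln (real n + Q + 1) / real n + L =
    (c + ln (real n + Q + 1) + (real n + Q) * L) / real n) sequentially"
   using eventually_gt_at_top[of 0] by eventually_elim (simp add: field_simps)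
 qed
qed

lemma sum_UN_le:
 fixes g :: "'a => real"
 assumes "finite F" "!!b. b \<in> F ==> finite (A b)" "!!x. g x >= 0"
 shows "sum g (\<Union>b\<in>F. A b) <= (\<Sum>b\<in>F. sum g (A b))"
 using assms(1,2)
proof (induction F)
 case (insert b F)
 have "sum g (A b Un (\<Union>b\<in>F. A b)) + sum g (A b Int (\<Union>b\<in>F. A b)) = sum g (A b) + sum g (\<Union>b\<in>F. A b)"
  by (rule sum.union_inter) (use insert in auto)
 moreover have "sum g (A b Int (\<Union>b\<in>F. A b)) >= 0" using assms(3) by (intro sum_nonneg) auto
 ultimately show ?case using insert by simp
qed simp

lemma itinerary_sub:
 assumes "itinerary f X (n + m) x = itinerary f X (n + m) y" "k <= n"
 shows "itinerary f X m ((f ^^ k) x) = itinerary f X m ((f ^^ k) y)"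
proof (rule nth_equalityI)
 fix i assume "i < length (itinerary f X m ((f ^^ k) x))"
 then have i: "i < m" by simp
 have "itinerary f X (n + m) x ! (k + i) = itinerary f X (n + m) y ! (k + i)" using assms(1) by simp
 then show "itinerary f X m ((f ^^ k) x) ! i = itinerary f X m ((f ^^ k) y) ! i"
  using i assms(2) by (simp add: nth_itinerary funpow_add add.commute[of k i])
qed simp

context markov_map
begin

text \<open>The number of letters of an itinerary before the orbit reaches a partition point.\<close>

definition free_length :: "nat list => nat" where
 "free_length w = length (takeWhile (%a. a < N) w)"

definition words_from :: "nat => nat => nat list set" where
 "words_from a n = {itin n x |x. x \<in> {0..1} & lab x = a}"

lemma finite_itin_image: "finite (itin n ` {0..1})"
proof (rule finite_subset)
 show "itin n ` {0..1} \<subseteq> {w. set w \<subseteq> {..<2 * N + 1} & length w = n}"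
  using lab_bound f_pow_unit by (auto simp: itinerary_def simp del: atLeastAtMost_iff)
qed (rule finite_lists_length_eq, simp)

lemma words_from_finite: "finite (words_from a n)"
 by (rule finite_subset[OF _ finite_itin_image[of n]]) (auto simp: words_from_def)

lemma words_from_union: "itin n ` {0..1} = (\<Union>a<2 * N + 1. words_from a n)"
proof
 show "itin n ` {0..1} \<subseteq> (\<Union>a<2 * N + 1. words_from a n)"
 proof
  fix w assume "w \<in> itin n ` {0..1}"
  then obtain x where x: "x \<in> {0..1}" "w = itin n x" by blast
  then have "w \<in> words_from (lab x) n" by (auto simp: words_from_def)
  then show "w \<in> (\<Union>a<2 * N + 1. words_from a n)" using lab_bound[OF x(1)] by blast
 qed
qed (auto simp: words_from_def)

text \<open>After a partition point there is no freedom, whatever \<open>f\<close> does there.\<close>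
lemma words_from_point: "a >= N ==> words_from a n \<subseteq> {itin n (p (a - N))}"
proof
 fix w assume a: "a >= N" and "w \<in> words_from a n"
 then obtain x where x: "x \<in> {0..1}" "lab x = a" "w = itin n x" by (auto simp: words_from_def)
 have "x = p (a - N)"
  by (rule lab_cases[OF x(1)]) (use x(2) a in "auto simp: lab_p")
 then show "w \<in> {itin n (p (a - N))}" using x(3) by simp
qed

lemma words_from_Suc:
 assumes a: "a < N"
 shows "words_from a (Suc n) \<subseteq>
  (#) a ` ((\<Union>b\<in>{b. b < N & adj a b}. words_from b n) Un (\<Union>b\<in>{N..2 * N}. words_from b n))"
proof
 fix w assume "w \<in> words_from a (Suc n)"
 then obtain x where x: "x \<in> {0..1}" "lab x = a" "w = a # itin n (f x)"
  by (auto simp: words_from_def itinerary_Suc)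
 have xa: "x \<in> I a" using lab_in_I[OF x(1)] x(2) a by simp
 have fx: "f x \<in> {0..1}" by (rule f_unit[OF x(1)])
 have mem: "itin n (f x) \<in> words_from (lab (f x)) n" using fx by (auto simp: words_from_def)
 have "itin n (f x) \<in> (\<Union>b\<in>{b. b < N & adj a b}. words_from b n) Un (\<Union>b\<in>{N..2 * N}. words_from b n)"
 proof (cases "lab (f x) < N")
  case True
  then show ?thesis using mem f_adj[OF a True xa lab_in_I[OF fx True]] by auto
 next
  case False
  then show ?thesis using mem lab_bound[OF fx] by (intro UnI2 UN_I[of "lab (f x)"]) auto
 qed
 then show "w \<in> (#) a ` ((\<Union>b\<in>{b. b < N & adj a b}. words_from b n) Un (\<Union>b\<in>{N..2 * N}. words_from b n))"
  unfolding x(3) by (rule imageI)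
qed

end

locale perron_markov_map = transitive_markov_map f N p slope for f N p slope +
 fixes rho :: real and rv lv :: "nat => real"
 assumes rv_pos: "i < N ==> rv i > 0" and lv_pos: "i < N ==> lv i > 0"
  and rv_eigen: "i < N ==> (\<Sum>j<N. (if adj i j then 1 else 0) * rv j) = rho * rv i"
  and lv_eigen: "j < N ==> (\<Sum>i<N. (if adj i j then 1 else 0) * lv i) = rho * lv j"
begin

lemma telescoping_lengths:
 fixes P :: "nat => real"
 assumes "a <= b" "b <= N"
 shows "(\<Sum>j<N. if a <= j & j < b then P (Suc j) - P j else 0) = P b - P a"
proof -
 have "(\<Sum>j<N. if a <= j & j < b then P (Suc j) - P j else 0) = (\<Sum>j\<in>{a..<b}. P (Suc j) - P j)"
  by (rule sum.mono_neutral_cong_right) (use assms in auto)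
 also have "... = P b - P a" using assms(1) by (rule sum_Suc_diff')
 finally show ?thesis .
qed

lemma adj_index:
 assumes i: "i < N" and ab: "a < b" "b <= N" "lower i = p a" "upper i = p b" and j: "j < N"
 shows "adj i j \<longleftrightarrow> a <= j & j < b"
proof -
 have m: "p j < mid j" "mid j < p (Suc j)" using mid_in[OF j] by (auto simp: branch_interval_def)
 have "adj i j \<longleftrightarrow> p a < mid j & mid j < p b" using adj_iff[OF i j mid_in[OF j]] ab by simp
 also have "... \<longleftrightarrow> a <= j & j < b"
 proof
  assume h: "p a < mid j & mid j < p b"
  have "\<not> j < a" using p_mono[of "Suc j" a] ab h m by auto
  moreover have "\<not> b <= j" using p_mono[of b j] j h m by auto
  ultimately show "a <= j & j < b" by simp
 next
  assume h: "a <= j & j < b"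
  then show "p a < mid j & mid j < p b" using p_mono[of a j] p_mono[of "Suc j" b] ab j m by auto
 qed
 finally show ?thesis .
qed

text \<open>The lengths of the intervals satisfy \<open>A len = slope len\<close>; compare them with the Perron eigenvector where the ratio is smallest.\<close>
lemma rho_gt_1: "rho > 1"
proof -
 define len where "len j = p (Suc j) - p j" for j
 have len: "len j > 0" if "j < N" for j using p_less[OF that] by (simp add: len_def)
 have len_sum: "(\<Sum>j<N. (if adj i j then 1 else 0) * len j) = slope i * len i" if i: "i < N" for i
 proof -
  obtain a b where ab: "a < b" "b <= N" "lower i = p a" "upper i = p b" using lower_upper_partition[OF i] .
  have "(\<Sum>j<N. (if adj i j then 1 else 0) * len j) = (\<Sum>j<N. if a <= j & j < b then p (Suc j) - p j else 0)"
   by (intro sum.cong refl) (use adj_index[OF i ab] in "auto simp: len_def")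
  also have "... = upper i - lower i" using telescoping_lengths[of a b p] ab by simp
  finally show ?thesis by (simp add: upper_lower len_def)
 qed
 define c where "c = Min ((%i. rv i / len i) ` {..<N})"
 have fin: "finite ((%i. rv i / len i) ` {..<N})" "(%i. rv i / len i) ` {..<N} ~= {}" using N_pos by auto
 obtain i where i: "i < N" "c = rv i / len i" using Min_in[OF fin] unfolding c_def by auto
 have c_le: "c * len j <= rv j" if "j < N" for j
 proof -
  have "c <= rv j / len j" unfolding c_def by (rule Min_le[OF fin(1)]) (use that in auto)
  then show ?thesis using len[OF that] by (simp add: field_simps)
 qed
 have c: "c > 0" using i rv_pos[OF i(1)] len[OF i(1)] by simp
 have "rate * rv i = rate * (c * len i)" using i len[OF i(1)] by simp
 also have "... <= slope i * (c * len i)" using slope_ge_rate[OF i(1)] c len[OF i(1)] by (intro mult_right_mono) auto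
 also have "... = (\<Sum>j<N. (if adj i j then 1 else 0) * (c * len j))"
  using arg_cong[OF len_sum[OF i(1)], of "(*) c"] by (simp add: sum_distrib_left mult_ac)
 also have "... <= (\<Sum>j<N. (if adj i j then 1 else 0) * rv j)"
  by (intro sum_mono mult_left_mono c_le) auto
 also have "... = rho * rv i" by (rule rv_eigen[OF i(1)])
 finally show ?thesis using rv_pos[OF i(1)] rate_gt_1 by simp
qed

text \<open>Weighting a word by its letters before the first partition point makes the recursion for the intervals that of the Perron eigenvector; the words through a partition point add at most a constant at each step.\<close>
lemma weighted_count_from:
 obtains c where "c > 0" "!!a n. a < N ==> (\<Sum>w\<in>words_from a n. (1 / rho) ^ free_length w) <= c * rv a * (real n + 1)"
proof -
 define c where "c = (\<Sum>i<N. (real N + 1) / rv i)"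
 have c: "real N + 1 <= c * rv a" if "a < N" for a
 proof -
  have "(real N + 1) / rv a <= c" unfolding c_def
   by (rule member_le_sum) (use that rv_pos in "auto intro!: divide_nonneg_pos")
  then show ?thesis using rv_pos[OF that] by (simp add: field_simps)
 qed
 have c0: "c > 0"
 proof -
  have "c * rv 0 > 0" using c[OF N_pos] N_pos by simp
  then show ?thesis using rv_pos[OF N_pos] by (simp add: zero_less_mult_iff)
 qed
 have q: "0 <= 1 / rho" "1 / rho <= 1" using rho_gt_1 by auto
 let ?y = "%a n. \<Sum>w\<in>words_from a n. (1 / rho) ^ free_length w"
 have y_nn: "?y a n >= 0" for a n using q by (intro sum_nonneg) auto
 have point: "?y a n <= 1" if "a >= N" for a n
 proof -
  have "?y a n <= (\<Sum>w\<in>{itin n (p (a - N))}. (1 / rho) ^ free_length w)"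
   by (rule sum_mono2) (use words_from_point[OF that] q in auto)
  also have "... <= 1" using q by (simp add: power_le_one)
  finally show ?thesis .
 qed
 have "?y a n <= c * rv a * (real n + 1)" if "a < N" for a n
  using that
 proof (induction n arbitrary: a)
  case 0
  have "words_from a 0 \<subseteq> {[]}" by (auto simp: words_from_def)
  then have "?y a 0 <= (\<Sum>w\<in>{[]}. (1 / rho) ^ free_length w)" by (rule sum_mono2[rotated]) (use q in auto)
  also have "... = 1" by (simp add: free_length_def)
  finally show ?case using c[OF 0] by simp
 next
  case (Suc n)
  let ?A = "\<Union>b\<in>{b. b < N & adj a b}. words_from b n" and ?B = "\<Union>b\<in>{N..2 * N}. words_from b n"
  have UN: "(\<Sum>w\<in>(\<Union>b\<in>F. words_from b n). (1 / rho) ^ free_length w) <= (\<Sum>b\<in>F. ?y b n)" if "finite F" for F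
   by (rule sum_UN_le) (use that words_from_finite q in auto)
  have "?y a (Suc n) <= (\<Sum>w\<in>(#) a ` (?A Un ?B). (1 / rho) ^ free_length w)"
   by (rule sum_mono2) (use words_from_Suc[OF Suc.prems] words_from_finite q in auto)
  also have "... = (\<Sum>w\<in>?A Un ?B. (1 / rho) ^ Suc (free_length w))"
   using Suc.prems by (subst sum.reindex) (auto simp: free_length_def)
  also have "... = 1 / rho * (\<Sum>w\<in>?A Un ?B. (1 / rho) ^ free_length w)" by (simp add: sum_distrib_left)
  also have "... <= 1 / rho * ((\<Sum>w\<in>?A. (1 / rho) ^ free_length w) + (\<Sum>w\<in>?B. (1 / rho) ^ free_length w))"
  proof (rule mult_left_mono[OF _ q(1)])
   have "(\<Sum>w\<in>?A Un ?B. (1 / rho) ^ free_length w) + (\<Sum>w\<in>?A Int ?B. (1 / rho) ^ free_length w) =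
     (\<Sum>w\<in>?A. (1 / rho) ^ free_length w) + (\<Sum>w\<in>?B. (1 / rho) ^ free_length w)"
    by (rule sum.union_inter) (use words_from_finite in auto)
   moreover have "(\<Sum>w\<in>?A Int ?B. (1 / rho) ^ free_length w) >= 0" using q by (intro sum_nonneg) auto
   ultimately show "(\<Sum>w\<in>?A Un ?B. (1 / rho) ^ free_length w) <=
     (\<Sum>w\<in>?A. (1 / rho) ^ free_length w) + (\<Sum>w\<in>?B. (1 / rho) ^ free_length w)" by simp
  qed
  also have "... <= 1 / rho * ((\<Sum>b\<in>{b. b < N & adj a b}. ?y b n) + (\<Sum>b\<in>{N..2 * N}. ?y b n))"
   by (intro mult_left_mono[OF _ q(1)] add_mono UN) auto
  also have "... <= 1 / rho * ((\<Sum>b\<in>{b. b < N & adj a b}. c * rv b * (real n + 1)) + (\<Sum>b\<in>{N..2 * N}. 1))"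
   by (intro mult_left_mono[OF _ q(1)] add_mono sum_mono Suc.IH point) auto
  also have "(\<Sum>b\<in>{b. b < N & adj a b}. c * rv b * (real n + 1)) = c * (real n + 1) * (rho * rv a)"
  proof -
   have "(\<Sum>b\<in>{b. b < N & adj a b}. c * rv b * (real n + 1)) = (\<Sum>b<N. c * (real n + 1) * ((if adj a b then 1 else 0) * rv b))"
    by (rule sum.mono_neutral_cong_left) auto
   then show ?thesis using rv_eigen[OF Suc.prems] by (simp add: sum_distrib_left[symmetric])
  qed
  also have "1 / rho * (c * (real n + 1) * (rho * rv a) + (\<Sum>b\<in>{N..2 * N}. 1)) = c * rv a * (real n + 1) + (real N + 1) / rho"
   using rho_gt_1 by (simp add: field_simps)
  also have "... <= c * rv a * (real n + 1) + c * rv a"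
  proof -
   have "(real N + 1) / rho <= real N + 1" using rho_gt_1 by (simp add: divide_le_eq)
   then show ?thesis using c[OF Suc.prems] by linarith
  qed
  also have "... = c * rv a * (real (Suc n) + 1)" by (simp add: algebra_simps)
  finally show ?case .
 qed
 with c0 show thesis by (rule that)
qed

lemma weighted_count:
 obtains C where "C >= 1" "!!n. (\<Sum>w\<in>itin n ` {0..1}. (1 / rho) ^ free_length w) <= C * (real n + 1)"
proof -
 obtain c where c: "c > 0" "!!a n. a < N ==> (\<Sum>w\<in>words_from a n. (1 / rho) ^ free_length w) <= c * rv a * (real n + 1)"
  using weighted_count_from by blast
 have q: "0 <= 1 / rho" "1 / rho <= 1" using rho_gt_1 by auto
 define C where "C = (\<Sum>a<2 * N + 1. if a < N then c * rv a else 1)"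
 have "(1::real) <= C"
 proof -
  have "(%a. if a < N then c * rv a else 1) N <= C" unfolding C_def
   by (rule member_le_sum) (use c(1) rv_pos in "auto intro: less_imp_le")
  then show ?thesis by simp
 qed
 moreover have "(\<Sum>w\<in>itin n ` {0..1}. (1 / rho) ^ free_length w) <= C * (real n + 1)" for n
 proof -
  have "(\<Sum>w\<in>itin n ` {0..1}. (1 / rho) ^ free_length w) <= (\<Sum>a<2 * N + 1. \<Sum>w\<in>words_from a n. (1 / rho) ^ free_length w)"
   unfolding words_from_union by (rule sum_UN_le) (use words_from_finite q in auto)
  also have "... <= (\<Sum>a<2 * N + 1. (if a < N then c * rv a else 1) * (real n + 1))"
  proof (rule sum_mono)
   fix a
   show "(\<Sum>w\<in>words_from a n. (1 / rho) ^ free_length w) <= (if a < N then c * rv a else 1) * (real n + 1)"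
   proof (cases "a < N")
    case False
    have "(\<Sum>w\<in>words_from a n. (1 / rho) ^ free_length w) <= (\<Sum>w\<in>{itin n (p (a - N))}. (1 / rho) ^ free_length w)"
     by (rule sum_mono2) (use words_from_point[of a n] False q in auto)
    also have "... <= 1" using q by (simp add: power_le_one)
    finally show ?thesis using False by simp
   qed (use c(2) in simp)
  qed
  finally show ?thesis unfolding C_def sum_distrib_right .
 qed
 ultimately show thesis by (rule that)
qed

lemma word_count_upper:
 obtains C where "C >= 1" "!!n. real (card (itin n ` {0..1})) <= C * (real n + 1) * rho ^ n"
proof -
 obtain C where C: "C >= 1" "!!n. (\<Sum>w\<in>itin n ` {0..1}. (1 / rho) ^ free_length w) <= C * (real n + 1)"
  using weighted_count by blast
 have "real (card (itin n ` {0..1})) <= C * (real n + 1) * rho ^ n" for n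
 proof -
  have "real (card (itin n ` {0..1})) * (1 / rho) ^ n = (\<Sum>w\<in>itin n ` {0..1}. (1 / rho) ^ n)" by simp
  also have "... <= (\<Sum>w\<in>itin n ` {0..1}. (1 / rho) ^ free_length w)"
  proof (rule sum_mono)
   fix w assume "w \<in> itin n ` {0..1}"
   then have "free_length w <= n" unfolding free_length_def
    using length_takeWhile_le[of "%a. a < N" w] by auto
   then show "(1 / rho) ^ n <= (1 / rho) ^ free_length w" using rho_gt_1 by (intro power_decreasing) auto
  qed
  also have "... <= C * (real n + 1)" by (rule C(2))
  finally have "real (card (itin n ` {0..1})) * (1 / rho) ^ n * rho ^ n <= C * (real n + 1) * rho ^ n"
   using rho_gt_1 by (intro mult_right_mono) auto
  then show ?thesis using rho_gt_1 by (simp add: power_divide)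
 qed
 with C(1) show thesis by (rule that)
qed

definition free_words :: "nat => nat => nat list set" where
 "free_words a n = {itin n x |x. x \<in> I a & x \<notin> Z n}"

lemma free_words_Suc:
 assumes a: "a < N" and b: "b < N" "adj a b" and w: "w \<in> free_words b n"
 shows "a # w \<in> free_words a (Suc n)"
proof -
 obtain y where y: "y \<in> I b" "y \<notin> Z n" "w = itin n y" using w by (auto simp: free_words_def)
 let ?x = "inv_branch a y"
 have x: "?x \<in> I a" using adj_inv_branch_in[OF a b(1) y(1)] b(2) by simp
 have fx: "f ?x = y" by (rule f_inv_branch[OF a x])
 have "?x \<notin> Z (Suc n)"
  unfolding Z_Suc using y(2) fx I_U[OF a x] p_notin_U by auto
 moreover have "itin (Suc n) ?x = a # w" using fx y(3) lab_I[OF a x] by (simp add: itinerary_Suc)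
 ultimately show ?thesis using x unfolding free_words_def by (metis (mono_tags, lifting) mem_Collect_eq)
qed

lemma free_words_hd: "a < N ==> w \<in> free_words a (Suc n) ==> hd w = a"
 by (auto simp: free_words_def itinerary_Suc lab_I)

lemma free_words_finite: "a < N ==> finite (free_words a n)"
 by (rule finite_subset[OF _ finite_itin_image[of n]]) (use I_unit in "auto simp: free_words_def")

lemma free_word_count:
 obtains c where "c > 0" "!!n. real (card (free_words 0 (Suc n))) >= c * rho ^ n"
proof -
 define M where "M = (\<Sum>i<N. rv i)"
 have M: "rv i <= M" if "i < N" for i
  unfolding M_def by (rule member_le_sum) (use that rv_pos in "auto intro: less_imp_le")
 have M0: "M > 0" using M[OF N_pos] rv_pos[OF N_pos] by linarith
 have "real (card (free_words a (Suc n))) >= rv a / M * rho ^ n" if "a < N" for a n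
  using that
 proof (induction n arbitrary: a)
  case 0
  have "itin (Suc 0) (mid a) \<in> free_words a (Suc 0)"
   using mid_in[OF 0] I_U[OF 0 mid_in[OF 0]] by (auto simp: free_words_def Z_def)
  then have "card (free_words a (Suc 0)) > 0" using free_words_finite[OF 0] card_gt_0_iff by blast
  moreover have "rv a / M <= 1" using M[OF 0] M0 by simp
  ultimately show ?case by simp
 next
  case (Suc n)
  let ?F = "{b. b < N & adj a b}"
  have disj: "free_words b (Suc n) Int free_words b' (Suc n) = {}" if "b < N" "b' < N" "b ~= b'" for b b'
   using free_words_hd that by blast
  have "(#) a ` (\<Union>b\<in>?F. free_words b (Suc n)) \<subseteq> free_words a (Suc (Suc n))"
   using free_words_Suc[OF Suc.prems] by auto
  then have "card ((#) a ` (\<Union>b\<in>?F. free_words b (Suc n))) <= card (free_words a (Suc (Suc n)))"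
   by (rule card_mono[OF free_words_finite[OF Suc.prems]])
  moreover have "card ((#) a ` (\<Union>b\<in>?F. free_words b (Suc n))) = card (\<Union>b\<in>?F. free_words b (Suc n))"
   by (rule card_image) simp
  moreover have "card (\<Union>b\<in>?F. free_words b (Suc n)) = (\<Sum>b\<in>?F. card (free_words b (Suc n)))"
   by (rule card_UN_disjoint) (use free_words_finite disj in auto)
  ultimately have "real (card (free_words a (Suc (Suc n)))) >= (\<Sum>b\<in>?F. real (card (free_words b (Suc n))))"
   by (metis of_nat_le_iff of_nat_sum)
  moreover have "(\<Sum>b\<in>?F. real (card (free_words b (Suc n)))) >= (\<Sum>b\<in>?F. rv b / M * rho ^ n)"
   by (intro sum_mono Suc.IH) simp
  moreover have "(\<Sum>b\<in>?F. rv b / M * rho ^ n) = rv a / M * rho ^ Suc n"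
  proof -
   have "(\<Sum>b\<in>?F. rv b / M * rho ^ n) = (\<Sum>b<N. rho ^ n / M * ((if adj a b then 1 else 0) * rv b))"
    by (rule sum.mono_neutral_cong_left) auto
   also have "... = rho ^ n / M * (rho * rv a)"
    unfolding sum_distrib_left[symmetric] rv_eigen[OF Suc.prems] ..
   finally show ?thesis by simp
  qed
  ultimately show ?case by linarith
 qed
 from this[OF N_pos] show thesis
  using that[of "rv 0 / M"] rv_pos[OF N_pos] M0 by simp
qed

lemma topological_entropy_le: "topological_entropy f <= ereal (ln rho)"
 unfolding topological_entropy_def
proof (rule SUP_least)
 fix e :: real assume "e \<in> {0<..}"
 then obtain q where q: "(1 / rate) ^ q < e" using real_arch_pow_inv[of e "1 / rate"] rate_gt_1 by auto
 obtain C where C: "C >= 1" "!!n. real (card (itin n ` {0..1})) <= C * (real n + 1) * rho ^ n"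
  using word_count_upper by blast
 define b where "b n = (ln C + ln (real n + real q + 1) + (real n + real q) * ln rho) / real n" for n
 have "b \<longlonglongrightarrow> ln rho"
  unfolding b_def[abs_def] by (rule entropy_bound_limit) simp
 then have lim: "limsup (%n. ereal (b n)) = ereal (ln rho)"
  by (intro lim_imp_Limsup tendsto_ereal) auto
 have "eventually (%n. (SUP E\<in>{E. separated f n e E}. ereal (ln (real (card E)) / real n)) <= ereal (b n)) sequentially"
  using eventually_gt_at_top[of 0]
 proof eventually_elim
  case (elim n)
  show ?case
  proof (rule SUP_least)
   fix E assume "E \<in> {E. separated f n e E}"
   then have E: "finite E" "E \<subseteq> {0..1}" and sep: "!!x y. x \<in> E ==> y \<in> E ==> x ~= y ==> EX k<n. dist ((f ^^ k) x) ((f ^^ k) y) > e"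
    by (auto simp: separated_def)
   have "inj_on (itin (n + q)) E"
   proof (rule inj_onI, rule ccontr)
    fix x y assume xy: "x \<in> E" "y \<in> E" "itin (n + q) x = itin (n + q) y" "x ~= y"
    obtain k where k: "k < n" "dist ((f ^^ k) x) ((f ^^ k) y) > e" using sep[OF xy(1,2,4)] by blast
    have "\<bar>(f ^^ k) x - (f ^^ k) y\<bar> <= (1 / rate) ^ q"
     by (rule itin_close[OF f_pow_unit f_pow_unit itinerary_sub[OF xy(3)]]) (use xy E k in auto)
    then show False using k(2) q by (simp add: dist_real_def)
   qed
   then have "card E = card (itin (n + q) ` E)" by (rule card_image[symmetric])
   also have "... <= card (itin (n + q) ` {0..1})"
    by (rule card_mono[OF finite_itin_image image_mono[OF E(2)]])
   finally have "real (card E) <= real (card (itin (n + q) ` {0..1}))" by simp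
   also have "... <= C * (real (n + q) + 1) * rho ^ (n + q)" by (rule C(2))
   finally have le: "real (card E) <= C * (real (n + q) + 1) * rho ^ (n + q)" .
   have "1 * 1 * 1 <= C * (real (n + q) + 1) * rho ^ (n + q)"
    using C(1) rho_gt_1 by (intro mult_mono) (auto intro: one_le_power)
   then have "ln (real (card E)) <= ln (C * (real (n + q) + 1) * rho ^ (n + q))"
    using le by (cases "card E = 0") (auto simp: ln_ge_zero)
   also have "... = ln C + ln (real n + real q + 1) + (real n + real q) * ln rho"
    using C(1) rho_gt_1 by (simp add: ln_mult ln_realpow add_nonneg_eq_0_iff)
   finally show "ereal (ln (real (card E)) / real n) <= ereal (b n)"
    unfolding b_def by (simp add: divide_right_mono)
  qed
 qed
 then show "limsup (%n. SUP E\<in>{E. separated f n e E}. ereal (ln (real (card E)) / real n)) <= ereal (ln rho)"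
  unfolding lim[symmetric] by (rule Limsup_mono)
qed

lemma Z_add: "x \<in> {0..1} ==> x \<notin> Z (k + m) ==> (f ^^ k) x \<notin> Z m"
proof
 assume x: "x \<in> {0..1}" "x \<notin> Z (k + m)" and "(f ^^ k) x \<in> Z m"
 then obtain i where i: "i < m" "(f ^^ i) ((f ^^ k) x) \<notin> U" by (auto simp: Z_def)
 then have "(f ^^ (k + i)) x \<notin> U" by (simp add: funpow_add add.commute[of k])
 moreover have "k + i < k + m" using i by simp
 ultimately show False using x by (auto simp: Z_def)
qed

text \<open>If \<open>x\<close> and \<open>y\<close> are closer than the gaps of \<open>S\<close>, at most one point of \<open>S\<close> lies between them, and parity detects it.\<close>
lemma parity_separates:
 fixes S :: "real set"
 assumes S: "finite S" and gap: "!!z z'. z \<in> S ==> z' \<in> S ==> z ~= z' ==> e <= \<bar>z - z'\<bar>"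
  and xy: "x <= y" "y - x <= e" "y \<notin> S" and par: "even (card {z \<in> S. z < x}) = even (card {z \<in> S. z < y})"
 shows "{x..y} Int S = {}"
proof (rule ccontr)
 assume "{x..y} Int S ~= {}"
 then obtain z where z: "z \<in> S" "x <= z" "z <= y" by auto
 have "z ~= y" using z(1) xy(3) by blast
 then have zy: "z < y" using z(3) by simp
 have uniq: "w = z" if "w \<in> S" "x <= w" "w < y" for w
 proof (rule ccontr)
  assume "w ~= z"
  from gap[OF that(1) z(1) this] have "e <= \<bar>w - z\<bar>" .
  then show False using that z zy xy(2) by linarith
 qed
 have "{w \<in> S. w < y} = insert z {w \<in> S. w < x}"
 proof (rule Set.set_eqI)
  fix w show "w \<in> {w \<in> S. w < y} \<longleftrightarrow> w \<in> insert z {w \<in> S. w < x}"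
   using uniq[of w] z(1) zy xy(1) by (cases "w < x") auto
 qed
 then have "card {w \<in> S. w < y} = Suc (card {w \<in> S. w < x})" using z S by simp
 then show False using par by simp
qed

text \<open>Points on two sides of a point of \<open>Z l\<close> can stay close although their words differ. Colouring orbits by the parities at times \<open>k l\<close> and keeping the most frequent colour costs a factor \<open>2^n\<close>, negligible for large \<open>l\<close>.\<close>
lemma separated_words:
 assumes e: "!!z z'. z \<in> Z l ==> z' \<in> Z l ==> z ~= z' ==> e <= \<bar>z - z'\<bar>" and l: "l >= 1"
 shows "EX E. separated f (n * l) e E & real (card (free_words 0 (n * l))) <= 2 ^ n * real (card E)"
proof -
 let ?W = "free_words 0 (n * l)"
 define r where "r w = (SOME x. x \<in> I 0 & x \<notin> Z (n * l) & itin (n * l) x = w)" for w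
 have r: "r w \<in> I 0" "r w \<notin> Z (n * l)" "itin (n * l) (r w) = w" if "w \<in> ?W" for w
 proof -
  have "EX x. x \<in> I 0 & x \<notin> Z (n * l) & itin (n * l) x = w" using that by (auto simp: free_words_def)
  from someI_ex[OF this] show "r w \<in> I 0" "r w \<notin> Z (n * l)" "itin (n * l) (r w) = w" by (auto simp: r_def)
 qed
 define c where "c x = map (%k. even (card {z \<in> Z l. z < (f ^^ (k * l)) x})) [0..<n]" for x
 let ?C = "{s :: bool list. set s \<subseteq> UNIV & length s = n}"
 have C: "finite ?C" "card ?C = 2 ^ n" using finite_lists_length_eq[of "UNIV :: bool set" n] card_lists_length_eq[of "UNIV :: bool set" n] by auto
 have finW: "finite ?W" by (rule free_words_finite[OF N_pos])
 define F where "F s = {w \<in> ?W. c (r w) = s}" for s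
 have "EX s:?C. real (card ?W) <= 2 ^ n * real (card (F s))"
 proof (rule ccontr)
  assume neg: "\<not> ?thesis"
  have "?W = (\<Union>s\<in>?C. F s)" by (auto simp: F_def c_def)
  then have "card ?W <= (\<Sum>s\<in>?C. card (F s))" using card_UN_le[OF C(1)] by simp
  then have "real (card ?W) <= (\<Sum>s\<in>?C. real (card (F s)))" by (metis of_nat_le_iff of_nat_sum)
  also have "... < (\<Sum>s\<in>?C. real (card ?W) / 2 ^ n)"
  proof (rule sum_strict_mono[OF C(1)])
   show "?C ~= {}" using C(2) by force
   show "real (card (F s)) < real (card ?W) / 2 ^ n" if "s \<in> ?C" for s
    using neg that by (auto simp: field_simps not_le)
  qed
  also have "... = real (card ?W)" using C(2) by simp
  finally show False by simp
 qed
 then obtain s where s: "real (card ?W) <= 2 ^ n * real (card (F s))" by blast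
 have injr: "inj_on r (F s)" by (rule inj_on_inverseI[of _ "itin (n * l)"]) (use r in "auto simp: F_def")
 have "separated f (n * l) e (r ` F s)"
  unfolding separated_def
 proof (intro conjI ballI impI)
  show "finite (r ` F s)" using finW by (simp add: F_def)
  show "r ` F s \<subseteq> {0..1}" using r(1) set_mp[OF I_unit[OF N_pos]] by (auto simp: F_def simp del: atLeastAtMost_iff)
  fix x y assume x: "x \<in> r ` F s" and y: "y \<in> r ` F s" and ne: "x ~= y"
  have xy: "x \<in> {0..1}" "x \<notin> Z (n * l)" "y \<in> {0..1}" "y \<notin> Z (n * l)" "c x = c y"
   "r (itin (n * l) x) = x" "r (itin (n * l) y) = y"
   using x y r set_mp[OF I_unit[OF N_pos]] by (auto simp: F_def simp del: atLeastAtMost_iff)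
  show "EX k<n * l. dist ((f ^^ k) x) ((f ^^ k) y) > e"
  proof (rule ccontr)
   assume "\<not> ?thesis"
   then have close: "\<bar>(f ^^ k) x - (f ^^ k) y\<bar> <= e" if "k < n * l" for k
    using that unfolding dist_real_def by (meson not_less)
   have block: "itin l ((f ^^ (k * l)) x) = itin l ((f ^^ (k * l)) y)" if k: "k < n" for k
   proof -
    let ?x = "(f ^^ (k * l)) x" and ?y = "(f ^^ (k * l)) y"
    have kl: "k * l + l <= n * l" using k by (metis Suc_leI add.commute mult_Suc mult_le_mono1)
    have "Z (k * l + l) \<subseteq> Z (n * l)" unfolding Z_def using less_le_trans[OF _ kl] by blast
    then have nz: "?x \<notin> Z l" "?y \<notin> Z l" using Z_add xy by blast+
    have u: "?x \<in> {0..1}" "?y \<in> {0..1}" using f_pow_unit xy by blast+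
    have "c x ! k = c y ! k" using xy(5) by simp
    then have par: "even (card {z \<in> Z l. z < ?x}) = even (card {z \<in> Z l. z < ?y})" using k by (simp add: c_def)
    have d: "\<bar>?x - ?y\<bar> <= e" by (rule close) (use kl l in linarith)
    show ?thesis
    proof (cases "?x <= ?y")
     case True
     have "{?x..?y} Int Z l = {}"
      by (rule parity_separates[OF Z_finite e True _ nz(2) par]) (use d in auto)
     then show ?thesis by (rule itin_eq_between[OF u True])
    next
     case False
     then have le: "?y <= ?x" by simp
     have "{?y..?x} Int Z l = {}"
      by (rule parity_separates[OF Z_finite e le _ nz(1) par[symmetric]]) (use d in auto)
     then show ?thesis by (rule itin_eq_between[OF u(2,1) le, symmetric])
    qed
   qed
   have "itin (n * l) x = itin (n * l) y"
   proof (rule nth_equalityI)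
    fix i assume "i < length (itin (n * l) x)"
    then have i: "i < n * l" by simp
    define k j where "k = i div l" and "j = i mod l"
    have kj: "k < n" "j < l" "i = j + k * l" using i l by (auto simp: k_def j_def less_mult_imp_div_less)
    have "lab ((f ^^ j) ((f ^^ (k * l)) x)) = lab ((f ^^ j) ((f ^^ (k * l)) y))"
     using block[OF kj(1)] kj(2) by (metis nth_itinerary)
    then show "itin (n * l) x ! i = itin (n * l) y ! i"
     using i unfolding kj(3) by (simp add: nth_itinerary funpow_add)
   qed simp
   then show False using xy(6,7) ne by metis
  qed
 qed
 moreover have "card (r ` F s) = card (F s)" by (rule card_image[OF injr])
 ultimately show ?thesis using s by metis
qed

lemma topological_entropy_ge_approx:
 assumes l: "l >= 1"
 shows "ereal (ln rho - ln 2 / real l) <= topological_entropy f"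
proof -
 define D where "D = insert 1 ((%(z, z'). \<bar>z - z'\<bar>) ` {(z, z'). z \<in> Z l & z' \<in> Z l & z ~= z'})"
 have "finite {(z, z'). z \<in> Z l & z' \<in> Z l & z ~= z'}"
  by (rule finite_subset[of _ "Z l \<times> Z l"]) (use Z_finite in auto)
 then have fD: "finite D" by (simp add: D_def)
 define e where "e = Min D"
 have e0: "e > 0" unfolding e_def by (subst Min_gr_iff) (use fD in "auto simp: D_def")
 have e: "e <= \<bar>z - z'\<bar>" if "z \<in> Z l" "z' \<in> Z l" "z ~= z'" for z z'
  unfolding e_def by (rule Min_le[OF fD]) (use that in "auto simp: D_def")
 obtain c where c: "c > 0" "!!n. real (card (free_words 0 (Suc n))) >= c * rho ^ n"
  using free_word_count by blast
 let ?S = "%n. SUP E\<in>{E. separated f n e E}. ereal (ln (real (card E)) / real n)"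
 define b where "b n = (ln c - ln rho) / real l / real n + (ln rho - ln 2 / real l)" for n
 have b_le: "ereal (b n) <= (?S \<circ> (%n. n * l)) n" if n: "n > 0" for n
 proof -
  obtain E where E: "separated f (n * l) e E" "real (card (free_words 0 (n * l))) <= 2 ^ n * real (card E)"
   using separated_words[OF e l] by blast
  have nl: "n * l >= 1" using n l by simp
  have "c * rho ^ (n * l - 1) <= real (card (free_words 0 (n * l)))" using c(2)[of "n * l - 1"] nl by simp
  then have ge: "c * rho ^ (n * l - 1) <= 2 ^ n * real (card E)" using E(2) by simp
  have pos: "c * rho ^ (n * l - 1) > 0" using c(1) rho_gt_1 by simp
  then have E0: "real (card E) > 0" using ge by (cases "card E = 0") auto
  have "ln (c * rho ^ (n * l - 1)) <= ln (2 ^ n * real (card E))" using ge pos by simp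
  moreover have "ln (c * rho ^ (n * l - 1)) = ln c + (real n * real l - 1) * ln rho"
   using c(1) rho_gt_1 nl by (simp add: ln_mult ln_realpow of_nat_diff)
  moreover have "ln (2 ^ n * real (card E)) = real n * ln 2 + ln (real (card E))"
   using E0 by (simp add: ln_mult ln_realpow)
  ultimately have "ln c + (real n * real l - 1) * ln rho - real n * ln 2 <= ln (real (card E))" by simp
  then have "(ln c + (real n * real l - 1) * ln rho - real n * ln 2) / real (n * l) <= ln (real (card E)) / real (n * l)"
   by (rule divide_right_mono) simp
  moreover have "b n = (ln c + (real n * real l - 1) * ln rho - real n * ln 2) / real (n * l)"
   using n l unfolding b_def by (simp add: field_simps)
  ultimately have "ereal (b n) <= ereal (ln (real (card E)) / real (n * l))" by simp
  also have "... <= ?S (n * l)" by (rule SUP_upper) (use E in simp)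
  finally show ?thesis by simp
 qed
 have "(%n. (ln c - ln rho) / real l / real n) \<longlonglongrightarrow> 0" by (rule lim_const_over_n)
 from tendsto_add[OF this tendsto_const] have "b \<longlonglongrightarrow> ln rho - ln 2 / real l"
  unfolding b_def[abs_def] by simp
 then have "ereal (ln rho - ln 2 / real l) = limsup (%n. ereal (b n))"
  by (intro lim_imp_Limsup[symmetric] tendsto_ereal) auto
 also have "... <= limsup (?S \<circ> (%n. n * l))"
  by (rule Limsup_mono, rule eventually_mono[OF eventually_gt_at_top[of 0]]) (rule b_le)
 also have "... <= limsup ?S"
  by (rule limsup_subseq_mono) (use l in "auto simp: strict_mono_def")
 also have "... <= topological_entropy f"
  unfolding topological_entropy_def by (rule SUP_upper) (use e0 in simp)
 finally show ?thesis .
qed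

theorem topological_entropy_eq: "topological_entropy f = ereal (ln rho)"
proof (rule antisym[OF topological_entropy_le])
 have "(%l. ln 2 / real l) \<longlonglongrightarrow> 0" by (rule lim_const_over_n)
 from tendsto_diff[OF tendsto_const this] have "(%l. ln rho - ln 2 / real l) \<longlonglongrightarrow> ln rho" by simp
 then have "(%l. ereal (ln rho - ln 2 / real l)) \<longlonglongrightarrow> ereal (ln rho)" by (rule tendsto_ereal)
 then show "ereal (ln rho) <= topological_entropy f"
  by (rule LIMSEQ_le_const2) (use topological_entropy_ge_approx in "auto intro: exI[of _ 1]")
qed

end

section \<open>Entropy of finite partitions\<close>

definition mass :: "real measure => (real => 'a) => 'a => real" where
 "mass M X v = measure M (X -` {v} Int space M)"

lemma mass_nonneg: "mass M X v >= 0"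
 by (simp add: mass_def)

lemma integral_simple_comp:
 fixes g :: "'a => real" and M :: "real measure"
 assumes M: "prob_space M" and X: "simple_function M X" and S: "finite S" "X ` space M \<subseteq> S"
 shows "integrable M (%x. g (X x))" and "(\<integral>x. g (X x) \<partial>M) = (\<Sum>v\<in>S. g v * mass M X v)"
proof -
 interpret prob_space M by fact
 have A: "X -` {v} Int space M \<in> sets M" for v by (rule simple_functionD(2)[OF X])
 have eq: "g (X x) = (\<Sum>v\<in>S. g v * indicator (X -` {v} Int space M) x)" if x: "x \<in> space M" for x
 proof -
  have "(\<Sum>v\<in>S. g v * indicator (X -` {v} Int space M) x) = (\<Sum>v\<in>S. if v = X x then g v else 0)"
   by (intro sum.cong refl) (use x in "auto simp: indicator_def")
  then show ?thesis using S x by auto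
 qed
 have i: "integrable M (%x. g v * indicator (X -` {v} Int space M) x)" for v
  using A by (auto intro!: integrable_mult_right integrable_real_indicator simp: emeasure_eq_measure)
 have "integrable M (%x. g (X x)) \<longleftrightarrow> integrable M (%x. \<Sum>v\<in>S. g v * indicator (X -` {v} Int space M) x)"
  by (rule Bochner_Integration.integrable_cong[OF refl eq])
 then show "integrable M (%x. g (X x))"
  using Bochner_Integration.integrable_sum[of S M "%v x. g v * indicator (X -` {v} Int space M) x"] i by simp
 have "(\<integral>x. g (X x) \<partial>M) = (\<integral>x. (\<Sum>v\<in>S. g v * indicator (X -` {v} Int space M) x) \<partial>M)"
  by (rule Bochner_Integration.integral_cong[OF refl eq])
 also have "... = (\<Sum>v\<in>S. (\<integral>x. g v * indicator (X -` {v} Int space M) x \<partial>M))"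
  by (rule Bochner_Integration.integral_sum) (rule i)
 also have "... = (\<Sum>v\<in>S. g v * mass M X v)"
  using A by (simp add: mass_def)
 finally show "(\<integral>x. g (X x) \<partial>M) = (\<Sum>v\<in>S. g v * mass M X v)" .
qed

lemma sum_mass:
 assumes M: "prob_space M" and X: "simple_function M X" and S: "finite S" "X ` space M \<subseteq> S"
 shows "(\<Sum>v\<in>S. mass M X v) = 1"
 using integral_simple_comp(2)[OF assms, of "%_. 1"] prob_space.prob_space[OF M] by simp

lemma partition_entropy_integral:
 assumes M: "prob_space M" and X: "simple_function M X"
 shows "partition_entropy M X = - (\<integral>x. ln (mass M X (X x)) \<partial>M)"
proof -
 interpret prob_space M by fact
 interpret information_space M "exp 1" by unfold_locales simp
 have fin: "finite (X ` space M)" by (rule simple_functionD(1)[OF X])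
 have "simple_distributed M X (mass M X)"
  using X by (rule simple_distributedI) (auto simp: mass_def)
 then have "partition_entropy M X = - (\<Sum>v\<in>X ` space M. mass M X v * log (exp 1) (mass M X v))"
  unfolding partition_entropy_def by (rule entropy_simple_distributed)
 also have "... = - (\<Sum>v\<in>X ` space M. ln (mass M X v) * mass M X v)" by (simp add: log_def mult.commute)
 also have "... = - (\<integral>x. ln (mass M X (X x)) \<partial>M)"
  unfolding integral_simple_comp(2)[OF M X fin order_refl, of "%v. ln (mass M X v)"] ..
 finally show ?thesis .
qed

lemma AE_mass_pos:
 assumes M: "prob_space M" and X: "simple_function M X"
 shows "AE x in M. mass M X (X x) > 0"
proof -
 interpret prob_space M by fact
 have "AE x in M. X x = v --> mass M X v > 0" for v
 proof (cases "mass M X v > 0")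
  case False
  then have "measure M (X -` {v} Int space M) = 0"
   using mass_nonneg[of M X v] unfolding mass_def by linarith
  then have "AE x in M. x \<notin> X -` {v} Int space M"
   using simple_functionD(2)[OF X, of "{v}"] by (intro AE_not_in) (auto simp: null_sets_def emeasure_eq_measure)
  then show ?thesis using AE_space by eventually_elim auto
 qed auto
 then have "AE x in M. ALL v:X ` space M. X x = v --> mass M X v > 0"
  by (intro AE_finite_allI simple_functionD(1)[OF X])
 then show ?thesis using AE_space by eventually_elim auto
qed

text \<open>From \<open>ln t \<le> t - 1\<close> with \<open>t = q / mass\<close>, and equality only for \<open>t = 1\<close>.\<close>
lemma gibbs_inequality:
 assumes M: "prob_space M" and X: "simple_function M X" and S: "finite S" "X ` space M \<subseteq> S"
  and q: "!!v. v \<in> S ==> q v >= 0" "sum q S <= 1" "AE x in M. q (X x) > 0"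
 shows "partition_entropy M X <= - (\<integral>x. ln (q (X x)) \<partial>M)"
  and "partition_entropy M X = - (\<integral>x. ln (q (X x)) \<partial>M) ==> v \<in> S ==> mass M X v = q v"
proof -
 interpret prob_space M by fact
 let ?m = "mass M X"
 define d where "d v = q v - ?m v - (ln (q v) * ?m v - ln (?m v) * ?m v)" for v
 have q_pos: "q v > 0" if "?m v > 0" for v
 proof (rule ccontr)
  assume neg: "\<not> q v > 0"
  have "AE x in M. x \<notin> X -` {v} Int space M" using q(3) by eventually_elim (use neg in auto)
  then have "?m v = 0"
   unfolding mass_def using prob_eq_0[OF simple_functionD(2)[OF X, of "{v}"]] by blast
  then show False using that by simp
 qed
 have d0: "d v >= 0 & (d v = 0 --> ?m v = q v)" if v: "v \<in> S" for v
 proof (cases "?m v > 0")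
  case True
  note qv = q_pos[OF True]
  have t: "q v / ?m v > 0" using True qv by simp
  have dv: "d v = ?m v * (q v / ?m v - 1 - ln (q v / ?m v))"
   using True qv by (simp add: d_def ln_div algebra_simps)
  have "d v >= 0" unfolding dv using ln_le_minus_one[OF t] True by simp
  moreover have "?m v = q v" if "d v = 0"
  proof -
   have "ln (q v / ?m v) = q v / ?m v - 1" using that True unfolding dv by simp
   then have "q v / ?m v = 1" by (rule ln_eq_minus_one[OF t])
   then show ?thesis using True by simp
  qed
  ultimately show ?thesis by blast
 next
  case False
  then have "?m v = 0" using mass_nonneg[of M X v] by simp
  then show ?thesis using q(1)[OF v] by (auto simp: d_def)
 qed
 have H: "partition_entropy M X = - (\<Sum>v\<in>S. ln (?m v) * ?m v)"
  unfolding partition_entropy_integral[OF M X] integral_simple_comp(2)[OF M X S, of "%v. ln (mass M X v)"] ..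
 have G: "- (\<integral>x. ln (q (X x)) \<partial>M) = - (\<Sum>v\<in>S. ln (q v) * ?m v)"
  unfolding integral_simple_comp(2)[OF M X S, of "%v. ln (q v)"] ..
 have sum_d: "sum d S = sum q S - 1 - ((\<Sum>v\<in>S. ln (q v) * ?m v) - (\<Sum>v\<in>S. ln (?m v) * ?m v))"
  unfolding d_def sum_subtractf sum_mass[OF M X S] ..
 have "sum d S >= 0" using d0 by (intro sum_nonneg) auto
 then show "partition_entropy M X <= - (\<integral>x. ln (q (X x)) \<partial>M)"
  using sum_d q(2) unfolding H G by linarith
 assume eq: "partition_entropy M X = - (\<integral>x. ln (q (X x)) \<partial>M)" and v: "v \<in> S"
 have "sum d S <= 0" using sum_d q(2) eq unfolding H G by linarith
 then have "sum d S = 0" using \<open>sum d S >= 0\<close> by simp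
 then have "d v = 0" using sum_nonneg_eq_0_iff[OF S(1), of d] d0 v by blast
 then show "?m v = q v" using d0[OF v] by blast
qed

lemma sum_lists_prod_le:
 fixes g :: "nat => 'a => real"
 assumes A: "finite A" and g: "!!k b. g k b >= 0" "!!k. (\<Sum>b\<in>A. g k b) <= 1"
 shows "(\<Sum>u\<in>{u. set u \<subseteq> A & length u = n}. \<Prod>k<n. g k (u ! k)) <= 1"
 using g
proof (induction n arbitrary: g)
 case 0
 have "{u. set u \<subseteq> A & length u = 0} = {[]}" by auto
 then show ?case by simp
next
 case (Suc n)
 let ?L = "{u. set u \<subseteq> A & length u = n}"
 have IH: "(\<Sum>u\<in>?L. \<Prod>k<n. g (Suc k) (u ! k)) <= 1"
  by (rule Suc.IH) (use Suc.prems in auto)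
 have "(\<Sum>u\<in>{u. set u \<subseteq> A & length u = Suc n}. \<Prod>k<Suc n. g k (u ! k)) =
   (\<Sum>(u, b)\<in>?L \<times> A. g 0 b * (\<Prod>k<n. g (Suc k) (u ! k)))"
  unfolding lists_length_Suc_eq
  by (subst sum.reindex) (auto simp: inj_on_def prod.lessThan_Suc_shift intro!: sum.cong simp del: prod.lessThan_Suc)
 also have "... = (\<Sum>u\<in>?L. (\<Sum>b\<in>A. g 0 b) * (\<Prod>k<n. g (Suc k) (u ! k)))"
  by (simp add: sum.cartesian_product[symmetric] sum_distrib_right)
 also have "... <= (\<Sum>u\<in>?L. 1 * (\<Prod>k<n. g (Suc k) (u ! k)))"
  by (intro sum_mono mult_right_mono Suc.prems prod_nonneg)
 also have "... <= 1" using IH by simp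
 finally show ?case .
qed

context invariant_markov_measure
begin

lemma integral_pow_invariant:
 fixes h :: "real => real"
 assumes "h \<in> borel_measurable \<mu>"
 shows "(\<integral>x. h ((f ^^ k) x) \<partial>\<mu>) = (\<integral>x. h x \<partial>\<mu>)"
proof -
 have "(\<integral>x. h ((f ^^ k) x) \<partial>\<mu>) = (\<integral>x. h x \<partial>distr \<mu> \<mu> (f ^^ k))"
  by (rule integral_distr[OF f_pow_measurable assms, symmetric])
 then show ?thesis unfolding f_pow_invariant .
qed

abbreviation H :: "nat => real" where "H n \<equiv> partition_entropy \<mu> (itin n)"

text \<open>Approximate \<open>X\<close> by a function \<open>theta\<close> of the itinerary, and apply Gibbs' inequality to the law of a noisy channel that sends the \<open>theta\<close>-word to the \<open>X\<close>-word with error probability \<open>eta\<close> per letter.\<close>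
lemma entropy_generator:
 assumes X: "simple_function \<mu> X" and delta: "delta > 0"
 shows "EX m. ALL n. partition_entropy \<mu> (itinerary f X n) <= H (n + m) + real n * delta"
proof -
 let ?V = "X ` space \<mu>"
 note pr = prob_space_axioms
 have V: "finite ?V" "?V ~= {}" using simple_functionD(1)[OF X] not_empty by auto
 define K where "K = real (card ?V)"
 have K: "K >= 1" using V by (simp add: K_def Suc_le_eq card_gt_0_iff)
 define eta where "eta = 1 - exp (- (delta / 2))"
 have eta: "0 < eta" "eta < 1" using delta by (auto simp: eta_def)
 define L where "L = - ln (eta / K)"
 have L: "L >= 0" using eta K by (simp add: L_def ln_le_zero_iff)
 define eps where "eps = delta / 2 / (1 + L)"
 have eps: "eps > 0" "L * eps <= delta / 2" using delta L by (auto simp: eps_def field_simps)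
 have "EX n S. prob {x \<in> space \<mu>. (x \<in> X -` {v} Int space \<mu>) ~= (itin n x \<in> S)} < eps / K" for v
  by (rule itinerary_approximation) (use simple_functionD(2)[OF X] eps K in auto)
 then have "ALL v. EX n S. prob {x \<in> space \<mu>. (x \<in> X -` {v} Int space \<mu>) ~= (itin n x \<in> S)} < eps / K" by blast
 from choice[OF this] obtain a where "ALL v. EX S. prob {x \<in> space \<mu>. (x \<in> X -` {v} Int space \<mu>) ~= (itin (a v) x \<in> S)} < eps / K" ..
 from choice[OF this] obtain S
  where aS: "!!v. prob {x \<in> space \<mu>. (x \<in> X -` {v} Int space \<mu>) ~= (itin (a v) x \<in> S v)} < eps / K" by auto
 define m where "m = Max (a ` ?V)"
 have am: "a v <= m" if "v \<in> ?V" for v unfolding m_def using V that by (intro Max_ge) auto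
 define theta where "theta w = (SOME v. v \<in> ?V & take (a v) w \<in> S v)" for w
 define D where "D v = {x \<in> space \<mu>. (x \<in> X -` {v} Int space \<mu>) ~= (itin (a v) x \<in> S v)}" for v
 have D_sets: "D v \<in> sets \<mu>" for v
 proof -
  have "D v = sym_diff (X -` {v} Int space \<mu>) {x \<in> space \<mu>. itin (a v) x \<in> S v}" by (auto simp: D_def)
  then show ?thesis using simple_functionD(2)[OF X, of "{v}"] itin_sets[of "a v" "S v"] by simp
 qed
 define Bad where "Bad = {x \<in> space \<mu>. theta (itin m x) ~= X x}"
 have pair: "simple_function \<mu> (%x. (itin m x, X x))" by (rule simple_function_Pair[OF simple_itin X])
 have Bad_sets: "Bad \<in> sets \<mu>"
  using simple_functionD(2)[OF pair, of "{(w, v). theta w ~= v}"] by (simp add: Bad_def vimage_def Int_def conj_commute)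
 have "Bad \<subseteq> (\<Union>v\<in>?V. D v)"
 proof
  fix x assume x: "x \<in> Bad"
  show "x \<in> (\<Union>v\<in>?V. D v)"
  proof (rule ccontr)
   assume n: "x \<notin> (\<Union>v\<in>?V. D v)"
   have xs: "x \<in> space \<mu>" using x by (simp add: Bad_def)
   have iff: "take (a v) (itin m x) \<in> S v \<longleftrightarrow> X x = v" if "v \<in> ?V" for v
    using n that xs take_itinerary[OF am[OF that]] by (auto simp: D_def)
   have "theta (itin m x) = X x" unfolding theta_def by (rule some_equality) (use iff xs in auto)
   then show False using x by (simp add: Bad_def)
  qed
 qed
 then have "prob Bad <= prob (\<Union>v\<in>?V. D v)"
  by (rule finite_measure_mono[OF _ sets.finite_UN[OF V(1) D_sets]])
 also have "... <= (\<Sum>v\<in>?V. prob (D v))" by (rule measure_UNION_le) (use D_sets V in auto)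
 also have "... <= (\<Sum>v\<in>?V. eps / K)" unfolding D_def by (intro sum_mono less_imp_le aS)
 also have "... = eps" using K by (simp add: K_def)
 finally have Bad: "prob Bad <= eps" .
 define kappa where "kappa u v = (if u = v then 1 - eta else eta / K)" for u v :: nat
 have kappa: "kappa u v > 0" for u v using eta K by (simp add: kappa_def)
 have kappa_sum: "(\<Sum>v\<in>?V. kappa u v) <= 1" for u
 proof -
  have "(\<Sum>v\<in>?V. kappa u v) <= (\<Sum>v\<in>?V. (if v = u then 1 - eta else 0) + eta / K)"
   by (intro sum_mono) (use eta K in "auto simp: kappa_def")
  also have "... = (if u \<in> ?V then 1 - eta else 0) + eta"
   unfolding sum.distrib using V K by (simp add: K_def)
  also have "... <= 1" using eta by simp
  finally show ?thesis .
 qed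
 define h where "h x = - ln (kappa (theta (itin m x)) (X x))" for x
 have hm: "h \<in> borel_measurable \<mu>"
  using integral_simple_comp(1)[OF pr pair simple_functionD(1)[OF pair] order_refl, of "%(w, v). - ln (kappa (theta w) v)"]
  by (simp add: h_def[abs_def] integrable_iff_bounded)
 have hi: "integrable \<mu> h"
  using integral_simple_comp(1)[OF pr pair simple_functionD(1)[OF pair] order_refl, of "%(w, v). - ln (kappa (theta w) v)"]
  by (simp add: h_def[abs_def])
 have h_int: "(\<integral>x. h x \<partial>\<mu>) <= delta"
 proof -
  have "(\<integral>x. h x \<partial>\<mu>) <= (\<integral>x. delta / 2 + L * indicator Bad x \<partial>\<mu>)"
  proof (rule Bochner_Integration.integral_mono[OF hi])
   show "integrable \<mu> (%x. delta / 2 + L * indicator Bad x)"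
    using Bad_sets by (auto intro!: integrable_mult_right integrable_real_indicator simp: emeasure_eq_measure)
   show "h x <= delta / 2 + L * indicator Bad x" if "x \<in> space \<mu>" for x
    using that delta by (auto simp: h_def kappa_def Bad_def L_def eta_def)
  qed
  also have "... = delta / 2 + L * prob Bad"
   using Bad_sets by (subst Bochner_Integration.integral_add)
    (auto intro!: integrable_mult_right integrable_real_indicator simp: emeasure_eq_measure prob_space)
  also have "... <= delta" using mult_left_mono[OF Bad L] eps(2) by simp
  finally show ?thesis .
 qed
 have "partition_entropy \<mu> (itinerary f X n) <= H (n + m) + real n * delta" for n
 proof -
  let ?W = "itin (n + m) ` space \<mu>" and ?S = "{u. set u \<subseteq> ?V & length u = n}"
  have simp_n: "simple_function \<mu> (itin (n + m))" by (rule simple_itin)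
  have W: "finite ?W" by (rule simple_functionD(1)[OF simp_n])
  define g where "g w u = (\<Prod>k<n. kappa (theta (take m (drop k w))) (u ! k))" for w and u :: "nat list"
  have g_nn: "g w u >= 0" for w u unfolding g_def using kappa by (intro prod_nonneg) (auto intro: less_imp_le)
  define q where "q u = (\<Sum>w\<in>?W. mass \<mu> (itin (n + m)) w * g w u)" for u
  have S: "finite ?S" using V by (intro finite_lists_length_eq)
  have S_sub: "itinerary f X n ` space \<mu> \<subseteq> ?S"
  proof
   fix u assume "u \<in> itinerary f X n ` space \<mu>"
   then obtain x where x: "x \<in> space \<mu>" "u = itinerary f X n x" by blast
   have "(f ^^ k) x \<in> space \<mu>" for k using x(1) f_pow_unit unfolding space_\<mu> by blast
   then show "u \<in> ?S" unfolding x(2) by (auto simp: itinerary_def)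
  qed
  have q_nn: "q u >= 0" for u unfolding q_def by (intro sum_nonneg mult_nonneg_nonneg mass_nonneg g_nn)
  have q_sum: "sum q ?S <= 1"
  proof -
   have "sum q ?S = (\<Sum>w\<in>?W. mass \<mu> (itin (n + m)) w * (\<Sum>u\<in>?S. g w u))"
    unfolding q_def by (subst sum.swap) (simp add: sum_distrib_left)
   also have "... <= (\<Sum>w\<in>?W. mass \<mu> (itin (n + m)) w * 1)"
    unfolding g_def by (intro sum_mono mult_left_mono mass_nonneg sum_lists_prod_le V kappa_sum) (use kappa in "auto intro: less_imp_le")
   also have "... = 1" using sum_mass[OF pr simp_n W order_refl] by simp
   finally show ?thesis .
  qed
  have g_x: "g (itin (n + m) x) (itinerary f X n x) = (\<Prod>k<n. kappa (theta (itin m ((f ^^ k) x))) (X ((f ^^ k) x)))" for x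
   unfolding g_def
  proof (intro prod.cong refl)
   fix k assume k: "k \<in> {..<n}"
   have "itin (n + m) x = itin k x @ itin (n + m - k) ((f ^^ k) x)"
    using itinerary_add[of f lab k "n + m - k" x] k by simp
   then have "take m (drop k (itin (n + m) x)) = itin m ((f ^^ k) x)"
    using take_itinerary[of m "n + m - k" f lab "(f ^^ k) x"] k by simp
   then show "kappa (theta (take m (drop k (itin (n + m) x)))) (itinerary f X n x ! k) =
     kappa (theta (itin m ((f ^^ k) x))) (X ((f ^^ k) x))" using k by (simp add: nth_itinerary)
  qed
  have q_ge: "mass \<mu> (itin (n + m)) (itin (n + m) x) * g (itin (n + m) x) (itinerary f X n x) <= q (itinerary f X n x)"
   if "x \<in> space \<mu>" for x
   unfolding q_def by (rule member_le_sum) (use that W in "auto intro!: mult_nonneg_nonneg g_nn mass_nonneg")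
  have g_pos: "g (itin (n + m) x) (itinerary f X n x) > 0" for x
   unfolding g_x using kappa by (intro prod_pos) auto
  have ln_ge: "AE x in \<mu>. q (itinerary f X n x) > 0 &
    ln (mass \<mu> (itin (n + m)) (itin (n + m) x)) - (\<Sum>k<n. h ((f ^^ k) x)) <= ln (q (itinerary f X n x))"
   using AE_mass_pos[OF pr simp_n] AE_space
  proof eventually_elim
   case (elim x)
   let ?a = "mass \<mu> (itin (n + m)) (itin (n + m) x)" and ?g = "g (itin (n + m) x) (itinerary f X n x)"
   have pos: "?a * ?g > 0" using elim(1) g_pos[of x] by simp
   have "ln ?g = - (\<Sum>k<n. h ((f ^^ k) x))"
    unfolding g_x h_def by (subst ln_prod) (use kappa in "auto simp: sum_negf less_imp_neq[THEN not_sym]")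
   then have "ln (?a * ?g) = ln ?a - (\<Sum>k<n. h ((f ^^ k) x))" using elim(1) g_pos[of x] by (simp add: ln_mult_pos)
   moreover have "ln (?a * ?g) <= ln (q (itinerary f X n x))" using pos q_ge[OF elim(2)] by simp
   ultimately show ?case using pos q_ge[OF elim(2)] by simp
  qed
  have Xn: "simple_function \<mu> (itinerary f X n)" by (rule simple_function_itinerary[OF X f_measurable])
  have i1: "integrable \<mu> (%x. ln (mass \<mu> (itin (n + m)) (itin (n + m) x)))"
   by (rule integral_simple_comp(1)[OF pr simp_n W order_refl])
  have i2: "integrable \<mu> (%x. h ((f ^^ k) x))" for k
  proof -
   have "integrable (distr \<mu> \<mu> (f ^^ k)) h" using hi unfolding f_pow_invariant .
   then show ?thesis by (rule integrable_distr[OF f_pow_measurable])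
  qed
  have "partition_entropy \<mu> (itinerary f X n) <= - (\<integral>x. ln (q (itinerary f X n x)) \<partial>\<mu>)"
   by (rule gibbs_inequality(1)[OF pr Xn S S_sub q_nn q_sum]) (use ln_ge in \<open>eventually_elim\<close>, simp)
  also have "... <= - (\<integral>x. ln (mass \<mu> (itin (n + m)) (itin (n + m) x)) - (\<Sum>k<n. h ((f ^^ k) x)) \<partial>\<mu>)"
   unfolding neg_le_iff_le
  proof (rule integral_mono_AE)
   show "integrable \<mu> (%x. ln (mass \<mu> (itin (n + m)) (itin (n + m) x)) - (\<Sum>k<n. h ((f ^^ k) x)))"
    by (intro Bochner_Integration.integrable_diff Bochner_Integration.integrable_sum i1 i2)
   show "integrable \<mu> (%x. ln (q (itinerary f X n x)))"
    by (rule integral_simple_comp(1)[OF pr Xn S S_sub])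
   show "AE x in \<mu>. ln (mass \<mu> (itin (n + m)) (itin (n + m) x)) - (\<Sum>k<n. h ((f ^^ k) x)) <= ln (q (itinerary f X n x))"
    using ln_ge by eventually_elim simp
  qed
  also have "... = H (n + m) + (\<Sum>k<n. (\<integral>x. h ((f ^^ k) x) \<partial>\<mu>))"
   unfolding partition_entropy_integral[OF pr simp_n]
   using i1 i2 by (simp add: Bochner_Integration.integral_diff Bochner_Integration.integrable_sum)
  also have "... = H (n + m) + real n * (\<integral>x. h x \<partial>\<mu>)"
   by (simp add: integral_pow_invariant[OF hm])
  also have "... <= H (n + m) + real n * delta"
   using mult_left_mono[OF h_int, of "real n"] by simp
  finally show ?thesis .
 qed
 then show ?thesis by blast
qed

end

lemma lists_length_snoc:
 "{w. set w \<subseteq> A & length w = Suc n} = (%(w, a). w @ [a]) ` ({w. set w \<subseteq> A & length w = n} \<times> A)"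
proof (intro equalityI subsetI)
 fix w assume w: "w \<in> {w. set w \<subseteq> A & length w = Suc n}"
 then have "w ~= []" by auto
 then have e: "w = butlast w @ [last w]" by simp
 have "last w \<in> A" "set (butlast w) \<subseteq> A" using w \<open>w ~= []\<close> last_in_set[of w] in_set_butlastD[of _ w] by auto
 then have "(butlast w, last w) \<in> {w. set w \<subseteq> A & length w = n} \<times> A" using w by simp
 then show "w \<in> (%(w, a). w @ [a]) ` ({w. set w \<subseteq> A & length w = n} \<times> A)"
  using e by (metis (mono_tags, lifting) case_prod_conv image_eqI)
qed auto

lemma sum_lists_Cons:
 fixes g :: "'a list => real"
 shows "(\<Sum>w\<in>{w. set w \<subseteq> A & length w = Suc n}. g w) = (\<Sum>w\<in>{w. set w \<subseteq> A & length w = n}. \<Sum>a\<in>A. g (a # w))"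
 unfolding lists_length_Suc_eq
 by (subst sum.reindex) (auto simp: inj_on_def sum.cartesian_product intro!: sum.cong)

lemma sum_lists_snoc:
 fixes g :: "'a list => real"
 shows "(\<Sum>w\<in>{w. set w \<subseteq> A & length w = Suc n}. g w) = (\<Sum>w\<in>{w. set w \<subseteq> A & length w = n}. \<Sum>a\<in>A. g (w @ [a]))"
 unfolding lists_length_snoc
 by (subst sum.reindex) (auto simp: inj_on_def sum.cartesian_product intro!: sum.cong)

context invariant_markov_measure
begin

lemma entropy_growth:
 assumes bound: "!!n. H n <= c + ln (real n + 1) + real n * b"
 shows "metric_entropy f \<mu> <= ereal b"
 unfolding metric_entropy_def
proof (rule SUP_least)
 fix X :: "real => nat" assume "X \<in> {X. simple_function \<mu> X}"
 then have X: "simple_function \<mu> X" by simp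
 show "limsup (%n. ereal (partition_entropy \<mu> (itinerary f X n) / real n)) <= ereal b"
 proof (rule ereal_le_epsilon2)
  fix delta :: real assume delta: "delta > 0"
  obtain m where m: "!!n. partition_entropy \<mu> (itinerary f X n) <= H (n + m) + real n * delta"
   using entropy_generator[OF X delta] by blast
  define B where "B n = (c + ln (real n + real m + 1) + (real n + real m) * b) / real n + delta" for n
  have "B \<longlonglongrightarrow> b + delta"
   unfolding B_def[abs_def] by (intro tendsto_add entropy_bound_limit tendsto_const) simp
  then have lim: "limsup (%n. ereal (B n)) = ereal (b + delta)"
   by (intro lim_imp_Limsup tendsto_ereal) auto
  have "eventually (%n. ereal (partition_entropy \<mu> (itinerary f X n) / real n) <= ereal (B n)) sequentially"
   using eventually_gt_at_top[of 0]
  proof eventually_elim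
   case (elim n)
   have "partition_entropy \<mu> (itinerary f X n) <= c + ln (real n + real m + 1) + (real n + real m) * b + real n * delta"
    using m[of n] bound[of "n + m"] by simp
   then have "partition_entropy \<mu> (itinerary f X n) / real n <=
     (c + ln (real n + real m + 1) + (real n + real m) * b + real n * delta) / real n"
    by (rule divide_right_mono) simp
   then show ?case using elim by (simp add: B_def add_divide_distrib)
  qed
  then have "limsup (%n. ereal (partition_entropy \<mu> (itinerary f X n) / real n)) <= limsup (%n. ereal (B n))"
   by (rule Limsup_mono)
  then show "limsup (%n. ereal (partition_entropy \<mu> (itinerary f X n) / real n)) <= ereal b + ereal delta"
   unfolding lim by simp
 qed
qed

abbreviation letters :: "nat set" where "letters \<equiv> {..<2 * N + 1}"
abbreviation wordset :: "nat => nat list set" where "wordset n \<equiv> {w. set w \<subseteq> letters & length w = n}"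

lemma wordset_finite: "finite (wordset n)"
 by (rule finite_lists_length_eq) simp

lemma itin_wordset: "itin n ` space \<mu> \<subseteq> wordset n"
 using lab_bound f_pow_unit unfolding space_\<mu> by (auto simp: itinerary_def simp del: atLeastAtMost_iff)

abbreviation \<pi> :: "nat list => real" where "\<pi> w \<equiv> mass \<mu> (itin (length w)) w"

lemma \<pi>_eq: "mass \<mu> (itin n) w = prob {x \<in> space \<mu>. itin n x = w}"
 by (simp add: mass_def vimage_def Int_def conj_commute)

lemma word_sets: "{x \<in> space \<mu>. itin n x = w} \<in> sets \<mu>"
 using itin_sets[of n "{w}"] by simp

lemma f_space: "x \<in> space \<mu> ==> f x \<in> space \<mu>"
 using f_unit unfolding space_\<mu> .

lemma sum_\<pi>_Cons: "(\<Sum>a\<in>letters. \<pi> (a # w)) = \<pi> w"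
proof -
 let ?A = "%a. {x \<in> space \<mu>. itin (length (a # w)) x = a # w}"
 have "(\<Sum>a\<in>letters. \<pi> (a # w)) = prob (\<Union>a\<in>letters. ?A a)"
  unfolding \<pi>_eq
  by (rule finite_measure_finite_Union[symmetric]) (use word_sets in "auto simp: disjoint_family_on_def")
 also have "(\<Union>a\<in>letters. ?A a) = (f ^^ 1) -` {x \<in> space \<mu>. itin (length w) x = w} Int space \<mu>"
  using f_space lab_bound by (auto simp: itinerary_Suc space_\<mu> simp del: atLeastAtMost_iff)
 also have "prob ... = \<pi> w"
  unfolding \<pi>_eq by (rule measure_vimage[OF word_sets])
 finally show ?thesis .
qed

lemma sum_wordset_\<pi>: "(\<Sum>w\<in>wordset n. \<pi> w) = 1"
proof -
 have "(\<Sum>w\<in>wordset n. \<pi> w) = (\<Sum>w\<in>wordset n. mass \<mu> (itin n) w)" by (intro sum.cong) auto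
 then show ?thesis using sum_mass[OF prob_space_axioms simple_itin wordset_finite itin_wordset] by simp
qed

lemma AE_f: "AE x in \<mu>. P x ==> AE x in \<mu>. P (f x)"
 using AE_distrD[OF f_measurable, of P] by (simp only: f_invariant)

lemma AE_\<pi>_pos: "AE x in \<mu>. \<pi> (itin n x) > 0"
 using AE_mass_pos[OF prob_space_axioms simple_itin, of n] by simp

lemma itin_integrable: "integrable \<mu> (%x. g (itin n x) :: real)"
 by (rule integral_simple_comp(1)[OF prob_space_axioms simple_itin wordset_finite itin_wordset])

lemma itin_f_integrable: "integrable \<mu> (%x. g (itin n (f x)) :: real)"
 using itin_integrable[of "%w. g (tl w)" "Suc n"] by (simp add: itinerary_Suc)

lemma itin_f_integral: "(\<integral>x. g (itin n (f x)) \<partial>\<mu>) = (\<integral>x. g (itin n x) \<partial>\<mu>)" for g :: "nat list => real"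
 using integral_pow_invariant[of "%x. g (itin n x)" 1] itin_integrable[of g n] by simp

lemma entropy_itin: "H n = - (\<integral>x. ln (\<pi> (itin n x)) \<partial>\<mu>)"
 using partition_entropy_integral[OF prob_space_axioms simple_itin] by simp

lemma gibbs_itin:
 assumes q: "!!w. q w >= 0" "sum q (wordset n) <= 1" "AE x in \<mu>. q (itin n x) > 0"
 shows "H n <= - (\<integral>x. ln (q (itin n x)) \<partial>\<mu>)"
  and "H n = - (\<integral>x. ln (q (itin n x)) \<partial>\<mu>) ==> w \<in> wordset n ==> \<pi> w = q w"
 using gibbs_inequality[OF prob_space_axioms simple_itin wordset_finite itin_wordset q] by auto

lemma butlast_itin: "butlast (itin (Suc n) x) = itin n x"
 by (simp add: itinerary_snoc)

lemma tl_itin: "tl (itin (Suc n) x) = itin n (f x)"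
 by (simp add: itinerary_Suc)

text \<open>Strong subadditivity: compare the law of a word \<open>a z b\<close> with the one that makes \<open>a\<close> and \<open>b\<close> independent given \<open>z\<close>.\<close>
lemma entropy_concave:
 "H (Suc (Suc n)) + H n <= 2 * H (Suc n)"
proof -
 define q where "q w = \<pi> (butlast w) * \<pi> (tl w) / \<pi> (butlast (tl w))" for w
 have q_nn: "q w >= 0" for w unfolding q_def by (intro divide_nonneg_nonneg mult_nonneg_nonneg mass_nonneg)
 have "sum q (wordset (Suc (Suc n))) = (\<Sum>u\<in>wordset (Suc n). \<Sum>a\<in>letters. q (a # u))"
  by (rule sum_lists_Cons)
 also have "... = (\<Sum>z\<in>wordset n. \<Sum>b\<in>letters. \<Sum>a\<in>letters. q (a # z @ [b]))"
  by (rule sum_lists_snoc)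
 also have "... <= (\<Sum>z\<in>wordset n. \<Sum>b\<in>letters. \<pi> (z @ [b]))"
 proof (intro sum_mono)
  fix z b
  have "(\<Sum>a\<in>letters. q (a # z @ [b])) = (\<Sum>a\<in>letters. \<pi> (a # z)) * \<pi> (z @ [b]) / \<pi> z"
   unfolding q_def sum_distrib_right sum_divide_distrib by (intro sum.cong refl) (simp add: butlast_append)
  also have "... <= \<pi> (z @ [b])"
   unfolding sum_\<pi>_Cons using mass_nonneg by (cases "\<pi> z = 0") auto
  finally show "(\<Sum>a\<in>letters. q (a # z @ [b])) <= \<pi> (z @ [b])" .
 qed
 also have "... = (\<Sum>u\<in>wordset (Suc n). \<pi> u)" by (rule sum_lists_snoc[symmetric])
 also have "... = 1" by (rule sum_wordset_\<pi>)
 finally have q_sum: "sum q (wordset (Suc (Suc n))) <= 1" .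
 have q_itin: "q (itin (Suc (Suc n)) x) = \<pi> (itin (Suc n) x) * \<pi> (itin (Suc n) (f x)) / \<pi> (itin n (f x))" for x
  unfolding q_def by (simp only: butlast_itin tl_itin)
 have AE: "AE x in \<mu>. q (itin (Suc (Suc n)) x) > 0 & ln (q (itin (Suc (Suc n)) x)) =
   ln (\<pi> (itin (Suc n) x)) + ln (\<pi> (itin (Suc n) (f x))) - ln (\<pi> (itin n (f x)))"
  using AE_\<pi>_pos[of "Suc n"] AE_f[OF AE_\<pi>_pos[of "Suc n"]] AE_f[OF AE_\<pi>_pos[of n]]
  unfolding q_itin by eventually_elim (simp add: ln_mult_pos ln_div)
 have "H (Suc (Suc n)) <= - (\<integral>x. ln (q (itin (Suc (Suc n)) x)) \<partial>\<mu>)"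
  by (rule gibbs_itin(1)[OF q_nn q_sum]) (use AE in \<open>eventually_elim\<close>, simp)
 also have "(\<integral>x. ln (q (itin (Suc (Suc n)) x)) \<partial>\<mu>) =
   (\<integral>x. ln (\<pi> (itin (Suc n) x)) + ln (\<pi> (itin (Suc n) (f x))) - ln (\<pi> (itin n (f x))) \<partial>\<mu>)"
 proof (rule integral_cong_AE)
  show "(%x. ln (q (itin (Suc (Suc n)) x))) \<in> borel_measurable \<mu>"
   using itin_integrable[of "%w. ln (q w)"] by (rule borel_measurable_integrable)
  show "(%x. ln (\<pi> (itin (Suc n) x)) + ln (\<pi> (itin (Suc n) (f x))) - ln (\<pi> (itin n (f x)))) \<in> borel_measurable \<mu>"
   by (intro borel_measurable_add borel_measurable_diff borel_measurable_integrable
     itin_integrable[of "%w. ln (\<pi> w)"] itin_f_integrable[of "%w. ln (\<pi> w)"])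
  show "AE x in \<mu>. ln (q (itin (Suc (Suc n)) x)) =
    ln (\<pi> (itin (Suc n) x)) + ln (\<pi> (itin (Suc n) (f x))) - ln (\<pi> (itin n (f x)))"
   using AE by eventually_elim simp
 qed
 also have "... = (\<integral>x. ln (\<pi> (itin (Suc n) x)) \<partial>\<mu>) + (\<integral>x. ln (\<pi> (itin (Suc n) (f x))) \<partial>\<mu>) - (\<integral>x. ln (\<pi> (itin n (f x))) \<partial>\<mu>)"
  using itin_integrable[of "%w. ln (\<pi> w)"] itin_f_integrable[of "%w. ln (\<pi> w)"]
  by (simp del: length_itinerary)
 also have "... = - 2 * H (Suc n) + H n"
  unfolding entropy_itin itin_f_integral[of "%w. ln (\<pi> w)"] by simp
 finally show ?thesis by simp
qed

text \<open>The increments decrease, so one small increment would bound the growth rate.\<close>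
lemma entropy_increment:
 assumes h: "ereal b <= metric_entropy f \<mu>"
 shows "b <= H (Suc k) - H k"
proof (rule ccontr)
  define d where "d = H (Suc k) - H k"
 assume "\<not> ?thesis"
 then have db: "d < b" by (simp add: d_def)
 have inc: "H (Suc (k + j)) - H (k + j) <= d" for j
 proof (induction j)
  case (Suc j)
  then show ?case using entropy_concave[of "k + j"] by simp
 qed (simp add: d_def)
 have lin: "H (k + j) <= H k + real j * d" for j
 proof (induction j)
  case (Suc j)
  then show ?case using inc[of j] by (simp add: algebra_simps)
 qed simp
 define c where "c = (\<Sum>i\<le>k. \<bar>H i - real i * d\<bar>)"
 have c: "\<bar>H i - real i * d\<bar> <= c" if "i <= k" for i
  unfolding c_def by (rule member_le_sum) (use that in auto)
 have "H n <= c + ln (real n + 1) + real n * d" for n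
 proof -
  have "H n <= c + real n * d"
  proof (cases "n <= k")
   case True
   then show ?thesis using c[of n] by linarith
  next
   case False
   then obtain j where n: "n = k + j" by (metis le_add_diff_inverse nat_le_linear)
   then show ?thesis using lin[of j] c[of k] by (simp add: algebra_simps)
  qed
  moreover have "ln (real n + 1) >= 0" by simp
  ultimately show ?thesis by linarith
 qed
 then have "metric_entropy f \<mu> <= ereal d" by (rule entropy_growth)
 then have "ereal b <= ereal d" using h by (rule order_trans[rotated])
 then show False using db by simp
qed

end

locale maximal_entropy_setting =
 perron_markov_map f N p slope rho rv lv + transitive_invariant_measure f N p slope \<mu>
 for f N p slope rho rv lv \<mu> +
 assumes entropy: "ereal (ln rho) <= metric_entropy f \<mu>"
begin

text \<open>Entropy is gained only before an orbit meets a partition point, at a rate of at most \<open>ln rho\<close> times \<open>\<mu>(U)\<close>.\<close>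
lemma measure_U: "prob U = 1"
proof -
 have U: "U \<in> sets \<mu>" by (rule borel_\<mu>'[OF U_borel U_unit])
 have rho: "ln rho > 0" using rho_gt_1 by simp
 obtain C where C: "C >= 1" "!!n. (\<Sum>w\<in>itin n ` {0..1}. (1 / rho) ^ free_length w) <= C * (real n + 1)"
  using weighted_count by blast
 have "H n <= ln C + ln (real n + 1) + real n * (ln rho * prob U)" for n
 proof -
  define q where "q w = (1 / rho) ^ free_length w / (C * (real n + 1))" for w
  have q0: "q w > 0" for w unfolding q_def using rho_gt_1 C(1) by (intro divide_pos_pos) auto
  have "sum q (itin n ` {0..1}) <= C * (real n + 1) / (C * (real n + 1))"
   unfolding q_def sum_divide_distrib[symmetric] by (rule divide_right_mono[OF C(2)]) (use C(1) in simp)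
  also have "... = 1" using C(1) by simp
  finally have q1: "sum q (itin n ` {0..1}) <= 1" .
  have ln_q: "- ln (q w) = ln C + ln (real n + 1) + real (free_length w) * ln rho" for w
   unfolding q_def using C(1) rho_gt_1 by (simp add: ln_div ln_mult_pos ln_realpow)
  have fl: "real (free_length (itin n x)) <= (\<Sum>k<n. indicator U ((f ^^ k) x))" if x: "x \<in> space \<mu>" for x
  proof -
   let ?m = "free_length (itin n x)"
   have mn: "?m <= n" unfolding free_length_def using length_takeWhile_le[of "%a. a < N" "itin n x"] by simp
   have "(f ^^ k) x \<in> U" if k: "k < ?m" for k
   proof -
    have "takeWhile (%a. a < N) (itin n x) ! k < N"
     using nth_mem[of k "takeWhile (%a. a < N) (itin n x)"] k unfolding free_length_def by (blast dest: set_takeWhileD)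
    then have "itin n x ! k < N" using takeWhile_nth[of k "%a. a < N" "itin n x"] k by (simp add: free_length_def)
    then have "lab ((f ^^ k) x) < N" using k mn by (simp add: nth_itinerary)
    then show ?thesis using lab_less_iff f_pow_unit x unfolding space_\<mu> by blast
   qed
   then have "real ?m = (\<Sum>k<?m. indicator U ((f ^^ k) x))" by simp
   also have "... <= (\<Sum>k<n. indicator U ((f ^^ k) x))" by (rule sum_mono2) (use mn in auto)
   finally show ?thesis .
  qed
  have iU: "integrable \<mu> (indicator U :: real => real)"
   using U by (auto intro!: integrable_real_indicator simp: emeasure_eq_measure)
  have iUk: "integrable \<mu> (%x. indicator U ((f ^^ k) x) :: real)" for k
  proof -
   have "integrable (distr \<mu> \<mu> (f ^^ k)) (indicator U :: real => real)" using iU unfolding f_pow_invariant .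
   then show ?thesis by (rule integrable_distr[OF f_pow_measurable])
  qed
  have "(\<integral>x. real (free_length (itin n x)) \<partial>\<mu>) <= (\<integral>x. (\<Sum>k<n. indicator U ((f ^^ k) x)) \<partial>\<mu>)"
  proof (rule Bochner_Integration.integral_mono)
   show "integrable \<mu> (%x. real (free_length (itin n x)))" by (rule itin_integrable)
   show "integrable \<mu> (%x. \<Sum>k<n. indicator U ((f ^^ k) x) :: real)"
    by (intro Bochner_Integration.integrable_sum iUk)
  qed (rule fl)
  also have "... = (\<Sum>k<n. (\<integral>x. indicator U ((f ^^ k) x) \<partial>\<mu>))" by (rule Bochner_Integration.integral_sum[OF iUk])
  also have "... = real n * prob U"
   using U by (simp add: integral_pow_invariant[of "indicator U"] borel_measurable_integrable[OF iU])
  finally have fl_int: "(\<integral>x. real (free_length (itin n x)) \<partial>\<mu>) <= real n * prob U" .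
  have "H n <= - (\<integral>x. ln (q (itin n x)) \<partial>\<mu>)"
   by (rule gibbs_inequality(1)[OF prob_space_axioms simple_itin finite_itin_image])
    (use q0 q1 in "auto simp: space_\<mu> intro: less_imp_le")
  also have "... = (\<integral>x. ln C + ln (real n + 1) + real (free_length (itin n x)) * ln rho \<partial>\<mu>)"
   unfolding ln_q[symmetric] by simp
  also have "... = ln C + ln (real n + 1) + (\<integral>x. real (free_length (itin n x)) \<partial>\<mu>) * ln rho"
   using itin_integrable[of "%w. real (free_length w)" n] prob_space by simp
  also have "... <= ln C + ln (real n + 1) + real n * prob U * ln rho"
   using mult_right_mono[OF fl_int, of "ln rho"] rho by simp
  finally show ?thesis by (simp add: mult_ac)
 qed
 then have "metric_entropy f \<mu> <= ereal (ln rho * prob U)" by (rule entropy_growth)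
 then have "ereal (ln rho) <= ereal (ln rho * prob U)" using entropy by (rule order_trans[rotated])
 then have "1 <= prob U" using rho by simp
 then show ?thesis using prob_le_1[of U] by simp
qed

lemma point_null:
 assumes j: "j <= N" shows "prob {p j} = 0"
proof -
 have U: "U \<in> sets \<mu>" by (rule borel_\<mu>'[OF U_borel U_unit])
 have "prob {p j} <= prob (space \<mu> - U)"
  by (rule finite_measure_mono[OF _ sets.compl_sets[OF U]]) (use p_unit[OF j] p_notin_U[OF j] in "auto simp: space_\<mu>")
 also have "... = 0" using prob_compl[OF U] measure_U by simp
 finally show ?thesis using measure_nonneg[of \<mu> "{p j}"] by linarith
qed

lemma orbit_U: "AE x in \<mu>. ALL n. (f ^^ n) x \<in> U"
 by (rule AE_orbit_U) (rule point_null)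

text \<open>The transition probabilities of the Parry measure.\<close>
definition transition :: "nat => nat => real" where
 "transition i j = (if i < N & j < N & adj i j then rv j / (rho * rv i) else 0)"

lemma transition_nonneg: "transition i j >= 0"
 unfolding transition_def using rv_pos rho_gt_1 by (auto intro!: divide_nonneg_nonneg mult_nonneg_nonneg less_imp_le)

lemma transition_sum: "(\<Sum>a\<in>letters. transition i a) <= 1"
proof (cases "i < N")
 case True
 have "(\<Sum>a\<in>letters. transition i a) = (\<Sum>a<N. (if adj i a then 1 else 0) * rv a / (rho * rv i))"
  by (rule sum.mono_neutral_cong_right) (use True in "auto simp: transition_def")
 also have "... = 1"
  unfolding sum_divide_distrib[symmetric] rv_eigen[OF True] using rv_pos[OF True] rho_gt_1 by simp
 finally show ?thesis by simp
qed (simp add: transition_def)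

text \<open>Gibbs' inequality with these probabilities gives an increment of at most \<open>ln rho\<close>; by maximality there is equality.\<close>
lemma \<pi>_markov:
 assumes w: "w \<in> wordset (Suc m)" and a: "a \<in> letters"
 shows "\<pi> (w @ [a]) = \<pi> w * transition (last w) a"
proof -
 define q where "q v = \<pi> (butlast v) * transition (last (butlast v)) (last v)" for v
 have q_nn: "q v >= 0" for v unfolding q_def by (intro mult_nonneg_nonneg mass_nonneg transition_nonneg)
 have "sum q (wordset (Suc (Suc m))) = (\<Sum>w\<in>wordset (Suc m). \<Sum>a\<in>letters. \<pi> w * transition (last w) a)"
  unfolding sum_lists_snoc[of _ _ "Suc m"] q_def by simp
 also have "... <= (\<Sum>w\<in>wordset (Suc m). \<pi> w * 1)"
  unfolding sum_distrib_left[symmetric] by (intro sum_mono mult_left_mono transition_sum mass_nonneg)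
 also have "... = 1" using sum_wordset_\<pi> by simp
 finally have q_sum: "sum q (wordset (Suc (Suc m))) <= 1" .
 let ?g = "%x. ln (rv (lab x))"
 have q_itin: "q (itin (Suc (Suc m)) x) = \<pi> (itin (Suc m) x) * transition (lab ((f ^^ m) x)) (lab ((f ^^ Suc m) x))" for x
 proof -
  have "last (itin (Suc k) x) = lab ((f ^^ k) x)" for k by (simp add: itinerary_snoc)
  then show ?thesis unfolding q_def butlast_itin by simp
 qed
 have AE: "AE x in \<mu>. q (itin (Suc (Suc m)) x) > 0 & ln (q (itin (Suc (Suc m)) x)) =
   ln (\<pi> (itin (Suc m) x)) + ?g ((f ^^ Suc m) x) - ?g ((f ^^ m) x) - ln rho"
  using AE_\<pi>_pos[of "Suc m"] orbit_U
 proof eventually_elim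
  case (elim x)
  let ?y = "(f ^^ m) x"
  have y: "?y \<in> U" "f ?y \<in> U" using elim(2)[rule_format, of m] elim(2)[rule_format, of "Suc m"] by auto
  then obtain i j where ij: "i < N" "?y \<in> I i" "j < N" "f ?y \<in> I j" by (meson U_E)
  have t: "transition (lab ?y) (lab (f ?y)) = rv j / (rho * rv i)"
   using ij f_adj[OF ij(1,3,2,4)] by (simp add: transition_def lab_I)
  have tpos: "rv j / (rho * rv i) > 0" using rv_pos ij rho_gt_1 by simp
  have "ln (rv j / (rho * rv i)) = ?g (f ?y) - ?g ?y - ln rho"
   using rv_pos[OF ij(1)] rv_pos[OF ij(3)] rho_gt_1 ij by (simp add: lab_I ln_div ln_mult_pos)
  then obtain t where "transition (lab ?y) (lab (f ?y)) = t" "t > 0" "ln t = ?g (f ?y) - ?g ?y - ln rho"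
   using t tpos by blast
  then show ?case
   unfolding q_itin using elim(1) by (simp add: ln_mult_pos)
 qed
 have g: "integrable \<mu> ?g"
  using itin_integrable[of "%w. ln (rv (hd w))" 1] by (simp add: itinerary_Suc)
 have gk: "integrable \<mu> (%x. ?g ((f ^^ k) x))" for k
 proof -
  have "integrable (distr \<mu> \<mu> (f ^^ k)) ?g" using g unfolding f_pow_invariant .
  then show ?thesis by (rule integrable_distr[OF f_pow_measurable])
 qed
 have g_int: "(\<integral>x. ?g ((f ^^ k) x) \<partial>\<mu>) = (\<integral>x. ?g x \<partial>\<mu>)" for k
  by (rule integral_pow_invariant[OF borel_measurable_integrable[OF g]])
 have i\<pi>: "integrable \<mu> (%x. ln (\<pi> (itin (Suc m) x)))" by (rule itin_integrable)
 have "(\<integral>x. ln (q (itin (Suc (Suc m)) x)) \<partial>\<mu>) =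
   (\<integral>x. ln (\<pi> (itin (Suc m) x)) + ?g ((f ^^ Suc m) x) - ?g ((f ^^ m) x) - ln rho \<partial>\<mu>)"
 proof (rule integral_cong_AE)
  show "(%x. ln (q (itin (Suc (Suc m)) x))) \<in> borel_measurable \<mu>"
   using itin_integrable[of "%w. ln (q w)"] by (rule borel_measurable_integrable)
  show "(%x. ln (\<pi> (itin (Suc m) x)) + ?g ((f ^^ Suc m) x) - ?g ((f ^^ m) x) - ln rho) \<in> borel_measurable \<mu>"
   by (intro borel_measurable_add borel_measurable_diff borel_measurable_const borel_measurable_integrable[OF gk]
     borel_measurable_integrable[OF i\<pi>])
  show "AE x in \<mu>. ln (q (itin (Suc (Suc m)) x)) =
    ln (\<pi> (itin (Suc m) x)) + ?g ((f ^^ Suc m) x) - ?g ((f ^^ m) x) - ln rho"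
   using AE by eventually_elim simp
 qed
 also have "... = (\<integral>x. ln (\<pi> (itin (Suc m) x)) \<partial>\<mu>) + (\<integral>x. ?g ((f ^^ Suc m) x) \<partial>\<mu>) - (\<integral>x. ?g ((f ^^ m) x) \<partial>\<mu>) - ln rho"
  using i\<pi> gk[of "Suc m"] gk[of m] prob_space by (simp del: length_itinerary funpow.simps)
 also have "... = - H (Suc m) - ln rho"
  unfolding g_int entropy_itin by simp
 finally have G: "- (\<integral>x. ln (q (itin (Suc (Suc m)) x)) \<partial>\<mu>) = H (Suc m) + ln rho" by simp
 have qAE: "AE x in \<mu>. q (itin (Suc (Suc m)) x) > 0" using AE by eventually_elim simp
 note gibbs = gibbs_itin[OF q_nn q_sum qAE]
 have "H (Suc (Suc m)) = - (\<integral>x. ln (q (itin (Suc (Suc m)) x)) \<partial>\<mu>)"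
  using gibbs(1) entropy_increment[OF entropy, of "Suc m"] unfolding G by simp
 moreover have "w @ [a] \<in> wordset (Suc (Suc m))" using w a by simp
 ultimately have "\<pi> (w @ [a]) = q (w @ [a])" by (rule gibbs(2))
 then show ?thesis by (simp add: q_def)
qed

lemma \<pi>_cons:
 assumes ij: "i < N" "j < N"
 shows "set w \<subseteq> letters ==> w ~= [] ==> hd w = j ==> \<pi> (i # w) * \<pi> [j] = \<pi> [i] * transition i j * \<pi> w"
proof (induction w rule: rev_induct)
 case (snoc a w)
 show ?case
 proof (cases "w = []")
  case True
  then show ?thesis using \<pi>_markov[of "[i]" 0 a] snoc.prems ij by simp
 next
  case False
  then obtain m where m: "length w = Suc m" by (cases w) auto
  have "\<pi> ((i # w) @ [a]) = \<pi> (i # w) * transition (last (i # w)) a"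
   by (rule \<pi>_markov[of _ "Suc m"]) (use snoc.prems ij m in auto)
  moreover have "\<pi> (w @ [a]) = \<pi> w * transition (last w) a"
   by (rule \<pi>_markov[of _ m]) (use snoc.prems m in auto)
  ultimately show ?thesis using snoc.IH snoc.prems False by simp
 qed
qed simp

text \<open>On cylinders the claim is the Markov property read from the left; Borel sets are approximated by cylinders.\<close>
theorem bm_local_jacobian: "EX l. local_jacobian 0 rho l"
proof -
 have \<pi>_I: "\<pi> [j] = prob (I j)" if j: "j < N" for j
 proof -
  have "{x \<in> space \<mu>. itin (length [j]) x = [j]} = I j"
   using lab_in_I[of _] lab_I[OF j] I_unit[OF j] j unfolding space_\<mu> by (auto simp: itinerary_Suc simp del: atLeastAtMost_iff)
  then show ?thesis unfolding \<pi>_eq by simp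
 qed
 have pre_sets: "{x \<in> I i. f x \<in> E} \<in> sets \<mu>" if "i < N" "E \<in> sets \<mu>" for i E
 proof -
  have "{x \<in> I i. f x \<in> E} = I i Int (f -` E Int space \<mu>)" using I_unit[OF that(1)] by (auto simp: space_\<mu>)
  then show ?thesis using borel_\<mu>'[OF I_borel I_unit[OF that(1)]] measurable_sets[OF f_measurable that(2)] by simp
 qed
 define c where "c i j = \<pi> [i] * transition i j / \<pi> [j]" for i j
 have pos: "\<pi> [j] > 0" if j: "j < N" for j
 proof -
  have "EX i<N. \<pi> [i] > 0"
  proof (rule ccontr)
   assume neg: "\<not> (EX i<N. \<pi> [i] > 0)"
   have "prob (\<Union>i<N. I i) <= (\<Sum>i<N. prob (I i))"
    by (rule measure_UNION_le) (use borel_\<mu>'[OF I_borel I_unit] in auto)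
   also have "... <= (\<Sum>i<N. 0)" 
   proof (rule sum_mono)
    fix i assume "i \<in> {..<N}"
    then have "i < N" by simp
    then show "prob (I i) <= 0" using neg unfolding \<pi>_I[OF \<open>i < N\<close>, symmetric] by (meson not_less)
   qed
   finally show False using measure_U by (simp add: branch_union_def)
  qed
  then obtain i0 where i0: "i0 < N" "\<pi> [i0] > 0" by blast
  show ?thesis
  proof (rule irreducible_positive[of i0 "%i. \<pi> [i]", OF i0 _ j])
   fix i j assume ij: "i < N" "j < N" "adj i j" "\<pi> [i] > 0"
   have "0 < \<pi> [i] * transition i j"
    using ij rv_pos rho_gt_1 by (simp add: transition_def)
   also have "... = \<pi> ([i] @ [j])" using \<pi>_markov[of "[i]" 0 j] ij by simp
   also have "... <= (\<Sum>a\<in>letters. \<pi> (a # [j]))"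
   proof -
    have "\<pi> (i # [j]) <= (\<Sum>a\<in>letters. \<pi> (a # [j]))"
     by (rule member_le_sum) (use ij mass_nonneg in auto)
    then show ?thesis by (simp del: sum.lessThan_Suc)
   qed
   also have "... = \<pi> [j]" by (rule sum_\<pi>_Cons)
   finally show "\<pi> [j] > 0" .
  qed
 qed
 have c_nn: "c i j >= 0" for i j
  unfolding c_def by (intro divide_nonneg_nonneg mult_nonneg_nonneg mass_nonneg transition_nonneg)
 have main: "prob {x \<in> I i. f x \<in> E} = c i j * prob E"
  if i: "i < N" and j: "j < N" and E: "E \<in> sets \<mu>" and EI: "E \<subseteq> I j" for i j E
 proof -
  let ?a = "%E. prob {x \<in> I i. f x \<in> E}"
  have approx: "\<bar>?a E - c i j * prob E\<bar> <= (1 + c i j) * delta" if delta: "delta > 0" for delta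
  proof -
   obtain n S where nS: "prob {x \<in> space \<mu>. (x \<in> E) ~= (itin n x \<in> S)} < delta"
    using itinerary_approximation[OF E delta] by blast
   define D where "D = {x \<in> space \<mu>. (x \<in> E) ~= (itin n x \<in> S)}"
   have "D = sym_diff E {x \<in> space \<mu>. itin n x \<in> S}" using sets.sets_into_space[OF E] by (auto simp: D_def)
   then have D: "D \<in> sets \<mu>" using E itin_sets[of n S] by simp
   define T where "T = {w \<in> wordset (Suc n). take n w \<in> S & hd w = j}"
   define F where "F = {x \<in> space \<mu>. itin (Suc n) x \<in> T}"
   have F: "F \<in> sets \<mu>" unfolding F_def by (rule itin_sets)
   have F_iff: "x \<in> F \<longleftrightarrow> x \<in> space \<mu> & itin n x \<in> S & lab x = j" for x
   proof -
    have "hd (itin (Suc n) x) = lab x" by (simp add: itinerary_Suc)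
    moreover have "take n (itin (Suc n) x) = itin n x" by (rule take_itinerary) simp
    ultimately show ?thesis using itin_wordset[of "Suc n"] unfolding F_def T_def by auto
   qed
   have EF: "x \<in> D" if "(x \<in> E) ~= (x \<in> F)" for x
   proof -
    have xs: "x \<in> space \<mu>" using that F_iff[of x] sets.sets_into_space[OF E] by blast
    have "lab x = j \<longleftrightarrow> x \<in> I j" using lab_I[OF j] lab_in_I[of x] xs j unfolding space_\<mu> by blast
    then show ?thesis using that F_iff[of x] xs EI unfolding D_def by blast
   qed
   have close: "\<bar>prob A - prob A'\<bar> <= prob G"
    if "A \<in> sets \<mu>" "A' \<in> sets \<mu>" "G \<in> sets \<mu>" "!!x. (x \<in> A) ~= (x \<in> A') ==> x \<in> G" for A A' G
   proof -
    have "prob A <= prob (A' Un G)" "prob A' <= prob (A Un G)"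
     by (rule finite_measure_mono; use that in blast)+
    moreover have "prob (A' Un G) <= prob A' + prob G" "prob (A Un G) <= prob A + prob G"
     by (rule measure_Un_le; use that in blast)+
    ultimately show ?thesis by linarith
   qed
   have 1: "\<bar>prob E - prob F\<bar> <= delta" using close[OF E F D EF] nS unfolding D_def by linarith
   have 2: "\<bar>?a E - ?a F\<bar> <= delta"
   proof -
    have "\<bar>?a E - ?a F\<bar> <= prob ((f ^^ 1) -` D Int space \<mu>)"
     by (rule close) (use pre_sets[OF i E] pre_sets[OF i F] measurable_sets[OF f_pow_measurable D, of 1] EF I_unit[OF i] in "auto simp: space_\<mu>")
    also have "... = prob D" by (rule measure_vimage[OF D])
    finally show ?thesis using nS unfolding D_def by linarith
   qed
   have 3: "?a F = c i j * prob F"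
   proof -
    have T: "finite T" by (rule finite_subset[OF _ wordset_finite[of "Suc n"]]) (auto simp: T_def)
    have Tw: "set w \<subseteq> letters" "w ~= []" "hd w = j" "length w = Suc n" if "w \<in> T" for w
     using that by (auto simp: T_def)
    have FT: "F = (\<Union>w\<in>T. {x \<in> space \<mu>. itin (Suc n) x = w})" by (auto simp: F_def)
    have "prob F = (\<Sum>w\<in>T. prob {x \<in> space \<mu>. itin (Suc n) x = w})"
     unfolding FT by (rule finite_measure_finite_Union) (use T word_sets in "auto simp: disjoint_family_on_def")
    also have "... = (\<Sum>w\<in>T. \<pi> w)" by (intro sum.cong refl) (use Tw in "simp add: \<pi>_eq")
    finally have mF: "prob F = (\<Sum>w\<in>T. \<pi> w)" .
    have pre: "{x \<in> I i. f x \<in> F} = (\<Union>w\<in>T. {x \<in> space \<mu>. itin (Suc (Suc n)) x = i # w})"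
     using I_unit[OF i] lab_I[OF i] lab_in_I i f_space unfolding F_def
     by (auto simp: itinerary_Suc[of f lab "Suc n"] space_\<mu> simp del: atLeastAtMost_iff)
    have "?a F = (\<Sum>w\<in>T. prob {x \<in> space \<mu>. itin (Suc (Suc n)) x = i # w})"
     unfolding pre by (rule finite_measure_finite_Union) (use T word_sets in "auto simp: disjoint_family_on_def")
    also have "... = (\<Sum>w\<in>T. \<pi> (i # w))" by (intro sum.cong refl) (use Tw in "simp add: \<pi>_eq")
    also have "... = (\<Sum>w\<in>T. c i j * \<pi> w)"
    proof (intro sum.cong refl)
     fix w assume "w \<in> T"
     from \<pi>_cons[OF i j Tw(1,2,3)[OF this]] show "\<pi> (i # w) = c i j * \<pi> w"
      using pos[OF j] by (simp add: c_def field_simps)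
    qed
    finally show ?thesis unfolding mF sum_distrib_left .
   qed
   have "\<bar>c i j * prob E - c i j * prob F\<bar> <= c i j * delta"
    using mult_left_mono[OF 1 c_nn[of i j]] by (simp add: abs_mult c_nn right_diff_distrib[symmetric])
   then show ?thesis using 2 3 by (simp add: distrib_right)
  qed
  have "?a E - c i j * prob E = 0"
  proof (rule ccontr)
   assume "?a E - c i j * prob E ~= 0"
   then have d: "\<bar>?a E - c i j * prob E\<bar> > 0" by simp
   have c1: "1 + c i j > 0" using c_nn[of i j] by simp
   have "\<bar>?a E - c i j * prob E\<bar> <= (1 + c i j) * (\<bar>?a E - c i j * prob E\<bar> / (2 * (1 + c i j)))"
    by (rule approx) (use d c1 in simp)
   also have "... = \<bar>?a E - c i j * prob E\<bar> / 2"
   proof -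
    have "a * (d / (2 * a)) = d / 2" if "a > 0" for a d :: real using that by simp
    from this[OF c1] show ?thesis .
   qed
   finally show False using d by simp
  qed
  then show ?thesis by simp
 qed
 define l where "l j = \<pi> [j] / rv j" for j
 have "local_jacobian 0 rho l"
  unfolding local_jacobian_def
 proof (intro conjI allI impI ballI)
  fix i j E assume h: "i < N" "j < N" "E \<in> sets borel" "adj i j" "E \<subseteq> I j"
  have "E \<in> sets \<mu>" by (rule borel_\<mu>'[OF h(3)]) (use h(5) I_unit[OF h(2)] in blast)
  from main[OF h(1,2) this h(5)]
  show "prob {x \<in> I i. f x \<in> E} = l i * inverse (slope i) ^ 0 / (rho * l j) * prob E"
   using h rv_pos[OF h(1)] rv_pos[OF h(2)] rho_gt_1 by (simp add: c_def l_def transition_def mult_ac)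
 qed (use pos \<pi>_I point_null rv_pos rho_gt_1 in "auto simp: l_def")
 then show ?thesis by blast
qed

end

section \<open>A measure of entropy \<open>ln rho\<close>\<close>

context transitive_markov_map
begin

text \<open>Pairing the two eigenvectors shows that the eigenvalues agree.\<close>
lemma perron_data_exists: "EX rho rv lv. perron_markov_map f N p slope rho rv lv"
proof -
 define A where "A i j = (if adj i j then 1 else 0 :: real)" for i j
 let ?R = "{(i, j). i < N & j < N & adj i j}"
 have A: "A i j >= 0" for i j by (simp add: A_def)
 have R: "{(i, j). i < N & j < N & A i j > 0} = ?R" "{(i, j). i < N & j < N & A j i > 0} = ?R\<inverse>"
  by (auto simp: A_def)
 have irr: "(i, j) \<in> {(i, j). i < N & j < N & A i j > 0}\<^sup>*" if "i < N" "j < N" for i j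
  unfolding R by (rule irreducible[OF that])
 have irrT: "(i, j) \<in> {(i, j). i < N & j < N & A j i > 0}\<^sup>*" if "i < N" "j < N" for i j
  unfolding R rtrancl_converse using irreducible[OF that(2,1)] by simp
 have "EX rho x. (ALL i<N. x i > 0) & (ALL i<N. (\<Sum>j<N. A i j * x j) = rho * x i)"
  by (rule positive_eigenvector[of N A, OF N_pos A irr]) auto
 then obtain rho rv where rv: "!!i. i < N ==> rv i > 0" "!!i. i < N ==> (\<Sum>j<N. A i j * rv j) = rho * rv i"
  by blast
 have "\<exists>\<sigma> x. (ALL i<N. x i > 0) & (ALL j<N. (\<Sum>i<N. A i j * x i) = \<sigma> * x j)"
  by (rule positive_eigenvector[of N "%i j. A j i", OF N_pos A irrT]) auto
 then obtain \<sigma> lv where lv: "!!i. i < N ==> lv i > 0" "!!j. j < N ==> (\<Sum>i<N. A i j * lv i) = \<sigma> * lv j"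
  by blast
 have "rho * (\<Sum>i<N. lv i * rv i) = (\<Sum>i<N. lv i * (\<Sum>j<N. A i j * rv j))"
  using rv(2) by (simp add: sum_distrib_left mult_ac)
 also have "... = (\<Sum>j<N. rv j * (\<Sum>i<N. A i j * lv i))"
  unfolding sum_distrib_left by (subst sum.swap) (simp add: mult_ac)
 also have "... = \<sigma> * (\<Sum>i<N. lv i * rv i)"
  using lv(2) by (simp add: sum_distrib_left mult_ac)
 finally have "rho * (\<Sum>i<N. lv i * rv i) = \<sigma> * (\<Sum>i<N. lv i * rv i)" .
 moreover have "(\<Sum>i<N. lv i * rv i) > 0" by (rule sum_pos) (use lv(1) rv(1) N_pos in auto)
 ultimately have "\<sigma> = rho" by simp
 then have "perron_markov_map f N p slope rho rv lv"
  by unfold_locales (use rv lv in "auto simp: A_def")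
 then show ?thesis by blast
qed

end

context perron_markov_map
begin

definition total :: real where "total = (\<Sum>j<N. rv j)"
text \<open>The images of the partition points under the conjugacy \<open>F\<close> to a map of constant slope \<open>rho\<close>.\<close>
definition P :: "nat => real" where "P i = (\<Sum>j<i. rv j) / total"

lemma total_pos: "total > 0"
 unfolding total_def by (rule sum_pos) (use rv_pos N_pos in auto)

lemma P_0: "P 0 = 0" and P_N: "P N = 1" and P_Suc: "P (Suc i) = P i + rv i / total"
 using total_pos by (auto simp: P_def total_def add_divide_distrib)

lemma P_mono: "i <= j ==> j <= N ==> P i <= P j"
proof (induction j rule: dec_induct)
 case (step j)
 then show ?case using P_Suc[of j] rv_pos[of j] total_pos by (simp add: divide_nonneg_pos add_increasing2 order_trans)
qed simp

lemma P_unit: "i <= N ==> P i \<in> {0..1}"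
 using P_mono[of 0 i] P_mono[of i N] P_0 P_N by auto

definition idx :: "real => nat" where "idx x = (GREATEST i. i < N & p i <= x)"
definition fr :: "real => real" where "fr x = lower (idx x) + slope (idx x) * (x - p (idx x))"
definition la :: "nat => nat" where "la i = (SOME a. EX b. a < b & b <= N & lower i = p a & upper i = p b)"
definition lb :: "nat => nat" where "lb i = (SOME b. la i < b & b <= N & lower i = p (la i) & upper i = p b)"

lemma lab_lower_upper:
 assumes i: "i < N"
 shows "la i < lb i" "lb i <= N" "lower i = p (la i)" "upper i = p (lb i)"
proof -
 have "EX a b. a < b & b <= N & lower i = p a & upper i = p b" using lower_upper_partition[OF i] by metis
 then have "EX b. la i < b & b <= N & lower i = p (la i) & upper i = p b" unfolding la_def by (rule someI_ex)
 from someI_ex[OF this] show "la i < lb i" "lb i <= N" "lower i = p (la i)" "upper i = p (lb i)"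
  unfolding lb_def by auto
qed

lemma P_upper: "i < N ==> P (lb i) - P (la i) = rho * (P (Suc i) - P i)"
proof -
 assume i: "i < N"
 note ab = lab_lower_upper[OF i]
 have "P (lb i) - P (la i) = (\<Sum>j<N. if la i <= j & j < lb i then P (Suc j) - P j else 0)"
  using telescoping_lengths[of "la i" "lb i" P] ab by simp
 also have "... = (\<Sum>j<N. (if adj i j then 1 else 0) * rv j / total)"
  by (intro sum.cong refl) (use adj_index[OF i ab] in "auto simp: P_Suc")
 also have "... = rho * rv i / total" unfolding sum_divide_distrib[symmetric] rv_eigen[OF i] ..
 finally show ?thesis by (simp add: P_Suc)
qed

lemma idx:
 assumes x: "0 <= x" "x < 1"
 shows "idx x < N" "p (idx x) <= x" "x < p (Suc (idx x))"
proof -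
 have ex: "0 < N & p 0 <= x" using N_pos p_0 x by simp
 have g: "idx x < N & p (idx x) <= x"
  unfolding idx_def
  by (rule GreatestI_nat[where P = "%i. i < N & p i <= x" and k = 0 and b = N]) (use ex in auto)
 then show "idx x < N" "p (idx x) <= x" by auto
 show "x < p (Suc (idx x))"
 proof (rule ccontr)
  assume n: "\<not> x < p (Suc (idx x))"
  have "Suc (idx x) ~= N" using n x p_N by auto
  then have "Suc (idx x) < N & p (Suc (idx x)) <= x" using g n by auto
  then have "Suc (idx x) <= idx x"
   unfolding idx_def 
   by (rule Greatest_le_nat[where P = "%i. i < N & p i <= x" and b = N]) auto
  then show False by simp
 qed
qed

lemma idx_eq: "i < N ==> p i <= x ==> x < p (Suc i) ==> idx x = i"
proof -
 assume i: "i < N" "p i <= x" "x < p (Suc i)"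
 have x: "0 <= x" "x < 1" using i p_unit[of i] p_unit[of "Suc i"] by auto
 note k = idx[OF x]
 have "\<not> Suc (idx x) <= i" using p_mono[of "Suc (idx x)" i] i k by auto
 moreover have "\<not> Suc i <= idx x" using p_mono[of "Suc i" "idx x"] i k by auto
 ultimately show ?thesis by simp
qed

lemma fr:
 assumes x: "0 <= x" "x < 1"
 shows "lower (idx x) <= fr x" "fr x < upper (idx x)" "0 <= fr x" "fr x < 1"
proof -
 note k = idx[OF x]
 show l: "lower (idx x) <= fr x" unfolding fr_def using k slope_gt_1[OF k(1)] by simp
 show u: "fr x < upper (idx x)" unfolding fr_def upper_lower using k slope_gt_1[OF k(1)] by simp
 show "0 <= fr x" "fr x < 1" using l u lower_upper_unit[OF k(1)] by auto
qed

text \<open>Picard iteration for \<open>F\<close>, with right-continuous branches so that every iterate is monotone and right-continuous.\<close>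
primrec G :: "nat => real => real" where
 "G 0 x = P (idx x)"
| "G (Suc n) x = P (idx x) + (G n (fr x) - P (la (idx x))) / rho"

lemma rho_pos: "rho > 0"
 using rho_gt_1 by simp

lemma G_bounds: "0 <= x ==> x < 1 ==> i <= N ==> (p i <= x --> P i <= G n x) & (x < p i --> G n x <= P i)"
proof (induction n arbitrary: x i)
 case 0
 note k = idx[OF 0(1,2)]
 have "P i <= P (idx x)" if "p i <= x"
 proof -
  have "\<not> Suc (idx x) <= i" using p_mono[of "Suc (idx x)" i] that k 0 by auto
  then show ?thesis using P_mono[of i "idx x"] k by simp
 qed
 moreover have "P (idx x) <= P i" if "x < p i"
 proof -
  have "\<not> i <= idx x" using p_mono[of i "idx x"] that k by auto
  then show ?thesis using P_mono[of "idx x" i] 0 by simp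
 qed
 ultimately show ?case by simp
next
 case (Suc n)
 note k = idx[OF Suc.prems(1,2)] and y = fr[OF Suc.prems(1,2)]
 note ab = lab_lower_upper[OF k(1)]
 have "P (la (idx x)) <= G n (fr x)" using Suc.IH[OF y(3,4), of "la (idx x)"] y(1) ab by simp
 then have lo: "P (idx x) <= G (Suc n) x" using rho_pos by simp
 have "G n (fr x) <= P (lb (idx x))" using Suc.IH[OF y(3,4), of "lb (idx x)"] y(2) ab by simp
 then have "(G n (fr x) - P (la (idx x))) / rho <= (P (lb (idx x)) - P (la (idx x))) / rho"
  using rho_pos by (intro divide_right_mono) auto
 then have hi: "G (Suc n) x <= P (Suc (idx x))" unfolding P_upper[OF k(1)] using rho_pos by simp
 have "P i <= G (Suc n) x" if "p i <= x"
 proof -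
  have "\<not> Suc (idx x) <= i" using p_mono[of "Suc (idx x)" i] that k Suc.prems by auto
  then show ?thesis using P_mono[of i "idx x"] k lo by simp
 qed
 moreover have "G (Suc n) x <= P i" if "x < p i"
 proof -
  have "\<not> i <= idx x" using p_mono[of i "idx x"] that k by auto
  then show ?thesis using P_mono[of "Suc (idx x)" i] Suc.prems hi by simp
 qed
 ultimately show ?case by simp
qed

lemma fr_mono: "0 <= x ==> x <= y ==> y < 1 ==> idx x = idx y ==> fr x <= fr y"
 unfolding fr_def using slope_gt_1[OF idx(1)[of x]] by (auto simp: mult_left_mono)

lemma G_mono: "0 <= x ==> x <= y ==> y < 1 ==> G n x <= G n y"
proof (induction n arbitrary: x y)
 case (Suc n)
 have x: "0 <= x" "x < 1" and y: "0 <= y" "y < 1" using Suc.prems by auto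
 show ?case
 proof (cases "idx x = idx y")
  case True
  have "G n (fr x) <= G n (fr y)" by (rule Suc.IH[OF fr(3)[OF x] fr_mono fr(4)[OF y]]) (use Suc.prems True in auto)
  then show ?thesis using True rho_pos by (simp add: divide_right_mono)
 next
  case False
  have "x < p (idx y)"
  proof (rule ccontr)
   assume "\<not> x < p (idx y)"
   then have "idx x = idx y" using idx_eq[of "idx y" x] idx[OF y] Suc.prems by simp
   then show False using False by simp
  qed
  then have "G (Suc n) x <= P (idx y)" using G_bounds[OF x, of "idx y" "Suc n"] idx(1)[OF y] by simp
  also have "... <= G (Suc n) y" using G_bounds[OF y, of "idx y" "Suc n"] idx(1,2)[OF y] by simp
  finally show ?thesis .
 qed
next
 case 0
 have "G 0 y >= P (idx x)"
  using G_bounds[of y "idx x" 0] idx[of x] 0 by auto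
 then show ?case by simp
qed

lemma G_Suc_ge: "0 <= x ==> x < 1 ==> G n x <= G (Suc n) x"
proof (induction n arbitrary: x)
 case 0
 then show ?case using G_bounds[OF 0, of "idx x" "Suc 0"] idx[OF 0] by simp
next
 case (Suc n)
 have "G n (fr x) <= G (Suc n) (fr x)" by (rule Suc.IH[OF fr(3,4)[OF Suc.prems]])
 then show ?case using rho_pos by (simp add: divide_right_mono del: G.simps add: G.simps(2)[of n x] G.simps(2)[of "Suc n" x])
qed

lemma G_unit: "0 <= x ==> x < 1 ==> 0 <= G n x & G n x <= 1"
 using G_bounds[of x 0 n] G_bounds[of x N n] p_0 p_N P_0 P_N by auto

definition F :: "real => real" where
 "F x = (if x < 0 then 0 else if x >= 1 then 1 else lim (%n. G n x))"

lemma G_F: "0 <= x ==> x < 1 ==> (%n. G n x) \<longlonglongrightarrow> F x"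
proof -
 assume x: "0 <= x" "x < 1"
 have "incseq (%n. G n x)" using G_Suc_ge[OF x] by (rule incseq_SucI)
 then obtain L where "(%n. G n x) \<longlonglongrightarrow> L"
  by (rule incseq_convergent[of _ 1]) (use G_unit[OF x] in auto)
 then show ?thesis using x by (simp add: F_def limI)
qed

lemma F_eq: "0 <= x ==> x < 1 ==> F x = P (idx x) + (F (fr x) - P (la (idx x))) / rho"
proof -
 assume x: "0 <= x" "x < 1"
 have "(%n. G (Suc n) x) \<longlonglongrightarrow> P (idx x) + (F (fr x) - P (la (idx x))) / rho"
  unfolding G.simps by (intro tendsto_intros G_F fr x) (use rho_pos in auto)
 moreover have "(%n. G (Suc n) x) \<longlonglongrightarrow> F x" by (rule LIMSEQ_Suc[OF G_F[OF x]])
 ultimately show ?thesis by (rule LIMSEQ_unique[rotated])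
qed

lemma F_unit: "0 <= F x" "F x <= 1"
proof -
 have "0 <= F x & F x <= 1"
 proof (cases "0 <= x & x < 1")
  case True
  then show ?thesis
   using LIMSEQ_le_const[OF G_F, of x 0] LIMSEQ_le_const2[OF G_F, of x 1] G_unit[of x] by auto
 qed (auto simp: F_def)
 then show "0 <= F x" "F x <= 1" by auto
qed

lemma F_mono: "x <= y ==> F x <= F y"
proof -
 assume xy: "x <= y"
 consider "x < 0" | "y >= 1" | "0 <= x" "y < 1" by linarith
 then show ?thesis
 proof cases
  case 1
  then show ?thesis using F_unit[of y] by (simp add: F_def)
 next
  case 2
  then show ?thesis using F_unit[of x] by (simp add: F_def)
 next
  case 3
  show ?thesis by (rule LIMSEQ_le[OF G_F G_F]) (use 3 xy G_mono in auto)
 qed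
qed

lemma F_p: "i <= N ==> F (p i) = P i"
proof (cases "i = N")
 case False
 assume "i <= N"
 then have i: "i < N" using False by simp
 have x: "0 <= p i" "p i < 1" using p_unit[of i] p_strict[of i N] i p_N by auto
 have idx: "idx (p i) = i" using idx_eq[of i "p i"] i p_less by simp
 have "G n (p i) = P i" for n using i
 proof (induction n arbitrary: i)
  case (Suc n)
  have "idx (p i) = i" using idx_eq[of i "p i"] Suc.prems p_less by simp
  moreover have "fr (p i) = p (la i)" using calculation lab_lower_upper[OF Suc.prems] by (simp add: fr_def)
  moreover have "la i < N" using lab_lower_upper[OF Suc.prems] by simp
  ultimately show ?case using Suc.IH[of "la i"] by simp
 next
  case 0
  then show ?case using idx_eq[of i "p i"] p_less by simp
 qed
 then show ?thesis using LIMSEQ_unique[OF G_F[OF x]] by simp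
qed (simp add: F_def p_N P_N)

lemma F_G_close: "0 <= x ==> x < 1 ==> G n x <= F x & F x <= G n x + (1 / rho) ^ n"
proof
 assume x: "0 <= x" "x < 1"
 have "incseq (%n. G n x)" using G_Suc_ge[OF x] by (rule incseq_SucI)
 then show "G n x <= F x" by (rule incseq_le[OF _ G_F[OF x]])
 show "F x <= G n x + (1 / rho) ^ n"
  using x
 proof (induction n arbitrary: x)
  case 0
  then show ?case using F_unit[of x] P_unit[of "idx x"] idx[OF 0] by simp
 next
  case (Suc n)
  have "(F (fr x) - P (la (idx x))) / rho <= (G n (fr x) + (1 / rho) ^ n - P (la (idx x))) / rho"
   using Suc.IH[OF fr(3,4)[OF Suc.prems]] rho_pos by (intro divide_right_mono) auto
  then show ?case using F_eq[OF Suc.prems] rho_pos by (simp add: add_divide_distrib diff_divide_distrib)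
 qed
qed

lemma eventually_at_right_less:
 assumes "x < (y :: real)" shows "eventually (%z. x < z & z < y) (at_right x)"
 by (rule eventually_mono[OF eventually_at_right_real[OF assms]]) auto

lemma idx_right:
 assumes x: "0 <= x" "x < 1" shows "eventually (%z. idx z = idx x) (at_right x)"
 using eventually_at_right_less[OF idx(3)[OF x]]
proof eventually_elim
 case (elim z)
 show ?case by (rule idx_eq[OF idx(1)[OF x]]) (use idx(2)[OF x] elim in auto)
qed

lemma G_right_limit: "0 <= x ==> x < 1 ==> (G n \<longlongrightarrow> G n x) (at_right x)"
proof (induction n arbitrary: x)
 case 0
 note k = idx[OF 0]
 have "eventually (%z. G 0 z = G 0 x) (at_right x)"
  using idx_right[OF 0] by eventually_elim simp
 then show ?case by (rule tendsto_eventually)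
next
 case (Suc n)
 note k = idx[OF Suc.prems]
 note ev = idx_right[OF Suc.prems]
 let ?h = "%z. lower (idx x) + slope (idx x) * (z - p (idx x))"
 have "filterlim ?h (at_right (fr x)) (at_right x)"
  unfolding filterlim_at
 proof
  show "eventually (%z. ?h z \<in> {fr x<..} & ?h z ~= fr x) (at_right x)"
   using eventually_at_right_less[OF k(3)]
   by eventually_elim (use slope_gt_1[OF k(1)] in "auto simp: fr_def")
  show "(?h \<longlongrightarrow> fr x) (at_right x)" unfolding fr_def by (intro tendsto_intros)
 qed
 then have "((%z. G n (?h z)) \<longlongrightarrow> G n (fr x)) (at_right x)"
  by (rule filterlim_compose[OF Suc.IH[OF fr(3,4)[OF Suc.prems]]])
 then have "((%z. P (idx x) + (G n (?h z) - P (la (idx x))) / rho) \<longlongrightarrow> G (Suc n) x) (at_right x)"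
  unfolding G.simps by (intro tendsto_intros) (use rho_pos in auto)
 then show ?case
  by (rule Lim_transform_eventually) (use ev in eventually_elim, simp add: fr_def)
qed

lemma F_right_cont: "continuous (at_right x) F"
proof -
 consider "x < 0" | "x >= 1" | "0 <= x" "x < 1" by linarith
 then have "(F \<longlongrightarrow> F x) (at_right x)"
 proof cases
  case 1
  then have "eventually (%z. F z = F x) (at_right x)"
   using eventually_at_right_less[of x 0] by (auto elim!: eventually_mono simp: F_def)
  then show ?thesis by (rule tendsto_eventually)
 next
  case 2
  then have "eventually (%z. F z = F x) (at_right x)"
   using eventually_at_right_less[of x "x + 1"] by (auto elim!: eventually_mono simp: F_def)
  then show ?thesis by (rule tendsto_eventually)
 next
  case 3
  show ?thesis
  proof (rule tendstoI)
   fix e :: real assume e: "e > 0"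
   obtain n where n: "(1 / rho) ^ n < e / 2" using real_arch_pow_inv[of "e / 2" "1 / rho"] e rho_gt_1 by auto
   have "eventually (%z. dist (G n z) (G n x) < e / 2) (at_right x)"
    using tendstoD[OF G_right_limit[OF 3, of n], of "e / 2"] e by simp
   moreover have "eventually (%z. x < z & z < 1) (at_right x)" by (rule eventually_at_right_less[OF 3(2)])
   ultimately show "eventually (%z. dist (F z) (F x) < e) (at_right x)"
   proof eventually_elim
    case (elim z)
    have "F z <= G n z + (1 / rho) ^ n" "G n x <= F x" "F x <= F z"
     using F_G_close[of z n] F_G_close[OF 3, of n] F_mono[of x z] elim 3 by auto
    then show ?case using elim n unfolding dist_real_def by linarith
   qed
  qed
 qed
 then show ?thesis unfolding continuous_within .
qed

definition R :: "real measure" where "R = interval_measure F"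

lemma R_distribution: "real_distribution R"
 unfolding R_def
proof (rule real_distribution_interval_measure)
 have "eventually (%x. F x = 0) at_bot" using eventually_at_bot_dense[of "%x. F x = 0"] by (auto simp: F_def intro!: exI[of _ 0])
 then show "(F \<longlongrightarrow> 0) at_bot" by (rule tendsto_eventually)
 have "eventually (%x. F x = 1) at_top" using eventually_ge_at_top[of 1] by eventually_elim (simp add: F_def)
 then show "(F \<longlongrightarrow> 1) at_top" by (rule tendsto_eventually)
qed (use F_mono F_right_cont in auto)

sublocale R: real_distribution R
 by (rule R_distribution)

lemma R_Ioc: "a <= b ==> measure R {a<..b} = F b - F a"
 unfolding R_def by (rule measure_interval_measure_Ioc) (use F_mono F_right_cont in auto)

text \<open>Continuity of \<open>F\<close> at the partition points: the functional equation divides a jump by \<open>rho\<close>.\<close>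
lemma F_left_close: "i < N ==> EX x. p i <= x & x < p (Suc i) & P (Suc i) - F x <= (1 / rho) ^ n"
proof (induction n arbitrary: i)
 case 0
 then show ?case using P_unit[of "Suc i"] F_unit(1)[of "p i"] p_less[of i] by (intro exI[of _ "p i"]) auto
next
 case (Suc n)
 note i = Suc.prems and ab = lab_lower_upper[OF Suc.prems]
 obtain b where b: "lb i = Suc b" using ab by (cases "lb i") auto
 have bN: "b < N" using b ab by simp
 obtain y where y: "p b <= y" "y < p (Suc b)" "P (Suc b) - F y <= (1 / rho) ^ n" using Suc.IH[OF bN] by blast
 have "lower i <= y" using ab p_mono[of "la i" b] b bN y by simp
 define x where "x = inv_branch i y"
 have s: "slope i > 1" by (rule slope_gt_1[OF i])
 have y_eq: "lower i + slope i * (x - p i) = y" using s by (simp add: x_def inv_branch_def)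
 have x1: "p i <= x" using \<open>lower i <= y\<close> s by (simp add: x_def inv_branch_def)
 have "x < p (Suc i)"
 proof (rule ccontr)
  assume "\<not> x < p (Suc i)"
  then have "slope i * (p (Suc i) - p i) <= slope i * (x - p i)" using s by (intro mult_left_mono) auto
  then show False using y_eq y(2) ab(4) b upper_lower[of i] by simp
 qed
 note x = x1 this
 have x01: "0 <= x" "x < 1" using x p_unit[of i] p_unit[of "Suc i"] i by auto
 have idx: "idx x = i" by (rule idx_eq[OF i x])
 then have "fr x = y" using y_eq by (simp add: fr_def)
 then have "F x = P i + (F y - P (la i)) / rho" using F_eq[OF x01] idx by simp
 moreover have "P (Suc i) = P i + (P (lb i) - P (la i)) / rho" using P_upper[OF i] rho_pos by simp
 ultimately have "P (Suc i) - F x = (P (Suc b) - F y) / rho" using b by (simp add: diff_divide_distrib)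
 also have "... <= (1 / rho) ^ Suc n" using y(3) rho_pos divide_right_mono[OF y(3), of rho] by simp
 finally show ?case using x by blast
qed

lemma R_point: "i <= N ==> measure R {p i} = 0"
proof (cases i)
 case 0
 have "measure R {p 0} <= measure R {-1<..0}" by (rule R.finite_measure_mono) (auto simp: p_0)
 also have "... = F (p 0) - F (-1)" by (simp add: R_Ioc p_0)
 also have "... = 0" using F_p[of 0] P_0 by (simp add: F_def)
 finally show ?thesis using 0 measure_nonneg[of R "{p 0}"] by simp
next
 case (Suc j)
 assume "i <= N"
 then have j: "j < N" using Suc by simp
 have le: "measure R {p (Suc j)} <= (1 / rho) ^ n" for n
 proof -
  obtain x where x: "p j <= x" "x < p (Suc j)" "P (Suc j) - F x <= (1 / rho) ^ n" using F_left_close[OF j] by blast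
  have "measure R {p (Suc j)} <= measure R {x<..p (Suc j)}" by (rule R.finite_measure_mono) (use x in auto)
  also have "... = P (Suc j) - F x" using R_Ioc[of x "p (Suc j)"] x F_p[of "Suc j"] j by simp
  finally show ?thesis using x(3) by simp
 qed
 have "(%n. (1 / rho) ^ n) \<longlonglongrightarrow> 0" using rho_gt_1 by (intro LIMSEQ_realpow_zero) auto
 then have "measure R {p (Suc j)} <= 0" by (rule LIMSEQ_le_const) (use le in auto)
 then show ?thesis using Suc measure_nonneg[of R "{p (Suc j)}"] by simp
qed

lemma R_I: "j < N ==> measure R (I j) = rv j / total"
proof -
 assume j: "j < N"
 have "{p j<..p (Suc j)} = I j Un {p (Suc j)}" using p_less[OF j] by (auto simp: branch_interval_def)
 moreover have "measure R (I j Un {p (Suc j)}) = measure R (I j) + measure R {p (Suc j)}"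
  by (rule R.finite_measure_Union) (auto simp: branch_interval_def)
 moreover have "measure R {p j<..p (Suc j)} = P (Suc j) - P j"
  using R_Ioc[of "p j" "p (Suc j)"] p_less[OF j] F_p[of j] F_p[of "Suc j"] j by simp
 ultimately show ?thesis using R_point[of "Suc j"] j by (simp add: P_Suc)
qed

text \<open>By the functional equation both sides have the same distribution function.\<close>
lemma R_conformal:
 assumes i: "i < N" and E: "E \<in> sets borel"
 shows "measure R {x \<in> I i. fb x \<in> E} = measure R (E Int {lower i<..<upper i}) / rho"
proof -
 note ab = lab_lower_upper[OF i]
 let ?h = "%x. lower i + slope i * (x - p i)"
 have s: "slope i > 1" by (rule slope_gt_1[OF i])
 have hm: "?h \<in> borel_measurable borel" by measurable
 define M1 where "M1 = distr (density R (indicator (I i))) borel ?h"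
 define M2 where "M2 = density R (%x. ennreal (1 / rho) * indicator {lower i<..<upper i} x)"
 have m1: "emeasure M1 E = ennreal (measure R (I i Int ?h -` E))" if "E \<in> sets borel" for E
 proof -
  have hE: "?h -` E \<in> sets borel" using measurable_sets[OF hm that] by simp
  have "emeasure M1 E = emeasure (density R (indicator (I i))) (?h -` E)"
   unfolding M1_def by (subst emeasure_distr) (use that hm in auto)
  also have "... = (\<integral>\<^sup>+x. indicator (I i Int ?h -` E) x \<partial>R)"
   using hE by (subst emeasure_density) (auto simp: indicator_inter_arith[symmetric] intro!: nn_integral_cong split: split_indicator)
  also have "... = emeasure R (I i Int ?h -` E)" by (rule nn_integral_indicator) (use hE in auto)
  finally show ?thesis by (simp add: R.emeasure_eq_measure)
 qed
 have m2: "emeasure M2 E = ennreal (measure R (E Int {lower i<..<upper i}) / rho)" if "E \<in> sets borel" for E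
 proof -
  have "emeasure M2 E = (\<integral>\<^sup>+x. ennreal (1 / rho) * indicator (E Int {lower i<..<upper i}) x \<partial>R)"
   unfolding M2_def using that by (subst emeasure_density) (auto intro!: nn_integral_cong split: split_indicator)
  also have "... = ennreal (1 / rho) * emeasure R (E Int {lower i<..<upper i})"
   by (rule nn_integral_cmult_indicator) (use that in auto)
  also have "... = ennreal (1 / rho * measure R (E Int {lower i<..<upper i}))"
   unfolding R.emeasure_eq_measure using rho_pos by (intro ennreal_mult[symmetric]) auto
  finally show ?thesis by simp
 qed
 have "M1 = M2"
 proof (rule cdf_unique')
  show "finite_borel_measure M1"
  proof (intro finite_borel_measure.intro finite_borel_measure_axioms.intro finite_measureI)
   show "sets M1 = sets borel" by (simp add: M1_def)
   have "space M1 = UNIV" by (simp add: M1_def)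
   then show "emeasure M1 (space M1) ~= \<infinity>" using m1[of UNIV] by simp
  qed
  show "finite_borel_measure M2"
  proof (intro finite_borel_measure.intro finite_borel_measure_axioms.intro finite_measureI)
   show "sets M2 = sets borel" by (simp add: M2_def)
   have "space M2 = UNIV" by (simp add: M2_def)
   then show "emeasure M2 (space M2) ~= \<infinity>" using m2[of UNIV] by simp
  qed
  show "cdf M1 = cdf M2"
  proof
   fix t
   have c1: "cdf M1 t = measure R (I i Int ?h -` {..t})" using m1[of "{..t}"] by (simp add: cdf_def measure_def)
   have c2: "cdf M2 t = measure R ({..t} Int {lower i<..<upper i}) / rho"
    using m2[of "{..t}"] rho_pos by (simp add: cdf_def measure_def[of M2])
   have h_iff: "x \<in> I i \<longleftrightarrow> lower i < ?h x & ?h x < upper i" for x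
    using s unfolding branch_interval_def upper_lower by (auto simp: zero_less_mult_iff)
   have full: "measure R {lower i<..<upper i} = rho * measure R (I i)"
   proof -
    have lu: "lower i < upper i" by (rule lower_less_upper[OF i])
    have "{lower i<..upper i} = {lower i<..<upper i} Un {upper i}" using lu by auto
    moreover have "measure R ({lower i<..<upper i} Un {upper i}) = measure R {lower i<..<upper i} + measure R {upper i}"
     by (rule R.finite_measure_Union) auto
    moreover have "measure R {lower i<..upper i} = P (lb i) - P (la i)"
     using R_Ioc[of "lower i" "upper i"] lu ab F_p[of "la i"] F_p[of "lb i"] by simp
    moreover have "measure R {upper i} = 0" using R_point[of "lb i"] ab by simp
    ultimately show ?thesis using P_upper[OF i] R_I[OF i] by (simp add: P_Suc)
   qed
   consider "t <= lower i" | "t >= upper i" | "lower i < t" "t < upper i" by linarith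
   then show "cdf M1 t = cdf M2 t"
   proof cases
    case 1
    then have "I i Int ?h -` {..t} = {}" "{..t} Int {lower i<..<upper i} = {}" using h_iff by auto
    then show ?thesis unfolding c1 c2 by simp
   next
    case 2
    then have "I i Int ?h -` {..t} = I i" "{..t} Int {lower i<..<upper i} = {lower i<..<upper i}" using h_iff by auto
    then show ?thesis unfolding c1 c2 using full rho_pos by simp
   next
    case 3
    let ?x = "inv_branch i t"
    have hx: "?h ?x = t" using s by (simp add: inv_branch_def)
    then have xI: "?x \<in> I i" using h_iff 3 by simp
    have x01: "0 <= ?x" "?x < 1" and xp: "p i <= ?x" "?x < p (Suc i)"
     using xI p_unit[of i] p_unit[of "Suc i"] i by (auto simp: branch_interval_def)
    have le_iff: "?h x <= t \<longleftrightarrow> x <= ?x" for x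
     using s hx unfolding inv_branch_def by (simp add: pos_le_divide_eq mult.commute field_simps)
    have e1: "I i Int ?h -` {..t} = {p i<..?x}" using le_iff xp by (auto simp: branch_interval_def)
    have e2: "{..t} Int {lower i<..<upper i} = {lower i<..t}" using 3 by auto
    have idx: "idx ?x = i" by (rule idx_eq[OF i xp])
    have "fr ?x = t" using hx by (simp add: fr_def idx)
    then have "F ?x = P i + (F t - P (la i)) / rho" using F_eq[OF x01] idx by simp
    moreover have "measure R {p i<..?x} = F ?x - P i" using R_Ioc[OF xp(1)] F_p[of i] i by simp
    moreover have "measure R {lower i<..t} = F t - P (la i)" using R_Ioc[of "lower i" t] 3 ab F_p[of "la i"] by simp
    ultimately show ?thesis unfolding c1 c2 e1 e2 by simp
   qed
  qed
 qed
 then have "ennreal (measure R (I i Int ?h -` E)) = ennreal (measure R (E Int {lower i<..<upper i}) / rho)"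
  using m1[OF E] m2[OF E] by simp
 moreover have "I i Int ?h -` E = {x \<in> I i. fb x \<in> E}"
  using fb_eq[OF I_U[OF i]] f_affine[OF i] by auto
 ultimately show ?thesis using rho_pos by (simp add: ennreal_inj)
qed

end

context perron_markov_map
begin

definition pair_total :: real where "pair_total = (\<Sum>j<N. lv j * rv j / total)"

definition D :: "real set => real" where
 "D E = (\<Sum>j<N. lv j / pair_total * measure R (E Int I j))"

text \<open>The Parry measure: the conformal measure \<open>R\<close> with density proportional to the left eigenvector.\<close>
definition \<nu> :: "real measure" where
 "\<nu> = restrict_space (density R (%x. \<Sum>j<N. ennreal (lv j / pair_total) * indicator (I j) x)) {0..1}"

lemma pair_total_pos: "pair_total > 0"
 unfolding pair_total_def by (rule sum_pos) (use N_pos lv_pos rv_pos total_pos in auto)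

lemma weight_nonneg: "j < N ==> 0 <= lv j / pair_total"
 using lv_pos[of j] pair_total_pos by simp

lemma D_nonneg: "D E >= 0"
 unfolding D_def by (intro sum_nonneg mult_nonneg_nonneg weight_nonneg) auto

lemma sets_\<nu>: "sets \<nu> = sets unit_borel"
 unfolding \<nu>_def by (simp add: sets_restrict_space R_def)

lemma space_\<nu>: "space \<nu> = {0..1}"
 unfolding \<nu>_def by (simp add: space_restrict_space)

lemma emeasure_\<nu>:
 assumes E: "E \<in> sets borel" "E \<subseteq> {0..1}"
 shows "emeasure \<nu> E = ennreal (D E)"
proof -
 have meas: "(%x. \<Sum>j<N. ennreal (lv j / pair_total) * indicator (I j) x) \<in> borel_measurable R" by measurable
 have "emeasure \<nu> E = emeasure (density R (%x. \<Sum>j<N. ennreal (lv j / pair_total) * indicator (I j) x)) E"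
  unfolding \<nu>_def by (rule emeasure_restrict_space) (use E in auto)
 also have "... = (\<integral>\<^sup>+x. (\<Sum>j<N. ennreal (lv j / pair_total) * indicator (I j) x) * indicator E x \<partial>R)"
  by (rule emeasure_density[OF meas]) (use E in simp)
 also have "... = (\<integral>\<^sup>+x. (\<Sum>j<N. ennreal (lv j / pair_total) * indicator (E Int I j) x) \<partial>R)"
  unfolding sum_distrib_right by (intro nn_integral_cong sum.cong refl) (auto split: split_indicator)
 also have "... = (\<Sum>j<N. (\<integral>\<^sup>+x. ennreal (lv j / pair_total) * indicator (E Int I j) x \<partial>R))"
  by (rule nn_integral_sum) (use E in auto)
 also have "... = (\<Sum>j<N. ennreal (lv j / pair_total * measure R (E Int I j)))"
 proof (intro sum.cong refl)
  fix j assume "j \<in> {..<N}"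
  then have j: "j < N" by simp
  have "(\<integral>\<^sup>+x. ennreal (lv j / pair_total) * indicator (E Int I j) x \<partial>R) = ennreal (lv j / pair_total) * emeasure R (E Int I j)"
   by (rule nn_integral_cmult_indicator) (use E in auto)
  then show "(\<integral>\<^sup>+x. ennreal (lv j / pair_total) * indicator (E Int I j) x \<partial>R) = ennreal (lv j / pair_total * measure R (E Int I j))"
   unfolding R.emeasure_eq_measure ennreal_mult[OF weight_nonneg[OF j] measure_nonneg] .
 qed
 also have "... = ennreal (D E)"
  unfolding D_def by (rule sum_ennreal) (intro mult_nonneg_nonneg weight_nonneg; simp)
 finally show ?thesis .
qed

lemma borel_of_\<nu>: "E \<in> sets \<nu> ==> E \<in> sets borel & E \<subseteq> {0..1}"
 unfolding sets_\<nu> sets_restrict_space by auto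

lemma \<nu>_sets: "E \<in> sets borel ==> E \<subseteq> {0..1} ==> E \<in> sets \<nu>"
 unfolding sets_\<nu> sets_restrict_space by (metis Int_absorb1 image_eqI)

lemma measure_\<nu>: "E \<in> sets \<nu> ==> measure \<nu> E = D E"
 using emeasure_\<nu>[of E] borel_of_\<nu>[of E] D_nonneg[of E] by (simp add: measure_def)

lemma prob_space_\<nu>: "prob_space \<nu>"
proof (rule prob_spaceI)
 have "D {0..1} = (\<Sum>j<N. lv j / pair_total * (rv j / total))"
  unfolding D_def by (intro sum.cong refl) (use I_unit R_I in "auto simp: Int_absorb1")
 also have "... = (\<Sum>j<N. lv j * rv j / total) / pair_total" by (simp add: sum_divide_distrib mult_ac)
 also have "... = 1" using pair_total_pos unfolding pair_total_def by simp
 finally show "emeasure \<nu> (space \<nu>) = 1" unfolding space_\<nu> using emeasure_\<nu>[of "{0..1}"] by simp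
qed

lemma f_preimage:
 assumes E: "E \<in> sets borel"
 shows "f -` E Int {0..1} \<in> sets borel"
proof -
 have "f -` E Int {0..1} = (U Int (fb -` E Int space borel)) Un (f -` E Int p ` {..N})"
  using fb_eq unit_minus_U U_unit by auto
 moreover have "finite (f -` E Int p ` {..N})" by simp
 ultimately show ?thesis
  using U_borel measurable_sets[OF fb_borel E] by (simp add: borel_closed finite_imp_closed)
qed

lemma f_measurable_\<nu>: "f \<in> measurable \<nu> \<nu>"
proof (rule measurableI)
 show "f x \<in> space \<nu>" if "x \<in> space \<nu>" for x using that unfolding space_\<nu> by (rule f_unit)
 show "f -` E Int space \<nu> \<in> sets \<nu>" if "E \<in> sets \<nu>" for E
  unfolding space_\<nu> by (rule \<nu>_sets[OF f_preimage]) (use borel_of_\<nu>[OF that] in auto)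
qed

lemma R_partition:
 assumes i: "i < N" and E: "E \<in> sets borel"
 shows "measure R (E Int {lower i<..<upper i}) = (\<Sum>j<N. (if adj i j then 1 else 0) * measure R (E Int I j))"
proof -
 let ?L = "{lower i<..<upper i}"
 have null: "measure R (p ` {..N}) = 0"
 proof -
  have "measure R (\<Union>j\<le>N. {p j}) <= (\<Sum>j\<le>N. measure R {p j})" by (rule measure_UNION_le) auto
  also have "... = 0" using R_point by simp
  also have "(\<Union>j\<le>N. {p j}) = p ` {..N}" by auto
  finally show ?thesis using measure_nonneg[of R "p ` {..N}"] by linarith
 qed
 have fin: "p ` {..N} \<in> sets R" by (simp add: borel_closed finite_imp_closed)
 have Lu: "?L \<subseteq> {0..1}" using lower_upper_unit[OF i] by auto
 have "measure R (E Int ?L) = measure R (E Int ?L Int U)"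
 proof (rule antisym)
  have "E Int ?L \<subseteq> (E Int ?L Int U) Un p ` {..N}" using Lu unit_minus_U by blast
  then have "measure R (E Int ?L) <= measure R ((E Int ?L Int U) Un p ` {..N})"
   by (rule R.finite_measure_mono) (use E fin in auto)
  also have "... <= measure R (E Int ?L Int U) + measure R (p ` {..N})"
   by (rule measure_Un_le) (use E fin in auto)
  finally show "measure R (E Int ?L) <= measure R (E Int ?L Int U)" using null by simp
  show "measure R (E Int ?L Int U) <= measure R (E Int ?L)" by (rule R.finite_measure_mono) (use E in auto)
 qed
 also have "E Int ?L Int U = (\<Union>j<N. E Int ?L Int I j)" by (auto simp: branch_union_def)
 also have "measure R ... = (\<Sum>j<N. measure R (E Int ?L Int I j))"
  by (rule R.finite_measure_finite_Union) (use E I_disjoint in "auto simp: disjoint_family_on_def")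
 also have "... = (\<Sum>j<N. (if adj i j then 1 else 0) * measure R (E Int I j))"
 proof (intro sum.cong refl)
  fix j assume "j \<in> {..<N}"
  then have j: "j < N" by simp
  show "measure R (E Int ?L Int I j) = (if adj i j then 1 else 0) * measure R (E Int I j)"
  proof (cases "adj i j")
   case True
   then have "E Int ?L Int I j = E Int I j" using adj_iff[OF i j] by blast
   then show ?thesis using True by simp
  next
   case False
   then have "E Int ?L Int I j = {}" using adj_iff[OF i j] by blast
   then show ?thesis using False by simp
  qed
 qed
 finally show ?thesis .
qed

lemma D_invariant:
 assumes E: "E \<in> sets borel"
 shows "D (f -` E Int {0..1}) = D E"
proof -
 let ?A = "%i j. if adj i j then 1 else 0 :: real"
 have "D (f -` E Int {0..1}) = (\<Sum>i<N. lv i / pair_total * ((\<Sum>j<N. ?A i j * measure R (E Int I j)) / rho))"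
  unfolding D_def
 proof (intro sum.cong refl)
  fix i assume "i \<in> {..<N}"
  then have i: "i < N" by simp
  have "f -` E Int {0..1} Int I i = {x \<in> I i. fb x \<in> E}"
   using I_unit[OF i] fb_eq[OF I_U[OF i]] by auto
  then show "lv i / pair_total * measure R (f -` E Int {0..1} Int I i) =
    lv i / pair_total * ((\<Sum>j<N. ?A i j * measure R (E Int I j)) / rho)"
   using R_conformal[OF i E] R_partition[OF i E] by simp
 qed
 also have "... = (\<Sum>i<N. \<Sum>j<N. measure R (E Int I j) / (pair_total * rho) * (?A i j * lv i))"
  by (simp add: sum_distrib_left sum_divide_distrib mult_ac)
 also have "... = (\<Sum>j<N. measure R (E Int I j) / (pair_total * rho) * (\<Sum>i<N. ?A i j * lv i))"
  by (subst sum.swap) (simp add: sum_distrib_left)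
 also have "... = D E"
  unfolding D_def
 proof (intro sum.cong refl)
  fix j assume "j \<in> {..<N}"
  then have j: "j < N" by simp
  show "measure R (E Int I j) / (pair_total * rho) * (\<Sum>i<N. ?A i j * lv i) = lv j / pair_total * measure R (E Int I j)"
   unfolding lv_eigen[OF j] using rho_pos by simp
 qed
 finally show ?thesis .
qed

lemma \<nu>_invariant: "distr \<nu> \<nu> f = \<nu>"
proof (rule measure_eqI)
 fix E assume "E \<in> sets (distr \<nu> \<nu> f)"
 then have E: "E \<in> sets \<nu>" by simp
 have "emeasure (distr \<nu> \<nu> f) E = emeasure \<nu> (f -` E Int {0..1})"
  using emeasure_distr[OF f_measurable_\<nu> E] unfolding space_\<nu> .
 also have "... = emeasure \<nu> E"
  using emeasure_\<nu>[OF f_preimage] emeasure_\<nu>[of E] borel_of_\<nu>[OF E] D_invariant[of E] by simp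
 finally show "emeasure (distr \<nu> \<nu> f) E = emeasure \<nu> E" .
qed simp

lemma \<nu>_invariant_markov_measure: "invariant_markov_measure f N p slope \<nu>"
 by (intro invariant_markov_measure.intro invariant_markov_measure_axioms.intro markov_measure.intro
   markov_measure_axioms.intro markov_map_axioms prob_space_\<nu> sets_\<nu> f_measurable_\<nu> \<nu>_invariant)

lemma R_cylinder:
 assumes "!!n w. {x \<in> {0..1}. itin n x = w} \<in> sets borel"
 shows "measure R {x \<in> {0..1}. itin n x = w} <= (1 / rho) ^ n"
proof (induction n arbitrary: w)
 case (Suc n)
 let ?K = "%n w. {x \<in> {0..1}. itin n x = w}"
 show ?case
 proof (cases "EX a v. w = a # v & a < N")
  case True
  then obtain a v where w: "w = a # v" "a < N" by blast
  have "?K (Suc n) w \<subseteq> {x \<in> I a. fb x \<in> ?K n v}"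
  proof
   fix x assume "x \<in> ?K (Suc n) w"
   then have x: "x \<in> {0..1}" "lab x = a" "itin n (f x) = v" by (auto simp: w itinerary_Suc)
   have xa: "x \<in> I a" using lab_in_I[OF x(1)] x(2) w(2) by simp
   then show "x \<in> {x \<in> I a. fb x \<in> ?K n v}"
    using f_unit[OF x(1)] x(3) fb_eq[OF I_U[OF w(2) xa]] by simp
  qed
  moreover have "{x \<in> I a. fb x \<in> ?K n v} = I a Int (fb -` ?K n v Int space borel)" by auto
  then have "{x \<in> I a. fb x \<in> ?K n v} \<in> sets R"
   using measurable_sets[OF fb_borel assms[of n v]] by simp
  ultimately have "measure R (?K (Suc n) w) <= measure R {x \<in> I a. fb x \<in> ?K n v}"
   by (rule R.finite_measure_mono)
  also have "... = measure R (?K n v Int {lower a<..<upper a}) / rho" by (rule R_conformal[OF w(2) assms])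
  also have "... <= measure R (?K n v) / rho"
   using rho_pos by (intro divide_right_mono R.finite_measure_mono) (use assms in auto)
  also have "... <= (1 / rho) ^ n / rho" using Suc.IH rho_pos by (intro divide_right_mono) auto
  finally show ?thesis by simp
 next
  case False
  have "?K (Suc n) w \<subseteq> {p (hd w - N)}"
  proof
   fix x assume "x \<in> ?K (Suc n) w"
   then have x: "x \<in> {0..1}" "w = lab x # itin n (f x)" by (auto simp: itinerary_Suc)
   then have "\<not> lab x < N" using False by blast
   with x(1) show "x \<in> {p (hd w - N)}" unfolding x(2) by (elim lab_cases) auto
  qed
  moreover have "measure R {p (hd w - N)} = 0 \<or> ?K (Suc n) w = {}"
  proof (cases "hd w - N <= N")
   case False
   have "lab x < 2 * N + 1" if "x \<in> ?K (Suc n) w" for x using that lab_bound by blast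
   then have "?K (Suc n) w = {}" using False by (force simp: itinerary_Suc)
   then show ?thesis ..
  qed (use R_point in simp)
  ultimately have "measure R (?K (Suc n) w) <= 0"
  proof (elim disjE)
   assume sub: "?K (Suc n) w \<subseteq> {p (hd w - N)}" and z: "measure R {p (hd w - N)} = 0"
   have "measure R (?K (Suc n) w) <= measure R {p (hd w - N)}" by (rule R.finite_measure_mono[OF sub]) simp
   then show ?thesis unfolding z .
  next
   assume "?K (Suc n) w = {}"
   then show ?thesis by (simp only: measure_empty order_refl)
  qed
  then show ?thesis using rho_pos by (intro order_trans[OF \<open>measure R (?K (Suc n) w) <= 0\<close>]) simp
 qed
qed (use R.prob_le_1 in simp)

text \<open>Cylinders of length \<open>n\<close> have measure at most \<open>C rho^-n\<close>.\<close>
theorem large_entropy_measure: "\<exists>\<nu>. invariant_prob f \<nu> & ereal (ln rho) <= metric_entropy f \<nu>"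
proof -
 interpret \<nu>: invariant_markov_measure f N p slope \<nu> by (rule \<nu>_invariant_markov_measure)
 define C where "C = (\<Sum>j<N. lv j / pair_total)"
 have C: "C > 0" unfolding C_def by (rule sum_pos) (use N_pos lv_pos pair_total_pos in auto)
 have K_sets: "{x \<in> {0..1}. itin n x = w} \<in> sets borel" for n w
  using \<nu>.word_sets[of n w] borel_of_\<nu> unfolding space_\<nu> by blast
 have small: "mass \<nu> (itin n) w <= C * (1 / rho) ^ n" for n w
 proof -
  let ?K = "{x \<in> {0..1}. itin n x = w}"
  have "mass \<nu> (itin n) w = D ?K"
   unfolding \<nu>.\<pi>_eq using measure_\<nu>[OF \<nu>.word_sets[of n w]] unfolding space_\<nu> .
  also have "... <= (\<Sum>j<N. lv j / pair_total * (1 / rho) ^ n)"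
   unfolding D_def
  proof (intro sum_mono mult_left_mono)
   fix j
   have "measure R (?K Int I j) <= measure R ?K" by (rule R.finite_measure_mono) (use K_sets in auto)
   also have "... <= (1 / rho) ^ n" by (rule R_cylinder[OF K_sets])
   finally show "measure R (?K Int I j) <= (1 / rho) ^ n" .
  qed (use weight_nonneg in auto)
  finally show ?thesis by (simp add: C_def sum_distrib_right)
 qed
 have H: "real n * ln rho - ln C <= partition_entropy \<nu> (itin n)" for n
 proof -
  have "(\<integral>x. ln (mass \<nu> (itin n) (itin n x)) \<partial>\<nu>) <= (\<integral>x. ln C - real n * ln rho \<partial>\<nu>)"
  proof (rule integral_mono_AE)
   show "integrable \<nu> (%x. ln (mass \<nu> (itin n) (itin n x)))" by (rule \<nu>.itin_integrable)
   show "AE x in \<nu>. ln (mass \<nu> (itin n) (itin n x)) <= ln C - real n * ln rho"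
    using AE_mass_pos[OF prob_space_\<nu> \<nu>.simple_itin[of n]]
   proof eventually_elim
    case (elim x)
    have "ln (mass \<nu> (itin n) (itin n x)) <= ln (C * (1 / rho) ^ n)"
     using elim small[of n "itin n x"] by simp
    also have "... = ln C - real n * ln rho"
     using C rho_gt_1 by (simp add: ln_mult_pos ln_realpow ln_div)
    finally show ?case .
   qed
  qed simp
  then show ?thesis
   using partition_entropy_integral[OF prob_space_\<nu> \<nu>.simple_itin[of n]] \<nu>.prob_space by simp
 qed
 have lim: "(%n. - ln C / real n + ln rho) \<longlonglongrightarrow> ln rho"
  using tendsto_add[OF lim_const_over_n[of "- ln C"] tendsto_const[of "ln rho"]] by simp
 have "ereal (ln rho) = limsup (%n. ereal (- ln C / real n + ln rho))"
  by (intro lim_imp_Limsup[symmetric] tendsto_ereal lim) auto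
 also have "... <= limsup (%n. ereal (partition_entropy \<nu> (itin n) / real n))"
 proof (rule Limsup_mono, rule eventually_mono[OF eventually_gt_at_top[of 0]])
  fix n :: nat assume n: "n > 0"
  have "(real n * ln rho - ln C) / real n <= partition_entropy \<nu> (itin n) / real n"
   by (rule divide_right_mono[OF H]) simp
  then show "ereal (- ln C / real n + ln rho) <= ereal (partition_entropy \<nu> (itin n) / real n)"
   using n by (simp add: diff_divide_distrib)
 qed
 also have "... <= metric_entropy f \<nu>"
  unfolding metric_entropy_def by (rule SUP_upper) (use \<nu>.simple_lab in simp)
 finally have "ereal (ln rho) <= metric_entropy f \<nu>" .
 moreover have "invariant_prob f \<nu>"
  unfolding invariant_prob_def using prob_space_\<nu> sets_\<nu> f_measurable_\<nu> \<nu>_invariant by blast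
 ultimately show ?thesis by blast
qed

end

section \<open>Expansion of the correlations\<close>

lemma (in invariant_markov_measure) correlation_expansion:
 assumes J: "local_jacobian s kappa l" and kappa: "kappa >= 1"
  and E: "!!n S. E n S = complex_of_real ((1 / kappa) ^ n) * S"
 shows "EX (J :: nat set) (xi :: nat => complex) (m :: nat => nat) (C :: nat => nat => form).
    (ALL i:J. m i >= 1) &
    (ALL i:J. ALL k<m i. bilinear_form N p (C i k) & finite_rank_form N p (C i k) &
            nonzero_form N p (C i k)) &
    jordan_blocks N p J xi m C &
    (ALL phi:V. ALL psi:V. ALL eps::real. eps > 0 -->
     finite {i \<in> J. cmod (xi i) >= eps} &
     (%n. (\<integral>x. phi x * psi ((f ^^ n) x) \<partial>\<mu>) -
        E n (\<Sum>i\<in>{i \<in> J. cmod (xi i) >= eps}. \<Sum>k<m i. xi i ^ n * of_nat n ^ k * C i k phi psi))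
      \<in> o(%n. complex_of_real eps ^ n)) &
    xi ` J = (\<Union>l\<in>{s..}. spectrum (weighted_adjacency f N p slope l)) &
    (ALL z. list_multiplicity J xi m z = total_multiplicity {s..} (weighted_adjacency f N p slope) z)"
proof -
 have a: "\<bar>(1 / kappa) ^ n\<bar> <= 1" for n using kappa by (simp add: power_le_one)
 have l: "l j > 0" if "j < N" for j using J that by (rule local_jacobianD(2))
 have bounded: "EX C. ALL eta:V. ALL S. (ALL x:U. norm (eta x) <= S) --> norm (pairing l eta psi) <= C * S" if "psi \<in> V" for psi
  by (rule pairing_bounded[OF l that])
 show ?thesis
 proof (simp only: E correlation_eq_pairing[OF J] cong: ball_cong,
   rule resonance_expansion[where s = s and pair = "pairing l" and l = l and a = "%n. (1 / kappa) ^ n"])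
  show "bilinear_form N p (pairing l)" by (rule pairing_bilinear)
  show "eta x = 0" if "eta \<in> V" "pairing l eta (%x. cnj (eta x)) = 0" "x \<in> U" for eta x
   by (rule pairing_nondegenerate[OF J that])
 qed (use bounded l a in auto)
qed


theorem theorem2p1:
  fixes f :: "real \<Rightarrow> real" and N :: nat and p slope :: "nat \<Rightarrow> real"
    and \<mu>\<^sub>S\<^sub>R\<^sub>B \<mu>\<^sub>B\<^sub>M :: "real measure"
  defines "B \<equiv> weighted_adjacency f N p slope"
    and "h \<equiv> real_of_ereal (topological_entropy f)"
  assumes "affine_markov_map f N p slope"
    and "transitive_map f N p"
    and "srb_measure f \<mu>\<^sub>S\<^sub>R\<^sub>B"
    and "max_entropy_measure f \<mu>\<^sub>B\<^sub>M"
  shows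
    "(\<exists>(J :: nat set) (\<xi> :: nat \<Rightarrow> complex) (m :: nat \<Rightarrow> nat) (C :: nat \<Rightarrow> nat \<Rightarrow> form).
        (\<forall>i\<in>J. m i \<ge> 1) \<and>
        (\<forall>i\<in>J. \<forall>k<m i. bilinear_form N p (C i k) \<and> finite_rank_form N p (C i k) \<and>
                        nonzero_form N p (C i k)) \<and>
        jordan_blocks N p J \<xi> m C \<and>
        (\<forall>\<phi>\<in>piecewise_smooth N p. \<forall>\<psi>\<in>piecewise_smooth N p. \<forall>\<epsilon>::real. \<epsilon> > 0 \<longrightarrow>
           finite {i \<in> J. cmod (\<xi> i) \<ge> \<epsilon>} \<and>
           (\<lambda>n. (\<integral>x. \<phi> x * \<psi> ((f ^^ n) x) \<partial>\<mu>\<^sub>S\<^sub>R\<^sub>B) -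
                (\<Sum>i\<in>{i \<in> J. cmod (\<xi> i) \<ge> \<epsilon>}. \<Sum>k<m i. \<xi> i ^ n * of_nat n ^ k * C i k \<phi> \<psi>))
             \<in> o(\<lambda>n. complex_of_real \<epsilon> ^ n)) \<and>
        \<xi> ` J = (\<Union>l\<in>{1..}. spectrum (B l)) \<and>
        (\<forall>z. list_multiplicity J \<xi> m z = total_multiplicity {1..} B z)) \<and>
     (\<exists>(J :: nat set) (\<xi> :: nat \<Rightarrow> complex) (m :: nat \<Rightarrow> nat) (C :: nat \<Rightarrow> nat \<Rightarrow> form).
        (\<forall>i\<in>J. m i \<ge> 1) \<and>
        (\<forall>i\<in>J. \<forall>k<m i. bilinear_form N p (C i k) \<and> finite_rank_form N p (C i k) \<and>
                        nonzero_form N p (C i k)) \<and>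
        jordan_blocks N p J \<xi> m C \<and>
        (\<forall>\<phi>\<in>piecewise_smooth N p. \<forall>\<psi>\<in>piecewise_smooth N p. \<forall>\<epsilon>::real. \<epsilon> > 0 \<longrightarrow>
           finite {i \<in> J. cmod (\<xi> i) \<ge> \<epsilon>} \<and>
           (\<lambda>n. (\<integral>x. \<phi> x * \<psi> ((f ^^ n) x) \<partial>\<mu>\<^sub>B\<^sub>M) -
                complex_of_real (exp (- real n * h)) *
                (\<Sum>i\<in>{i \<in> J. cmod (\<xi> i) \<ge> \<epsilon>}. \<Sum>k<m i. \<xi> i ^ n * of_nat n ^ k * C i k \<phi> \<psi>))
             \<in> o(\<lambda>n. complex_of_real \<epsilon> ^ n)) \<and>
        \<xi> ` J = (\<Union>l\<in>{0..}. spectrum (B l)) \<and>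
        (\<forall>z. list_multiplicity J \<xi> m z = total_multiplicity {0..} B z))"
proof -
 interpret transitive_markov_map f N p slope by unfold_locales (fact assms)+
 have invariant: "transitive_invariant_measure f N p slope \<mu>" if "invariant_prob f \<mu>" for \<mu>
  using that unfolding invariant_prob_def
  by (intro transitive_invariant_measure.intro transitive_markov_map_axioms invariant_markov_measure.intro
    invariant_markov_measure_axioms.intro markov_measure.intro markov_measure_axioms.intro markov_map_axioms) auto
 interpret SRB: transitive_invariant_measure f N p slope \<mu>\<^sub>S\<^sub>R\<^sub>B
  by (rule invariant) (use assms in "simp add: srb_measure_def")
 have "absolutely_continuous (restrict_space lborel {0..1}) \<mu>\<^sub>S\<^sub>R\<^sub>B" using assms by (simp add: srb_measure_def)
 then obtain l where l: "SRB.local_jacobian 1 1 l" using SRB.srb_local_jacobian by blast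
 obtain rho rv lv where "perron_markov_map f N p slope rho rv lv" using perron_data_exists by blast
 then interpret PM: perron_markov_map f N p slope rho rv lv .
 have inv_BM: "invariant_prob f \<mu>\<^sub>B\<^sub>M"
  and max: "!!\<nu>. invariant_prob f \<nu> ==> metric_entropy f \<nu> <= metric_entropy f \<mu>\<^sub>B\<^sub>M"
  using assms by (auto simp: max_entropy_measure_def)
 interpret T: transitive_invariant_measure f N p slope \<mu>\<^sub>B\<^sub>M by (rule invariant[OF inv_BM])
 have "ereal (ln rho) <= metric_entropy f \<mu>\<^sub>B\<^sub>M"
  using PM.large_entropy_measure max order_trans by blast
 then interpret BM: maximal_entropy_setting f N p slope rho rv lv \<mu>\<^sub>B\<^sub>M
  by unfold_locales
 obtain l' where l': "T.local_jacobian 0 rho l'" using BM.bm_local_jacobian by blast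
 have rho: "rho > 1" by (rule PM.rho_gt_1)
 have h: "h = ln rho" unfolding h_def PM.topological_entropy_eq by simp
 have exp_h: "exp (- real n * h) = (1 / rho) ^ n" for n
 proof -
  have "exp (- real n * h) = exp (real n * ln (1 / rho))" using rho by (simp add: h ln_div)
  also have "... = (1 / rho) ^ n" using rho by (simp only: exp_of_nat_mult) simp
  finally show ?thesis .
 qed
 show ?thesis
  unfolding B_def
  by (rule conjI[OF SRB.correlation_expansion[OF l order_refl] T.correlation_expansion[OF l' less_imp_le[OF rho]]])
   (simp_all only: exp_h div_by_1 power_one of_real_1 mult_1)
qed

end
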